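(* Let $\lambda\in\mathbb{R}$ and let $G\subseteq\mathbb{R}^3$ be a bounded regular domain as in the context, $\Omega=\mathbb{R}^3\setminus\overline G$, $S=\partial G$, with $\eta$ the unit normal on $S$ pointing out of $G$. Let $u\in C^1(\overline\Omega,\mathbb{C}^3)$ satisfy, as $R\to+\infty$, $$\int_{\partial B_R(0)}\Big|i\frac{x}{R}\times u(x)-u(x)\Big|\,d_xS=o(R),\qquad \int_{\partial B_R(0)}|u(x)|\,d_xS=o(R^2).$$ Assume that $\operatorname{div}u$ and $\operatorname{curl}u-\lambda u$ are $O(|x|^{-\rho})$ as $|x|\to+\infty$ for some exponent $2<\rho<3$. Then, for every $x\in\Omega$, $$u(x)=-\nabla\phi(x)+\operatorname{curl}A(x)+\lambda A(x),$$ where $$\phi(x)=\int_\Omega\Gamma_\lambda(x-y)\operatorname{div}u(y)\,dy+\int_S\Gamma_\lambda(x-y)\,\eta(y)\cdot u(y)\,d_yS,$$ $$A(x)=\int_\Omega\Gamma_\lambda(x-y)\big(\operatorname{curl}u(y)-\lambda u(y)\big)\,dy+\int_S\Gamma_\lambda(x-y)\,\eta(y)\times u(y)\,d_yS.$$ As a consequence, $u=O(|x|^{-(\rho-2)})$ as $|x|\to+\infty$. Moreover, when both $\operatorname{div}u$ and $\operatorname{curl}u-\lambda u$ are compactly supported, one has $u=O(|x|^{-1})$ as $|x|\to+\infty$, and each component $a$ of $u$ satisfies the Sommerfeld radiation condition $$\sup_{y\in\partial B_R(0)}\Big|\nabla a(y)\cdot\frac{y}{R}-i\lambda a(y)\Big|=o\Big(\frac1R\Big),\qquad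 R\to+\infty.$$
   Context: $G$ is a bounded domain of class $C^{k+5}$ (for some integer $k\ge0$), homeomorphic to a Euclidean ball, with $0\in G$. $\Gamma_\lambda(x)=\dfrac{e^{i\lambda|x|}}{4\pi|x|}$, $x\in\mathbb{R}^3\setminus\{0\}$, is the fundamental solution of the Helmholtz equation. $C^1(\overline\Omega,\mathbb{C}^3)$ denotes bounded $C^1$ fields with bounded first derivatives, all extending continuously to $\overline\Omega$. *)

theory Defs
  imports "HOL-Analysis.Analysis" "HOL-Library.Landau_Symbols"
begin

subsection \<open>Differential operators\<close>

definition partial_deriv :: "3 \<Rightarrow> (real^3 \<Rightarrow> 'b::real_normed_vector) \<Rightarrow> real^3 \<Rightarrow> 'b"
  where "partial_deriv j f x = frechet_derivative f (at x) (axis j 1)"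

definition grad :: "(real^3 \<Rightarrow> complex) \<Rightarrow> real^3 \<Rightarrow> complex^3"
  where "grad f x = (\<chi> j. partial_deriv j f x)"

definition divergence :: "(real^3 \<Rightarrow> complex^3) \<Rightarrow> real^3 \<Rightarrow> complex"
  where "divergence u x = (\<Sum>j\<in>UNIV. partial_deriv j u x $ j)"

definition curl :: "(real^3 \<Rightarrow> complex^3) \<Rightarrow> real^3 \<Rightarrow> complex^3"
  where "curl u x = vector
    [partial_deriv 2 u x $ 3 - partial_deriv 3 u x $ 2,
     partial_deriv 3 u x $ 1 - partial_deriv 1 u x $ 3,
     partial_deriv 1 u x $ 2 - partial_deriv 2 u x $ 1]"

text \<open>The dot and cross product of a real with a complex vector are bilinear (no conjugation).\<close>

definition rc_dot :: "real^3 \<Rightarrow> complex^3 \<Rightarrow> complex"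
  where "rc_dot a v = (\<Sum>j\<in>UNIV. of_real (a $ j) * v $ j)"

definition rc_cross :: "real^3 \<Rightarrow> complex^3 \<Rightarrow> complex^3"
  where "rc_cross a v = vector
    [of_real (a $ 2) * v $ 3 - of_real (a $ 3) * v $ 2,
     of_real (a $ 3) * v $ 1 - of_real (a $ 1) * v $ 3,
     of_real (a $ 1) * v $ 2 - of_real (a $ 2) * v $ 1]"

subsection \<open>Regularity classes\<close>

text \<open>\<open>C_on m f U\<close>: \<open>f\<close> is of class $C^m$ on the open set \<open>U\<close>.\<close>

primrec C_on :: "nat \<Rightarrow> ('a::euclidean_space \<Rightarrow> 'b::real_normed_vector) \<Rightarrow> 'a set \<Rightarrow> bool"
  where
    "C_on 0 f U \<longleftrightarrow> continuous_on U f"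
  | "C_on (Suc m) f U \<longleftrightarrow> (\<forall>x\<in>U. f differentiable (at x)) \<and>
       (\<forall>v. C_on m (\<lambda>x. frechet_derivative f (at x) v) U)"

text \<open>
  The space $C^1(\overline\Omega, \mathbb{C}^3)$ for open \<open>\<Omega>\<close>. The continuous extension of the field
  to the boundary is given by the values of \<open>u\<close> there; values outside the closure are irrelevant.
\<close>

definition C1_closure :: "(real^3) set \<Rightarrow> (real^3 \<Rightarrow> complex^3) \<Rightarrow> bool"
  where "C1_closure \<Omega> u \<longleftrightarrow>
    continuous_on (closure \<Omega>) u \<and> bounded (u ` \<Omega>) \<and>
    (\<forall>x\<in>\<Omega>. u differentiable (at x)) \<and>
    (\<forall>j. bounded (partial_deriv j u ` \<Omega>) \<and>
         (\<exists>D. continuous_on (closure \<Omega>) D \<and> (\<forall>x\<in>\<Omega>. D x = partial_deriv j u x)))"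

text \<open>
  Near each boundary point the domain is, in suitable orthonormal coordinates, the region above
  the graph of a $C^m$ function of the first two coordinates.
\<close>

definition bounded_domain_of_class :: "nat \<Rightarrow> (real^3) set \<Rightarrow> bool"
  where "bounded_domain_of_class m G \<longleftrightarrow>
    open G \<and> connected G \<and> G \<noteq> {} \<and> bounded G \<and>
    (\<forall>p\<in>frontier G. \<exists>r>0. \<exists>Q \<gamma>.
       orthogonal_transformation (Q :: real^3 \<Rightarrow> real^3) \<and> C_on m (\<gamma> :: real^2 \<Rightarrow> real) UNIV \<and>
       G \<inter> ball p r = {x \<in> ball p r. Q x $ 3 > \<gamma> (vector [Q x $ 1, Q x $ 2])})"

subsection \<open>Surface measure and unit normal\<close>

definition local_param :: "(real^3) set \<Rightarrow> (real^2) set \<Rightarrow> (real^2 \<Rightarrow> real^3) \<Rightarrow> bool"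
  where "local_param S U \<psi> \<longleftrightarrow>
    open U \<and> C_on 1 \<psi> U \<and> (\<forall>p\<in>U. inj (frechet_derivative \<psi> (at p))) \<and>
    openin (top_of_set S) (\<psi> ` U) \<and> (\<exists>\<phi>. homeomorphism U (\<psi> ` U) \<psi> \<phi>)"

definition area_density :: "(real^2 \<Rightarrow> real^3) \<Rightarrow> real^2 \<Rightarrow> real"
  where "area_density \<psi> p = norm (cross3 (frechet_derivative \<psi> (at p) (axis 1 1))
                                        (frechet_derivative \<psi> (at p) (axis 2 1)))"

text \<open>
  Each local parametrization \<open>\<psi>\<close> of a $C^1$ surface \<open>S\<close> carries the area element
  $|\partial_1\psi\times\partial_2\psi|\,dp$ to a Borel measure on \<open>\<psi> ` U\<close>. By the change of variables
  formula, two such measures agree on the overlap of their images, so their supremum in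
  the complete lattice of measures is the measure that restricts to each of them: the surface
  measure of \<open>S\<close>, which vanishes off \<open>S\<close>.
\<close>

definition surface_measure :: "(real^3) set \<Rightarrow> (real^3) measure"
  where "surface_measure S =
    Sup {distr (density (restrict_space lborel U) (\<lambda>p. ennreal (area_density \<psi> p))) borel \<psi>
         | U \<psi>. local_param S U \<psi>}"

lemma sets_surface_measure [simp, measurable_cong]: "sets (surface_measure S) = sets borel"
proof -
  let ?M = "{distr (density (restrict_space lborel U) (\<lambda>p. ennreal (area_density \<psi> p))) borel \<psi>
             | U \<psi>. local_param S U \<psi>}"
  have "local_param S {} (\<lambda>_. 0)" by (simp add: local_param_def)
  then have "?M \<noteq> {}" by blast
  moreover have "sets m = sets borel" if "m \<in> ?M" for m using that by auto
  ultimately have "sets (SUP m\<in>?M. m) = sets borel" by (intro sets_SUP)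
  then show ?thesis unfolding surface_measure_def image_ident .
qed

lemma param_measure_le_surface_measure:
  assumes "local_param S U \<psi>"
  shows "distr (density (restrict_space lborel U) (\<lambda>p. ennreal (area_density \<psi> p))) borel \<psi>
    \<le> surface_measure S"
  unfolding surface_measure_def using assms by (intro Sup_upper) auto

definition outward_unit_normal :: "(real^3) set \<Rightarrow> (real^3 \<Rightarrow> real^3) \<Rightarrow> bool"
  where "outward_unit_normal G \<eta> \<longleftrightarrow> (\<forall>y\<in>frontier G.
    norm (\<eta> y) = 1 \<and>
    (\<forall>U \<psi> p v. local_param (frontier G) U \<psi> \<and> p \<in> U \<and> \<psi> p = y \<longrightarrow>
       orthogonal (\<eta> y) (frechet_derivative \<psi> (at p) v)) \<and>
    (\<forall>\<^sub>F t in at_right 0. y + t *\<^sub>R \<eta> y \<notin> closure G \<and> y - t *\<^sub>R \<eta> y \<in> G))"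

subsection \<open>Helmholtz potentials\<close>

definition helmholtz_kernel :: "real \<Rightarrow> real^3 \<Rightarrow> complex"
  where "helmholtz_kernel lam x = exp (\<i> * of_real (lam * norm x)) / of_real (4 * pi * norm x)"

text \<open>The potentials of the exterior domain of \<open>G\<close>, with \<open>\<eta>\<close> the unit normal pointing out of \<open>G\<close>.\<close>

definition scalar_potential ::
    "real \<Rightarrow> (real^3) set \<Rightarrow> (real^3 \<Rightarrow> real^3) \<Rightarrow> (real^3 \<Rightarrow> complex^3) \<Rightarrow> real^3 \<Rightarrow> complex"
  where "scalar_potential lam G \<eta> u x =
    (LINT y:(- closure G)|lborel. helmholtz_kernel lam (x - y) * divergence u y) +
    (LINT y:frontier G|surface_measure (frontier G).
       helmholtz_kernel lam (x - y) * rc_dot (\<eta> y) (u y))"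

definition vector_potential ::
    "real \<Rightarrow> (real^3) set \<Rightarrow> (real^3 \<Rightarrow> real^3) \<Rightarrow> (real^3 \<Rightarrow> complex^3) \<Rightarrow> real^3 \<Rightarrow> complex^3"
  where "vector_potential lam G \<eta> u x =
    (LINT y:(- closure G)|lborel. helmholtz_kernel lam (x - y) *s (curl u y - lam *\<^sub>R u y)) +
    (LINT y:frontier G|surface_measure (frontier G).
       helmholtz_kernel lam (x - y) *s rc_cross (\<eta> y) (u y))"

end

theory Submission
  imports Defs
begin

text \<open>
  Replacing $|z|$ by $r_\varepsilon(z) = \sqrt{|z|^2 + \varepsilon^2}$ in $\Gamma_\lambda$ gives a smooth kernel
  $\Gamma_\varepsilon$ for which $-\Delta\Gamma_\varepsilon - \lambda^2\Gamma_\varepsilon$ is an approximate identity, up to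
  terms that vanish with $\varepsilon$. Green's formula in the exterior domain, applied to the products of
  $\Gamma_\varepsilon(x - \cdot)$, its first derivatives and a cut-off of $u$ at radius $R$, and followed by
  $\varepsilon \to 0$, represents $u(x)$ by potentials over $\Omega$ and $S$ plus an error supported in
  $R < |y| < 2R$. There $\nabla\Gamma_\lambda(x - y)$ equals $-i\lambda\Gamma_\lambda(x - y)\,y/|y|$ up to
  $O(|y|^{-2})$, so the error is an integral over radii of the two spherical means in the hypotheses, and it
  tends to $0$ as $R \to \infty$. The derivatives in the representation move outside the integrals.
  The decay follows by splitting $\int |x - y|^{-a}|y|^{-\rho}\,dy$ for $a = 1, 2$ into $|y| \le |x|/2$,
  $|y| > 2|x|$ and the shell between them. For compactly supported sources the radiation condition is inherited from the kernel.
\<close>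

subsection \<open>Surface measure on graphs and spheres\<close>

text \<open>\<open>u\<close> is only C^1, so Green's formula cannot be used with the Laplacian of
  \<open>u\<close>. For each component of \<open>u\<close> the divergence is taken of a vector field
  built from \<open>u\<close>, the kernel K and grad K, chosen so that mixed second derivatives of K
  cancel and the derivatives of \<open>u\<close> assemble into div u and curl u - lam u. The
  gradient of the cut-off is radial and has length of order 1/R. With n = y/|y|, the leading error
  is i lam K times that length times a component of i n \<times> u - u, the quantity in the first
  spherical mean. K is also of order 1/R and the shell has width R, so o(R) is the rate required of
  this mean. The remainder of grad K costs one more power of R, which is met by o(R^2) for the
  second mean. For the singular kernel, differentiation under the volume integral has no integrable
  majorant, as the singularity of order |x - y|^-2 moves with x. It is done for the regularised
  kernels, whose potentials have locally uniformly convergent gradients. The surface measure is a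
  supremum over all parametrizations; it is computed on graphs, where the graph parametrization
  attains the supremum.\<close>

lemma distr_density_change_of_variables:
  fixes g :: "real^'m::{finite,wellorder} \<Rightarrow> real^'m::_"
  assumes X: "X \<in> sets borel" and gX: "g ` X \<in> sets borel"
    and der: "\<And>x. x \<in> X \<Longrightarrow> (g has_derivative g' x) (at x within X)"
    and inj: "inj_on g X"
    and det [measurable]: "(\<lambda>x. det (matrix (g' x))) \<in> borel_measurable (restrict_space borel X)"
  shows "distr (density (restrict_space lborel X) (\<lambda>x. ennreal \<bar>det (matrix (g' x))\<bar>)) borel g
    = density lborel (indicator (g ` X))"
proof (rule measure_eqI)
  let ?d = "\<lambda>x. \<bar>det (matrix (g' x))\<bar>"
  let ?M = "density (restrict_space lborel X) (\<lambda>x. ennreal (?d x))"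
  have g_cont: "continuous_on X g"
    using der has_derivative_continuous continuous_on_eq_continuous_within by blast
  have gm [measurable]: "g \<in> borel_measurable (restrict_space borel X)"
    by (rule borel_measurable_continuous_on_restrict[OF g_cont])
  have sets_r: "sets (restrict_space lborel X) = sets (restrict_space borel X)"
    by (intro sets_restrict_space_cong) simp
  have det' [measurable]: "(\<lambda>x. det (matrix (g' x))) \<in> borel_measurable (restrict_space lborel X)"
    using det by (simp cong: measurable_cong_sets add: measurable_cong_sets[OF sets_r refl])
  have gm' [measurable]: "g \<in> measurable (restrict_space lborel X) borel"
    using gm by (simp add: measurable_cong_sets[OF sets_r refl])
  show "sets (distr ?M borel g) = sets (density lborel (indicator (g ` X)))" by simp
  fix A assume "A \<in> sets (distr ?M borel g)"
  then have A [measurable]: "A \<in> sets borel" by simp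
  define Y where "Y = {x\<in>X. g x \<in> A}"
  have "g -` A \<inter> space (restrict_space borel X) \<in> sets (restrict_space borel X)"
    using gm A by (rule measurable_sets)
  then have Y: "Y \<in> sets borel"
    using X by (auto simp: Y_def space_restrict_space sets_restrict_space_iff Int_def conj_commute)
  have im: "g ` Y = A \<inter> g ` X" by (auto simp: Y_def)
  have "emeasure (distr ?M borel g) A = emeasure ?M (g -` A \<inter> X)"
    by (subst emeasure_distr) (auto simp: space_restrict_space)
  also have "g -` A \<inter> X = Y" by (auto simp: Y_def)
  also have "emeasure ?M Y = (\<integral>\<^sup>+x. ennreal (?d x) * indicator Y x \<partial>restrict_space lborel X)"
    using X Y by (intro emeasure_density) (auto simp: sets_restrict_space_iff Y_def)
  also have "\<dots> = (\<integral>\<^sup>+x. ennreal (?d x) * indicator Y x * indicator X x \<partial>lborel)"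
    using X by (subst nn_integral_restrict_space) auto
  also have "\<dots> = (\<integral>\<^sup>+x. ennreal (?d x * indicator Y x) \<partial>lborel)"
    by (intro nn_integral_cong) (auto simp: Y_def indicator_def)
  finally have 1: "emeasure (distr ?M borel g) A = (\<integral>\<^sup>+x. ennreal (?d x * indicator Y x) \<partial>lborel)" .
  have dX: "(\<lambda>x. indicator X x *\<^sub>R ?d x) \<in> borel_measurable borel"
    using X det by (subst borel_measurable_restrict_space_iff[symmetric]) auto
  have "(\<lambda>x. ?d x * indicator Y x) = (\<lambda>x. (indicator X x *\<^sub>R ?d x) * indicator Y x)"
    by (auto simp: Y_def indicator_def fun_eq_iff)
  then have dY: "(\<lambda>x. ?d x * indicator Y x) \<in> borel_measurable borel"
    using dX Y by simp
  have derY: "(g has_derivative g' x) (at x within Y)" if "x \<in> Y" for x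
    using der[of x] that by (auto simp: Y_def intro: has_derivative_subset)
  have injY: "inj_on g Y" using inj by (auto simp: Y_def intro: inj_on_subset)
  have mi: "(g ` Y \<in> lmeasurable \<and> measure lebesgue (g ` Y) = m) = ((?d has_integral m) Y)" for m
    by (rule has_measure_differentiable_image[OF _ derY injY]) (use Y in simp)
  have hi: "(?d has_integral m) Y \<longleftrightarrow> ((\<lambda>x. ?d x * indicator Y x) has_integral m) UNIV" for m
    by (subst has_integral_restrict_UNIV[symmetric])
       (simp add: indicator_def of_bool_def if_distrib[of "(*) _"] cong: if_cong)
  have gY: "g ` Y \<in> sets borel" using A gX by (simp add: im)
  \<comment> \<open>\<open>mi\<close> settles finite values m only. If the integral is infinite, a
    finite measure of the image would make it finite, again through \<open>mi\<close>.\<close>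
  have 2: "emeasure lborel (g ` Y) = (\<integral>\<^sup>+x. ennreal (?d x * indicator Y x) \<partial>lborel)" 
  proof (cases "(\<integral>\<^sup>+x. ennreal (?d x * indicator Y x) \<partial>lborel) < \<infinity>")
    case True
    then obtain m where m: "(\<integral>\<^sup>+x. ennreal (?d x * indicator Y x) \<partial>lborel) = ennreal m" "m \<ge> 0"
      by (cases "\<integral>\<^sup>+x. ennreal (?d x * indicator Y x) \<partial>lborel" rule: ennreal_cases) auto
    have "((\<lambda>x. ?d x * indicator Y x) has_integral m) UNIV"
      by (rule nn_integral_has_integral[OF dY _ m]) simp
    then have "(?d has_integral m) Y"
      by (simp add: hi)
    then have "g ` Y \<in> lmeasurable" "measure lebesgue (g ` Y) = m" using mi by auto
    then have "emeasure lebesgue (g ` Y) = ennreal m" by (simp add: emeasure_eq_measure2)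
    then show ?thesis using m gY by simp
  next
    case False
    have "emeasure lborel (g ` Y) = \<infinity>"
    proof (rule ccontr)
      assume "emeasure lborel (g ` Y) \<noteq> \<infinity>"
      then have "g ` Y \<in> lmeasurable" using gY by (intro fmeasurableI) (auto simp: less_top)
      then have "(?d has_integral measure lebesgue (g ` Y)) Y" using mi by blast
      then have "(\<integral>\<^sup>+x. ennreal (?d x * indicator Y x) \<partial>lborel) = measure lebesgue (g ` Y)"
        using dY by (intro nn_integral_has_integral_lborel) (auto simp: hi)
      then show False using False by simp
    qed
    then show ?thesis using False by (auto simp: less_top[symmetric])
  qed
  have "emeasure (density lborel (indicator (g ` X))) A = (\<integral>\<^sup>+x. indicator (g ` X) x * indicator A x \<partial>lborel)"
    using gX A by (subst emeasure_density) auto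
  also have "\<dots> = (\<integral>\<^sup>+x. indicator (g ` Y) x \<partial>lborel)"
    by (intro nn_integral_cong) (auto simp: im indicator_def)
  also have "\<dots> = emeasure lborel (g ` Y)" using gY by simp
  finally show "emeasure (distr ?M borel g) A = emeasure (density lborel (indicator (g ` X))) A"
    unfolding 1 2[symmetric] by (rule sym)
qed

definition lift3 :: "real^2 \<Rightarrow> real \<Rightarrow> real^3" where "lift3 s t = vector [s $ 1, s $ 2, t]"

definition drop2 :: "real^3 \<Rightarrow> real^2" where "drop2 x = vector [x $ 1, x $ 2]"

lemma lift3_nth [simp]: "lift3 s t $ 1 = s $ 1" "lift3 s t $ 2 = s $ 2" "lift3 s t $ 3 = t"
  by (simp_all add: lift3_def)

lemma drop2_nth [simp]: "drop2 x $ 1 = x $ 1" "drop2 x $ 2 = x $ 2"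
  by (simp_all add: drop2_def)

lemma drop2_lift3 [simp]: "drop2 (lift3 s t) = s" 
  by (simp add: vec_eq_iff forall_2)

lemma lift3_drop2: "lift3 (drop2 x) (x $ 3) = x" 
  by (simp add: vec_eq_iff forall_3)

lemma bounded_linear_drop2: "bounded_linear drop2"
  unfolding linear_conv_bounded_linear[symmetric]
  by (rule linearI) (simp_all add: vec_eq_iff forall_2)

lemma bounded_linear_lift3: "bounded_linear (\<lambda>p. lift3 (fst p) (snd p))"
  unfolding linear_conv_bounded_linear[symmetric]
  by (rule linearI) (simp_all add: vec_eq_iff forall_3)

lemma has_derivative_lift3 [derivative_intros]:
  assumes "(f has_derivative f') (at x within X)" "(g has_derivative g') (at x within X)"
  shows "((\<lambda>x. lift3 (f x) (g x)) has_derivative (\<lambda>h. lift3 (f' h) (g' h))) (at x within X)"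
  using bounded_linear.has_derivative[OF bounded_linear_lift3 has_derivative_Pair[OF assms]]
  by simp

lemma continuous_on_lift3 [continuous_intros]:
  assumes "continuous_on A f" "continuous_on A g"
  shows "continuous_on A (\<lambda>x. lift3 (f x) (g x))"
  using bounded_linear.continuous_on[OF bounded_linear_lift3 continuous_on_Pair[OF assms]] by simp

lemmas continuous_on_drop2 [continuous_intros] = bounded_linear.continuous_on[OF bounded_linear_drop2]

lemma cross3_orthogonal_norm:
  assumes "orthogonal_transformation P"
  shows "norm (cross3 (P a) (P b)) = norm (cross3 a b)"
proof -
  have "(norm (cross3 (P a) (P b)))\<^sup>2 = (norm (cross3 a b))\<^sup>2"
    using assms by (simp add: norm_cross orthogonal_transformation_norm orthogonal_transformation_def)
  then show ?thesis by (simp add: power2_eq_iff_nonneg)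
qed

definition param_measure :: "(real^2) set \<Rightarrow> (real^2 \<Rightarrow> real^3) \<Rightarrow> (real^3) measure"
  where "param_measure U \<psi> =
    distr (density (restrict_space lborel U) (\<lambda>p. ennreal (area_density \<psi> p))) borel \<psi>"

lemma sets_param_measure [simp, measurable_cong]: "sets (param_measure U \<psi>) = sets borel"
  by (simp add: param_measure_def)

lemma sets_restrict_lborel: "sets (restrict_space lborel X) = sets (restrict_space borel X)"
  by (intro sets_restrict_space_cong) simp

lemma measurable_restrict_lborel: "measurable (restrict_space lborel X) N = measurable (restrict_space borel X) N"
  by (intro measurable_cong_sets sets_restrict_lborel refl)

lemma local_param_has_derivative:
  assumes "local_param S U \<psi>" "p \<in> U"
  shows "(\<psi> has_derivative frechet_derivative \<psi> (at p)) (at p)"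
  using assms frechet_derivative_works by (auto simp: local_param_def)

lemma local_param_continuous_on:
  assumes "local_param S U \<psi>" shows "continuous_on U \<psi>"
  using assms by (auto simp: local_param_def homeomorphism_def)

lemma area_density_nonneg: "0 \<le> area_density \<psi> s"
  by (simp add: area_density_def)

lemma continuous_on_area_density:
  assumes "local_param S U \<psi>" shows "continuous_on U (area_density \<psi>)"
  using assms unfolding area_density_def local_param_def
  by (auto intro!: continuous_on_norm continuous_on_cross)

lemma emeasure_param_measure:
  assumes "local_param S U \<psi>" "A \<in> sets borel"
  shows "emeasure (param_measure U \<psi>) A = (\<integral>\<^sup>+p. ennreal (area_density \<psi> p) * indicator A (\<psi> p) * indicator U p \<partial>lborel)"
proof -
  have U: "U \<in> sets borel" "open U" using assms by (auto simp: local_param_def)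
  note [measurable] = assms(2)
  have m1 [measurable]: "\<psi> \<in> measurable (restrict_space lborel U) borel"
    unfolding measurable_restrict_lborel
    by (rule borel_measurable_continuous_on_restrict[OF local_param_continuous_on[OF assms(1)]])
  have m2 [measurable]: "area_density \<psi> \<in> measurable (restrict_space lborel U) borel"
    unfolding measurable_restrict_lborel
    by (rule borel_measurable_continuous_on_restrict[OF continuous_on_area_density[OF assms(1)]])
  have "emeasure (param_measure U \<psi>) A = (\<integral>\<^sup>+p. indicator A p \<partial>param_measure U \<psi>)"
    using assms by simp
  also have "\<dots> = (\<integral>\<^sup>+p. ennreal (area_density \<psi> p) * indicator A (\<psi> p) \<partial>restrict_space lborel U)"
    unfolding param_measure_def
    by (simp add: nn_integral_distr nn_integral_density del: nn_integral_indicator emeasure_distr)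
  also have "\<dots> = (\<integral>\<^sup>+p. ennreal (area_density \<psi> p) * indicator A (\<psi> p) * indicator U p \<partial>lborel)"
    using U by (subst nn_integral_restrict_space) auto
  finally show ?thesis .
qed

lemma surface_measure_eq: "surface_measure S = Sup {param_measure U \<psi> | U \<psi>. local_param S U \<psi>}"
  unfolding surface_measure_def param_measure_def ..

lemma le_measure_borel:
  assumes "sets M = sets N" "\<And>A. A \<in> sets M \<Longrightarrow> emeasure M A \<le> emeasure N A" shows "M \<le> N"
  using le_measure[OF assms(1)] assms by auto

text \<open>A supremum of measures has no formula, but it lies below every upper bound. The measure
  \<open>\<nu>\<close> agrees with the chart measure on subsets of \<open>N\<close> and is infinite
  on every Borel set that meets the complement of \<open>N\<close>. By \<open>le\<close> each member
  of the family lies below it, so on \<open>N\<close> the supremum cannot exceed the chart measure,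
  which is itself a member.\<close>

lemma surface_measure_local:
  assumes p: "local_param S V \<psi>" and N [measurable]: "N \<in> sets borel" and im: "\<psi> ` V \<subseteq> N"
    and le: "\<And>U \<phi> A. local_param S U \<phi> \<Longrightarrow> A \<in> sets borel \<Longrightarrow>
      emeasure (param_measure U \<phi>) (A \<inter> N) \<le> emeasure (param_measure V \<psi>) A"
    and A [measurable]: "A \<in> sets borel"
  shows "emeasure (surface_measure S) (A \<inter> N) = emeasure (param_measure V \<psi>) A"
proof (rule antisym)
  \<comment> \<open>Infinite mass for each point off \<open>N\<close>, where \<open>le\<close> says
    nothing about the other parametrizations.\<close>
  let ?k = "density (count_space (- N)) (\<lambda>_. \<infinity>)"
  define f where "f A = emeasure (param_measure V \<psi>) A + emeasure ?k (A - N)" for A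
  define \<nu> where "\<nu> = measure_of UNIV (sets borel) f"
  have sets_\<nu>: "sets \<nu> = sets borel" 
    unfolding \<nu>_def using sets.sets_measure_of_eq[of "borel :: (real^3) measure"] by simp
  have "emeasure \<nu> A = f A" if "A \<in> sets borel" for A
    unfolding \<nu>_def
  proof (rule emeasure_measure_of_sigma)
    show "A \<in> sets borel" by (rule that)
    show "sigma_algebra UNIV (sets (borel :: (real^3) measure))"
      using sets.sigma_algebra_axioms[of "borel :: (real^3) measure"] by simp
    show "positive (sets borel) f" by (simp add: positive_def f_def)
    show "countably_additive (sets borel) f"
    proof (rule countably_additiveI)
      fix A :: "nat \<Rightarrow> (real^3) set" assume A: "range A \<subseteq> sets borel" "disjoint_family A"
      have "(\<Sum>i. emeasure (param_measure V \<psi>) (A i)) = emeasure (param_measure V \<psi>) (\<Union>i. A i)"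
        using A by (intro suminf_emeasure) auto
      moreover have "(\<Sum>i. emeasure ?k (A i - N)) = emeasure ?k (\<Union>i. A i - N)"
        using A by (intro suminf_emeasure) (auto simp: disjoint_family_on_def)
      moreover have "(\<Union>i. A i - N) = (\<Union>i. A i) - N" by auto
      ultimately show "(\<Sum>i. f (A i)) = f (\<Union>i. A i)"
        unfolding f_def by (subst suminf_add[symmetric]) simp_all
    qed
  qed
  note em = this
  have "surface_measure S \<le> \<nu>"
    unfolding surface_measure_eq
  proof (rule Sup_least, clarify)
    fix U \<phi> assume q: "local_param S U \<phi>"
    show "param_measure U \<phi> \<le> \<nu>"
    proof (rule le_measure_borel)
      fix A assume "A \<in> sets (param_measure U \<phi>)"
      then have [measurable]: "A \<in> sets borel" by simp
      have "emeasure (param_measure U \<phi>) A \<le> f A"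
      proof (cases "A \<subseteq> N")
        case True
        then show ?thesis using le[OF q, of A] by (simp add: f_def Int_absorb2 add_increasing2)
      next
        case False
        then obtain x where x: "x \<in> A - N" by auto
        have "\<infinity> = emeasure ?k {x}"
          using x by (subst emeasure_density) (auto simp: nn_integral_count_space_indicator)
        also have "\<dots> \<le> emeasure ?k (A - N)"
          using x by (intro emeasure_mono) auto
        finally show ?thesis by (simp add: f_def top_unique)
      qed
      then show "emeasure (param_measure U \<phi>) A \<le> emeasure \<nu> A" by (simp add: em)
    qed (simp add: sets_\<nu>)
  qed
  then have "emeasure (surface_measure S) (A \<inter> N) \<le> emeasure \<nu> (A \<inter> N)"
    by (rule le_measureD3) (simp add: sets_\<nu>)
  also have "\<dots> = emeasure (param_measure V \<psi>) (A \<inter> N)"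
    by (subst em) (simp_all add: f_def Diff_eq Int_assoc)
  also have "\<dots> \<le> emeasure (param_measure V \<psi>) A"
    by (intro emeasure_mono) auto
  finally show "emeasure (surface_measure S) (A \<inter> N) \<le> emeasure (param_measure V \<psi>) A" .
  have "emeasure (param_measure V \<psi>) A = emeasure (param_measure V \<psi>) (A \<inter> N)"
    using p im by (subst (1 2) emeasure_param_measure) (auto intro!: nn_integral_cong simp: indicator_def image_subset_iff)
  also have "\<dots> \<le> emeasure (surface_measure S) (A \<inter> N)"
    using param_measure_le_surface_measure[OF p, folded param_measure_def]
    by (rule le_measureD3) simp
  finally show "emeasure (param_measure V \<psi>) A \<le> emeasure (surface_measure S) (A \<inter> N)" .
qed

text \<open>In the orthonormal coordinates given by \<open>Q\<close>, with inverse \<open>P\<close>,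
  the piece \<open>S \<inter> N\<close> of a surface is a graph over \<open>V\<close>;
  \<open>\<gamma>1\<close> and \<open>\<gamma>2\<close> are the partial derivatives of
  \<open>\<gamma>\<close>. Hemispheres and pieces of the boundary of the domain are both
  instances.\<close>

locale graph_patch =
  fixes S N :: "(real^3) set" and V :: "(real^2) set" and P Q :: "real^3 \<Rightarrow> real^3"
    and \<gamma> \<gamma>1 \<gamma>2 :: "real^2 \<Rightarrow> real"
  assumes P: "orthogonal_transformation P" and PQ [simp]: "\<And>x. P (Q x) = x" and QP [simp]: "\<And>x. Q (P x) = x"
    and open_N: "open N" and open_V: "open V"
    and deriv: "\<And>s. s \<in> V \<Longrightarrow> (\<gamma> has_derivative (\<lambda>h. \<gamma>1 s * h $ 1 + \<gamma>2 s * h $ 2)) (at s)"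
    and cont: "continuous_on V \<gamma>1" "continuous_on V \<gamma>2"
    and image: "S \<inter> N = (\<lambda>s. P (lift3 s (\<gamma> s))) ` V"
begin

definition \<psi> where "\<psi> s = P (lift3 s (\<gamma> s))"

lemma Q: "orthogonal_transformation Q"
  unfolding orthogonal_transformation
proof safe
  have "linear P" using P by (simp add: orthogonal_transformation_def)
  show "linear Q"
  proof (rule linearI)
    show "Q (x + y) = Q x + Q y" for x y
      using QP[of "Q x + Q y"] linear_add[OF \<open>linear P\<close>, of "Q x" "Q y"] by simp
    show "Q (c *\<^sub>R x) = c *\<^sub>R Q x" for c x
      using QP[of "c *\<^sub>R Q x"] linear_scale[OF \<open>linear P\<close>, of c "Q x"] by simp
  qed
  show "norm (Q v) = norm v" for v
    using P PQ by (metis orthogonal_transformation_norm)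
qed

lemma bounded_linear_P: "bounded_linear P" and bounded_linear_Q: "bounded_linear Q"
  using P Q linear_conv_bounded_linear by (auto simp: orthogonal_transformation_def)

lemma psi_image: "\<psi> ` V = S \<inter> N"
  using image by (simp add: \<psi>_def[abs_def])

lemma drop2_Q_psi [simp]: "drop2 (Q (\<psi> s)) = s"
  by (simp add: \<psi>_def)

lemma psi_drop2_Q: "x \<in> S \<Longrightarrow> x \<in> N \<Longrightarrow> \<psi> (drop2 (Q x)) = x"
  using psi_image by (metis IntI drop2_Q_psi imageE)

lemma psi_deriv:
  "s \<in> V \<Longrightarrow> (\<psi> has_derivative (\<lambda>h. P (lift3 h (\<gamma>1 s * h $ 1 + \<gamma>2 s * h $ 2)))) (at s)"
  unfolding \<psi>_def[abs_def]
  by (intro bounded_linear.has_derivative[OF bounded_linear_P] has_derivative_lift3 has_derivative_ident deriv)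

lemma frechet_psi: "s \<in> V \<Longrightarrow> frechet_derivative \<psi> (at s) = (\<lambda>h. P (lift3 h (\<gamma>1 s * h $ 1 + \<gamma>2 s * h $ 2)))"
  using frechet_derivative_at[OF psi_deriv] by simp

lemma continuous_on_psi: "continuous_on V \<psi>"
  by (rule has_derivative_continuous_on[OF has_derivative_at_withinI[OF psi_deriv]])

lemma local_param_psi: "local_param S V \<psi>"
  unfolding local_param_def
proof (intro conjI ballI)
  show "openin (top_of_set S) (\<psi> ` V)" using psi_image open_N by auto
  show "C_on 1 \<psi> V"
  proof (simp, intro conjI ballI allI)
    show "\<psi> differentiable (at s)" if "s \<in> V" for s
      using psi_deriv[OF that] differentiableI by blast
    show "continuous_on V (\<lambda>x. frechet_derivative \<psi> (at x) v)" for v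
    proof (rule continuous_on_eq)
      show "continuous_on V (\<lambda>s. P (lift3 v (\<gamma>1 s * v $ 1 + \<gamma>2 s * v $ 2)))"
        by (intro bounded_linear.continuous_on[OF bounded_linear_P] continuous_intros cont)
    qed (simp add: frechet_psi)
  qed
  show "inj (frechet_derivative \<psi> (at p))" if "p \<in> V" for p
    unfolding frechet_psi[OF that]
    by (rule inj_on_inverseI[where g="\<lambda>x. drop2 (Q x)"]) simp
  show "\<exists>\<phi>. homeomorphism V (\<psi> ` V) \<psi> \<phi>"
    by (rule exI[where x="\<lambda>x. drop2 (Q x)"])
       (auto simp: homeomorphism_def image_image continuous_on_psi
         intro!: continuous_on_drop2 bounded_linear.continuous_on[OF bounded_linear_Q] continuous_on_id)
qed (rule open_V)

lemma area_density_psi: "s \<in> V \<Longrightarrow> area_density \<psi> s = sqrt (1 + (\<gamma>1 s)\<^sup>2 + (\<gamma>2 s)\<^sup>2)"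
  unfolding area_density_def frechet_psi
  by (simp add: cross3_orthogonal_norm[OF P])
     (simp add: norm_eq_sqrt_inner inner_vec_def sum_3 cross3_simps axis_def power2_eq_square)

text \<open>\<open>T\<close> reads off the graph coordinates of a point of the other
  parametrization, so \<open>\<phi>\<close> is \<open>\<psi>\<close> after \<open>T\<close> on
  \<open>U'\<close>, and the chain rule compares the area densities: the cross product is
  alternating and bilinear, hence scales by the determinant of \<open>T'\<close>. Openness of the
  image of \<open>T\<close> is invariance of domain, since \<open>T\<close> is continuous and
  injective.\<close>

lemma area_density_transition:
  assumes p: "local_param S U \<phi>" and U': "U' = {p\<in>U. \<phi> p \<in> N}"
    and T: "T = (\<lambda>p. drop2 (Q (\<phi> p)))" and T': "T' = (\<lambda>p h. drop2 (Q (frechet_derivative \<phi> (at p) h)))"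
  shows "open U'" "T ` U' \<subseteq> V" "inj_on T U'" "open (T ` U')"
    "\<And>p. p \<in> U' \<Longrightarrow> (T has_derivative T' p) (at p)" "\<And>p. p \<in> U' \<Longrightarrow> \<psi> (T p) = \<phi> p"
    "continuous_on U' (\<lambda>p. det (matrix (T' p)))"
    "\<And>p. p \<in> U' \<Longrightarrow> area_density \<phi> p = area_density \<psi> (T p) * \<bar>det (matrix (T' p))\<bar>"
proof -
  have U: "open U" and cont\<phi>: "continuous_on U \<phi>" and inj\<phi>: "inj_on \<phi> U"
    and C1: "\<And>v. continuous_on U (\<lambda>x. frechet_derivative \<phi> (at x) v)"
    using p by (auto simp: local_param_def homeomorphism_def intro: inj_on_inverseI)
  have "openin (top_of_set S) (\<phi> ` U)" using p by (simp add: local_param_def)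
  then have im\<phi>: "\<phi> ` U \<subseteq> S" by (rule openin_imp_subset)
  show "open U'"
    using continuous_open_preimage[OF cont\<phi> U open_N] by (simp add: U' Int_def vimage_def)
  note oU' = this
  show ps: "\<psi> (T p) = \<phi> p" if "p \<in> U'" for p
    using that im\<phi> by (auto simp: U' T intro!: psi_drop2_Q)
  show TV: "T ` U' \<subseteq> V"
  proof
    fix s assume "s \<in> T ` U'"
    then obtain p where q: "p \<in> U'" "s = T p" by auto
    then have "\<phi> p \<in> \<psi> ` V" using im\<phi> by (auto simp: psi_image U')
    then show "s \<in> V" using q by (auto simp: T)
  qed
  show injT: "inj_on T U'"
    using inj\<phi> ps by (smt (verit) U' inj_on_def mem_Collect_eq)
  have "continuous_on U' T"
    unfolding T by (intro continuous_on_drop2 bounded_linear.continuous_on[OF bounded_linear_Q]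
        continuous_on_subset[OF cont\<phi>]) (auto simp: U')
  then show "open (T ` U')"
    using invariance_of_domain oU' injT by blast
  show dT: "(T has_derivative T' p) (at p)" if "p \<in> U'" for p
    unfolding T T' using that 
    by (intro bounded_linear.has_derivative[OF bounded_linear_drop2]
       bounded_linear.has_derivative[OF bounded_linear_Q] local_param_has_derivative[OF p]) (auto simp: U')
  have "continuous_on U' (\<lambda>p. T' p v)" for v
    unfolding T' by (intro continuous_on_drop2 bounded_linear.continuous_on[OF bounded_linear_Q]
        continuous_on_subset[OF C1]) (auto simp: U')
  then show "continuous_on U' (\<lambda>p. det (matrix (T' p)))"
    unfolding det_2 matrix_def by (auto intro!: continuous_intros)
  fix p assume q: "p \<in> U'"
  have TpV: "T p \<in> V" using TV q by auto
  have "((\<lambda>x. \<psi> (T x)) has_derivative (\<lambda>h. frechet_derivative \<psi> (at (T p)) (T' p h))) (at p)"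
    using has_derivative_compose[OF dT[OF q] psi_deriv[OF TpV]] by (simp add: frechet_psi[OF TpV])
  then have "(\<phi> has_derivative (\<lambda>h. frechet_derivative \<psi> (at (T p)) (T' p h))) (at p)"
    using oU' q ps by (rule has_derivative_transform_within_open)
  then have eq: "frechet_derivative \<phi> (at p) = (\<lambda>h. frechet_derivative \<psi> (at (T p)) (T' p h))"
    by (rule frechet_derivative_at[symmetric])
  have lin: "linear (frechet_derivative \<psi> (at (T p)))"
    using local_param_has_derivative[OF local_param_psi TpV] has_derivative_linear by blast
  have dec: "v = v $ 1 *\<^sub>R axis 1 1 + v $ 2 *\<^sub>R axis 2 1" for v :: "real^2"
    by (simp add: vec_eq_iff forall_2 axis_def)
  have cr: "cross3 (L v) (L w) = (v $ 1 * w $ 2 - v $ 2 * w $ 1) *\<^sub>R cross3 (L (axis 1 1)) (L (axis 2 1))"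
    if "linear L" for L :: "real^2 \<Rightarrow> real^3" and v w
    by (subst dec[of v], subst dec[of w])
       (simp add: linear_add[OF that] linear_scale[OF that] cross_add_left cross_add_right 
         cross_mult_left cross_mult_right cross_refl algebra_simps cross_skew[of "L (axis 2 1)" "L (axis 1 1)"])
  show "area_density \<phi> p = area_density \<psi> (T p) * \<bar>det (matrix (T' p))\<bar>"
    unfolding area_density_def eq
    by (subst cr[OF lin]) (simp add: det_2 matrix_def mult.commute)
qed

text \<open>Changing variables by \<open>T\<close> turns the measure of an arbitrary parametrization
  into an integral of the graph's own density over the image of \<open>T\<close>. Only an inequality
  results, because that image may be a proper part of \<open>V\<close>.\<close>

lemma param_measure_le:
  assumes p: "local_param S U \<phi>" and A [measurable]: "A \<in> sets borel"
  shows "emeasure (param_measure U \<phi>) (A \<inter> N) \<le> emeasure (param_measure V \<psi>) A"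
proof -
  define U' where "U' = {p\<in>U. \<phi> p \<in> N}"
  define T where "T = (\<lambda>p. drop2 (Q (\<phi> p)))"
  define T' where "T' = (\<lambda>p h. drop2 (Q (frechet_derivative \<phi> (at p) h)))"
  note tr = area_density_transition[OF p U'_def T_def T'_def]
  have N [measurable]: "N \<in> sets borel" using open_N by simp
  define h where "h s = indicator V s * (ennreal (area_density \<psi> s) * indicator A (\<psi> s))" for s
  have [measurable]: "V \<in> sets borel" using open_V by simp
  have mp [measurable]: "\<psi> \<in> borel_measurable (restrict_space borel V)"
    by (rule borel_measurable_continuous_on_restrict[OF continuous_on_psi])
  have ma [measurable]: "area_density \<psi> \<in> borel_measurable (restrict_space borel V)"
    by (rule borel_measurable_continuous_on_restrict[OF continuous_on_area_density[OF local_param_psi]])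
  have h [measurable]: "h \<in> borel_measurable borel"
  proof -
    have "(\<lambda>s. ennreal (area_density \<psi> s) * indicator A (\<psi> s)) \<in> borel_measurable (restrict_space borel V)"
      by measurable
    then show ?thesis unfolding h_def
      by (subst (asm) borel_measurable_restrict_space_iff_ennreal) (auto simp: mult.commute)
  qed
  have cont_dT: "continuous_on U' T"
    using has_derivative_continuous_on[OF has_derivative_at_withinI[OF tr(5)]] by blast
  have m1: "T \<in> measurable (restrict_space lborel U') borel"
    unfolding measurable_restrict_lborel by (rule borel_measurable_continuous_on_restrict[OF cont_dT])
  have m2: "(\<lambda>p. det (matrix (T' p))) \<in> measurable (restrict_space lborel U') borel"
    unfolding measurable_restrict_lborel by (rule borel_measurable_continuous_on_restrict[OF tr(7)])
  have "emeasure (param_measure U \<phi>) (A \<inter> N) = 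
      (\<integral>\<^sup>+p. ennreal (area_density \<phi> p) * indicator (A \<inter> N) (\<phi> p) * indicator U p \<partial>lborel)"
    by (intro emeasure_param_measure[OF p]) auto
  also have "\<dots> = (\<integral>\<^sup>+p. ennreal \<bar>det (matrix (T' p))\<bar> * h (T p) * indicator U' p \<partial>lborel)"
  proof (intro nn_integral_cong)
    fix p
    show "ennreal (area_density \<phi> p) * indicator (A \<inter> N) (\<phi> p) * indicator U p
       = ennreal \<bar>det (matrix (T' p))\<bar> * h (T p) * indicator U' p"
    proof (cases "p \<in> U'")
      case True
      then have "T p \<in> V" "\<psi> (T p) = \<phi> p" "p \<in> U" "\<phi> p \<in> N" using tr(2) tr(6) by (auto simp: U'_def)
      then show ?thesis using True tr(8)[OF True]
        by (simp add: h_def ennreal_mult' indicator_def ac_simps area_density_def)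
    next
      case False
      then show ?thesis by (auto simp: U'_def indicator_def)
    qed
  qed
  also have "\<dots> = (\<integral>\<^sup>+p. ennreal \<bar>det (matrix (T' p))\<bar> * h (T p) \<partial>restrict_space lborel U')"
    using tr(1) by (subst nn_integral_restrict_space) auto
  also have "\<dots> = (\<integral>\<^sup>+p. h p \<partial>distr (density (restrict_space lborel U') (\<lambda>p. ennreal \<bar>det (matrix (T' p))\<bar>)) borel T)"
    using m1 m2 by (simp add: nn_integral_distr nn_integral_density)
  also have "\<dots> = (\<integral>\<^sup>+p. h p \<partial>density lborel (indicator (T ` U')))"
    using tr m2 
    by (subst distr_density_change_of_variables) 
       (auto simp: measurable_restrict_lborel intro: has_derivative_at_withinI borel_open)
  also have "\<dots> = (\<integral>\<^sup>+p. indicator (T ` U') p * h p \<partial>lborel)"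
    using tr(4) by (subst nn_integral_density) auto
  also have "\<dots> \<le> (\<integral>\<^sup>+s. ennreal (area_density \<psi> s) * indicator A (\<psi> s) * indicator V s \<partial>lborel)"
    by (intro nn_integral_mono) (auto simp: h_def indicator_def)
  also have "\<dots> = emeasure (param_measure V \<psi>) A"
    by (rule emeasure_param_measure[OF local_param_psi A, symmetric])
  finally show ?thesis .
qed

text \<open>On a graph patch the supremum that defines the surface measure is attained by the graph
  parametrization. Surface integrals over graphs are computed through this equation.\<close>

lemma density_surface_measure: "density (surface_measure S) (indicator N) = param_measure V \<psi>"
proof (rule measure_eqI)
  fix A assume "A \<in> sets (density (surface_measure S) (indicator N))"
  then have [measurable]: "A \<in> sets borel" by simp
  have [measurable]: "N \<in> sets borel" using open_N by simp
  have "emeasure (density (surface_measure S) (indicator N)) A = (\<integral>\<^sup>+x. indicator (A \<inter> N) x \<partial>surface_measure S)"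
    by (subst emeasure_density)
       (auto intro!: nn_integral_cong simp: indicator_inter_arith mult.commute simp del: nn_integral_indicator)
  also have "\<dots> = emeasure (surface_measure S) (A \<inter> N)" by (rule nn_integral_indicator) simp
  also have "\<dots> = emeasure (param_measure V \<psi>) A"
    using psi_image by (intro surface_measure_local[OF local_param_psi _ _ param_measure_le]) auto
  finally show "emeasure (density (surface_measure S) (indicator N)) A = emeasure (param_measure V \<psi>) A" .
qed simp

lemma measurable_psi: "\<psi> \<in> measurable (restrict_space lborel V) borel"
  unfolding measurable_restrict_lborel
  by (rule borel_measurable_continuous_on_restrict[OF continuous_on_psi])

lemma measurable_area_density: "area_density \<psi> \<in> measurable (restrict_space lborel V) borel"
  unfolding measurable_restrict_lborel
  by (rule borel_measurable_continuous_on_restrict[OF continuous_on_area_density[OF local_param_psi]])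

lemma nn_integral_surface:
  assumes [measurable]: "f \<in> borel_measurable borel"
  shows "(\<integral>\<^sup>+x. indicator N x * f x \<partial>surface_measure S) =
    (\<integral>\<^sup>+s. indicator V s * (ennreal (area_density \<psi> s) * f (\<psi> s)) \<partial>lborel)"
proof -
  note [measurable] = measurable_psi measurable_area_density
  have [measurable]: "N \<in> sets borel" using open_N by simp
  have "(\<integral>\<^sup>+x. indicator N x * f x \<partial>surface_measure S) = (\<integral>\<^sup>+x. f x \<partial>param_measure V \<psi>)"
    unfolding density_surface_measure[symmetric] by (subst nn_integral_density) auto
  also have "\<dots> = (\<integral>\<^sup>+s. ennreal (area_density \<psi> s) * f (\<psi> s) \<partial>restrict_space lborel V)"
    unfolding param_measure_def by (simp add: nn_integral_distr nn_integral_density)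
  also have "\<dots> = (\<integral>\<^sup>+s. indicator V s * (ennreal (area_density \<psi> s) * f (\<psi> s)) \<partial>lborel)"
    using open_V by (subst nn_integral_restrict_space) (auto simp: mult.commute)
  finally show ?thesis .
qed

lemma integral_surface:
  fixes f :: "real^3 \<Rightarrow> 'b::{banach, second_countable_topology}"
  assumes [measurable]: "f \<in> borel_measurable borel"
  shows "(LINT x:N|surface_measure S. f x) = (LINT s:V|lborel. area_density \<psi> s *\<^sub>R f (\<psi> s))"
proof -
  note [measurable] = measurable_psi measurable_area_density
  have [measurable]: "N \<in> sets borel" using open_N by simp
  have "(LINT x:N|surface_measure S. f x) = (\<integral>x. f x \<partial>density (surface_measure S) (\<lambda>x. ennreal (indicator N x)))"
    unfolding set_lebesgue_integral_def by (subst integral_density) auto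
  also have "\<dots> = (\<integral>x. f x \<partial>param_measure V \<psi>)"
    unfolding density_surface_measure[symmetric] by (simp add: ennreal_indicator)
  also have "\<dots> = (\<integral>s. area_density \<psi> s *\<^sub>R f (\<psi> s) \<partial>restrict_space lborel V)"
    unfolding param_measure_def
    by (subst integral_distr, simp, simp, subst integral_density) (auto simp: area_density_nonneg)
  also have "\<dots> = (LINT s:V|lborel. area_density \<psi> s *\<^sub>R f (\<psi> s))"
    using open_V by (subst integral_restrict_space) (auto simp: set_lebesgue_integral_def)
  finally show ?thesis .
qed

text \<open>The area density is continuous, hence bounded, on a closed disc around \<open>s\<close>
  inside \<open>V\<close>, so the part of the surface over the open disc has finite area.\<close>

lemma emeasure_surface_finite_nbhd:
  assumes "x \<in> S" "x \<in> N"
  shows "\<exists>W. open W \<and> x \<in> W \<and> emeasure (surface_measure S) W < \<infinity>"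
proof -
  have "x \<in> \<psi> ` V" using assms psi_image by auto
  then obtain s where s: "s \<in> V" "x = \<psi> s" by auto
  obtain r where r: "r > 0" "cball s r \<subseteq> V" using open_V s(1) open_contains_cball by blast
  define W where "W = {y \<in> N. drop2 (Q y) \<in> ball s r}"
  have "continuous_on UNIV (\<lambda>y. drop2 (Q y))"
    by (intro continuous_on_drop2 bounded_linear.continuous_on[OF bounded_linear_Q] continuous_on_id)
  then have "open ((\<lambda>y. drop2 (Q y)) -` ball s r)" by (intro open_vimage) auto
  from open_Int[OF open_N this] have W: "open W" by (simp add: W_def Int_def vimage_def)
  have "compact (area_density \<psi> ` cball s r)"
    using continuous_on_subset[OF continuous_on_area_density[OF local_param_psi] r(2)]
    by (intro compact_continuous_image) auto
  then have "bdd_above (area_density \<psi> ` cball s r)"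
    by (intro bounded_imp_bdd_above compact_imp_bounded)
  then obtain C where C: "\<And>t. t \<in> cball s r \<Longrightarrow> area_density \<psi> t \<le> C"
    unfolding bdd_above_def by blast
  note [measurable] = borel_open[OF open_N] borel_open[OF W]
  have "emeasure (surface_measure S) W = (\<integral>\<^sup>+x. indicator N x * indicator W x \<partial>surface_measure S)"
  proof -
    have "(\<integral>\<^sup>+x. indicator N x * indicator W x \<partial>surface_measure S) = (\<integral>\<^sup>+x. indicator W x \<partial>surface_measure S)"
      by (intro nn_integral_cong) (auto simp: W_def indicator_def)
    then show ?thesis using borel_open[OF W] by simp
  qed
  also have "\<dots> = (\<integral>\<^sup>+t. indicator V t * (ennreal (area_density \<psi> t) * indicator W (\<psi> t)) \<partial>lborel)"
    by (rule nn_integral_surface) simp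
  also have "\<dots> \<le> (\<integral>\<^sup>+t. ennreal C * indicator (cball s r) t \<partial>lborel)"
    using C by (intro nn_integral_mono) (auto simp: W_def indicator_def intro!: ennreal_leI split: if_splits)
  also have "\<dots> = ennreal C * emeasure lborel (cball s r)" by (simp add: nn_integral_cmult_indicator)
  also have "\<dots> < \<infinity>" 
    using emeasure_bounded_finite[OF bounded_cball, of s r] by (simp add: ennreal_mult_less_top)
  finally show ?thesis using W assms s r by (intro exI[of _ W]) (auto simp: W_def)
qed

end

lemma emeasure_surface_finite:
  assumes "compact S" "\<And>x. x \<in> S \<Longrightarrow> \<exists>N V P Q \<gamma> \<gamma>1 \<gamma>2. x \<in> N \<and> graph_patch S N V P Q \<gamma> \<gamma>1 \<gamma>2"
  shows "emeasure (surface_measure S) S < \<infinity>"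
proof -
  have "\<forall>x\<in>S. \<exists>W. open W \<and> x \<in> W \<and> emeasure (surface_measure S) W < \<infinity>"
  proof
    fix x assume x: "x \<in> S"
    from assms(2)[OF x] show "\<exists>W. open W \<and> x \<in> W \<and> emeasure (surface_measure S) W < \<infinity>"
      by (elim exE conjE) (rule graph_patch.emeasure_surface_finite_nbhd[OF _ x])
  qed
  from bchoice[OF this] obtain W where
    W: "\<And>x. x \<in> S \<Longrightarrow> open (W x) \<and> x \<in> W x \<and> emeasure (surface_measure S) (W x) < \<infinity>"
    by blast
  obtain F where F: "F \<subseteq> S" "finite F" "S \<subseteq> (\<Union>x\<in>F. W x)"
    using compactE_image[OF assms(1), of S W] W by (metis UN_I subsetI)
  have [measurable]: "W x \<in> sets borel" if "x \<in> F" for x using W F that by auto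
  have "emeasure (surface_measure S) S \<le> emeasure (surface_measure S) (\<Union>x\<in>F. W x)"
    using F by (intro emeasure_mono) auto
  also have "\<dots> \<le> (\<Sum>x\<in>F. emeasure (surface_measure S) (W x))"
    using F by (intro emeasure_subadditive_finite) auto
  also have "\<dots> < \<infinity>" using F W by (auto simp: less_top[symmetric])
  finally show ?thesis .
qed

section \<open>Integration of radial functions in space\<close>

lemma emeasure_cball_real3: "a \<ge> 0 \<Longrightarrow> emeasure lborel (cball (0::real^3) a) = ennreal (4 / 3 * pi * a ^ 3)"
  using emeasure_cball[of a "0::real^3"] by (simp add: eval_unit_ball_vol)

text \<open>A measure on the line that is finite on half-lines \<open>{..a}\<close> is determined by
  its values there, so the radial part of Lebesgue measure is known from the volume 4/3 pi a^3 of
  balls; the density 4 pi r^2 is the derivative of that volume.\<close>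

lemma distr_norm_lborel:
  "distr lborel borel (norm :: real^3 \<Rightarrow> real) = density lborel (\<lambda>r. ennreal (4 * pi * r\<^sup>2) * indicator {0<..} r)"
  (is "?M = ?N")
proof (rule measure_eqI_generator_eq[where \<Omega>=UNIV and E="range atMost" and A="\<lambda>i. {..real i}"])
  show "Int_stable (range (atMost :: real \<Rightarrow> _))"
    by (auto simp: Int_stable_def)
  show "sets ?M = sigma_sets UNIV (range atMost)" "sets ?N = sigma_sets UNIV (range atMost)"
    by (simp_all add: borel_eq_atMost)
  have M: "emeasure ?M {..a} = ennreal (4 / 3 * pi * (max a 0) ^ 3)" for a
  proof -
    have "emeasure ?M {..a} = emeasure lborel (norm -` {..a} :: (real^3) set)"
      by (subst emeasure_distr) auto
    also have "(norm -` {..a} :: (real^3) set) = (if a \<ge> 0 then cball 0 a else {})"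
      by (auto simp: dist_norm intro: order_trans[OF norm_ge_zero])
    also have "emeasure lborel \<dots> = ennreal (4 / 3 * pi * (max a 0) ^ 3)"
      by (auto simp: emeasure_cball_real3)
    finally show ?thesis .
  qed
  have N: "emeasure ?N {..a} = ennreal (4 / 3 * pi * (max a 0) ^ 3)" for a
  proof -
    have "emeasure ?N {..a} = (\<integral>\<^sup>+r. ennreal (4 * pi * r\<^sup>2) * indicator {0<..} r * indicator {..a} r \<partial>lborel)"
      by (subst emeasure_density) auto
    also have "\<dots> = (\<integral>\<^sup>+r. ennreal (4 * pi * r\<^sup>2) * indicator {0..max a 0} r \<partial>lborel)"
      by (intro nn_integral_cong) (auto simp: indicator_def max_def)
    also have "\<dots> = ennreal (4 / 3 * pi * (max a 0) ^ 3 - 4 / 3 * pi * 0 ^ 3)"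
      by (intro nn_integral_FTC_Icc)
         (auto intro!: derivative_eq_intros simp: power2_eq_square has_real_derivative_iff_has_vector_derivative[symmetric])
    finally show ?thesis by simp
  qed
  show "emeasure ?M X = emeasure ?N X" if "X \<in> range atMost" for X
    using that M N by auto
  show "range (\<lambda>i. {..real i}) \<subseteq> range atMost" by auto
  show "(\<Union>i. {..real i}) = UNIV" using real_arch_simple by auto
  show "emeasure ?M {..real i} \<noteq> \<infinity>" for i by (simp add: M)
qed auto

lemma nn_integral_radial:
  assumes [measurable]: "f \<in> borel_measurable borel"
  shows "(\<integral>\<^sup>+x. f (norm (x::real^3)) \<partial>lborel) = (\<integral>\<^sup>+r. ennreal (4 * pi * r\<^sup>2) * indicator {0<..} r * f r \<partial>lborel)"
proof -
  have "(\<integral>\<^sup>+x. f (norm (x::real^3)) \<partial>lborel) = (\<integral>\<^sup>+r. f r \<partial>distr lborel borel (norm :: real^3 \<Rightarrow> real))"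
    by (subst nn_integral_distr) auto
  also have "\<dots> = (\<integral>\<^sup>+r. ennreal (4 * pi * r\<^sup>2) * indicator {0<..} r * f r \<partial>lborel)"
    unfolding distr_norm_lborel by (subst nn_integral_density) auto
  finally show ?thesis .
qed

lemma nn_integral_powr_ball:
  assumes a: "a < 3" and b: "b > 0"
  shows "(\<integral>\<^sup>+x. ennreal (norm (x::real^3) powr (- a)) * indicator (cball 0 b) x \<partial>lborel) < \<infinity>"
proof -
  have "(\<integral>\<^sup>+x. ennreal (norm (x::real^3) powr (- a)) * indicator (cball 0 b) x \<partial>lborel)
      = (\<integral>\<^sup>+x. ennreal (norm (x::real^3) powr (- a)) * indicator {..b} (norm x) \<partial>lborel)"
    by (intro nn_integral_cong) (auto simp: indicator_def)
  also have "\<dots> = (\<integral>\<^sup>+r. ennreal (4 * pi * r\<^sup>2) * indicator {0<..} r * (ennreal (r powr (- a)) * indicator {..b} r) \<partial>lborel)"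
    by (rule nn_integral_radial) simp
  also have "\<dots> = (\<integral>\<^sup>+r. ennreal (4 * pi * (indicator {0..b} r *\<^sub>R r powr (2 - a))) \<partial>lborel)"
    by (intro nn_integral_cong)
       (auto simp: indicator_def ennreal_mult[symmetric] powr_diff powr_minus field_simps powr_numeral)
  also have "\<dots> < \<infinity>"
  proof -
    have "(\<lambda>r. r powr (2 - a)) absolutely_integrable_on {0..b}"
      using integrable_on_powr_from_0'[of "2 - a" b] a b
      by (intro nonnegative_absolutely_integrable_1) (auto intro: integrable_on_powr_from_0)
    then have "integrable lebesgue (\<lambda>r. indicator {0..b} r *\<^sub>R r powr (2 - a))"
      by (simp add: set_integrable_def)
    then have "integrable lborel (\<lambda>r. indicator {0..b} r *\<^sub>R r powr (2 - a))"
      by (subst (asm) integrable_completion) auto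
    then have "integrable lborel (\<lambda>r. 4 * pi * (indicator {0..b} r *\<^sub>R r powr (2 - a)))" by simp
    then show ?thesis
      by (subst (asm) integrable_iff_bounded) (auto simp: abs_mult)
  qed
  finally show ?thesis .
qed

lemma nn_integral_powr_outside:
  assumes a: "a > 3" and b: "b > 0"
  shows "(\<integral>\<^sup>+x. ennreal (norm (x::real^3) powr (- a)) * indicator (- ball 0 b) x \<partial>lborel) < \<infinity>"
proof -
  have "(\<integral>\<^sup>+x. ennreal (norm (x::real^3) powr (- a)) * indicator (- ball 0 b) x \<partial>lborel)
      = (\<integral>\<^sup>+x. ennreal (norm (x::real^3) powr (- a)) * indicator {b..} (norm x) \<partial>lborel)"
    by (intro nn_integral_cong) (auto simp: indicator_def)
  also have "\<dots> = (\<integral>\<^sup>+r. ennreal (4 * pi * r\<^sup>2) * indicator {0<..} r * (ennreal (r powr (- a)) * indicator {b..} r) \<partial>lborel)"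
    by (rule nn_integral_radial) simp
  also have "\<dots> = (\<integral>\<^sup>+r. ennreal (4 * pi * r powr (2 - a)) * indicator {b..} r \<partial>lborel)"
    using b by (intro nn_integral_cong)
       (auto simp: indicator_def ennreal_mult[symmetric] powr_diff powr_minus field_simps powr_numeral)
  also have "\<dots> = ennreal (0 - 4 * pi / (3 - a) * b powr (3 - a))"
  proof (rule nn_integral_FTC_atLeast)
    show "((\<lambda>r. 4 * pi / (3 - a) * r powr (3 - a)) \<longlongrightarrow> 0) at_top"
    proof -
      have "((\<lambda>r. 4 * pi / (3 - a) * r powr (3 - a)) \<longlongrightarrow> 4 * pi / (3 - a) * 0) at_top"
        using a by (intro tendsto_mult tendsto_const tendsto_neg_powr filterlim_ident) auto
      then show ?thesis by simp
    qed
    show "((\<lambda>r. 4 * pi / (3 - a) * r powr (3 - a)) has_real_derivative 4 * pi * r powr (2 - a)) (at r)" if "b \<le> r" for r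
      using that b a by (auto intro!: derivative_eq_intros)
  qed auto
  finally show ?thesis by simp
qed

text \<open>The integrand is minus the Laplacian of 1/(4 pi sqrt(1 + |w|^2)) and becomes the profile
  of the approximate identity. Its mass is 1 because 3 r^2/q^5 with q = sqrt(1 + r^2) has the
  antiderivative (r/q)^3, which runs from 0 to 1.\<close>

lemma nn_integral_poisson_kernel:
  "(\<integral>\<^sup>+w. ennreal (3 / (4 * pi * sqrt (1 + (norm (w::real^3))\<^sup>2) ^ 5)) \<partial>lborel) = 1"
proof -
  have "(\<integral>\<^sup>+w. ennreal (3 / (4 * pi * sqrt (1 + (norm (w::real^3))\<^sup>2) ^ 5)) \<partial>lborel)
    = (\<integral>\<^sup>+r. ennreal (4 * pi * r\<^sup>2) * indicator {0<..} r * ennreal (3 / (4 * pi * sqrt (1 + r\<^sup>2) ^ 5)) \<partial>lborel)"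
    by (rule nn_integral_radial[of "\<lambda>r. ennreal (3 / (4 * pi * sqrt (1 + r\<^sup>2) ^ 5))"]) simp
  also have "\<dots> = (\<integral>\<^sup>+r. ennreal (3 * r\<^sup>2 / sqrt (1 + r\<^sup>2) ^ 5) * indicator {0..} r \<partial>lborel)"
    by (intro nn_integral_cong) (auto simp: indicator_def ennreal_mult[symmetric])
  also have "\<dots> = ennreal (1 - 0 ^ 3 / sqrt (1 + 0\<^sup>2) ^ 3)"
  proof (rule nn_integral_FTC_atLeast)
    show "((\<lambda>r::real. r ^ 3 / sqrt (1 + r\<^sup>2) ^ 3) \<longlongrightarrow> 1) at_top"
    proof -
      have "((\<lambda>r::real. 1 / sqrt (1 + inverse r ^ 2) ^ 3) \<longlongrightarrow> 1 / sqrt (1 + 0 ^ 2) ^ 3) at_top"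
        by (intro tendsto_intros tendsto_inverse_0_at_top filterlim_ident) auto
      moreover have "\<forall>\<^sub>F r::real in at_top. 1 / sqrt (1 + inverse r ^ 2) ^ 3 = r ^ 3 / sqrt (1 + r\<^sup>2) ^ 3"
        using eventually_gt_at_top[of 0]
      proof eventually_elim
        case (elim r)
        have "sqrt (1 + inverse r ^ 2) = sqrt ((1 + r\<^sup>2) / r\<^sup>2)" using elim by (simp add: field_simps)
        also have "\<dots> = sqrt (1 + r\<^sup>2) / r" using elim by (simp add: real_sqrt_divide)
        finally show ?case by (simp add: power_divide)
      qed
      ultimately show ?thesis by (simp add: filterlim_cong)
    qed
    show "((\<lambda>r. r ^ 3 / sqrt (1 + r\<^sup>2) ^ 3) has_real_derivative 3 * r\<^sup>2 / sqrt (1 + r\<^sup>2) ^ 5) (at r)" for r :: real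
    proof -
      define q where "q = sqrt (1 + r\<^sup>2)"
      have p: "1 + r\<^sup>2 > 0" by (intro add_pos_nonneg) auto
      have q: "q > 0" "q * q = 1 + r\<^sup>2" unfolding q_def using p by auto
      have d: "((\<lambda>r. sqrt (1 + r\<^sup>2)) has_real_derivative r / q) (at r)"
        unfolding q_def using p by (auto intro!: derivative_eq_intros simp: field_simps)
      have "((\<lambda>r. r ^ 3 / sqrt (1 + r\<^sup>2) ^ 3) has_real_derivative 
        (3 * r\<^sup>2 * q ^ 3 - r ^ 3 * (3 * q\<^sup>2 * (r / q))) / (q ^ 3 * q ^ 3)) (at r)"
        using q(1) DERIV_divide[OF DERIV_power[OF DERIV_ident, of 3] DERIV_power[OF d, of 3]]
        by (rule_tac DERIV_cong) (auto simp: q_def[symmetric] ac_simps)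
      also have "(3 * r\<^sup>2 * q ^ 3 - r ^ 3 * (3 * q\<^sup>2 * (r / q))) / (q ^ 3 * q ^ 3) = 3 * r\<^sup>2 * (q * q - r\<^sup>2) / q ^ 5"
        using q(1) by (simp add: field_simps power_numeral_reduce)
      finally show ?thesis by (simp add: q q_def)
    qed
  qed auto
  finally show ?thesis by simp
qed

section \<open>Volume-preserving coordinates near a graph\<close>

lemma distr_orthogonal_lborel:
  fixes P :: "real^'n::{finite,wellorder} \<Rightarrow> real^'n::_"
  assumes "orthogonal_transformation P"
  shows "distr lborel borel P = lborel"
proof -
  have lin: "linear P" and bl: "bounded_linear P" 
    using assms linear_conv_bounded_linear by (auto simp: orthogonal_transformation_def)
  have "surj P" using orthogonal_transformation_surj[OF assms] .
  have d: "\<bar>det (matrix P)\<bar> = 1" using orthogonal_transformation_det[OF assms] .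
  have [measurable]: "P \<in> borel_measurable borel"
    by (intro borel_measurable_continuous_onI linear_continuous_on bl)
  have "distr (density (restrict_space lborel UNIV) (\<lambda>x. ennreal \<bar>det (matrix P)\<bar>)) borel P
    = density lborel (indicator (P ` UNIV))"
    using \<open>surj P\<close> orthogonal_transformation_inj[OF assms]
    by (intro distr_density_change_of_variables) (auto intro: bounded_linear_imp_has_derivative bl)
  then have "distr (restrict_space lborel UNIV) borel P = lborel" using \<open>surj P\<close> d
    by (simp add: density_1 indicator_UNIV)
  moreover have "restrict_space lborel UNIV = (lborel :: (real^'n::_) measure)"
    by (rule measure_eqI) (auto simp: sets_restrict_space emeasure_restrict_space)
  ultimately show ?thesis by simp
qed

lemma distr_lift3_lborel: "distr (lborel :: ((real^2) \<times> real) measure) borel (\<lambda>p. lift3 (fst p) (snd p)) = lborel"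
proof (rule lborel_eqI[symmetric])
  have m [measurable]: "(\<lambda>p. lift3 (fst p) (snd p)) \<in> borel_measurable borel"
    by (intro borel_measurable_continuous_onI linear_continuous_on bounded_linear_lift3)
  fix l u :: "real^3" assume lu: "\<And>b. b \<in> Basis \<Longrightarrow> l \<bullet> b \<le> u \<bullet> b"
  have B: "(Basis :: (real^3) set) = {axis 1 1, axis 2 1, axis 3 1}"
    by (auto simp: Basis_vec_def UNIV_3)
  have B2: "(Basis :: (real^2) set) = {axis 1 1, axis 2 1}"
    by (auto simp: Basis_vec_def UNIV_2)
  have lu': "l $ 1 \<le> u $ 1" "l $ 2 \<le> u $ 2" "l $ 3 \<le> u $ 3"
    using lu[of "axis 1 1"] lu[of "axis 2 1"] lu[of "axis 3 1"] by (auto simp: B inner_axis)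
  have "(\<lambda>p. lift3 (fst p) (snd p)) -` box l u = box (drop2 l) (drop2 u) \<times> box (l $ 3) (u $ 3)"
    by (auto simp: mem_box B B2 inner_axis)
  then have "emeasure (distr (lborel :: ((real^2) \<times> real) measure) borel (\<lambda>p. lift3 (fst p) (snd p))) (box l u)
     = emeasure (lborel \<Otimes>\<^sub>M lborel) (box (drop2 l) (drop2 u) \<times> box (l $ 3) (u $ 3))"
    by (simp add: emeasure_distr lborel_prod)
  also have "\<dots> = emeasure lborel (box (drop2 l) (drop2 u)) * emeasure lborel (box (l $ 3) (u $ 3))"
    by (intro lborel.emeasure_pair_measure_Times) auto
  also have "\<dots> = ennreal (\<Prod>b\<in>Basis. (u - l) \<bullet> b)"
    using lu' by (subst (1 2) emeasure_lborel_box)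
       (auto simp: B B2 inner_axis axis_eq_axis ennreal_mult[symmetric])
  finally show "emeasure (distr lborel borel (\<lambda>p. lift3 (fst p) (snd p))) (box l u) = (\<Prod>b\<in>Basis. (u - l) \<bullet> b)" .
qed simp

text \<open>With the first component fixed, the map translates the last coordinate, which preserves
  length; Fubini does the rest.\<close>

lemma distr_shear_lborel:
  assumes [measurable]: "\<gamma> \<in> borel_measurable (borel :: 'a::euclidean_space measure)"
  shows "distr (lborel :: ('a \<times> real) measure) borel (\<lambda>p. (fst p, \<gamma> (fst p) + snd p)) = lborel"
proof (rule measure_eqI)
  fix A assume "A \<in> sets (distr (lborel :: ('a \<times> real) measure) borel (\<lambda>p. (fst p, \<gamma> (fst p) + snd p)))"
  then have A [measurable]: "A \<in> sets (borel :: ('a \<times> real) measure)" by simp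
  have m [measurable]: "(\<lambda>p. (fst p, \<gamma> (fst p) + snd p)) \<in> measurable (borel :: ('a \<times> real) measure) borel"
    unfolding borel_prod[symmetric] by measurable
  have A' [measurable]: "A \<in> sets (lborel \<Otimes>\<^sub>M lborel)" unfolding lborel_prod using A by simp
  have "emeasure (distr (lborel :: ('a \<times> real) measure) borel (\<lambda>p. (fst p, \<gamma> (fst p) + snd p))) A
     = (\<integral>\<^sup>+p. indicator A (fst p, \<gamma> (fst p) + snd p) \<partial>(lborel \<Otimes>\<^sub>M lborel))"
    by (subst nn_integral_indicator[symmetric], simp, subst nn_integral_distr) (auto simp: lborel_prod)
  also have "\<dots> = (\<integral>\<^sup>+s. \<integral>\<^sup>+t. indicator A (s, \<gamma> s + t) \<partial>lborel \<partial>lborel)"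
    by (subst lborel.nn_integral_fst[symmetric]) (auto intro!: measurable_compose[OF _ borel_measurable_indicator[OF A]] simp: lborel_prod)
  also have "\<dots> = (\<integral>\<^sup>+s. \<integral>\<^sup>+t. indicator A (s, t) \<partial>lborel \<partial>lborel)"
  proof (rule nn_integral_cong)
    fix s
    have "(\<lambda>t. indicator A (s, t) :: ennreal) \<in> borel_measurable borel"
      by (intro measurable_compose[OF _ borel_measurable_indicator[OF A]] borel_measurable_continuous_onI continuous_intros)
    from nn_integral_real_affine[OF this, of 1 "\<gamma> s"]
    show "(\<integral>\<^sup>+t. indicator A (s, \<gamma> s + t) \<partial>lborel) = (\<integral>\<^sup>+t. indicator A (s, t) \<partial>lborel)" by simp
  qed
  also have "\<dots> = (\<integral>\<^sup>+p. indicator A p \<partial>(lborel \<Otimes>\<^sub>M lborel))"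
    by (subst lborel.nn_integral_fst[symmetric]) auto
  also have "\<dots> = emeasure lborel A" by (simp add: lborel_prod)
  finally show "emeasure (distr (lborel :: ('a \<times> real) measure) borel (\<lambda>p. (fst p, \<gamma> (fst p) + snd p))) A = emeasure lborel A" .
qed simp

text \<open>An orthogonal map, a regrouping of coordinates and a shear each preserve volume, so the
  boundary can be flattened without a Jacobian factor.\<close>

lemma distr_graph_coordinates:
  fixes P :: "real^3 \<Rightarrow> real^3"
  assumes P: "orthogonal_transformation P" and [measurable]: "\<gamma> \<in> borel_measurable borel"
  shows "(\<lambda>p. P (lift3 (fst p) (\<gamma> (fst p) + snd p))) \<in> borel_measurable (lborel :: ((real^2) \<times> real) measure)"
    "distr (lborel :: ((real^2) \<times> real) measure) borel (\<lambda>p. P (lift3 (fst p) (\<gamma> (fst p) + snd p))) = lborel"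
proof -
  have "bounded_linear P" 
    using P linear_conv_bounded_linear by (auto simp: orthogonal_transformation_def)
  then have [measurable]: "P \<in> borel_measurable borel"
    by (intro borel_measurable_continuous_onI linear_continuous_on)
  have m [measurable]: "(\<lambda>p. lift3 (fst p) (snd p)) \<in> borel_measurable borel"
    by (intro borel_measurable_continuous_onI linear_continuous_on bounded_linear_lift3)
  have s [measurable]: "(\<lambda>p. (fst p, \<gamma> (fst p) + snd p)) \<in> measurable (borel :: ((real^2) \<times> real) measure) borel"
    unfolding borel_prod[symmetric] by measurable
  have ms: "(\<lambda>p. lift3 (fst p) (\<gamma> (fst p) + snd p)) \<in> borel_measurable (borel :: ((real^2) \<times> real) measure)"
    using measurable_compose[OF s m] by simp
  show "(\<lambda>p. P (lift3 (fst p) (\<gamma> (fst p) + snd p))) \<in> borel_measurable (lborel :: ((real^2) \<times> real) measure)"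
    using ms by measurable
  have "lborel = distr (distr (distr lborel borel (\<lambda>p. (fst p, \<gamma> (fst p) + snd p))) borel (\<lambda>p. lift3 (fst p) (snd p))) borel P"
    unfolding distr_shear_lborel[OF assms(2)] distr_lift3_lborel distr_orthogonal_lborel[OF P] ..
  also have "\<dots> = distr lborel borel (\<lambda>p. P (lift3 (fst p) (\<gamma> (fst p) + snd p)))"
  proof -
    let ?s = "\<lambda>p :: (real^2) \<times> real. (fst p, \<gamma> (fst p) + snd p)" and ?l = "\<lambda>p. lift3 (fst p) (snd p)"
    have "distr (distr lborel borel ?s) borel ?l = distr lborel borel (?l \<circ> ?s)"
      by (rule distr_distr) (use m s in simp_all)
    moreover have "distr (distr lborel borel (?l \<circ> ?s)) borel P = distr lborel borel (P \<circ> (?l \<circ> ?s))"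
      by (rule distr_distr) (use ms in \<open>simp_all add: comp_def\<close>)
    ultimately show ?thesis by (simp add: comp_def)
  qed
  finally show "distr (lborel :: ((real^2) \<times> real) measure) borel (\<lambda>p. P (lift3 (fst p) (\<gamma> (fst p) + snd p))) = lborel" ..
qed

lemma set_integrable_compact:
  fixes f :: "real^3 \<Rightarrow> 'b::{banach, second_countable_topology}"
  assumes M: "sets M = sets borel" and S: "compact S" "emeasure M S < \<infinity>" and f: "continuous_on S f"
  shows "set_integrable M S f"
  unfolding set_integrable_def
proof -
  have S' [measurable]: "S \<in> sets M" using S by (simp add: M borel_compact)
  have "compact (f ` S)" using S f by (intro compact_continuous_image)
  then obtain B where B: "\<And>x. x \<in> S \<Longrightarrow> norm (f x) \<le> B"
    using compact_imp_bounded bounded_iff by (metis imageI)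
  have "(\<lambda>x. indicator S x *\<^sub>R f x) \<in> borel_measurable borel"
    using S borel_compact by (intro borel_measurable_continuous_on_indicator f) auto
  then have "(\<lambda>x. indicator S x *\<^sub>R f x) \<in> borel_measurable M"
    by (simp add: measurable_cong_sets[OF M refl])
  with S' S(2) B show "integrable M (\<lambda>x. indicator S x *\<^sub>R f x)"
    by (intro integrableI_bounded_set[where A=S and B=B]) auto
qed

section \<open>Spheres as graphs, and the slicing of shells into spheres\<close>

lemma norm_lift3: "(norm (lift3 s t))\<^sup>2 = (norm s)\<^sup>2 + t\<^sup>2"
  by (simp add: norm_vec_def L2_set_def sum_3 sum_2 add_nonneg_nonneg)

text \<open>The half-space \<open>{y. 0 < Q y $ 3}\<close> cuts out an open hemisphere, a graph over
  a disc. Its equator is missing, but \<open>P\<close> can be chosen to carry the pole to any given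
  point of the sphere.\<close>

lemma sphere_graph_patch:
  fixes P Q :: "real^3 \<Rightarrow> real^3"
  assumes P: "orthogonal_transformation P" and PQ: "\<And>x. P (Q x) = x" and QP: "\<And>x. Q (P x) = x"
    and R: "R > 0"
  shows "graph_patch (sphere 0 R) {y. 0 < Q y $ 3} (ball 0 R) P Q (\<lambda>s. sqrt (R\<^sup>2 - (norm s)\<^sup>2))
    (\<lambda>s. - s $ 1 / sqrt (R\<^sup>2 - (norm s)\<^sup>2)) (\<lambda>s. - s $ 2 / sqrt (R\<^sup>2 - (norm s)\<^sup>2))"
proof
  have normP: "norm (P x) = norm x" for x using P by (simp add: orthogonal_transformation_norm)
  have "linear P" using P by (simp add: orthogonal_transformation_def)
  have "linear Q"
  proof (rule linearI)
    show "Q (x + y) = Q x + Q y" for x y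
      using QP[of "Q x + Q y"] linear_add[OF \<open>linear P\<close>, of "Q x" "Q y"] by (simp add: PQ)
    show "Q (c *\<^sub>R x) = c *\<^sub>R Q x" for c x
      using QP[of "c *\<^sub>R Q x"] linear_scale[OF \<open>linear P\<close>, of c "Q x"] by (simp add: PQ)
  qed
  then have "continuous_on UNIV Q" by (rule linear_continuous_on[OF linear_conv_bounded_linear[THEN iffD1]])
  then show "open {y. 0 < Q y $ 3}"
    by (intro open_Collect_less continuous_intros)
  have pos: "R\<^sup>2 - (norm s)\<^sup>2 > 0" if "s \<in> ball 0 R" for s :: "real^2"
    using that R by (simp add: power_strict_mono)
  show "((\<lambda>s. sqrt (R\<^sup>2 - (norm s)\<^sup>2)) has_derivative
      (\<lambda>h. - s $ 1 / sqrt (R\<^sup>2 - (norm s)\<^sup>2) * h $ 1 + - s $ 2 / sqrt (R\<^sup>2 - (norm s)\<^sup>2) * h $ 2)) (at s)"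
    if "s \<in> ball 0 R" for s :: "real^2"
  proof -
    have "((\<lambda>s. R\<^sup>2 - s \<bullet> s) has_derivative (\<lambda>h. - (2 * (s \<bullet> h)))) (at s)"
      by (auto intro!: derivative_eq_intros simp: inner_commute)
    from has_derivative_real_sqrt[OF _ this] pos[OF that]
    have "((\<lambda>s. sqrt (R\<^sup>2 - s \<bullet> s)) has_derivative (\<lambda>h. - (2 * (s \<bullet> h)) * (inverse (sqrt (R\<^sup>2 - s \<bullet> s)) / 2))) (at s)"
      by (simp add: power2_norm_eq_inner)
    moreover have "- (2 * (a * c + b * d)) * (inverse w / 2) = - a / w * c + - b / w * d"
      if "w \<noteq> 0" for a b c d w :: real using that by (simp add: field_simps)
    from this[of "sqrt (R\<^sup>2 - s \<bullet> s)"] pos[OF that]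
    have "- (2 * (s \<bullet> h)) * (inverse (sqrt (R\<^sup>2 - s \<bullet> s)) / 2)
       = - s $ 1 / sqrt (R\<^sup>2 - s \<bullet> s) * h $ 1 + - s $ 2 / sqrt (R\<^sup>2 - s \<bullet> s) * h $ 2" for h
      by (simp add: inner_vec_def sum_2 power2_norm_eq_inner)
    ultimately show ?thesis unfolding power2_norm_eq_inner by simp
  qed
  show "continuous_on (ball 0 R) (\<lambda>s::real^2. - s $ 1 / sqrt (R\<^sup>2 - (norm s)\<^sup>2))"
    "continuous_on (ball 0 R) (\<lambda>s::real^2. - s $ 2 / sqrt (R\<^sup>2 - (norm s)\<^sup>2))"
    by (intro continuous_intros ballI; use pos in force)+
  show "sphere 0 R \<inter> {y. 0 < Q y $ 3} = (\<lambda>s. P (lift3 s (sqrt (R\<^sup>2 - (norm s)\<^sup>2)))) ` ball 0 R"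
  proof safe
    fix y assume y: "y \<in> sphere 0 R" "0 < Q y $ 3"
    have n: "norm (Q y) = R" using y normP[of "Q y"] by (simp add: PQ)
    have "R\<^sup>2 = (norm (drop2 (Q y)))\<^sup>2 + (Q y $ 3)\<^sup>2"
      using norm_lift3[of "drop2 (Q y)" "Q y $ 3"] n by (simp add: lift3_drop2)
    then have e: "R\<^sup>2 - (norm (drop2 (Q y)))\<^sup>2 = (Q y $ 3)\<^sup>2" by simp
    have "(norm (drop2 (Q y)))\<^sup>2 < R\<^sup>2" using e zero_less_power[OF y(2), of 2] by linarith
    then have "norm (drop2 (Q y)) < R" using R by (rule power2_less_imp_less[OF _ less_imp_le])
    moreover note e
    ultimately show "y \<in> (\<lambda>s. P (lift3 s (sqrt (R\<^sup>2 - (norm s)\<^sup>2)))) ` ball 0 R"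
      using y by (intro image_eqI[where x="drop2 (Q y)"]) (auto simp: lift3_drop2 PQ)
  next
    fix s :: "real^2" assume s: "s \<in> ball 0 R"
    have "(norm (lift3 s (sqrt (R\<^sup>2 - (norm s)\<^sup>2))))\<^sup>2 = R\<^sup>2"
      using pos[OF s] by (subst norm_lift3) simp
    then show "P (lift3 s (sqrt (R\<^sup>2 - (norm s)\<^sup>2))) \<in> sphere 0 R"
      using R by (simp add: normP power2_eq_iff_nonneg)
    show "0 < Q (P (lift3 s (sqrt (R\<^sup>2 - (norm s)\<^sup>2)))) $ 3"
      using pos[OF s] by (simp add: QP)
  qed
qed (use P PQ QP in auto)

lemma surface_sphere_finite:
  assumes R: "R > 0" shows "emeasure (surface_measure (sphere 0 R)) (sphere 0 R) < \<infinity>"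
proof (rule emeasure_surface_finite)
  fix x :: "real^3" assume x: "x \<in> sphere 0 R"
  have "norm (lift3 0 R) = R" using norm_lift3[of 0 R] R by (simp add: power2_eq_iff_nonneg)
  then obtain P where P: "orthogonal_transformation P" "P (lift3 0 R) = x"
    using orthogonal_transformation_exists[of "lift3 0 R" x] x by auto
  have PQ: "P (inv P y) = y" "inv P (P y) = y" for y
    using orthogonal_transformation_surj[OF P(1)] orthogonal_transformation_inj[OF P(1)]
    by (auto simp: surj_f_inv_f)
  have "x \<in> {y. 0 < inv P y $ 3}" using P PQ R by auto
  then show "\<exists>N V P Q \<gamma> \<gamma>1 \<gamma>2. x \<in> N \<and> graph_patch (sphere 0 R) N V P Q \<gamma> \<gamma>1 \<gamma>2"
    by (intro exI conjI) (assumption, rule sphere_graph_patch[OF P(1) PQ R])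
qed simp

text \<open>The half-shell is parametrized by (s, r), with r the radius and s the projection to the
  equatorial disc. The Jacobian r / sqrt(r^2 - |s|^2) is exactly the area density of the hemisphere
  of radius r, so integration over s gives a spherical integral for each r, bounded by
  \<open>K\<close>, and no weight in r is left.\<close>

lemma nn_integral_half_annulus:
  fixes P Q :: "real^3 \<Rightarrow> real^3"
  assumes P: "orthogonal_transformation P" and PQ: "\<And>x. P (Q x) = x" and QP: "\<And>x. Q (P x) = x"
    and a: "0 < a" and F [measurable]: "F \<in> borel_measurable borel"
    and K: "\<And>r. a < r \<Longrightarrow> r < b \<Longrightarrow> (\<integral>\<^sup>+x. indicator (sphere 0 r) x * F x \<partial>surface_measure (sphere 0 r)) \<le> K"
  shows "(\<integral>\<^sup>+y. indicator {y. a < norm y \<and> norm y < b \<and> 0 < Q y $ 3} y * F y \<partial>lborel) \<le> K * ennreal (b - a)"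
proof -
  \<comment> \<open>The third coordinate of \<open>x\<close> plays the radius and
    \<open>drop2 x\<close> the base point; the first condition keeps the base point inside the disc
    of that radius.\<close>
  define X where "X = {x::real^3. norm (drop2 x) < x $ 3 \<and> a < x $ 3 \<and> x $ 3 < b}"
  define q where "q x = sqrt ((x $ 3)\<^sup>2 - (norm (drop2 x))\<^sup>2)" for x :: "real^3"
  define \<Phi> where "\<Phi> x = lift3 (drop2 x) (q x)" for x :: "real^3"
  define \<Phi>' where "\<Phi>' x h = lift3 (drop2 h) ((x $ 3 * h $ 3 - drop2 x \<bullet> drop2 h) / q x)" for x h :: "real^3"
  have normP: "norm (P x) = norm x" for x using P by (simp add: orthogonal_transformation_norm)
  have bP: "bounded_linear P" using P linear_conv_bounded_linear by (auto simp: orthogonal_transformation_def)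
  have mP [measurable]: "P \<in> borel_measurable borel"
    by (intro borel_measurable_continuous_onI linear_continuous_on bP)
  have cd: "continuous_on UNIV drop2" by (rule linear_continuous_on[OF bounded_linear_drop2])
  have X: "open X" unfolding X_def
    by (intro open_Collect_conj open_Collect_less continuous_intros cd)
  have pos: "(x $ 3)\<^sup>2 - (norm (drop2 x))\<^sup>2 > 0" if "x \<in> X" for x
    using that a by (simp add: X_def power_strict_mono)
  have q: "q x > 0" if "x \<in> X" for x using pos[OF that] by (simp add: q_def)
  have der: "(\<Phi> has_derivative \<Phi>' x) (at x)" if x: "x \<in> X" for x
  proof -
    have d: "(drop2 has_derivative drop2) (at x)" by (rule bounded_linear_imp_has_derivative[OF bounded_linear_drop2])
    have d3: "((\<lambda>x. x $ 3) has_derivative (\<lambda>h. h $ 3)) (at x)"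
      by (rule bounded_linear_imp_has_derivative[OF bounded_linear_vec_nth])
    have "((\<lambda>x. (x $ 3)\<^sup>2 - drop2 x \<bullet> drop2 x) has_derivative (\<lambda>h. 2 * (x $ 3 * h $ 3 - drop2 x \<bullet> drop2 h))) (at x)"
      by (auto intro!: derivative_eq_intros d d3 simp: inner_commute algebra_simps)
    from has_derivative_real_sqrt[OF _ this] pos[OF x]
    have "(q has_derivative (\<lambda>h. (x $ 3 * h $ 3 - drop2 x \<bullet> drop2 h) / q x)) (at x)"
      unfolding q_def[abs_def] power2_norm_eq_inner
      by (auto elim!: has_derivative_eq_rhs simp: field_simps fun_eq_iff)
    then show ?thesis unfolding \<Phi>_def[abs_def] \<Phi>'_def[abs_def]
      by (intro has_derivative_lift3 d)
  qed
  have qsq: "(q x)\<^sup>2 = (x $ 3)\<^sup>2 - (norm (drop2 x))\<^sup>2" if "x \<in> X" for x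
    using pos[OF that] by (simp add: q_def)
  have det: "det (matrix (\<Phi>' x)) = x $ 3 / q x" if "x \<in> X" for x
    by (simp add: det_3 matrix_def \<Phi>'_def axis_def inner_vec_def sum_2)
  have nPhi: "norm (\<Phi> x) = x $ 3" if "x \<in> X" for x
  proof -
    have "(norm (\<Phi> x))\<^sup>2 = (x $ 3)\<^sup>2" using qsq[OF that] by (simp add: \<Phi>_def norm_lift3)
    then show ?thesis using that a by (simp add: X_def power2_eq_iff_nonneg)
  qed
  have inj: "inj_on \<Phi> X"
  proof (rule inj_onI)
    fix x y assume xy: "x \<in> X" "y \<in> X" "\<Phi> x = \<Phi> y"
    then have "x $ 3 = y $ 3" using nPhi[of x] nPhi[of y] by simp
    moreover have "drop2 x = drop2 y" using arg_cong[OF xy(3), of drop2] by (simp add: \<Phi>_def)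
    ultimately show "x = y" using lift3_drop2 by metis
  qed
  have im: "\<Phi> ` X = {y. a < norm y \<and> norm y < b \<and> 0 < y $ 3}"
  proof safe
    fix x assume x: "x \<in> X"
    show "a < norm (\<Phi> x)" "norm (\<Phi> x) < b" using nPhi[OF x] x by (auto simp: X_def)
    show "0 < \<Phi> x $ 3" using q[OF x] by (simp add: \<Phi>_def)
  next
    fix y :: "real^3" assume y: "a < norm y" "norm y < b" "0 < y $ 3"
    have n: "(norm y)\<^sup>2 = (norm (drop2 y))\<^sup>2 + (y $ 3)\<^sup>2" using norm_lift3[of "drop2 y" "y $ 3"] by (simp add: lift3_drop2)
    have "(norm (drop2 y))\<^sup>2 < (norm y)\<^sup>2" using n y zero_less_power[of "y $ 3" 2] by linarith
    then have "norm (drop2 y) < norm y" by (rule power2_less_imp_less) simp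
    then have "lift3 (drop2 y) (norm y) \<in> X" using y by (simp add: X_def)
    moreover have "\<Phi> (lift3 (drop2 y) (norm y)) = y"
      using n y by (simp add: \<Phi>_def q_def lift3_drop2)
    ultimately show "y \<in> \<Phi> ` X" by (metis imageI)
  qed
  have oim: "open {y::real^3. a < norm y \<and> norm y < b \<and> 0 < y $ 3}"
    by (intro open_Collect_conj open_Collect_less continuous_on_norm continuous_on_const continuous_on_id
      continuous_on_component)
  have cq: "continuous_on X q" unfolding q_def[abs_def] by (intro continuous_intros continuous_on_subset[OF cd]) auto
  have cPhi: "continuous_on X \<Phi>" unfolding \<Phi>_def[abs_def] by (intro continuous_intros cq continuous_on_subset[OF cd]) auto
  have cdet: "continuous_on X (\<lambda>x. x $ 3 / q x)" using q by (intro continuous_intros cq) (metis less_irrefl)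
  have mdet [measurable]: "(\<lambda>x. x $ 3 / q x) \<in> borel_measurable (restrict_space lborel X)"
    unfolding measurable_restrict_lborel by (rule borel_measurable_continuous_on_restrict[OF cdet])
  have mPhi [measurable]: "\<Phi> \<in> borel_measurable (restrict_space lborel X)"
    unfolding measurable_restrict_lborel by (rule borel_measurable_continuous_on_restrict[OF cPhi])
  define g where "g x = indicator X x * (ennreal \<bar>x $ 3 / q x\<bar> * F (P (\<Phi> x)))" for x
  have g [measurable]: "g \<in> borel_measurable borel"
  proof -
    have "(\<lambda>x. ennreal \<bar>x $ 3 / q x\<bar> * F (P (\<Phi> x))) \<in> borel_measurable (restrict_space lborel X)" by measurable
    then show ?thesis unfolding measurable_restrict_lborel g_def using borel_open[OF X]
      by (subst (asm) borel_measurable_restrict_space_iff_ennreal) (auto simp: mult.commute)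
  qed
  have cq3: "continuous_on UNIV (\<lambda>y. y $ 3 :: real)" by (intro continuous_intros)
  have "(\<integral>\<^sup>+y. indicator {y. a < norm y \<and> norm y < b \<and> 0 < Q y $ 3} y * F y \<partial>lborel)
     = (\<integral>\<^sup>+y. indicator {y. a < norm y \<and> norm y < b \<and> 0 < Q y $ 3} y * F y \<partial>distr lborel borel P)"
    by (simp only: distr_orthogonal_lborel[OF P])
  also have "\<dots> = (\<integral>\<^sup>+y. indicator {y. a < norm y \<and> norm y < b \<and> 0 < Q y $ 3} (P y) * F (P y) \<partial>lborel)"
  proof (rule nn_integral_distr)
    have "linear Q"
      using P PQ QP graph_patch.bounded_linear_Q[OF sphere_graph_patch[OF P PQ QP, of 1]]
      by (simp add: linear_conv_bounded_linear)
    then have "continuous_on UNIV Q" by (rule linear_continuous_on[OF linear_conv_bounded_linear[THEN iffD1]])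
    then have "open {y. a < norm y \<and> norm y < b \<and> 0 < Q y $ 3}"
      by (intro open_Collect_conj open_Collect_less continuous_intros)
    from borel_open[OF this] show "(\<lambda>y. indicator {y. a < norm y \<and> norm y < b \<and> 0 < Q y $ 3} y * F y) \<in> borel_measurable (distr lborel borel P)"
      by simp
  qed simp
  also have "\<dots> = (\<integral>\<^sup>+y. indicator (\<Phi> ` X) y * F (P y) \<partial>lborel)"
    by (intro nn_integral_cong) (simp add: im indicator_def normP QP)
  also have "\<dots> = (\<integral>\<^sup>+y. F (P y) \<partial>density lborel (indicator (\<Phi> ` X)))"
    using borel_open[OF oim] by (subst nn_integral_density) (auto simp: im)
  also have "density lborel (indicator (\<Phi> ` X)) = distr (density (restrict_space lborel X) (\<lambda>x. ennreal \<bar>det (matrix (\<Phi>' x))\<bar>)) borel \<Phi>"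
  proof (rule distr_density_change_of_variables[symmetric])
    show "(\<lambda>x. det (matrix (\<Phi>' x))) \<in> borel_measurable (restrict_space borel X)"
      using mdet unfolding measurable_restrict_lborel
      by (rule measurable_cong[THEN iffD1, rotated]) (simp add: space_restrict_space det)
  qed (use X oim im der inj in \<open>auto intro: has_derivative_at_withinI\<close>)
  also have "density (restrict_space lborel X) (\<lambda>x. ennreal \<bar>det (matrix (\<Phi>' x))\<bar>) = density (restrict_space lborel X) (\<lambda>x. ennreal \<bar>x $ 3 / q x\<bar>)"
  proof (rule density_cong)
    show "(\<lambda>x. ennreal \<bar>det (matrix (\<Phi>' x))\<bar>) \<in> borel_measurable (restrict_space lborel X)"
      by (rule measurable_cong[THEN iffD1, of _ "\<lambda>x. ennreal \<bar>x $ 3 / q x\<bar>"])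
         (simp add: space_restrict_space det, intro measurable_compose[OF _ measurable_ennreal] borel_measurable_abs mdet)
    show "(\<lambda>x. ennreal \<bar>x $ 3 / q x\<bar>) \<in> borel_measurable (restrict_space lborel X)"
      by (intro measurable_compose[OF _ measurable_ennreal] borel_measurable_abs mdet)
    show "AE x in restrict_space lborel X. ennreal \<bar>det (matrix (\<Phi>' x))\<bar> = ennreal \<bar>x $ 3 / q x\<bar>"
      by (rule AE_I2) (simp add: space_restrict_space det)
  qed
  also have "(\<integral>\<^sup>+y. F (P y) \<partial>distr (density (restrict_space lborel X) (\<lambda>x. ennreal \<bar>x $ 3 / q x\<bar>)) borel \<Phi>)
     = (\<integral>\<^sup>+x. ennreal \<bar>x $ 3 / q x\<bar> * F (P (\<Phi> x)) \<partial>restrict_space lborel X)"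
  proof -
    have [measurable]: "(\<lambda>x. ennreal \<bar>x $ 3 / q x\<bar>) \<in> borel_measurable (restrict_space lborel X)"
      by (intro measurable_compose[OF _ measurable_ennreal] borel_measurable_abs mdet)
    show ?thesis by (simp add: nn_integral_distr nn_integral_density del: abs_divide)
  qed
  also have "\<dots> = (\<integral>\<^sup>+x. g x \<partial>lborel)"
    using X by (subst nn_integral_restrict_space)
      (auto simp: g_def mult.commute simp del: abs_divide intro!: nn_integral_cong)
  also have "\<dots> = (\<integral>\<^sup>+x. g x \<partial>distr lborel borel (\<lambda>p. lift3 (fst p) (snd p)))"
    by (simp only: distr_lift3_lborel)
  also have "\<dots> = (\<integral>\<^sup>+p. g (lift3 (fst p) (snd p)) \<partial>lborel)"
    by (intro nn_integral_distr) (auto intro!: borel_measurable_continuous_onI linear_continuous_on bounded_linear_lift3)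
  also have "\<dots> = (\<integral>\<^sup>+r. \<integral>\<^sup>+s. g (lift3 s r) \<partial>lborel \<partial>lborel)"
  proof -
    have "(\<lambda>p. g (lift3 (fst p) (snd p))) \<in> borel_measurable (lborel \<Otimes>\<^sub>M lborel)"
      unfolding lborel_prod by (intro measurable_compose[OF _ g])
        (auto intro!: borel_measurable_continuous_onI linear_continuous_on bounded_linear_lift3)
    from lborel_pair.nn_integral_snd[OF this] show ?thesis by (simp add: lborel_prod)
  qed
  also have "\<dots> \<le> (\<integral>\<^sup>+r. K * indicator {a..b} r \<partial>lborel)"
  proof (intro nn_integral_mono)
    fix r
    show "(\<integral>\<^sup>+s. g (lift3 s r) \<partial>lborel) \<le> K * indicator {a..b} r"
    proof (cases "a < r \<and> r < b")
      case False
      then have "g (lift3 s r) = 0" for s by (auto simp: g_def X_def)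
      then show ?thesis by simp
    next
      case True
      then have r: "r > 0" using a by simp
      interpret graph_patch "sphere 0 r" "{y. 0 < Q y $ 3}" "ball 0 r" P Q "\<lambda>s. sqrt (r\<^sup>2 - (norm s)\<^sup>2)"
        "\<lambda>s. - s $ 1 / sqrt (r\<^sup>2 - (norm s)\<^sup>2)" "\<lambda>s. - s $ 2 / sqrt (r\<^sup>2 - (norm s)\<^sup>2)"
        by (rule sphere_graph_patch[OF P PQ QP r])
      \<comment> \<open>The same expression as the Jacobian in \<open>det\<close>, which makes
        \<open>g (lift3 s r)\<close> the integrand of the surface integral over the
        hemisphere.\<close>
      have ad: "area_density \<psi> s = r / sqrt (r\<^sup>2 - (norm s)\<^sup>2)" if "s \<in> ball 0 r" for s
      proof -
        have p: "r\<^sup>2 - (norm s)\<^sup>2 > 0" using that r by (simp add: power_strict_mono)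
        have "1 + (- s $ 1 / sqrt (r\<^sup>2 - (norm s)\<^sup>2))\<^sup>2 + (- s $ 2 / sqrt (r\<^sup>2 - (norm s)\<^sup>2))\<^sup>2
           = (r\<^sup>2 - (norm s)\<^sup>2 + ((s $ 1)\<^sup>2 + (s $ 2)\<^sup>2)) / (r\<^sup>2 - (norm s)\<^sup>2)"
          using p by (simp add: power_divide add_divide_distrib)
        also have "(s $ 1)\<^sup>2 + (s $ 2)\<^sup>2 = (norm s)\<^sup>2"
          by (simp add: norm_vec_def L2_set_def sum_2 add_nonneg_nonneg)
        finally show ?thesis using that r by (simp add: area_density_psi real_sqrt_divide)
      qed
      have "(\<integral>\<^sup>+s. g (lift3 s r) \<partial>lborel) = (\<integral>\<^sup>+s. indicator (ball 0 r) s * (ennreal (area_density \<psi> s) * (indicator (sphere 0 r) (\<psi> s) * F (\<psi> s))) \<partial>lborel)"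
      proof (rule nn_integral_cong)
        fix s
        show "g (lift3 s r) = indicator (ball 0 r) s * (ennreal (area_density \<psi> s) * (indicator (sphere 0 r) (\<psi> s) * F (\<psi> s)))"
        proof (cases "s \<in> ball 0 r")
          case True
          then have "\<psi> s \<in> sphere 0 r" using psi_image by blast
          then show ?thesis using True \<open>a < r \<and> r < b\<close> r
            by (simp add: g_def X_def ad \<Phi>_def q_def \<psi>_def)
        qed (simp add: g_def X_def)
      qed
      also have "\<dots> = (\<integral>\<^sup>+x. indicator {y. 0 < Q y $ 3} x * (indicator (sphere 0 r) x * F x) \<partial>surface_measure (sphere 0 r))"
        by (intro nn_integral_surface[symmetric] borel_measurable_times_ennreal borel_measurable_indicator F borel_closed closed_sphere)
      also have "\<dots> \<le> (\<integral>\<^sup>+x. indicator (sphere 0 r) x * F x \<partial>surface_measure (sphere 0 r))"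
        by (intro nn_integral_mono) (auto simp: indicator_def)
      also have "\<dots> \<le> K" using K True by blast
      finally show ?thesis using True by simp
    qed
  qed
  also have "\<dots> \<le> K * ennreal (b - a)"
    by (cases "a \<le> b") (simp_all add: nn_integral_cmult_indicator)
  finally show ?thesis .
qed

text \<open>The plane \<open>y $ 3 = 0\<close> is a null set and splits the shell into two
  half-shells. Each of them is bounded by the full spherical integral, whence the factor 2, which is
  harmless in an estimate.\<close>

lemma nn_integral_annulus_le:
  fixes F :: "real^3 \<Rightarrow> real"
  assumes a: "0 < a" and F [measurable]: "F \<in> borel_measurable borel" and F0: "\<And>x. F x \<ge> 0"
    and cont: "\<And>r. a < r \<Longrightarrow> r < b \<Longrightarrow> continuous_on (sphere 0 r) F"
    and K: "\<And>r. a < r \<Longrightarrow> r < b \<Longrightarrow> (LINT x:sphere 0 r|surface_measure (sphere 0 r). F x) \<le> K"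
  shows "(\<integral>\<^sup>+y. indicator {y. a < norm y \<and> norm y < b} y * ennreal (F y) \<partial>lborel) \<le> 2 * ennreal K * ennreal (b - a)"
proof -
  have KF: "(\<integral>\<^sup>+x. indicator (sphere 0 r) x * ennreal (F x) \<partial>surface_measure (sphere 0 r)) \<le> ennreal K" if "a < r" "r < b" for r
  proof -
    have "set_integrable (surface_measure (sphere 0 r)) (sphere 0 r) F"
      using that a by (intro set_integrable_compact cont surface_sphere_finite) auto
    then have "(\<integral>\<^sup>+x. ennreal (indicator (sphere 0 r) x *\<^sub>R F x) \<partial>surface_measure (sphere 0 r)) = ennreal (LINT x:sphere 0 r|surface_measure (sphere 0 r). F x)"
      unfolding set_integrable_def set_lebesgue_integral_def using F0 by (intro nn_integral_eq_integral) auto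
    also have "\<dots> \<le> ennreal K" by (rule ennreal_leI[OF K[OF that]])
    also have "(\<integral>\<^sup>+x. ennreal (indicator (sphere 0 r) x *\<^sub>R F x) \<partial>surface_measure (sphere 0 r)) = (\<integral>\<^sup>+x. indicator (sphere 0 r) x * ennreal (F x) \<partial>surface_measure (sphere 0 r))"
      by (intro nn_integral_cong) (auto simp: indicator_def)
    finally show ?thesis .
  qed
  have m [measurable]: "{y::real^3. a < norm y \<and> norm y < b \<and> 0 < y $ 3} \<in> sets borel"
      "{y::real^3. a < norm y \<and> norm y < b \<and> 0 < - y $ 3} \<in> sets borel"
    by (intro borel_open open_Collect_conj open_Collect_less continuous_intros)+
  have AE: "AE y in lborel. (y :: real^3) $ 3 \<noteq> 0"
  proof -
    have "negligible {y::real^3. y $ 3 = 0}" by (rule negligible_standard_hyperplane_cart)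
    then have "{y::real^3. y $ 3 = 0} \<in> null_sets lborel"
      by (auto simp: negligible_iff_null_sets null_sets_completion_iff intro!: borel_closed closed_Collect_eq continuous_intros)
    from AE_not_in[OF this] show ?thesis by simp
  qed
  have "(\<integral>\<^sup>+y. indicator {y. a < norm y \<and> norm y < b} y * ennreal (F y) \<partial>lborel)
     \<le> (\<integral>\<^sup>+y. indicator {y. a < norm y \<and> norm y < b \<and> 0 < y $ 3} y * ennreal (F y)
        + indicator {y. a < norm y \<and> norm y < b \<and> 0 < - y $ 3} y * ennreal (F y) \<partial>lborel)"
    using AE by (intro nn_integral_mono_AE) (auto elim!: eventually_mono simp: indicator_def)
  also have "\<dots> = (\<integral>\<^sup>+y. indicator {y. a < norm y \<and> norm y < b \<and> 0 < y $ 3} y * ennreal (F y) \<partial>lborel)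
        + (\<integral>\<^sup>+y. indicator {y. a < norm y \<and> norm y < b \<and> 0 < - y $ 3} y * ennreal (F y) \<partial>lborel)"
    by (intro nn_integral_add) auto
  also have "\<dots> \<le> ennreal K * ennreal (b - a) + ennreal K * ennreal (b - a)"
  proof (rule add_mono)
    show "(\<integral>\<^sup>+y. indicator {y. a < norm y \<and> norm y < b \<and> 0 < y $ 3} y * ennreal (F y) \<partial>lborel) \<le> ennreal K * ennreal (b - a)"
      using nn_integral_half_annulus[of id id a "\<lambda>x. ennreal (F x)" b "ennreal K"] a KF
      by (simp add: orthogonal_transformation_id id_def)
    show "(\<integral>\<^sup>+y. indicator {y. a < norm y \<and> norm y < b \<and> 0 < - y $ 3} y * ennreal (F y) \<partial>lborel) \<le> ennreal K * ennreal (b - a)"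
      using nn_integral_half_annulus[of uminus uminus a "\<lambda>x. ennreal (F x)" b "ennreal K"] a KF
      by (simp add: orthogonal_transformation_neg[of "\<lambda>x. x"])
  qed
  finally show ?thesis by (simp add: mult_2 distrib_right)
qed

subsection \<open>Green's formula in the exterior domain\<close>

definition pos_sq :: "real \<Rightarrow> real" where "pos_sq t = (max 0 t)\<^sup>2"

lemma pos_sq_deriv: "(pos_sq has_real_derivative 2 * max 0 t) (at t)"
proof -
  consider "t < 0" | "t > 0" | "t = 0" by linarith
  then show ?thesis
  proof cases
    case 1
    have "((\<lambda>_. 0) has_real_derivative 0) (at t)" by simp
    moreover have "\<forall>\<^sub>F s in nhds t. 0 = pos_sq s"
      using order_tendstoD(2)[OF filterlim_ident 1] by eventually_elim (simp add: pos_sq_def)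
    ultimately show ?thesis using 1 DERIV_cong_ev[of t t "\<lambda>_. 0" pos_sq 0 "2 * max 0 t"] by simp
  next
    case 2
    have "((\<lambda>s. s\<^sup>2) has_real_derivative 2 * t) (at t)" by (auto intro!: derivative_eq_intros)
    moreover have "\<forall>\<^sub>F s in nhds t. s\<^sup>2 = pos_sq s"
      using order_tendstoD(1)[OF filterlim_ident 2] by eventually_elim (simp add: pos_sq_def)
    ultimately show ?thesis using 2 DERIV_cong_ev[of t t "\<lambda>s. s\<^sup>2" pos_sq "2 * t" "2 * max 0 t"] by simp
  next
    case 3
    have "((\<lambda>s. pos_sq s / s) \<longlongrightarrow> 0) (at 0)"
    proof (rule Lim_null_comparison)
      show "\<forall>\<^sub>F s in at 0. norm (pos_sq s / s) \<le> \<bar>s\<bar>"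
        by (auto simp: pos_sq_def max_def power2_eq_square intro!: always_eventually)
      show "((\<lambda>s::real. \<bar>s\<bar>) \<longlongrightarrow> 0) (at 0)" by (intro tendsto_eq_intros) auto
    qed
    then show ?thesis using 3 by (simp add: DERIV_def pos_sq_def)
  qed
qed

text \<open>Cut-offs enter products that are differentiated once, so a C^1 step is what is asked
  for. One of the two squares vanishes for t \<le> 0 and the other for t \<ge> 1, which makes the
  quotient 0 and 1 there.\<close>

definition smooth_step :: "real \<Rightarrow> real" where "smooth_step t = pos_sq t / (pos_sq t + pos_sq (1 - t))"

definition smooth_step' :: "real \<Rightarrow> real" where
  "smooth_step' t = 2 * (max 0 t * pos_sq (1 - t) + pos_sq t * max 0 (1 - t)) / (pos_sq t + pos_sq (1 - t))\<^sup>2"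

lemma pos_sq_nonneg [simp]: "0 \<le> pos_sq t" by (simp add: pos_sq_def)

text \<open>On [0, 1] the sum is t^2 + (1 - t)^2, which is least at t = 1/2; outside that interval
  one term alone is at least 1.\<close>

lemma smooth_step_denominator: "pos_sq t + pos_sq (1 - t) \<ge> 1 / 2"
proof -
  consider "t < 0" | "t > 1" | "0 \<le> t" "t \<le> 1" by linarith
  then show ?thesis
  proof cases
    case 1
    then have "1 \<le> (1 - t)\<^sup>2" by (intro one_le_power) simp
    then have "1 / 2 \<le> (1 - t)\<^sup>2" by linarith
    then show ?thesis using 1 by (simp add: pos_sq_def)
  next
    case 2
    then have "1 \<le> t\<^sup>2" by (intro one_le_power) simp
    then have "1 / 2 \<le> t\<^sup>2" by linarith
    then show ?thesis using 2 by (simp add: pos_sq_def)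
  next
    case 3
    have "0 \<le> (2 * t - 1)\<^sup>2" by simp
    then show ?thesis using 3 by (simp add: pos_sq_def power2_eq_square algebra_simps)
  qed
qed

lemma smooth_step_deriv: "(smooth_step has_real_derivative smooth_step' t) (at t)"
proof -
  have pos: "pos_sq t + pos_sq (1 - t) \<noteq> 0" using smooth_step_denominator[of t] by linarith
  have d: "((\<lambda>t. pos_sq (1 - t)) has_real_derivative - (2 * max 0 (1 - t))) (at t)"
  proof -
    have "((\<lambda>t. 1 - t) has_real_derivative - 1) (at t)" by (auto intro!: derivative_eq_intros)
    from DERIV_chain2[where f=pos_sq, OF pos_sq_deriv this] show ?thesis by simp
  qed
  show ?thesis unfolding smooth_step_def[abs_def]
    by (rule DERIV_cong[OF DERIV_divide[OF pos_sq_deriv DERIV_add[OF pos_sq_deriv d] pos]])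
       (simp add: smooth_step'_def power2_eq_square algebra_simps)
qed

lemma smooth_step_le_0: "t \<le> 0 \<Longrightarrow> smooth_step t = 0" "t \<le> 0 \<Longrightarrow> smooth_step' t = 0"
  by (simp_all add: smooth_step_def smooth_step'_def pos_sq_def)

lemma smooth_step_ge_1: "1 \<le> t \<Longrightarrow> smooth_step t = 1" "1 \<le> t \<Longrightarrow> smooth_step' t = 0"
  by (simp_all add: smooth_step_def smooth_step'_def pos_sq_def)

lemma smooth_step_bounds: "0 \<le> smooth_step t" "smooth_step t \<le> 1"
  using smooth_step_denominator[of t] by (auto simp: smooth_step_def divide_simps)

text \<open>On [0, 1] the numerator is at most 4 and the squared denominator at least 1/4. The
  constant 16 reappears in the bound on the gradient of the cut-off at radius R.\<close>

lemma smooth_step'_bounds: "0 \<le> smooth_step' t" "smooth_step' t \<le> 16"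
proof -
  show "0 \<le> smooth_step' t" by (simp add: smooth_step'_def)
  show "smooth_step' t \<le> 16"
  proof (cases "0 \<le> t \<and> t \<le> 1")
    case True
    have n: "2 * (max 0 t * pos_sq (1 - t) + pos_sq t * max 0 (1 - t)) \<le> 2 * (1 * 1 + 1 * 1)"
      using True by (intro mult_left_mono add_mono mult_mono) (auto simp: pos_sq_def power_le_one)
    have "(1 / 2)\<^sup>2 \<le> (pos_sq t + pos_sq (1 - t))\<^sup>2"
      using smooth_step_denominator by (intro power_mono) auto
    then have "smooth_step' t \<le> 4 / (1 / 2)\<^sup>2"
      unfolding smooth_step'_def using n by (intro frac_le) auto
    then show ?thesis by (simp add: power2_eq_square)
  next
    case False
    then show ?thesis using smooth_step_le_0(2)[of t] smooth_step_ge_1(2)[of t] by auto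
  qed
qed

lemma continuous_on_smooth_step':
  assumes "continuous_on A f" shows "continuous_on A (\<lambda>x. smooth_step' (f x))"
proof -
  have "pos_sq (f x) + pos_sq (1 - f x) \<noteq> 0" for x using smooth_step_denominator[of "f x"] by linarith
  then show ?thesis unfolding smooth_step'_def pos_sq_def
    by (intro continuous_intros assms) auto
qed

text \<open>\<open>dw\<close> is the gradient together with its continuous extension to the closure.
  Carrying it as a separate function avoids any derivative at boundary points, where
  \<open>w\<close> is controlled from one side only.\<close>

definition C1_on :: "(real^3) set \<Rightarrow> (real^3 \<Rightarrow> complex) \<Rightarrow> (real^3 \<Rightarrow> complex^3) \<Rightarrow> bool" where
  "C1_on \<Omega> w dw \<longleftrightarrow> continuous_on (closure \<Omega>) w \<and> continuous_on (closure \<Omega>) dw \<and>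
    (\<forall>x\<in>\<Omega>. (w has_derivative (\<lambda>h. \<Sum>j\<in>UNIV. h $ j *\<^sub>R dw x $ j)) (at x))"

lemma C1_on_subset: "C1_on A w dw \<Longrightarrow> B \<subseteq> A \<Longrightarrow> C1_on B w dw"
  unfolding C1_on_def by (meson closure_mono continuous_on_subset subsetD)

lemma C1_on_mult:
  assumes "C1_on \<Omega> f df" "C1_on \<Omega> g dg"
  shows "C1_on \<Omega> (\<lambda>x. f x * g x) (\<lambda>x. \<chi> j. f x * dg x $ j + df x $ j * g x)"
  unfolding C1_on_def
proof (intro conjI ballI)
  show "continuous_on (closure \<Omega>) (\<lambda>x. \<chi> j. f x * dg x $ j + df x $ j * g x)"
    "continuous_on (closure \<Omega>) (\<lambda>x. f x * g x)"
    using assms by (auto simp: C1_on_def intro!: continuous_intros)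
  fix x assume x: "x \<in> \<Omega>"
  show "((\<lambda>x. f x * g x) has_derivative (\<lambda>h. \<Sum>j\<in>UNIV. h $ j *\<^sub>R (\<chi> j. f x * dg x $ j + df x $ j * g x) $ j)) (at x)"
    using assms x unfolding C1_on_def
    by (auto intro!: has_derivative_eq_rhs[OF has_derivative_mult]
       simp: fun_eq_iff sum_distrib_left sum_distrib_right sum.distrib algebra_simps)
qed

lemma C1_on_add:
  assumes "C1_on \<Omega> f df" "C1_on \<Omega> g dg"
  shows "C1_on \<Omega> (\<lambda>x. f x + g x) (\<lambda>x. df x + dg x)"
  using assms unfolding C1_on_def
  by (auto intro!: continuous_intros has_derivative_eq_rhs[OF has_derivative_add]
       simp: fun_eq_iff sum.distrib algebra_simps)

lemma C1_on_diff_const: "C1_on \<Omega> f df \<Longrightarrow> C1_on \<Omega> (\<lambda>x. c - f x) (\<lambda>x. - df x)"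
  unfolding C1_on_def
  by (auto intro!: continuous_intros derivative_eq_intros simp: sum_negf)

text \<open>The argument depends on the squared distance, so that the bump is differentiable at
  \<open>p\<close> too. The same lemma serves the bumps that localise to balls at the boundary and
  the cut-off at radius R.\<close>

lemma smooth_bump:
  fixes p :: "real^3"
  assumes "c \<noteq> 0" and \<tau>: "\<tau> = (\<lambda>x. b - c * (norm (x - p))\<^sup>2)"
  shows "C1_on UNIV (\<lambda>x. complex_of_real (smooth_step (\<tau> x)))
    (\<lambda>x. \<chi> j. complex_of_real (smooth_step' (\<tau> x) * (- 2 * c * (x - p) $ j)))"
  unfolding C1_on_def
proof (intro conjI ballI)
  have ct: "continuous_on A \<tau>" for A unfolding \<tau> by (intro continuous_intros)
  show "continuous_on (closure UNIV) (\<lambda>x. \<chi> j. complex_of_real (smooth_step' (\<tau> x) * (- 2 * c * (x - p) $ j)))"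
    by (intro continuous_intros continuous_on_smooth_step' ct)
  fix x :: "real^3"
  have "(\<tau> has_derivative (\<lambda>h. - 2 * c * ((x - p) \<bullet> h))) (at x)"
    unfolding \<tau> power2_norm_eq_inner by (auto intro!: derivative_eq_intros simp: inner_commute algebra_simps)
  from has_derivative_compose[OF this smooth_step_deriv[unfolded has_field_derivative_def]]
  have "((\<lambda>x. smooth_step (\<tau> x)) has_derivative (\<lambda>h. smooth_step' (\<tau> x) * (- 2 * c * ((x - p) \<bullet> h)))) (at x)"
    by simp
  from has_derivative_of_real[OF this]
  show "((\<lambda>x. complex_of_real (smooth_step (\<tau> x))) has_derivative (\<lambda>h. \<Sum>j\<in>UNIV. h $ j *\<^sub>R 
     (\<chi> j. complex_of_real (smooth_step' (\<tau> x) * (- 2 * c * (x - p) $ j))) $ j)) (at x)"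
    by (rule has_derivative_eq_rhs) (auto simp: fun_eq_iff inner_vec_def sum_distrib_left scaleR_conv_of_real algebra_simps)
  then have "continuous (at x) (\<lambda>x. complex_of_real (smooth_step (\<tau> x)))" 
    by (rule has_derivative_continuous)
next
  have "continuous_on UNIV smooth_step"
    by (rule DERIV_continuous_on[OF has_field_derivative_at_within[OF smooth_step_deriv]])
  moreover have "continuous_on UNIV \<tau>" unfolding \<tau> by (intro continuous_intros)
  ultimately show "continuous_on (closure UNIV) (\<lambda>x. complex_of_real (smooth_step (\<tau> x)))"
    using continuous_on_compose2[of UNIV smooth_step UNIV \<tau>] by (intro continuous_intros) auto
qed

text \<open>By translation invariance each difference quotient of \<open>F\<close> along
  \<open>v\<close> has integral 0. The mean value theorem bounds the quotients by \<open>C\<close>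
  on a bounded set, so dominated convergence passes to the derivative. The condition
  \<open>inv\<close> lets \<open>H\<close> be the whole space, or a half-space with \<open>v\<close>
  parallel to its boundary.\<close>

lemma integral_directional_derivative_0:
  fixes F :: "'a::euclidean_space \<Rightarrow> 'b::euclidean_space"
  assumes H [measurable]: "H \<in> sets borel" and inv: "\<And>p t. p + t *\<^sub>R v \<in> H \<longleftrightarrow> p \<in> H"
    and F: "(\<lambda>p. indicator H p *\<^sub>R F p) \<in> borel_measurable borel"
    and der: "\<And>p. p \<in> H \<Longrightarrow> ((\<lambda>t. F (p + t *\<^sub>R v)) has_vector_derivative dF p) (at 0)"
    and C: "\<And>p. p \<in> H \<Longrightarrow> norm (dF p) \<le> C" and C0: "\<And>p. p \<in> H \<Longrightarrow> norm (F p) \<le> C0"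
    and B: "bounded B" "\<And>p. p \<in> H \<Longrightarrow> p \<notin> B \<Longrightarrow> F p = 0"
  shows "(LINT p:H|lborel. dF p) = 0"
proof -
  define f where "f p = indicator H p *\<^sub>R F p" for p
  have f [measurable]: "f \<in> borel_measurable borel" using F by (simp add: f_def[abs_def])
  obtain R where R: "\<And>p. p \<in> B \<Longrightarrow> norm p \<le> R" using B(1) bounded_iff by blast
  have f0: "f p = 0" if "norm p > R" for p using that R B(2)[of p] by (force simp: f_def indicator_def)
  have bnd: "emeasure lborel (cball (0::'a) r) < \<infinity>" for r by (intro emeasure_bounded_finite) auto
  have C_nonneg: "p \<in> H \<Longrightarrow> C0 \<ge> 0" for p using C0[of p] norm_ge_zero order_trans by blast
  have int_f: "integrable lborel f"
    by (rule integrableI_bounded_set[where A="cball 0 R" and B="max 0 C0"])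
       (use bnd f0 C0 in \<open>auto simp: f_def indicator_def le_max_iff_disj\<close>)
  define q where "q n p = real (Suc n) *\<^sub>R (f (p + (1 / real (Suc n)) *\<^sub>R v) - f p)" for n p
  have der': "((\<lambda>t. F (p + t *\<^sub>R v)) has_vector_derivative dF (p + t *\<^sub>R v)) (at t)" if "p \<in> H" for p t
  proof -
    have "((\<lambda>s. F ((p + t *\<^sub>R v) + s *\<^sub>R v)) has_vector_derivative dF (p + t *\<^sub>R v)) (at 0)"
      using that by (intro der) (simp add: inv)
    then have "((\<lambda>s. F (p + s *\<^sub>R v)) \<circ> (\<lambda>s. t + s) has_vector_derivative dF (p + t *\<^sub>R v)) (at 0)"
      by (simp add: comp_def algebra_simps)
    then have "((\<lambda>s. F (p + s *\<^sub>R v)) \<circ> (\<lambda>s. t + s) \<circ> (\<lambda>s. s - t) has_vector_derivative 1 *\<^sub>R dF (p + t *\<^sub>R v)) (at t)"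
      by (intro vector_diff_chain_at) (auto intro!: derivative_eq_intros)
    then show ?thesis by (simp add: comp_def)
  qed
  \<comment> \<open>The steps 1/(n+1) are at most 1, so the support of a quotient exceeds that of
    \<open>F\<close> by at most \<open>norm v\<close>.\<close>
  have qC: "norm (q n p) \<le> max 0 C * indicator (cball 0 (R + norm v)) p" for n p
  proof (cases "p \<in> H")
    case True
    let ?d = "1 / real (Suc n)"
    have d: "0 < ?d" "?d \<le> 1" by auto
    have "\<exists>t\<in>{0<..<?d}. norm (F (p + ?d *\<^sub>R v) - F (p + 0 *\<^sub>R v)) \<le> norm ((?d - 0) *\<^sub>R dF (p + t *\<^sub>R v))"
      using der'[OF True]
      by (intro mvt_general[OF d(1), where f="\<lambda>t. F (p + t *\<^sub>R v)" and f'="\<lambda>t h. h *\<^sub>R dF (p + t *\<^sub>R v)"])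
         (auto simp: has_vector_derivative_def intro: continuous_at_imp_continuous_on has_derivative_continuous)
    then obtain t where "norm (F (p + ?d *\<^sub>R v) - F p) \<le> ?d * norm (dF (p + t *\<^sub>R v))"
      using d by auto
    also have "\<dots> \<le> ?d * C" using d True inv by (intro mult_left_mono C) auto
    finally have "norm (F (p + ?d *\<^sub>R v) - F p) \<le> C / real (Suc n)" by simp
    then have 1: "norm (q n p) \<le> C" using True inv
      by (simp add: q_def f_def pos_le_divide_eq mult.commute del: of_nat_Suc)
    show ?thesis
    proof (cases "norm p \<le> R + norm v")
      case True then show ?thesis using 1 by simp
    next
      case False
      have "norm p \<le> norm (p + ?d *\<^sub>R v) + norm (?d *\<^sub>R v)"
        using norm_triangle_ineq4[of "p + ?d *\<^sub>R v" "?d *\<^sub>R v"] by simp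
      moreover have "norm (?d *\<^sub>R v) \<le> norm v" using d(2) by (simp add: divide_le_eq mult_le_cancel_left1)
      ultimately have "norm (p + ?d *\<^sub>R v) > R" using False by linarith
      moreover have "norm p > R" using False norm_ge_zero[of v] by linarith
      ultimately show ?thesis using f0 by (simp add: q_def)
    qed
  next
    case False
    then show ?thesis using inv by (simp add: q_def f_def)
  qed
  have lim: "(\<lambda>n. q n p) \<longlonglongrightarrow> indicator H p *\<^sub>R dF p" for p
  proof (cases "p \<in> H")
    case True
    have "((\<lambda>t. (F (p + t *\<^sub>R v) - F p) /\<^sub>R t) \<longlongrightarrow> dF p) (at 0)"
    proof (rule LIM_zero_cancel, rule tendsto_norm_zero_cancel)
      have "(\<lambda>t. norm (F (p + t *\<^sub>R v) - F p - t *\<^sub>R dF p) / norm t) \<midarrow>0\<rightarrow> 0"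
        using der[OF True] by (simp add: has_vector_derivative_def has_derivative_at)
      moreover have "\<forall>\<^sub>F t in at 0. norm (F (p + t *\<^sub>R v) - F p - t *\<^sub>R dF p) / norm t = norm ((F (p + t *\<^sub>R v) - F p) /\<^sub>R t - dF p)"
        unfolding eventually_at_filter
      proof (rule always_eventually, intro allI impI)
        fix t :: real assume "t \<noteq> 0"
        then have "(F (p + t *\<^sub>R v) - F p) /\<^sub>R t - dF p = (F (p + t *\<^sub>R v) - F p - t *\<^sub>R dF p) /\<^sub>R t"
          by (simp add: scaleR_diff_right)
        then show "norm (F (p + t *\<^sub>R v) - F p - t *\<^sub>R dF p) / norm t = norm ((F (p + t *\<^sub>R v) - F p) /\<^sub>R t - dF p)"
          by (simp add: divide_inverse mult.commute)
      qed
      ultimately show "(\<lambda>t. norm ((F (p + t *\<^sub>R v) - F p) /\<^sub>R t - dF p)) \<midarrow>0\<rightarrow> 0"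
        by (simp add: filterlim_cong)
    qed
    moreover have "filterlim (\<lambda>n. 1 / real (Suc n)) (at 0) sequentially"
      using LIMSEQ_Suc[OF lim_1_over_n[where 'a=real]] by (simp add: filterlim_at)
    ultimately have "(\<lambda>n. (F (p + (1 / real (Suc n)) *\<^sub>R v) - F p) /\<^sub>R (1 / real (Suc n))) \<longlonglongrightarrow> dF p"
      by (rule filterlim_compose)
    then show ?thesis using True inv by (simp add: q_def f_def divide_inverse)
  qed (use inv in \<open>simp add: q_def f_def\<close>)
  have shift: "integrable lborel (\<lambda>p. f (p + a)) \<and> (\<integral>p. f (p + a) \<partial>lborel) = (\<integral>p. f p \<partial>lborel)" for a
  proof -
    have m: "(+) a \<in> measurable lborel (borel :: 'a measure)" by simp
    have "integrable (distr lborel borel ((+) a)) f" using int_f by (simp add: lborel_distr_plus)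
    from integrable_distr[OF m this] have "integrable lborel (\<lambda>p. f (p + a))" by (simp add: add.commute)
    moreover have "(\<integral>p. f p \<partial>distr lborel borel ((+) a)) = (\<integral>p. f (a + p) \<partial>lborel)"
      by (rule integral_distr) auto
    ultimately show ?thesis
      by (simp add: lborel_distr_plus add.commute)
  qed
  have q0: "(\<integral>p. q n p \<partial>lborel) = 0" for n
    unfolding q_def using int_f shift[of "(1 / real (Suc n)) *\<^sub>R v"] by (subst integral_scaleR_right) simp
  have qm [measurable]: "q n \<in> borel_measurable borel" for n unfolding q_def by measurable
  have "(\<lambda>n. \<integral>p. q n p \<partial>lborel) \<longlonglongrightarrow> (\<integral>p. indicator H p *\<^sub>R dF p \<partial>lborel)"
  proof (rule integral_dominated_convergence[where w="\<lambda>p. max 0 C * indicator (cball 0 (R + norm v)) p"])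
    show "(\<lambda>p. indicator H p *\<^sub>R dF p) \<in> borel_measurable lborel"
      by (rule borel_measurable_LIMSEQ_metric[where f=q]) (use lim in auto)
    show "integrable lborel (\<lambda>p::'a. max 0 C * indicator (cball 0 (R + norm v)) p)"
      using bnd by (intro integrable_mult_right integrable_real_indicator) auto
  qed (use lim qC in auto)
  then show ?thesis unfolding set_lebesgue_integral_def q0
    using LIMSEQ_unique tendsto_const by blast
qed


section \<open>Flattening the boundary of the domain\<close>

lemma C_on_imp_continuous_on: "C_on m f U \<Longrightarrow> continuous_on U f"
  by (cases m) (auto intro: continuous_at_imp_continuous_on differentiable_imp_continuous_within)

lemma C_on_SucD:
  assumes "C_on (Suc m) f U"
  shows "\<And>x. x \<in> U \<Longrightarrow> (f has_derivative frechet_derivative f (at x)) (at x)"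
    "continuous_on U (\<lambda>x. frechet_derivative f (at x) v)"
  using assms by (auto simp: frechet_derivative_works[symmetric] intro: C_on_imp_continuous_on)

text \<open>Inside \<open>N\<close> the domain lies above a graph in the coordinates of
  \<open>Q\<close>, and the exterior below it. The boundary between them is then a graph patch,
  which the sublocale \<open>graph\<close> records.\<close>

locale domain_patch =
  fixes G N :: "(real^3) set" and P Q :: "real^3 \<Rightarrow> real^3" and \<gamma> \<gamma>1 \<gamma>2 :: "real^2 \<Rightarrow> real"
  assumes open_G: "open G" and open_N: "open N"
    and P: "orthogonal_transformation P" and PQ [simp]: "\<And>x. P (Q x) = x" and QP [simp]: "\<And>x. Q (P x) = x"
    and deriv: "\<And>s. (\<gamma> has_derivative (\<lambda>h. \<gamma>1 s * h $ 1 + \<gamma>2 s * h $ 2)) (at s)"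
    and cont: "continuous_on UNIV \<gamma>1" "continuous_on UNIV \<gamma>2"
    and mem_G: "\<And>x. x \<in> N \<Longrightarrow> x \<in> G \<longleftrightarrow> \<gamma> (drop2 (Q x)) < Q x $ 3"

lemma domain_patch_exists:
  assumes G: "bounded_domain_of_class (Suc m) G" and p: "p \<in> frontier G"
  obtains r P Q \<gamma> \<gamma>1 \<gamma>2 where "r > 0" "domain_patch G (ball p r) P Q \<gamma> \<gamma>1 \<gamma>2"
proof -
  obtain r Q \<gamma> where r: "r > 0" and Q: "orthogonal_transformation (Q :: real^3 \<Rightarrow> real^3)"
    and \<gamma>: "C_on (Suc m) (\<gamma> :: real^2 \<Rightarrow> real) UNIV"
    and eq: "G \<inter> ball p r = {x \<in> ball p r. Q x $ 3 > \<gamma> (vector [Q x $ 1, Q x $ 2])}"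
    using G p unfolding bounded_domain_of_class_def by meson
  have QP: "Q (inv Q y) = y" "inv Q (Q y) = y" for y
    using orthogonal_transformation_surj[OF Q] orthogonal_transformation_inj[OF Q]
    by (auto simp: surj_f_inv_f)
  define \<gamma>1 where "\<gamma>1 s = frechet_derivative \<gamma> (at s) (axis 1 1)" for s
  define \<gamma>2 where "\<gamma>2 s = frechet_derivative \<gamma> (at s) (axis 2 1)" for s
  have "domain_patch G (ball p r) (inv Q) Q \<gamma> \<gamma>1 \<gamma>2"
  proof
    show "open G" using G by (simp add: bounded_domain_of_class_def)
    show "orthogonal_transformation (inv Q)" by (rule orthogonal_transformation_inv[OF Q])
    show "(\<gamma> has_derivative (\<lambda>h. \<gamma>1 s * h $ 1 + \<gamma>2 s * h $ 2)) (at s)" for s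
    proof -
      have d: "(\<gamma> has_derivative frechet_derivative \<gamma> (at s)) (at s)" using C_on_SucD(1)[OF \<gamma>] by simp
      have lin: "linear (frechet_derivative \<gamma> (at s))" by (rule has_derivative_linear[OF d])
      have "frechet_derivative \<gamma> (at s) h = \<gamma>1 s * h $ 1 + \<gamma>2 s * h $ 2" for h
      proof -
        have "h = h $ 1 *\<^sub>R axis 1 1 + h $ 2 *\<^sub>R axis 2 1" by (simp add: vec_eq_iff forall_2 axis_def)
        then have "frechet_derivative \<gamma> (at s) h = frechet_derivative \<gamma> (at s) (h $ 1 *\<^sub>R axis 1 1 + h $ 2 *\<^sub>R axis 2 1)" by simp
        also have "\<dots> = \<gamma>1 s * h $ 1 + \<gamma>2 s * h $ 2"
          by (simp add: linear_add[OF lin] linear_scale[OF lin] \<gamma>1_def \<gamma>2_def mult.commute)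
        finally show ?thesis .
      qed
      then show ?thesis using d by (simp add: has_derivative_eq_rhs fun_eq_iff)
    qed
    show "continuous_on UNIV \<gamma>1" "continuous_on UNIV \<gamma>2"
      unfolding \<gamma>1_def \<gamma>2_def using C_on_SucD(2)[OF \<gamma>] by auto
    show "x \<in> G \<longleftrightarrow> \<gamma> (drop2 (Q x)) < Q x $ 3" if "x \<in> ball p r" for x
      using eq that unfolding drop2_def by blast
  qed (use QP in auto)
  then show thesis using that r by blast
qed

context domain_patch
begin

text \<open>Signed height over the graph. At points of \<open>N\<close> it is positive in
  \<open>G\<close>, zero on the frontier and negative in the exterior. Together with
  \<open>drop2 (Q x)\<close> it inverts \<open>chart\<close>, so that near the boundary the exterior
  becomes the half-space \<open>snd p < 0\<close>.\<close>

definition height :: "real^3 \<Rightarrow> real" where "height x = Q x $ 3 - \<gamma> (drop2 (Q x))"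

definition chart :: "(real^2) \<times> real \<Rightarrow> real^3" where "chart p = P (lift3 (fst p) (\<gamma> (fst p) + snd p))"

lemma linear_P: "linear P" using P by (simp add: orthogonal_transformation_def)

lemma linear_Q: "linear Q"
proof (rule linearI)
  show "Q (x + y) = Q x + Q y" for x y
    using QP[of "Q x + Q y"] linear_add[OF linear_P, of "Q x" "Q y"] by simp
  show "Q (c *\<^sub>R x) = c *\<^sub>R Q x" for c x
    using QP[of "c *\<^sub>R Q x"] linear_scale[OF linear_P, of c "Q x"] by simp
qed

lemma bounded_linear_P: "bounded_linear P" and bounded_linear_Q: "bounded_linear Q"
  using linear_P linear_Q by (simp_all add: linear_conv_bounded_linear)

lemma inner_P [simp]: "P x \<bullet> P y = x \<bullet> y"
  using P by (simp add: orthogonal_transformation_def)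

lemma inner_Q [simp]: "Q x \<bullet> Q y = x \<bullet> y"
  using inner_P[of "Q x" "Q y"] by simp

lemma height_chart [simp]: "height (chart p) = snd p"
  by (simp add: height_def chart_def)

lemma drop2_Q_chart [simp]: "drop2 (Q (chart p)) = fst p"
  by (simp add: chart_def)

lemma chart_height [simp]: "chart (drop2 (Q x), height x) = x"
  by (simp add: height_def chart_def lift3_drop2)

lemma continuous_on_gamma: "continuous_on UNIV \<gamma>"
  by (rule has_derivative_continuous_on[OF has_derivative_at_withinI[OF deriv]])

lemma continuous_on_height: "continuous_on A height"
proof -
  have "continuous_on UNIV Q" by (rule linear_continuous_on[OF bounded_linear_Q])
  then show ?thesis unfolding height_def[abs_def]
    by (intro continuous_intros continuous_on_subset[of UNIV _ A] continuous_on_compose2[OF continuous_on_gamma]) auto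
qed

lemma continuous_on_chart: "continuous_on A chart"
proof -
  have "continuous_on UNIV chart" unfolding chart_def[abs_def]
    by (intro bounded_linear.continuous_on[OF bounded_linear_P] continuous_intros continuous_on_compose2[OF continuous_on_gamma]) auto
  then show ?thesis by (rule continuous_on_subset) simp
qed

lemma mem_G_height: "x \<in> N \<Longrightarrow> x \<in> G \<longleftrightarrow> 0 < height x"
  using mem_G by (simp add: height_def)

lemma height_shift: "height (x + t *\<^sub>R P (axis 3 1)) = height x + t"
proof -
  have "drop2 (axis 3 1) = 0" by (simp add: vec_eq_iff forall_2 axis_def)
  then show ?thesis
    by (simp add: height_def linear_add[OF linear_Q] linear_scale[OF linear_Q]
        linear_add[OF bounded_linear.linear[OF bounded_linear_drop2]]
        linear_scale[OF bounded_linear.linear[OF bounded_linear_drop2]])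
qed

lemma shift_tendsto: "((\<lambda>t. x + t *\<^sub>R P (axis 3 1)) \<longlongrightarrow> x) (at_right 0)"
  by (auto intro!: tendsto_eq_intros)

text \<open>A shift along \<open>P (axis 3 1)\<close> raises the height at unit speed, so a point of
  height 0 is a limit of points of \<open>G\<close>; a point of negative height has a whole
  neighbourhood below the graph.\<close>

lemma mem_closure_G: "x \<in> N \<Longrightarrow> x \<in> closure G \<longleftrightarrow> 0 \<le> height x"
proof
  assume x: "x \<in> N" "x \<in> closure G"
  show "0 \<le> height x"
  proof (rule ccontr)
    assume "\<not> 0 \<le> height x"
    then have "x \<in> N \<inter> {x. height x < 0}" using x by auto
    moreover have "open (N \<inter> {x. height x < 0})"
      using continuous_on_height by (intro open_Int open_N open_Collect_less) auto
    ultimately obtain y where "y \<in> G" "y \<in> N" "height y < 0"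
      using x(2) by (auto simp: closure_iff_nhds_not_empty)
    then show False using mem_G_height by auto
  qed
next
  assume x: "x \<in> N" "0 \<le> height x"
  have "\<forall>\<^sub>F t in at_right 0. x + t *\<^sub>R P (axis 3 1) \<in> N"
    by (rule topological_tendstoD[OF shift_tendsto open_N x(1)])
  moreover have "\<forall>\<^sub>F t in at_right (0::real). 0 < t" by (rule eventually_at_right_less)
  ultimately have "\<forall>\<^sub>F t in at_right 0. x + t *\<^sub>R P (axis 3 1) \<in> G"
    by eventually_elim (use x in \<open>simp add: mem_G_height height_shift\<close>)
  then show "x \<in> closure G"
    by (intro Lim_in_closed_set[OF closed_closure _ _ shift_tendsto])
       (auto elim: eventually_mono intro: closure_subset[THEN subsetD])
qed

lemma mem_frontier: "x \<in> N \<Longrightarrow> x \<in> frontier G \<longleftrightarrow> height x = 0"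
  using mem_closure_G[of x] mem_G_height[of x] open_G by (auto simp: frontier_def interior_open)

lemma mem_exterior: "x \<in> N \<Longrightarrow> x \<in> - closure G \<longleftrightarrow> height x < 0"
  using mem_closure_G[of x] by auto

lemma mem_closure_exterior: "x \<in> N \<Longrightarrow> height x \<le> 0 \<Longrightarrow> x \<in> closure (- closure G)"
proof -
  assume x: "x \<in> N" "height x \<le> 0"
  have tt: "((\<lambda>t. x + (- t) *\<^sub>R P (axis 3 1)) \<longlongrightarrow> x) (at_right 0)"
    by (auto intro!: tendsto_eq_intros)
  have "\<forall>\<^sub>F t in at_right 0. x + (- t) *\<^sub>R P (axis 3 1) \<in> N"
    by (rule topological_tendstoD[OF tt open_N x(1)])
  moreover have "\<forall>\<^sub>F t in at_right (0::real). 0 < t" by (rule eventually_at_right_less)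
  ultimately have "\<forall>\<^sub>F t in at_right 0. x + (- t) *\<^sub>R P (axis 3 1) \<in> - closure G"
  proof eventually_elim
    case (elim t)
    then have "height (x + (- t) *\<^sub>R P (axis 3 1)) < 0" using x height_shift[of x "- t"] by linarith
    with elim mem_exterior show ?case by blast
  qed
  then have "\<forall>\<^sub>F t in at_right 0. x + (- t) *\<^sub>R P (axis 3 1) \<in> closure (- closure G)"
    by (rule eventually_mono) (rule closure_subset[THEN subsetD])
  then show "x \<in> closure (- closure G)"
    by (intro Lim_in_closed_set[OF closed_closure _ _ tt]) auto
qed

sublocale graph: graph_patch "frontier G" N "{s. P (lift3 s (\<gamma> s)) \<in> N}" P Q \<gamma> \<gamma>1 \<gamma>2
proof
  have c: "continuous_on UNIV (\<lambda>s. P (lift3 s (\<gamma> s)))"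
    by (intro bounded_linear.continuous_on[OF bounded_linear_P] continuous_intros continuous_on_gamma)
  have "open ((\<lambda>s. P (lift3 s (\<gamma> s))) -` N)" using open_vimage[OF open_N c] .
  then show "open {s. P (lift3 s (\<gamma> s)) \<in> N}" by (simp add: vimage_def)
  show "frontier G \<inter> N = (\<lambda>s. P (lift3 s (\<gamma> s))) ` {s. P (lift3 s (\<gamma> s)) \<in> N}"
  proof safe
    fix x assume x: "x \<in> frontier G" "x \<in> N"
    then have "x = chart (drop2 (Q x), 0)" using mem_frontier[of x] chart_height[of x] by simp
    then have "x = P (lift3 (drop2 (Q x)) (\<gamma> (drop2 (Q x))))" by (simp add: chart_def)
    with x show "x \<in> (\<lambda>s. P (lift3 s (\<gamma> s))) ` {s. P (lift3 s (\<gamma> s)) \<in> N}" by auto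
  next
    fix s assume "P (lift3 s (\<gamma> s)) \<in> N"
    then show "P (lift3 s (\<gamma> s)) \<in> frontier G"
      using mem_frontier height_chart[of "(s, 0)"] by (simp add: chart_def)
  qed
qed (use P open_N deriv cont in \<open>auto intro: continuous_on_subset\<close>)

lemma chart_deriv:
  "(chart has_derivative (\<lambda>h. P (lift3 (fst h) (\<gamma>1 (fst p) * fst h $ 1 + \<gamma>2 (fst p) * fst h $ 2 + snd h)))) (at p)"
  unfolding chart_def[abs_def]
  by (intro bounded_linear.has_derivative[OF bounded_linear_P] has_derivative_lift3 has_derivative_fst has_derivative_snd
      has_derivative_ident has_derivative_add has_derivative_compose[OF has_derivative_fst[OF has_derivative_ident] deriv])

lemma distr_chart: "chart \<in> borel_measurable lborel" "distr lborel borel chart = lborel"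
  unfolding chart_def[abs_def]
  using distr_graph_coordinates[OF P, of \<gamma>] borel_measurable_continuous_onI[OF continuous_on_gamma] by auto

text \<open>Orthogonality to the tangent vectors fixes the direction of the normal up to a factor,
  and unit length leaves only the sign. If \<open>n $ 3\<close> were positive, the height would
  increase along the normal, which would then enter \<open>G\<close> instead of leaving it. The
  factor \<open>area_density\<close> cancels the square root of the normalisation; it is also the
  weight that the surface integral supplies.\<close>

lemma outward_normal_chart:
  assumes \<eta>: "outward_unit_normal G \<eta>" and s: "graph.\<psi> s \<in> N"
  shows "area_density graph.\<psi> s *\<^sub>R \<eta> (graph.\<psi> s) = - P (lift3 (vector [- \<gamma>1 s, - \<gamma>2 s]) 1)"
proof -
  let ?y = "graph.\<psi> s" and ?V = "{s. P (lift3 s (\<gamma> s)) \<in> N}"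
  define n where "n = Q (\<eta> ?y)"
  have sV: "s \<in> ?V" using s by (simp add: graph.\<psi>_def)
  have fr: "?y \<in> frontier G" using graph.psi_image sV by blast
  have norm1: "norm (\<eta> ?y) = 1"
    and orth: "\<And>v. orthogonal (\<eta> ?y) (frechet_derivative graph.\<psi> (at s) v)"
    and out: "\<forall>\<^sub>F t in at_right 0. ?y + t *\<^sub>R \<eta> ?y \<notin> closure G \<and> ?y - t *\<^sub>R \<eta> ?y \<in> G"
    using \<eta> fr sV graph.local_param_psi unfolding outward_unit_normal_def by blast+
  have "\<eta> ?y = P n" by (simp add: n_def)
  have o: "n \<bullet> lift3 v (\<gamma>1 s * v $ 1 + \<gamma>2 s * v $ 2) = 0" for v
    using orth[of v] unfolding graph.frechet_psi[OF sV] orthogonal_def \<open>\<eta> ?y = P n\<close> by simp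
  have n12: "n $ 1 = - \<gamma>1 s * n $ 3" "n $ 2 = - \<gamma>2 s * n $ 3"
    using o[of "axis 1 1"] o[of "axis 2 1"] by (auto simp: inner_vec_def sum_3 axis_def algebra_simps)
  define D where "D = 1 + (\<gamma>1 s)\<^sup>2 + (\<gamma>2 s)\<^sup>2"
  have D: "D > 0" unfolding D_def by (intro add_pos_nonneg) auto
  have ad: "area_density graph.\<psi> s = sqrt D" by (simp add: graph.area_density_psi[OF sV] D_def)
  have "n \<bullet> n = 1" using norm1 by (simp add: n_def norm_eq_1)
  then have n3: "(n $ 3)\<^sup>2 * D = 1"
    by (simp add: inner_vec_def sum_3 n12 D_def power2_eq_square algebra_simps)
  have "n $ 3 \<le> 0"
  proof (rule ccontr)
    assume "\<not> n $ 3 \<le> 0"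
    then have n3pos: "n $ 3 > 0" by simp
    define g where "g t = height (?y + t *\<^sub>R \<eta> ?y)" for t
    have dr: "drop2 (Q ?y) = s" by simp
    have "(g has_real_derivative (n $ 3 - (\<gamma>1 s * n $ 1 + \<gamma>2 s * n $ 2))) (at 0)"
    proof -
      have l: "((\<lambda>t. Q (?y + t *\<^sub>R \<eta> ?y)) has_derivative (\<lambda>t. t *\<^sub>R n)) (at 0)"
        by (rule has_derivative_eq_rhs, rule bounded_linear.has_derivative[OF bounded_linear_Q])
           (auto intro!: derivative_eq_intros simp: n_def linear_scale[OF linear_Q])
      have l2: "((\<lambda>t. drop2 (Q (?y + t *\<^sub>R \<eta> ?y))) has_derivative (\<lambda>t. drop2 (t *\<^sub>R n))) (at 0)"
        by (rule bounded_linear.has_derivative[OF bounded_linear_drop2 l])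
      have "((\<lambda>t. \<gamma> (drop2 (Q (?y + t *\<^sub>R \<eta> ?y)))) has_derivative (\<lambda>t. \<gamma>1 s * drop2 (t *\<^sub>R n) $ 1 + \<gamma>2 s * drop2 (t *\<^sub>R n) $ 2)) (at 0)"
        using has_derivative_compose[OF l2 deriv[of "drop2 (Q (?y + 0 *\<^sub>R \<eta> ?y))"]] by simp
      moreover have "((\<lambda>t. Q (?y + t *\<^sub>R \<eta> ?y) $ 3) has_derivative (\<lambda>t. (t *\<^sub>R n) $ 3)) (at 0)"
        by (rule bounded_linear.has_derivative[OF bounded_linear_vec_nth l])
      ultimately show ?thesis unfolding g_def[abs_def] height_def has_field_derivative_def
        by (intro has_derivative_eq_rhs[OF has_derivative_diff]) (auto simp: fun_eq_iff algebra_simps)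
    qed
    moreover have "n $ 3 - (\<gamma>1 s * n $ 1 + \<gamma>2 s * n $ 2) = n $ 3 * D"
      by (simp add: n12 D_def power2_eq_square algebra_simps)
    ultimately have "(g has_real_derivative n $ 3 * D) (at 0)" by simp
    from DERIV_pos_inc_right[OF this] n3pos D obtain d where d: "d > 0" "\<And>h. 0 < h \<Longrightarrow> h < d \<Longrightarrow> g 0 < g h"
      by (auto simp: zero_less_mult_iff)
    have g0: "g 0 = 0" using mem_frontier[OF s] fr by (simp add: g_def)
    have "((\<lambda>t. ?y + t *\<^sub>R \<eta> ?y) \<longlongrightarrow> ?y) (at_right 0)" by (auto intro!: tendsto_eq_intros)
    from topological_tendstoD[OF this open_N s] 
    have "\<forall>\<^sub>F t in at_right 0. ?y + t *\<^sub>R \<eta> ?y \<in> N" .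
    moreover have "\<forall>\<^sub>F t in at_right (0::real). t < d" using d by (intro eventually_at_right_real[THEN eventually_mono]) auto
    moreover have "\<forall>\<^sub>F t in at_right (0::real). 0 < t" by (rule eventually_at_right_less)
    ultimately have "\<forall>\<^sub>F t in at_right (0::real). False"
      using out
    proof eventually_elim
      case (elim t)
      then have "height (?y + t *\<^sub>R \<eta> ?y) < 0" using mem_exterior by blast
      then show False using d(2)[of t] elim g0 by (simp add: g_def)
    qed
    then show False by simp
  qed
  then have "sqrt D * n $ 3 = - sqrt ((n $ 3)\<^sup>2 * D)" by (simp add: real_sqrt_mult)
  then have k: "sqrt D * n $ 3 = - 1" using n3 by simp
  have "sqrt D *\<^sub>R n = - lift3 (vector [- \<gamma>1 s, - \<gamma>2 s]) 1"
  proof -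
    have "sqrt D * (- \<gamma>1 s * n $ 3) = - \<gamma>1 s * (sqrt D * n $ 3)" "sqrt D * (- \<gamma>2 s * n $ 3) = - \<gamma>2 s * (sqrt D * n $ 3)"
      by simp_all
    then show ?thesis using k by (simp add: vec_eq_iff forall_3 n12)
  qed
  then show ?thesis unfolding ad \<open>\<eta> ?y = P n\<close>
    by (simp flip: linear_scale[OF linear_P] linear_neg[OF linear_P])
qed

lemma continuous_on_normal:
  assumes \<eta>: "outward_unit_normal G \<eta>"
  shows "continuous_on (frontier G \<inter> N) \<eta>"
proof (rule continuous_on_eq)
  define m where "m s = (1 / sqrt (1 + (\<gamma>1 s)\<^sup>2 + (\<gamma>2 s)\<^sup>2)) *\<^sub>R - P (lift3 (\<chi> i. if i = 1 then - \<gamma>1 s else - \<gamma>2 s) 1)" for s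
  have nz: "1 + (\<gamma>1 s)\<^sup>2 + (\<gamma>2 s)\<^sup>2 > 0" for s by (intro add_pos_nonneg) auto
  have "continuous_on UNIV (\<lambda>s. if i = 1 then - \<gamma>1 s else - \<gamma>2 s)" for i :: 2
    by (cases "i = 1") (simp_all add: continuous_on_minus cont)
  then have "continuous_on UNIV m" unfolding m_def using nz
    by (intro continuous_intros bounded_linear.continuous_on[OF bounded_linear_P] cont)
       (metis less_irrefl real_sqrt_gt_zero)+
  then show "continuous_on (frontier G \<inter> N) (\<lambda>x. m (drop2 (Q x)))"
    by (rule continuous_on_compose2)
       (intro continuous_on_drop2 bounded_linear.continuous_on[OF bounded_linear_Q] continuous_on_id subset_UNIV)+
  fix x assume x: "x \<in> frontier G \<inter> N"
  then obtain s where s: "x = graph.\<psi> s" "s \<in> {s. P (lift3 s (\<gamma> s)) \<in> N}" using graph.psi_image by blast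
  have "area_density graph.\<psi> s *\<^sub>R \<eta> x = - P (lift3 (vector [- \<gamma>1 s, - \<gamma>2 s]) 1)"
    using outward_normal_chart[OF \<eta>, of s] s x by simp
  moreover have "(vector [- \<gamma>1 s, - \<gamma>2 s] :: real^2) = (\<chi> i. if i = 1 then - \<gamma>1 s else - \<gamma>2 s)"
    by (simp add: vec_eq_iff forall_2)
  ultimately have "sqrt (1 + (\<gamma>1 s)\<^sup>2 + (\<gamma>2 s)\<^sup>2) *\<^sub>R \<eta> x = - P (lift3 (\<chi> i. if i = 1 then - \<gamma>1 s else - \<gamma>2 s) 1)"
    using graph.area_density_psi[OF s(2)] by simp
  from arg_cong[OF this, of "\<lambda>y. (1 / sqrt (1 + (\<gamma>1 s)\<^sup>2 + (\<gamma>2 s)\<^sup>2)) *\<^sub>R y"]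
  have "\<eta> x = m s" using nz[of s] by (simp add: m_def)
  then show "m (drop2 (Q x)) = \<eta> x" using s by simp
qed

text \<open>\<open>g\<close> is known on the closed exterior only, while the chart reaches beyond
  \<open>N\<close>, so the pull-back is extended by zero. The half-space is the union of two
  relatively open sets, where the chart lies in \<open>N\<close> and where it lies off
  \<open>K\<close>; continuity is clear on each.\<close>

lemma continuous_on_glue:
  fixes g :: "real^3 \<Rightarrow> 'b::real_normed_vector"
  assumes g: "continuous_on (closure (- closure G)) g" and K: "compact K" "K \<subseteq> N"
    and 0: "\<And>x. x \<in> closure (- closure G) \<Longrightarrow> x \<notin> K \<Longrightarrow> g x = 0"
  shows "continuous_on {p. snd p \<le> 0} (\<lambda>p. if chart p \<in> K then g (chart p) else 0)"
proof -
  let ?H = "{p :: (real^2) \<times> real. snd p \<le> 0}" and ?f = "\<lambda>p. if chart p \<in> K then g (chart p) else 0"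
  let ?S = "?H \<inter> chart -` N" and ?T = "?H \<inter> chart -` (- K)"
  have S: "open (chart -` N)" by (rule open_vimage[OF open_N continuous_on_chart])
  have T: "open (chart -` (- K))" using K by (intro open_vimage[OF _ continuous_on_chart]) (auto simp: compact_imp_closed)
  have un: "?S \<union> ?T = ?H" using K by auto
  have mem: "chart p \<in> closure (- closure G)" if "p \<in> ?S" for p
    using that by (intro mem_closure_exterior) auto
  have "continuous_on (?S \<union> ?T) ?f"
  proof (rule continuous_on_Un_local_open)
    show "openin (top_of_set (?S \<union> ?T)) ?S" "openin (top_of_set (?S \<union> ?T)) ?T"
      unfolding un using S T by (auto intro: openin_open_Int)
    show "continuous_on ?S ?f"
    proof (rule continuous_on_eq)
      show "continuous_on ?S (\<lambda>p. g (chart p))"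
        by (rule continuous_on_compose2[OF g continuous_on_chart]) (use mem in blast)
      show "g (chart p) = ?f p" if "p \<in> ?S" for p using 0[OF mem[OF that]] by auto
    qed
    show "continuous_on ?T ?f"
      by (rule continuous_on_eq[OF continuous_on_const[of _ 0]]) auto
  qed
  then show ?thesis unfolding un .
qed

lemma integrable_halfspace:
  fixes h :: "(real^2) \<times> real \<Rightarrow> complex"
  assumes h: "continuous_on {p. snd p \<le> 0} h" and K: "compact K" and 0: "\<And>p. chart p \<notin> K \<Longrightarrow> h p = 0"
  shows "set_integrable lborel {p. snd p < 0} h" "\<exists>C. \<forall>p. snd p \<le> 0 \<longrightarrow> norm (h p) \<le> C"
    "(\<lambda>p. indicator {p. snd p < 0} p *\<^sub>R h p) \<in> borel_measurable borel"
proof -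
  define B where "B = (\<lambda>x. (drop2 (Q x), height x)) ` K"
  have cB: "compact B" unfolding B_def
    by (intro compact_continuous_image K continuous_on_Pair continuous_on_height continuous_on_drop2
        bounded_linear.continuous_on[OF bounded_linear_Q] continuous_on_id)
  have hB: "h p = 0" if "p \<notin> B" for p
  proof (rule 0)
    show "chart p \<notin> K"
    proof
      assume "chart p \<in> K"
      then have "p \<in> B" unfolding B_def by (intro image_eqI[where x="chart p"]) auto
      with that show False by simp
    qed
  qed
  have clH: "closed {p :: (real^2) \<times> real. snd p \<le> 0}" by (intro closed_Collect_le continuous_intros)
  then have "compact (B \<inter> {p. snd p \<le> 0})" using cB by (rule compact_Int_closed[rotated])
  from compact_continuous_image[OF continuous_on_subset[OF h] this] 
  have "bounded (h ` (B \<inter> {p. snd p \<le> 0}))" by (intro compact_imp_bounded) auto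
  then obtain C where C: "\<And>p. p \<in> B \<Longrightarrow> snd p \<le> 0 \<Longrightarrow> norm (h p) \<le> C" unfolding bounded_iff by blast
  have C': "norm (h p) \<le> max 0 C" if "snd p \<le> 0" for p
    using C[of p] hB[of p] that by (cases "p \<in> B") auto
  then show "\<exists>C. \<forall>p. snd p \<le> 0 \<longrightarrow> norm (h p) \<le> C" by blast
  have oH: "open {p :: (real^2) \<times> real. snd p < 0}" by (intro open_Collect_less continuous_intros)
  show m: "(\<lambda>p. indicator {p. snd p < 0} p *\<^sub>R h p) \<in> borel_measurable borel"
    by (intro borel_measurable_continuous_on_indicator continuous_on_subset[OF h] borel_open oH) auto
  show "set_integrable lborel {p. snd p < 0} h"
    unfolding set_integrable_def
  proof (rule integrableI_bounded_set[where A=B and B="max 0 C"])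
    show "emeasure lborel B < \<infinity>" by (intro emeasure_bounded_finite compact_imp_bounded cB)
  qed (use m C' hB borel_compact[OF cB] in \<open>auto simp: indicator_def\<close>)
qed

lemma chart_mem_exterior:
  assumes "chart p \<in> N" shows "chart p \<in> - closure G \<longleftrightarrow> snd p < 0"
  using mem_exterior[OF assms] by simp

text \<open>The chart preserves volume and makes the exterior a half-space \<open>snd p < 0\<close>.
  The direction \<open>axis j 1\<close> is split into a vector tangent to the graph and
  \<open>\<beta>\<close> times the vertical one. The tangential derivative integrates to 0, because
  the half-space is invariant in that direction; the vertical one is turned into a boundary value by
  the fundamental theorem of calculus. By \<open>outward_normal_chart\<close>,
  \<open>\<beta>\<close> is minus the area density times \<open>\<eta> $ j\<close>.\<close>

lemma local_green:
  assumes \<eta>: "outward_unit_normal G \<eta>" and c\<eta>: "continuous_on (frontier G) \<eta>"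
    and fr: "frontier G \<subseteq> closure (- closure G)"
    and w: "C1_on (- closure G) w dw" and K: "compact K" "K \<subseteq> N"
    and 0: "\<And>x. x \<in> closure (- closure G) \<Longrightarrow> x \<notin> K \<Longrightarrow> w x = 0 \<and> dw x = 0"
  shows "(LINT x:- closure G|lborel. dw x $ j) =
    - (LINT y:frontier G|surface_measure (frontier G). of_real (\<eta> y $ j) * w y)"
proof -
  let ?H = "{p :: (real^2) \<times> real. snd p < 0}"
  define f where "f p = (if chart p \<in> K then w (chart p) else 0)" for p
  define g where "g p = (if chart p \<in> K then dw (chart p) else 0)" for p
  define A where "A p v = P (lift3 (fst v) (\<gamma>1 (fst p) * fst v $ 1 + \<gamma>2 (fst p) * fst v $ 2 + snd v))" for p v :: "(real^2) \<times> real"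
  define F where "F p v = (\<Sum>k\<in>UNIV. A p v $ k *\<^sub>R g p $ k)" for p v
  have w': "continuous_on (closure (- closure G)) w" "continuous_on (closure (- closure G)) dw"
    "\<And>x. x \<in> - closure G \<Longrightarrow> (w has_derivative (\<lambda>h. \<Sum>j\<in>UNIV. h $ j *\<^sub>R dw x $ j)) (at x)"
    using w by (auto simp: C1_on_def)
  have cf: "continuous_on {p. snd p \<le> 0} f" unfolding f_def[abs_def]
    using 0 by (intro continuous_on_glue w' K) auto
  have cg: "continuous_on {p. snd p \<le> 0} g" unfolding g_def[abs_def]
    using 0 by (intro continuous_on_glue w' K) auto
  have cA: "continuous_on X (\<lambda>p. A p v)" for X v
    unfolding A_def by (intro bounded_linear.continuous_on[OF bounded_linear_P] continuous_intros 
      continuous_on_compose2[OF cont(1)] continuous_on_compose2[OF cont(2)]) auto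
  have cF: "continuous_on {p. snd p \<le> 0} (\<lambda>p. F p v)" for v
    unfolding F_def by (intro continuous_intros cA cg)
  have F0: "F p v = 0" if "chart p \<notin> K" for p v using that by (simp add: F_def g_def)
  have f0: "f p = 0" if "chart p \<notin> K" for p using that by (simp add: f_def)
  have oH: "open ?H" by (intro open_Collect_less continuous_intros)
  have dfF: "(f has_derivative F p) (at p)" if p: "p \<in> ?H" for p
  proof (cases "chart p \<in> N")
    case True
    have ext: "chart p \<in> - closure G" using chart_mem_exterior[OF True] p by blast
    have "((\<lambda>p. w (chart p)) has_derivative (\<lambda>v. \<Sum>k\<in>UNIV. A p v $ k *\<^sub>R dw (chart p) $ k)) (at p)"
      using has_derivative_compose[OF chart_deriv w'(3)[OF ext]] by (simp add: A_def)
    moreover have "(\<lambda>v. \<Sum>k\<in>UNIV. A p v $ k *\<^sub>R dw (chart p) $ k) = F p"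
      using 0[of "chart p"] closure_subset[THEN subsetD, OF ext] by (cases "chart p \<in> K") (simp_all add: F_def g_def fun_eq_iff)
    ultimately have d: "((\<lambda>p. w (chart p)) has_derivative F p) (at p)" by simp
    have o: "open (?H \<inter> chart -` N)" by (intro open_Int oH open_vimage[OF open_N continuous_on_chart])
    show ?thesis
    proof (rule has_derivative_transform_within_open[OF d o])
      show "w (chart q) = f q" if "q \<in> ?H \<inter> chart -` N" for q
        using that 0[of "chart q"] mem_closure_exterior[of "chart q"] by (auto simp: f_def)
    qed (use True p in auto)
  next
    case False
    then have n: "chart p \<notin> K" using K by auto
    have o: "open (chart -` (- K))" using K by (intro open_vimage[OF _ continuous_on_chart]) (auto simp: compact_imp_closed)
    have "F p = (\<lambda>v. 0)" using F0[OF n] by auto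
    then show ?thesis
      using has_derivative_transform_within_open[OF has_derivative_const[of 0 "at p"] o] n f0 by auto
  qed
  have dvec: "((\<lambda>t. f (p + t *\<^sub>R v)) has_vector_derivative F (p + t *\<^sub>R v) v) (at t)" if "p + t *\<^sub>R v \<in> ?H" for p t v
  proof -
    have lin: "linear (F (p + t *\<^sub>R v))" by (rule has_derivative_linear[OF dfF[OF that]])
    have "((\<lambda>t. p + t *\<^sub>R v) has_derivative (\<lambda>t. t *\<^sub>R v)) (at t)" by (auto intro!: derivative_eq_intros)
    from has_derivative_compose[OF this dfF[OF that]] show ?thesis
      by (simp add: has_vector_derivative_def linear_scale[OF lin])
  qed
  \<comment> \<open>\<open>a\<close> is the direction in the coordinates of \<open>Q\<close>. The
    tangent vector lying over \<open>\<alpha>\<close> has the horizontal part of \<open>a\<close>,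
    and \<open>\<beta>\<close> is what it misses in the vertical component.\<close>
  define a where "a = Q (axis j 1)"
  define \<alpha> where "\<alpha> = drop2 a"
  define \<beta> where "\<beta> s = a $ 3 - (\<gamma>1 s * a $ 1 + \<gamma>2 s * a $ 2)" for s
  note intF = integrable_halfspace[OF cF K(1) F0]
  have tangential: "(LINT p:?H|lborel. F p (\<alpha>, 0)) = 0"
  proof -
    obtain C1 where C1: "\<And>p. snd p \<le> 0 \<Longrightarrow> norm (F p (\<alpha>, 0)) \<le> C1" using intF(2) by blast
    obtain C2 where C2: "\<And>p. snd p \<le> 0 \<Longrightarrow> norm (f p) \<le> C2" using integrable_halfspace(2)[OF cf K(1) f0] by blast
    have "compact ((\<lambda>x. (drop2 (Q x), height x)) ` K)"
      by (intro compact_continuous_image K continuous_on_Pair continuous_on_height continuous_on_drop2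
        bounded_linear.continuous_on[OF bounded_linear_Q] continuous_on_id)
    then have bB: "bounded ((\<lambda>x. (drop2 (Q x), height x)) ` K)" by (rule compact_imp_bounded)
    show ?thesis
    proof (rule integral_directional_derivative_0[where F=f and v="(\<alpha>, 0)" and C=C1 and ?C0.0=C2, OF _ _ integrable_halfspace(3)[OF cf K(1) f0] _ _ _ bB])
      show "?H \<in> sets borel" using oH by simp
      show "((\<lambda>t. f (p + t *\<^sub>R (\<alpha>, 0))) has_vector_derivative F p (\<alpha>, 0)) (at 0)" if "p \<in> ?H" for p
        using dvec[of p 0 "(\<alpha>, 0)"] that by (simp add: zero_prod_def[symmetric])
      show "f p = 0" if "p \<notin> (\<lambda>x. (drop2 (Q x), height x)) ` K" for p
      proof (rule f0, rule notI)
        assume "chart p \<in> K"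
        then have "p \<in> (\<lambda>x. (drop2 (Q x), height x)) ` K" by (intro image_eqI[where x="chart p"]) auto
        with that show False by simp
      qed
    qed (use C1 C2 in auto)
  qed
  have cb: "continuous_on X (\<lambda>p. \<beta> (fst p))" for X :: "((real^2) \<times> real) set" unfolding \<beta>_def
    by (intro continuous_intros continuous_on_compose2[OF cont(1)] continuous_on_compose2[OF cont(2)]) auto
  have cbF: "continuous_on {p. snd p \<le> 0} (\<lambda>p. \<beta> (fst p) *\<^sub>R F p (0, 1))" by (intro continuous_intros cb cF)
  have bF0: "\<beta> (fst p) *\<^sub>R F p (0, 1) = 0" if "chart p \<notin> K" for p using F0[OF that] by simp
  note intbF = integrable_halfspace[OF cbF K(1) bF0]
  have vertical: "(LINT p:?H|lborel. \<beta> (fst p) *\<^sub>R F p (0, 1)) = (\<integral>s. \<beta> s *\<^sub>R f (s, 0) \<partial>lborel)"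
  proof -
    have "(LINT p:?H|lborel. \<beta> (fst p) *\<^sub>R F p (0, 1)) =
       (\<integral>p. indicator ?H p *\<^sub>R (\<beta> (fst p) *\<^sub>R F p (0, 1)) \<partial>(lborel \<Otimes>\<^sub>M lborel))"
      by (simp add: set_lebesgue_integral_def lborel_prod)
    also have "\<dots> = (\<integral>s. \<integral>t. indicator ?H (s, t) *\<^sub>R (\<beta> (fst (s, t)) *\<^sub>R F (s, t) (0, 1)) \<partial>lborel \<partial>lborel)"
      using intbF(1) unfolding set_integrable_def
      by (intro lborel_pair.integral_fst'[symmetric]) (simp add: lborel_prod)
    also have "\<dots> = (\<integral>s. \<beta> s *\<^sub>R f (s, 0) \<partial>lborel)"
    proof (rule Bochner_Integration.integral_cong[OF refl])
      fix s
      have "compact (height ` K)" by (intro compact_continuous_image K continuous_on_height)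
      then have "bounded (height ` K)" by (rule compact_imp_bounded)
      then obtain M where M: "\<And>x. x \<in> K \<Longrightarrow> \<bar>height x\<bar> \<le> M" unfolding bounded_iff by auto
      \<comment> \<open>Below the whole of \<open>K\<close>, so that the lower end of the interval
        contributes nothing.\<close>
      define m where "m = - (\<bar>M\<bar> + 1)"
      have m: "m < 0" "t \<le> m \<Longrightarrow> chart (s, t) \<notin> K" for t
        using M[of "chart (s, t)"] by (auto simp: m_def)
      have ct: "continuous_on {m..0} (\<lambda>t. (s, t))" by (intro continuous_intros)
      have "((\<lambda>t. F (s, t) (0, 1)) has_integral f (s, 0) - f (s, m)) {m..0}"
      proof (rule fundamental_theorem_of_calculus_interior)
        show "continuous_on {m..0} (\<lambda>t. f (s, t))" by (rule continuous_on_compose2[OF cf ct]) auto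
        show "((\<lambda>t. f (s, t)) has_vector_derivative F (s, t) (0, 1)) (at t)" if "t \<in> {m<..<0}" for t
          using dvec[of "(s, 0)" t "(0, 1)"] that by simp
      qed (use m in auto)
      then have "((\<lambda>t. F (s, t) (0, 1)) has_integral f (s, 0)) {m..0}" using f0[OF m(2)[of m]] by simp
      then have "((\<lambda>t. if t \<in> {m..0} then F (s, t) (0, 1) else 0) has_integral f (s, 0)) UNIV"
        by (simp only: has_integral_restrict_UNIV)
      \<comment> \<open>The closed interval and the open half-space differ at t = 0 only, a single
        point.\<close>
      then have hi: "((\<lambda>t. indicator ?H (s, t) *\<^sub>R F (s, t) (0, 1)) has_integral f (s, 0)) UNIV"
        by (rule has_integral_spike_finite[where S="{0}", rotated 2]) (use F0[OF m(2)] in \<open>auto simp: indicator_def\<close>)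
      obtain C where C: "\<And>p. snd p \<le> 0 \<Longrightarrow> norm (F p (0, 1)) \<le> C" using intF(2) by blast
      have "integrable lborel (\<lambda>t. indicator ?H (s, t) *\<^sub>R F (s, t) (0, 1))"
      proof (rule integrableI_bounded_set[where A="{m..0}" and B="C"])
        show "(\<lambda>t. indicator ?H (s, t) *\<^sub>R F (s, t) (0, 1)) \<in> borel_measurable lborel"
          using measurable_compose[OF borel_measurable_continuous_onI[of "\<lambda>t. (s, t)"] intF(3)[of "(0, 1)"]]
          by (simp add: continuous_intros)
        show "AE t in lborel. t \<in> {m..0} \<longrightarrow> norm (indicator ?H (s, t) *\<^sub>R F (s, t) (0, 1)) \<le> C"
          using C order_trans[OF norm_ge_zero C[of "(s, 0)"]] by (auto simp: indicator_def)
        show "AE t in lborel. t \<notin> {m..0} \<longrightarrow> indicator ?H (s, t) *\<^sub>R F (s, t) (0, 1) = 0"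
          using F0[OF m(2)] by (auto simp: indicator_def)
        show "emeasure lborel {m..0} < \<infinity>" by (intro emeasure_bounded_finite) auto
      qed auto
      from has_integral_unique[OF has_integral_integral_lborel[OF this] hi]
      have "(\<integral>t. indicator ?H (s, t) *\<^sub>R F (s, t) (0, 1) \<partial>lborel) = f (s, 0)" .
      moreover have "(\<integral>t. indicator ?H (s, t) *\<^sub>R (\<beta> (fst (s, t)) *\<^sub>R F (s, t) (0, 1)) \<partial>lborel)
         = (\<integral>t. \<beta> s *\<^sub>R (indicator ?H (s, t) *\<^sub>R F (s, t) (0, 1)) \<partial>lborel)"
        by (intro Bochner_Integration.integral_cong) auto
      ultimately show "(\<integral>t. indicator ?H (s, t) *\<^sub>R (\<beta> (fst (s, t)) *\<^sub>R F (s, t) (0, 1)) \<partial>lborel) = \<beta> s *\<^sub>R f (s, 0)"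
        by (simp only: integral_scaleR_right)
    qed
    finally show ?thesis .
  qed
  have dec: "g p $ j = F p (\<alpha>, 0) + \<beta> (fst p) *\<^sub>R F p (0, 1)" for p
  proof -
    have "A p (\<alpha>, 0) + \<beta> (fst p) *\<^sub>R A p (0, 1) = P (lift3 \<alpha> (\<gamma>1 (fst p) * \<alpha> $ 1 + \<gamma>2 (fst p) * \<alpha> $ 2) + \<beta> (fst p) *\<^sub>R lift3 0 1)"
      by (simp add: A_def linear_add[OF linear_P] linear_scale[OF linear_P])
    also have "lift3 \<alpha> (\<gamma>1 (fst p) * \<alpha> $ 1 + \<gamma>2 (fst p) * \<alpha> $ 2) + \<beta> (fst p) *\<^sub>R lift3 0 1 = a"
      by (simp add: vec_eq_iff forall_3 \<alpha>_def \<beta>_def)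
    finally have A: "A p (\<alpha>, 0) + \<beta> (fst p) *\<^sub>R A p (0, 1) = axis j 1" by (simp add: a_def)
    have "F p (\<alpha>, 0) + \<beta> (fst p) *\<^sub>R F p (0, 1) = (\<Sum>k\<in>UNIV. (A p (\<alpha>, 0) + \<beta> (fst p) *\<^sub>R A p (0, 1)) $ k *\<^sub>R g p $ k)"
      by (simp add: F_def scaleR_sum_right sum.distrib scaleR_add_left)
    also have "\<dots> = g p $ j" unfolding A by (simp add: axis_def if_distrib[of "\<lambda>c. c *\<^sub>R _"] cong: if_cong)
    finally show ?thesis ..
  qed
  have oE: "open (- closure G)" by (intro open_Compl closed_closure)
  have mg: "(\<lambda>x. indicator (- closure G) x *\<^sub>R dw x $ j) \<in> borel_measurable borel"
    by (intro borel_measurable_continuous_on_indicator borel_open oE continuous_intros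
      continuous_on_subset[OF w'(2) closure_subset])
  have "(LINT x:- closure G|lborel. dw x $ j) = (\<integral>x. indicator (- closure G) x *\<^sub>R dw x $ j \<partial>distr lborel borel chart)"
    by (simp add: set_lebesgue_integral_def distr_chart)
  also have "\<dots> = (\<integral>p. indicator (- closure G) (chart p) *\<^sub>R dw (chart p) $ j \<partial>lborel)"
    by (rule integral_distr) (use mg distr_chart in auto)
  also have "\<dots> = (LINT p:?H|lborel. F p (\<alpha>, 0) + \<beta> (fst p) *\<^sub>R F p (0, 1))"
    unfolding set_lebesgue_integral_def
  proof (rule Bochner_Integration.integral_cong[OF refl])
    fix p
    show "indicator (- closure G) (chart p) *\<^sub>R dw (chart p) $ j = indicator ?H p *\<^sub>R (F p (\<alpha>, 0) + \<beta> (fst p) *\<^sub>R F p (0, 1))"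
    proof (cases "chart p \<in> K")
      case True
      then show ?thesis using chart_mem_exterior[of p] K by (auto simp: dec[symmetric] g_def indicator_def)
    next
      case False
      then show ?thesis using 0[of "chart p"] closure_subset[of "- closure G"] by (auto simp: dec[symmetric] g_def indicator_def)
    qed
  qed
  also have "\<dots> = (LINT p:?H|lborel. F p (\<alpha>, 0)) + (LINT p:?H|lborel. \<beta> (fst p) *\<^sub>R F p (0, 1))"
    by (intro set_integral_add intF(1) intbF(1))
  also have "\<dots> = (\<integral>s. \<beta> s *\<^sub>R f (s, 0) \<partial>lborel)" using tangential vertical by simp
  finally have L: "(LINT x:- closure G|lborel. dw x $ j) = (\<integral>s. \<beta> s *\<^sub>R f (s, 0) \<partial>lborel)" .
  let ?S = "frontier G" and ?V = "{s. P (lift3 s (\<gamma> s)) \<in> N}"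
  define h where "h y = indicator ?S y *\<^sub>R (of_real (\<eta> y $ j) * w y)" for y
  have mh: "h \<in> borel_measurable borel" unfolding h_def
    by (intro borel_measurable_continuous_on_indicator borel_closed frontier_closed continuous_intros c\<eta>
       continuous_on_subset[OF w'(1) fr])
  have "(LINT y:?S|surface_measure ?S. of_real (\<eta> y $ j) * w y) = (LINT y:N|surface_measure ?S. h y)"
    unfolding set_lebesgue_integral_def h_def
  proof (rule Bochner_Integration.integral_cong[OF refl])
    fix y
    show "indicator ?S y *\<^sub>R (of_real (\<eta> y $ j) * w y) = indicator N y *\<^sub>R (indicator ?S y *\<^sub>R (of_real (\<eta> y $ j) * w y))"
      using 0[of y] K fr by (auto simp: indicator_def)
  qed
  also have "\<dots> = (LINT s:?V|lborel. area_density graph.\<psi> s *\<^sub>R h (graph.\<psi> s))"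
    by (rule graph.integral_surface[OF mh])
  also have "\<dots> = (\<integral>s. - (\<beta> s *\<^sub>R f (s, 0)) \<partial>lborel)"
    unfolding set_lebesgue_integral_def
  proof (rule Bochner_Integration.integral_cong[OF refl])
    fix s
    have cs: "chart (s, 0) = graph.\<psi> s" by (simp add: chart_def graph.\<psi>_def)
    show "indicator ?V s *\<^sub>R (area_density graph.\<psi> s *\<^sub>R h (graph.\<psi> s)) = - (\<beta> s *\<^sub>R f (s, 0))"
    proof (cases "s \<in> ?V")
      case True
      then have sN: "graph.\<psi> s \<in> N" by (simp add: graph.\<psi>_def)
      have sS: "graph.\<psi> s \<in> ?S" using graph.psi_image True by blast
      have "area_density graph.\<psi> s * \<eta> (graph.\<psi> s) $ j = (area_density graph.\<psi> s *\<^sub>R \<eta> (graph.\<psi> s)) \<bullet> axis j 1"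
        by (simp add: inner_axis)
      also have "\<dots> = - (P (lift3 (vector [- \<gamma>1 s, - \<gamma>2 s]) 1) \<bullet> P a)"
        unfolding outward_normal_chart[OF \<eta> sN] by (simp add: a_def)
      also have "\<dots> = - \<beta> s" unfolding inner_P by (simp add: inner_vec_def sum_3 \<beta>_def)
      finally have ad: "area_density graph.\<psi> s * \<eta> (graph.\<psi> s) $ j = - \<beta> s" .
      have "area_density graph.\<psi> s *\<^sub>R h (graph.\<psi> s) = complex_of_real (area_density graph.\<psi> s * \<eta> (graph.\<psi> s) $ j) * w (graph.\<psi> s)"
        using sS by (simp add: h_def scaleR_conv_of_real)
      also have "w (graph.\<psi> s) = f (s, 0)" using 0[of "graph.\<psi> s"] sS fr by (auto simp: f_def cs)
      finally show ?thesis using True unfolding ad by (simp add: scaleR_conv_of_real)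
    next
      case False
      then have "chart (s, 0) \<notin> K" using K by (auto simp: cs graph.\<psi>_def)
      then show ?thesis using False f0 by simp
    qed
  qed
  also have "\<dots> = - (\<integral>s. \<beta> s *\<^sub>R f (s, 0) \<partial>lborel)" by simp
  finally show ?thesis using L by simp
qed

end

section \<open>Green's formula for compactly supported functions\<close>

lemma frontier_subset_closure_exterior:
  assumes G: "bounded_domain_of_class (Suc m) G"
  shows "frontier G \<subseteq> closure (- closure G)"
proof
  fix p assume p: "p \<in> frontier G"
  from domain_patch_exists[OF G p] obtain r P Q \<gamma> \<gamma>1 \<gamma>2 where r: "r > 0" and "domain_patch G (ball p r) P Q \<gamma> \<gamma>1 \<gamma>2" .
  then interpret domain_patch G "ball p r" P Q \<gamma> \<gamma>1 \<gamma>2 by simp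
  show "p \<in> closure (- closure G)"
    using mem_closure_exterior[of p] mem_frontier[of p] p r by simp
qed

lemma continuous_on_frontier_normal:
  assumes G: "bounded_domain_of_class (Suc m) G" and \<eta>: "outward_unit_normal G \<eta>"
  shows "continuous_on (frontier G) \<eta>"
  unfolding continuous_on_eq_continuous_within
proof
  fix p assume p: "p \<in> frontier G"
  from domain_patch_exists[OF G p] obtain r P Q \<gamma> \<gamma>1 \<gamma>2 where r: "r > 0" and "domain_patch G (ball p r) P Q \<gamma> \<gamma>1 \<gamma>2" .
  then interpret domain_patch G "ball p r" P Q \<gamma> \<gamma>1 \<gamma>2 by simp
  have "continuous (at p within frontier G \<inter> ball p r) \<eta>"
    using continuous_on_normal[OF \<eta>] p r by (simp add: continuous_on_eq_continuous_within)
  moreover have "at p within frontier G \<inter> ball p r = at p within frontier G"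
    by (rule at_within_nhd[of _ "ball p r"]) (use r in auto)
  ultimately show "continuous (at p within frontier G) \<eta>" by simp
qed

lemma compact_frontier_domain:
  "bounded_domain_of_class m G \<Longrightarrow> compact (frontier G)"
  by (simp add: bounded_domain_of_class_def compact_frontier_bounded)

lemma surface_frontier_finite:
  assumes G: "bounded_domain_of_class (Suc m) G"
  shows "emeasure (surface_measure (frontier G)) (frontier G) < \<infinity>"
proof (rule emeasure_surface_finite[OF compact_frontier_domain[OF G]])
  fix p assume p: "p \<in> frontier G"
  from domain_patch_exists[OF G p] obtain r P Q \<gamma> \<gamma>1 \<gamma>2 where r: "r > 0" and "domain_patch G (ball p r) P Q \<gamma> \<gamma>1 \<gamma>2" .
  then interpret domain_patch G "ball p r" P Q \<gamma> \<gamma>1 \<gamma>2 by simp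
  show "\<exists>N V P Q \<gamma> \<gamma>1 \<gamma>2. p \<in> N \<and> graph_patch (frontier G) N V P Q \<gamma> \<gamma>1 \<gamma>2"
    by (intro exI conjI) (rule centre_in_ball[THEN iffD2, OF r], rule graph.graph_patch_axioms)
qed

lemma set_integrable_compact_support:
  fixes h :: "real^3 \<Rightarrow> complex"
  assumes \<Omega>: "open \<Omega>" and h: "continuous_on (closure \<Omega>) h" and K: "compact K"
    and 0: "\<And>x. x \<in> closure \<Omega> \<Longrightarrow> x \<notin> K \<Longrightarrow> h x = 0"
  shows "set_integrable lborel \<Omega> h" "\<exists>C\<ge>0. \<forall>x\<in>closure \<Omega>. norm (h x) \<le> C"
    "(\<lambda>x. indicator \<Omega> x *\<^sub>R h x) \<in> borel_measurable borel"
proof -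
  have "compact (h ` (K \<inter> closure \<Omega>))"
    using h K by (intro compact_continuous_image compact_Int_closed) (auto intro: continuous_on_subset)
  then have "bounded (h ` (K \<inter> closure \<Omega>))" by (rule compact_imp_bounded)
  then obtain C where C: "\<And>x. x \<in> K \<Longrightarrow> x \<in> closure \<Omega> \<Longrightarrow> norm (h x) \<le> C" unfolding bounded_iff by blast
  have C': "norm (h x) \<le> max 0 C" if "x \<in> closure \<Omega>" for x
    using C[of x] 0[of x] that by (cases "x \<in> K") auto
  then show "\<exists>C\<ge>0. \<forall>x\<in>closure \<Omega>. norm (h x) \<le> C" by (intro exI[of _ "max 0 C"]) auto
  show m: "(\<lambda>x. indicator \<Omega> x *\<^sub>R h x) \<in> borel_measurable borel"
    by (intro borel_measurable_continuous_on_indicator continuous_on_subset[OF h closure_subset] borel_open \<Omega>)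
  show "set_integrable lborel \<Omega> h"
    unfolding set_integrable_def
  proof (rule integrableI_bounded_set[where A=K and B="max 0 C"])
    show "emeasure lborel K < \<infinity>" by (intro emeasure_bounded_finite compact_imp_bounded K)
    show "AE x in lborel. x \<in> K \<longrightarrow> norm (indicator \<Omega> x *\<^sub>R h x) \<le> max 0 C"
      using C' closure_subset[of \<Omega>] by (auto simp: indicator_def)
    show "AE x in lborel. x \<notin> K \<longrightarrow> indicator \<Omega> x *\<^sub>R h x = 0"
      using 0 closure_subset[of \<Omega>] by (auto simp: indicator_def)
  qed (use m borel_compact[OF K] in auto)
qed

text \<open>Since \<open>K\<close> misses the frontier, the extension of \<open>w\<close> by zero is
  differentiable everywhere: a point off the exterior has \<open>G\<close> or the complement of
  \<open>K\<close> as a neighbourhood, and there the extension vanishes. The integral of a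
  directional derivative over the whole space is then 0.\<close>

lemma green_away_from_boundary:
  assumes fr: "frontier G \<subseteq> closure (- closure G)" and oG: "open G"
    and w: "C1_on (- closure G) w dw" and K: "compact K" "K \<inter> frontier G = {}"
    and 0: "\<And>x. x \<in> closure (- closure G) \<Longrightarrow> x \<notin> K \<Longrightarrow> w x = 0 \<and> dw x = 0"
  shows "(LINT x:- closure G|lborel. dw x $ j) = 0"
proof -
  let ?\<Omega> = "- closure G"
  define F where "F x = (if x \<in> ?\<Omega> then w x else 0)" for x
  define dF where "dF x = (if x \<in> ?\<Omega> then dw x $ j else 0)" for x
  have o: "open ?\<Omega>" by (intro open_Compl closed_closure)
  have w': "continuous_on (closure ?\<Omega>) w" "continuous_on (closure ?\<Omega>) (\<lambda>x. dw x $ j)"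
    "\<And>x. x \<in> ?\<Omega> \<Longrightarrow> (w has_derivative (\<lambda>h. \<Sum>j\<in>UNIV. h $ j *\<^sub>R dw x $ j)) (at x)"
    using w by (auto simp: C1_on_def intro!: continuous_intros)
  have van: "\<And>x. x \<in> closure ?\<Omega> \<Longrightarrow> x \<notin> K \<Longrightarrow> w x = 0" "\<And>x. x \<in> closure ?\<Omega> \<Longrightarrow> x \<notin> K \<Longrightarrow> dw x $ j = 0"
    using 0 by auto
  have sub: "x \<in> ?\<Omega> \<Longrightarrow> x \<in> closure ?\<Omega>" for x by (rule subsetD[OF closure_subset])
  obtain C where C: "C \<ge> 0" "\<And>x. x \<in> closure ?\<Omega> \<Longrightarrow> norm (dw x $ j) \<le> C"
    using set_integrable_compact_support(2)[OF o w'(2) K(1) van(2)] by blast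
  obtain C0 where C0: "C0 \<ge> 0" "\<And>x. x \<in> closure ?\<Omega> \<Longrightarrow> norm (w x) \<le> C0"
    using set_integrable_compact_support(2)[OF o w'(1) K(1) van(1)] by blast
  have der: "((\<lambda>t. F (x + t *\<^sub>R axis j 1)) has_vector_derivative dF x) (at 0)" for x
  proof -
    have line: "((\<lambda>t. x + t *\<^sub>R axis j 1) has_derivative (\<lambda>t. t *\<^sub>R axis j 1)) (at (0::real))"
      by (auto intro!: derivative_eq_intros)
    show ?thesis
    proof (cases "x \<in> ?\<Omega>")
      case True
      have "(F has_derivative (\<lambda>h. \<Sum>j\<in>UNIV. h $ j *\<^sub>R dw x $ j)) (at x)"
        by (rule has_derivative_transform_within_open[OF w'(3)[OF True] o True]) (simp add: F_def)
      then have "((\<lambda>t. F (x + t *\<^sub>R axis j 1)) has_derivative (\<lambda>t. \<Sum>i\<in>UNIV. (t *\<^sub>R axis j 1) $ i *\<^sub>R dw x $ i)) (at 0)"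
        using has_derivative_compose[OF line, of F "\<lambda>h. \<Sum>j\<in>UNIV. h $ j *\<^sub>R dw x $ j"] by simp
      then show ?thesis using True unfolding has_vector_derivative_def
        by (rule_tac has_derivative_eq_rhs)
           (auto simp: fun_eq_iff dF_def axis_def if_distrib[of "\<lambda>c. c *\<^sub>R _"] if_distrib[of "\<lambda>c. _ * c"] cong: if_cong)
    next
      case False
      define U where "U = (if x \<in> G then G else - K)"
      have U: "open U" "x \<in> U" using False K oG compact_imp_closed[OF K(1)]
        by (auto simp: U_def frontier_def interior_open)
      have F0: "F y = 0" if "y \<in> U" for y
        using that van(1)[of y] sub[of y] closure_subset[of G] by (auto simp: F_def U_def split: if_splits)
      have "(F has_derivative (\<lambda>h. 0)) (at x)"
        by (rule has_derivative_transform_within_open[OF has_derivative_const[of 0] U]) (simp add: F0)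
      then have "((\<lambda>t. F (x + t *\<^sub>R axis j 1)) has_derivative (\<lambda>t. 0)) (at 0)"
        using has_derivative_compose[OF line, of F] by simp
      then show ?thesis using False by (simp add: has_vector_derivative_def dF_def)
    qed
  qed
  have "(LINT x:UNIV|lborel. dF x) = 0"
  proof (rule integral_directional_derivative_0[where F=F and v="axis j 1" and C=C and ?C0.0=C0 and B=K])
    have "(\<lambda>p. indicator UNIV p *\<^sub>R F p) = (\<lambda>p. indicator ?\<Omega> p *\<^sub>R w p)" by (auto simp: F_def indicator_def)
    then show "(\<lambda>p. indicator UNIV p *\<^sub>R F p) \<in> borel_measurable borel"
      using set_integrable_compact_support(3)[OF o w'(1) K(1) van(1)] by simp
    show "bounded K" by (rule compact_imp_bounded[OF K(1)])
  qed (use der C C0 van sub in \<open>auto simp: F_def dF_def\<close>)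
  moreover have "(LINT x:UNIV|lborel. dF x) = (LINT x:?\<Omega>|lborel. dw x $ j)"
    unfolding set_lebesgue_integral_def by (intro Bochner_Integration.integral_cong) (auto simp: dF_def)
  ultimately show ?thesis by simp
qed

text \<open>Induction over the balls replaces a partition of unity. A bump that is 1 on the ball of
  half radius splits off a part supported inside one patch, to which \<open>local_green\<close>
  applies. The remainder is supported in \<open>K\<close> without that smaller ball, so one ball
  fewer covers its contact with the frontier; with no ball left there is no contact. This is why
  \<open>w\<close>, \<open>dw\<close> and \<open>K\<close> are arbitrary in the induction.\<close>

lemma green_cover:
  assumes \<eta>: "outward_unit_normal G \<eta>" and c\<eta>: "continuous_on (frontier G) \<eta>"
    and fr: "frontier G \<subseteq> closure (- closure G)" and oG: "open G"
    and fin: "compact (frontier G)" "emeasure (surface_measure (frontier G)) (frontier G) < \<infinity>"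
    and I: "finite I" "\<And>p. p \<in> I \<Longrightarrow> r p > 0 \<and> (\<exists>P Q \<gamma> \<gamma>1 \<gamma>2. domain_patch G (ball p (r p)) P Q \<gamma> \<gamma>1 \<gamma>2)"
    and w: "C1_on (- closure G) w dw" and K: "compact K" "K \<inter> frontier G \<subseteq> (\<Union>p\<in>I. ball p (r p / 2))"
    and 0: "\<And>x. x \<in> closure (- closure G) \<Longrightarrow> x \<notin> K \<Longrightarrow> w x = 0 \<and> dw x = 0"
  shows "(LINT x:- closure G|lborel. dw x $ j) =
    - (LINT y:frontier G|surface_measure (frontier G). of_real (\<eta> y $ j) * w y)"
  using I w K 0
proof (induction I arbitrary: w dw K rule: finite_induct)
  case empty
  have z: "w y = 0" if "y \<in> frontier G" for y using empty(4) empty(5)[OF subsetD[OF fr that]] that by auto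
  have "(LINT y:frontier G|surface_measure (frontier G). of_real (\<eta> y $ j) * w y) = (LINT y:frontier G|surface_measure (frontier G). 0)"
    unfolding set_lebesgue_integral_def by (intro Bochner_Integration.integral_cong refl) (auto simp: z indicator_def)
  moreover have "K \<inter> frontier G = {}" using empty(4) by simp
  ultimately show ?case using green_away_from_boundary[OF fr oG empty(2) empty(3) _ empty(5), where j=j]
    by (simp add: set_lebesgue_integral_def)
next
  case (insert p I)
  let ?\<Omega> = "- closure G"
  have o: "open ?\<Omega>" by (intro open_Compl closed_closure)
  have r: "r p > 0" using insert.prems(1) by simp
  \<comment> \<open>Chosen so that \<open>\<tau>\<close> is 1 at distance r/2 and 0 at distance 3r/4
    from \<open>p\<close>: the subtracted term is 4/5 at the one and 9/5 at the other.\<close>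
  define c where "c = 16 / (5 * (r p)\<^sup>2)"
  define \<tau> where "\<tau> = (\<lambda>x. 9 / 5 - c * (norm (x - p))\<^sup>2)"
  define a where "a x = complex_of_real (smooth_step (\<tau> x))" for x
  define da where "da x = (\<chi> j. complex_of_real (smooth_step' (\<tau> x) * (- 2 * c * (x - p) $ j)))" for x
  have "c \<noteq> 0" using r by (simp add: c_def)
  have a: "C1_on ?\<Omega> a da" unfolding a_def[abs_def] da_def[abs_def]
    by (rule C1_on_subset[OF smooth_bump[OF \<open>c \<noteq> 0\<close> \<tau>_def]]) simp
  have in1: "a x = 1" "da x = 0" if "x \<in> ball p (r p / 2)" for x
  proof -
    have "(norm (x - p))\<^sup>2 \<le> (r p / 2)\<^sup>2" using that by (intro power_mono) (auto simp: dist_norm norm_minus_commute)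
    then have "c * (norm (x - p))\<^sup>2 \<le> c * (r p / 2)\<^sup>2" using r by (intro mult_left_mono) (auto simp: c_def)
    also have "\<dots> = 4 / 5" using r by (simp add: c_def power2_eq_square)
    finally have "1 \<le> \<tau> x" by (simp add: \<tau>_def)
    then show "a x = 1" "da x = 0" by (auto simp: a_def da_def smooth_step_ge_1 vec_eq_iff)
  qed
  have out0: "a x = 0" "da x = 0" if "x \<notin> cball p (3 / 4 * r p)" for x
  proof -
    have "(3 / 4 * r p)\<^sup>2 \<le> (norm (x - p))\<^sup>2" using that r by (intro power_mono) (auto simp: dist_norm norm_minus_commute)
    then have "c * (3 / 4 * r p)\<^sup>2 \<le> c * (norm (x - p))\<^sup>2" using r by (intro mult_left_mono) (auto simp: c_def)
    moreover have "c * (3 / 4 * r p)\<^sup>2 = 9 / 5" using r by (simp add: c_def power2_eq_square)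
    ultimately have "\<tau> x \<le> 0" by (simp add: \<tau>_def)
    then show "a x = 0" "da x = 0" by (auto simp: a_def da_def smooth_step_le_0 vec_eq_iff)
  qed
  note w = insert.prems(2)
  define w1 where "w1 x = a x * w x" for x
  define dw1 where "dw1 x = (\<chi> j. a x * dw x $ j + da x $ j * w x)" for x
  define w2 where "w2 x = (1 - a x) * w x" for x
  define dw2 where "dw2 x = (\<chi> j. (1 - a x) * dw x $ j + (- da x) $ j * w x)" for x
  have C1: "C1_on ?\<Omega> w1 dw1" unfolding w1_def[abs_def] dw1_def[abs_def] by (rule C1_on_mult[OF a w])
  have C2: "C1_on ?\<Omega> w2 dw2" unfolding w2_def[abs_def] dw2_def[abs_def]
    by (rule C1_on_mult[OF C1_on_diff_const[OF a] w])
  have K1: "compact (K \<inter> cball p (3 / 4 * r p))" by (intro compact_Int insert.prems compact_cball)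
  have K2: "compact (K - ball p (r p / 2))" by (intro compact_diff insert.prems open_ball)
  have z1: "w1 x = 0 \<and> dw1 x = 0" if "x \<in> closure ?\<Omega>" "x \<notin> K \<inter> cball p (3 / 4 * r p)" for x
    using that insert.prems(5)[of x] out0[of x] by (cases "x \<in> K") (auto simp: w1_def dw1_def vec_eq_iff)
  have z2: "w2 x = 0 \<and> dw2 x = 0" if "x \<in> closure ?\<Omega>" "x \<notin> K - ball p (r p / 2)" for x
    using that insert.prems(5)[of x] in1[of x] by (cases "x \<in> K") (auto simp: w2_def dw2_def vec_eq_iff)
  have e1: "(LINT x:?\<Omega>|lborel. dw1 x $ j) = - (LINT y:frontier G|surface_measure (frontier G). of_real (\<eta> y $ j) * w1 y)"
  proof -
    obtain P Q \<gamma> \<gamma>1 \<gamma>2 where "domain_patch G (ball p (r p)) P Q \<gamma> \<gamma>1 \<gamma>2" using insert.prems(1)[of p] by blast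
    then interpret domain_patch G "ball p (r p)" P Q \<gamma> \<gamma>1 \<gamma>2 .
    show ?thesis
      by (rule local_green[OF \<eta> c\<eta> fr C1 K1 _ z1]) (use r in auto)
  qed
  have e2: "(LINT x:?\<Omega>|lborel. dw2 x $ j) = - (LINT y:frontier G|surface_measure (frontier G). of_real (\<eta> y $ j) * w2 y)"
  proof (rule insert.IH[OF _ C2 K2])
    show "(K - ball p (r p / 2)) \<inter> frontier G \<subseteq> (\<Union>p\<in>I. ball p (r p / 2))" using insert.prems(4) by auto
  qed (use insert.prems(1) z2 in auto)
  have i: "set_integrable lborel ?\<Omega> (\<lambda>x. dv x $ j)" if "C1_on ?\<Omega> v dv" "compact L" "\<And>x. x \<in> closure ?\<Omega> \<Longrightarrow> x \<notin> L \<Longrightarrow> v x = 0 \<and> dv x = 0" for v dv L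
    using that by (intro set_integrable_compact_support(1)[OF o _ that(2)]) (auto simp: C1_on_def intro!: continuous_intros)
  have s: "set_integrable (surface_measure (frontier G)) (frontier G) (\<lambda>y. of_real (\<eta> y $ j) * v y)" if "C1_on ?\<Omega> v dv" for v dv
    using that by (intro set_integrable_compact fin continuous_intros c\<eta>) (auto simp: C1_on_def intro: continuous_on_subset[OF _ fr])
  have "(LINT x:?\<Omega>|lborel. dw x $ j) = (LINT x:?\<Omega>|lborel. dw1 x $ j + dw2 x $ j)"
    unfolding set_lebesgue_integral_def by (intro Bochner_Integration.integral_cong) (auto simp: dw1_def dw2_def algebra_simps)
  also have "\<dots> = (LINT x:?\<Omega>|lborel. dw1 x $ j) + (LINT x:?\<Omega>|lborel. dw2 x $ j)"
    by (intro set_integral_add i[OF C1 K1 z1] i[OF C2 K2 z2])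
  also have "\<dots> = - ((LINT y:frontier G|surface_measure (frontier G). of_real (\<eta> y $ j) * w1 y) +
      (LINT y:frontier G|surface_measure (frontier G). of_real (\<eta> y $ j) * w2 y))"
    unfolding e1 e2 by simp
  also have "\<dots> = - (LINT y:frontier G|surface_measure (frontier G). of_real (\<eta> y $ j) * w1 y + of_real (\<eta> y $ j) * w2 y)"
    by (subst set_integral_add(2)[OF s[OF C1] s[OF C2]]) simp
  also have "(LINT y:frontier G|surface_measure (frontier G). of_real (\<eta> y $ j) * w1 y + of_real (\<eta> y $ j) * w2 y)
     = (LINT y:frontier G|surface_measure (frontier G). of_real (\<eta> y $ j) * w y)"
    unfolding set_lebesgue_integral_def by (intro Bochner_Integration.integral_cong) (auto simp: w1_def w2_def algebra_simps)
  finally show ?case .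
qed

text \<open>The compact support closes off the unbounded end of the exterior, so only the frontier
  contributes. The minus sign comes from \<open>\<eta>\<close> pointing into the exterior.\<close>

theorem green_exterior:
  assumes G: "bounded_domain_of_class (Suc m) G" and \<eta>: "outward_unit_normal G \<eta>"
    and w: "C1_on (- closure G) w dw" and K: "compact K"
    and 0: "\<And>x. x \<in> closure (- closure G) \<Longrightarrow> x \<notin> K \<Longrightarrow> w x = 0 \<and> dw x = 0"
  shows "(LINT x:- closure G|lborel. dw x $ j) =
    - (LINT y:frontier G|surface_measure (frontier G). of_real (\<eta> y $ j) * w y)"
proof -
  have "\<forall>p\<in>frontier G. \<exists>r>0. \<exists>P Q \<gamma> \<gamma>1 \<gamma>2. domain_patch G (ball p r) P Q \<gamma> \<gamma>1 \<gamma>2"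
    using domain_patch_exists[OF G] by metis
  from bchoice[OF this] obtain r where
    r: "\<And>p. p \<in> frontier G \<Longrightarrow> r p > 0 \<and> (\<exists>P Q \<gamma> \<gamma>1 \<gamma>2. domain_patch G (ball p (r p)) P Q \<gamma> \<gamma>1 \<gamma>2)" by blast
  have "\<exists>F\<subseteq>frontier G. finite F \<and> frontier G \<subseteq> (\<Union>p\<in>F. ball p (r p / 2))"
    by (rule compactE_image[OF compact_frontier_domain[OF G], of "frontier G" "\<lambda>p. ball p (r p / 2)"]) (use r in auto)
  then obtain F where F: "F \<subseteq> frontier G" "finite F" "frontier G \<subseteq> (\<Union>p\<in>F. ball p (r p / 2))" by blast
  have "open G" using G by (simp add: bounded_domain_of_class_def)
  show ?thesis
  proof (rule green_cover[OF \<eta> continuous_on_frontier_normal[OF G \<eta>] frontier_subset_closure_exterior[OF G] \<open>open G\<close>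
      compact_frontier_domain[OF G] surface_frontier_finite[OF G] F(2) _ w K _ 0])
    show "r p > 0 \<and> (\<exists>P Q \<gamma> \<gamma>1 \<gamma>2. domain_patch G (ball p (r p)) P Q \<gamma> \<gamma>1 \<gamma>2)" if "p \<in> F" for p
      using r that F by blast
  qed (use F in auto)
qed

subsection \<open>The regularised Helmholtz kernel\<close>

definition rad :: "real \<Rightarrow> real^3 \<Rightarrow> real" where "rad \<epsilon> z = sqrt ((norm z)\<^sup>2 + \<epsilon>\<^sup>2)"

text \<open>The radial functions take a complex argument, so that their derivatives follow from the
  rules for complex functions. \<open>radial1\<close> is the derivative of \<open>radial0\<close>
  divided by w, and \<open>radial2\<close> that of \<open>radial1\<close> divided by w; owing to
  these divisions the gradient is \<open>radial1\<close> times z, and no unit vector has to be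
  differentiated.\<close>

definition radial0 :: "real \<Rightarrow> complex \<Rightarrow> complex" where
  "radial0 lam w = exp (\<i> * of_real lam * w) / (of_real (4 * pi) * w)"

definition radial1 :: "real \<Rightarrow> complex \<Rightarrow> complex" where
  "radial1 lam w = (\<i> * of_real lam / w ^ 2 - 1 / w ^ 3) * (exp (\<i> * of_real lam * w) / of_real (4 * pi))"

definition radial2 :: "real \<Rightarrow> complex \<Rightarrow> complex" where
  "radial2 lam w = (3 / w ^ 5 - 3 * \<i> * of_real lam / w ^ 4 - of_real (lam\<^sup>2) / w ^ 3) * (exp (\<i> * of_real lam * w) / of_real (4 * pi))"

text \<open>For \<open>\<epsilon> = 0\<close> these are the Helmholtz kernel, its gradient and its Hessian; for \<open>\<epsilon> > 0\<close> they are
  smooth, because \<open>rad \<epsilon>\<close> does not vanish.\<close>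

definition ker0 :: "real \<Rightarrow> real \<Rightarrow> real^3 \<Rightarrow> complex" where
  "ker0 lam \<epsilon> z = radial0 lam (of_real (rad \<epsilon> z))"

definition ker1 :: "real \<Rightarrow> real \<Rightarrow> 3 \<Rightarrow> real^3 \<Rightarrow> complex" where
  "ker1 lam \<epsilon> j z = radial1 lam (of_real (rad \<epsilon> z)) * of_real (z $ j)"

definition ker2 :: "real \<Rightarrow> real \<Rightarrow> 3 \<Rightarrow> 3 \<Rightarrow> real^3 \<Rightarrow> complex" where
  "ker2 lam \<epsilon> i j z = radial1 lam (of_real (rad \<epsilon> z)) * (if i = j then 1 else 0)
    + radial2 lam (of_real (rad \<epsilon> z)) * of_real (z $ i * z $ j)"

lemma helmholtz_kernel_eq: "helmholtz_kernel lam z = ker0 lam 0 z"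
  by (simp add: helmholtz_kernel_def ker0_def radial0_def rad_def mult.assoc)

lemma norm_le_rad: "norm z \<le> rad \<epsilon> z"
  unfolding rad_def by (rule real_le_rsqrt) simp

lemma eps_le_rad: "0 \<le> \<epsilon> \<Longrightarrow> \<epsilon> \<le> rad \<epsilon> z"
  unfolding rad_def by (rule real_le_rsqrt) simp

lemma rad_pos: "z \<noteq> 0 \<or> \<epsilon> > 0 \<Longrightarrow> 0 < rad \<epsilon> z"
  using norm_le_rad[of z \<epsilon>] eps_le_rad[of \<epsilon> z] zero_less_norm_iff[of z] by linarith

lemma rad_0 [simp]: "rad 0 z = norm z"
  by (simp add: rad_def)

lemma norm_exp_real [simp]: "norm (exp (\<i> * of_real lam * complex_of_real r)) = 1"
  using norm_exp_i_times[of "lam * r"] by (simp add: mult.assoc)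

lemma radial0_deriv:
  assumes "w \<noteq> 0" shows "(radial0 lam has_field_derivative w * radial1 lam w) (at w)"
  unfolding radial0_def[abs_def] radial1_def using assms
  by (auto intro!: derivative_eq_intros simp: field_simps power2_eq_square power3_eq_cube)

lemma DERIV_divide_power:
  fixes a w :: complex
  assumes "w \<noteq> 0" shows "((\<lambda>w. a / w ^ n) has_field_derivative - of_nat n * a / w ^ Suc n) (at w)"
proof (cases n)
  case (Suc m)
  have "((\<lambda>w. a / w ^ n) has_field_derivative (0 * w ^ n - a * (of_nat n * w ^ m)) / (w ^ n * w ^ n)) (at w)"
    using DERIV_divide[OF DERIV_const[of a] DERIV_power[OF DERIV_ident, of n]] assms Suc by (simp del: of_nat_Suc)
  then show ?thesis by (rule DERIV_cong) (use assms Suc in \<open>simp add: field_simps\<close>)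
qed simp

lemma radial1_deriv:
  assumes "w \<noteq> 0" shows "(radial1 lam has_field_derivative w * radial2 lam w) (at w)"
proof -
  let ?l = "complex_of_real lam"
  define E where "E = exp (\<i> * ?l * w) / of_real (4 * pi)"
  have 1: "((\<lambda>w. \<i> * ?l / w ^ 2 - 1 / w ^ 3) has_field_derivative (- of_nat 2 * (\<i> * ?l) / w ^ Suc 2 - - of_nat 3 * 1 / w ^ Suc 3)) (at w)"
    by (intro DERIV_diff DERIV_divide_power assms)
  have 2: "((\<lambda>w. exp (\<i> * ?l * w) / of_real (4 * pi)) has_field_derivative \<i> * ?l * E) (at w)"
    unfolding E_def by (auto intro!: derivative_eq_intros)
  have a: "\<i> * ?l * (\<i> * ?l / w ^ 2 - 1 / w ^ 3) = - ?l\<^sup>2 / w ^ 2 - \<i> * ?l / w ^ 3"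
    by (simp add: power2_eq_square algebra_simps)
  have b: "w * (3 / w ^ 5 - 3 * \<i> * ?l / w ^ 4 - of_real (lam\<^sup>2) / w ^ 3) = 3 / w ^ 4 - 3 * \<i> * ?l / w ^ 3 - ?l\<^sup>2 / w ^ 2"
    using assms by (simp add: right_diff_distrib power_numeral_reduce)
  have c: "(- of_nat 2 * (\<i> * ?l) / w ^ Suc 2 - - of_nat 3 * 1 / w ^ Suc 3) + (- ?l\<^sup>2 / w ^ 2 - \<i> * ?l / w ^ 3)
     = 3 / w ^ 4 - 3 * \<i> * ?l / w ^ 3 - ?l\<^sup>2 / w ^ 2"
    using assms by (simp add: field_simps power_numeral_reduce)
  have "(- of_nat 2 * (\<i> * ?l) / w ^ Suc 2 - - of_nat 3 * 1 / w ^ Suc 3) * E + \<i> * ?l * E * (\<i> * ?l / w ^ 2 - 1 / w ^ 3)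
    = ((- of_nat 2 * (\<i> * ?l) / w ^ Suc 2 - - of_nat 3 * 1 / w ^ Suc 3) + \<i> * ?l * (\<i> * ?l / w ^ 2 - 1 / w ^ 3)) * E"
  proof -
    have "A * E + B * E * C = (A + B * C) * E" for A B C :: complex by (simp add: algebra_simps)
    then show ?thesis .
  qed
  also have "\<dots> = w * radial2 lam w" unfolding a c b[symmetric] by (simp only: radial2_def E_def mult.assoc)
  finally show ?thesis
    unfolding radial1_def[abs_def] using DERIV_mult[OF 1 2, folded E_def] by (simp only: E_def)
qed

lemma rad_deriv:
  assumes "z \<noteq> 0 \<or> \<epsilon> > 0"
  shows "(rad \<epsilon> has_derivative (\<lambda>h. (z \<bullet> h) / rad \<epsilon> z)) (at z)"
proof -
  have "((\<lambda>z. z \<bullet> z + \<epsilon>\<^sup>2) has_derivative (\<lambda>h. 2 * (z \<bullet> h))) (at z)"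
    by (auto intro!: derivative_eq_intros simp: inner_commute)
  moreover have "z \<bullet> z + \<epsilon>\<^sup>2 > 0" using rad_pos[OF assms] by (simp add: rad_def power2_norm_eq_inner)
  ultimately have "((\<lambda>z. sqrt (z \<bullet> z + \<epsilon>\<^sup>2)) has_derivative (\<lambda>h. 2 * (z \<bullet> h) * (inverse (sqrt (z \<bullet> z + \<epsilon>\<^sup>2)) / 2))) (at z)"
    by (rule has_derivative_real_sqrt[rotated])
  moreover have "(\<lambda>h. 2 * (z \<bullet> h) * (inverse (sqrt (z \<bullet> z + \<epsilon>\<^sup>2)) / 2)) = (\<lambda>h. (z \<bullet> h) / sqrt (z \<bullet> z + \<epsilon>\<^sup>2))"
  proof
    have "2 * a * (inverse s / 2) = a / s" for a s :: real by (cases "s = 0") (auto simp: field_simps)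
    then show "2 * (z \<bullet> h) * (inverse (sqrt (z \<bullet> z + \<epsilon>\<^sup>2)) / 2) = (z \<bullet> h) / sqrt (z \<bullet> z + \<epsilon>\<^sup>2)" for h .
  qed
  ultimately show ?thesis unfolding rad_def[abs_def] power2_norm_eq_inner by (rule subst[rotated])
qed

text \<open>The factor \<open>rad \<epsilon> z\<close> in the derivative of \<open>f\<close> cancels
  the denominator in the gradient z / \<open>rad \<epsilon> z\<close> of the radius.\<close>

lemma radial_comp_deriv:
  assumes z: "z \<noteq> 0 \<or> \<epsilon> > 0"
    and d: "(f has_field_derivative of_real (rad \<epsilon> z) * f') (at (of_real (rad \<epsilon> z)))"
  shows "((\<lambda>z. f (complex_of_real (rad \<epsilon> z))) has_derivative (\<lambda>h. of_real (z \<bullet> h) * f')) (at z)"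
proof -
  have r: "rad \<epsilon> z \<noteq> 0" using rad_pos[OF z] by simp
  have "((\<lambda>x. f (of_real x)) has_derivative (\<lambda>h. h *\<^sub>R (of_real (rad \<epsilon> z) * f'))) (at (rad \<epsilon> z))"
    using has_vector_derivative_real_field[OF d] by (simp add: has_vector_derivative_def)
  from has_derivative_compose[OF rad_deriv[OF z] this] show ?thesis
    by (rule has_derivative_eq_rhs) (use r in \<open>auto simp: fun_eq_iff scaleR_conv_of_real\<close>)
qed

lemma ker0_deriv:
  assumes z: "z \<noteq> 0 \<or> \<epsilon> > 0"
  shows "(ker0 lam \<epsilon> has_derivative (\<lambda>h. \<Sum>j\<in>UNIV. h $ j *\<^sub>R ker1 lam \<epsilon> j z)) (at z)"
  unfolding ker0_def[abs_def]
  by (rule has_derivative_eq_rhs[OF radial_comp_deriv[OF z radial0_deriv]])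
     (use rad_pos[OF z] in \<open>auto simp: fun_eq_iff ker1_def inner_vec_def sum_3 scaleR_conv_of_real algebra_simps\<close>)

lemma ker1_deriv:
  assumes z: "z \<noteq> 0 \<or> \<epsilon> > 0"
  shows "(ker1 lam \<epsilon> j has_derivative (\<lambda>h. \<Sum>i\<in>UNIV. h $ i *\<^sub>R ker2 lam \<epsilon> i j z)) (at z)"
proof -
  have "((\<lambda>z. complex_of_real (z $ j)) has_derivative (\<lambda>h. complex_of_real (h $ j))) (at z)"
    by (rule has_derivative_of_real[OF bounded_linear_imp_has_derivative[OF bounded_linear_vec_nth]])
  moreover have "((\<lambda>z. radial1 lam (of_real (rad \<epsilon> z))) has_derivative (\<lambda>h. of_real (z \<bullet> h) * radial2 lam (of_real (rad \<epsilon> z)))) (at z)"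
    by (rule radial_comp_deriv[OF z radial1_deriv]) (use rad_pos[OF z] in auto)
  ultimately show ?thesis
    unfolding ker1_def[abs_def]
    by (intro has_derivative_eq_rhs[OF has_derivative_mult])
       (use exhaust_3[of j] in \<open>auto simp: fun_eq_iff ker2_def inner_vec_def sum_3 scaleR_conv_of_real algebra_simps\<close>)
qed

text \<open>The trace of the Hessian is 3 \<open>radial1\<close> + |z|^2 \<open>radial2\<close>.
  With r^2 in place of |z|^2 the radial Helmholtz equation makes this - lam^2
  \<open>radial0\<close>; as |z|^2 = r^2 - \<epsilon>^2, exactly the term with \<epsilon>^2
  survives, and this term is the approximate identity.\<close>

lemma ker_laplace:
  assumes z: "z \<noteq> 0 \<or> \<epsilon> > 0"
  shows "- (\<Sum>i\<in>UNIV. ker2 lam \<epsilon> i i z) - of_real (lam\<^sup>2) * ker0 lam \<epsilon> z = of_real (\<epsilon>\<^sup>2) * radial2 lam (of_real (rad \<epsilon> z))"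
proof -
  define r where "r = complex_of_real (rad \<epsilon> z)"
  have r: "r \<noteq> 0" using rad_pos[OF z] by (simp add: r_def)
  have "(rad \<epsilon> z)\<^sup>2 = (norm z)\<^sup>2 + \<epsilon>\<^sup>2" by (simp add: rad_def)
  then have r2: "r\<^sup>2 = of_real ((norm z)\<^sup>2) + of_real (\<epsilon>\<^sup>2)" by (simp add: r_def flip: of_real_power of_real_add)
  have "complex_of_real ((norm z)\<^sup>2) = (\<Sum>i\<in>UNIV. of_real (z $ i * z $ i))"
    by (simp add: power2_norm_eq_inner inner_vec_def)
  then have "(\<Sum>i\<in>UNIV. ker2 lam \<epsilon> i i z) = 3 * radial1 lam r + radial2 lam r * (r\<^sup>2 - of_real (\<epsilon>\<^sup>2))"
    unfolding r2 by (simp add: ker2_def r_def[symmetric] sum.distrib sum_distrib_left)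
  moreover have "3 * radial1 lam r + radial2 lam r * r\<^sup>2 = - of_real (lam\<^sup>2) * radial0 lam r"
    using r by (simp add: radial0_def radial1_def radial2_def divide_simps) (simp add: algebra_simps power_numeral_reduce)
  ultimately have "(\<Sum>i\<in>UNIV. ker2 lam \<epsilon> i i z) = - of_real (lam\<^sup>2) * radial0 lam r - radial2 lam r * of_real (\<epsilon>\<^sup>2)"
    by (simp only: right_diff_distrib add_diff_eq)
  then show ?thesis by (simp only: ker0_def r_def[symmetric]) (simp add: algebra_simps)
qed

lemma norm_ker0:
  assumes z: "z \<noteq> 0 \<or> \<epsilon> > 0" shows "norm (ker0 lam \<epsilon> z) = 1 / (4 * pi * rad \<epsilon> z)"
  using rad_pos[OF z] by (simp add: ker0_def radial0_def norm_divide norm_mult)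

lemma four_pi: "1 \<le> 4 * pi" using pi_gt3 by simp

lemma norm_ker0_le:
  assumes z: "z \<noteq> 0 \<or> \<epsilon> > 0" shows "norm (ker0 lam \<epsilon> z) \<le> 1 / rad \<epsilon> z"
  unfolding norm_ker0[OF z] using rad_pos[OF z] four_pi by (intro divide_left_mono) (auto simp: mult_le_cancel_right1)

lemma norm_radial1_le:
  assumes r: "r > 0" shows "norm (radial1 lam (of_real r)) \<le> \<bar>lam\<bar> / r\<^sup>2 + 1 / r ^ 3"
proof -
  have "norm (\<i> * of_real lam / complex_of_real r ^ 2 - 1 / of_real r ^ 3) \<le> \<bar>lam\<bar> / r\<^sup>2 + 1 / r ^ 3"
    by (rule order_trans[OF norm_triangle_ineq4]) (use r in \<open>simp add: norm_divide norm_mult norm_power\<close>)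
  moreover have "norm (exp (\<i> * of_real lam * complex_of_real r) / of_real (4 * pi)) \<le> 1"
    using four_pi by (simp add: norm_divide)
  ultimately show ?thesis unfolding radial1_def norm_mult
    using mult_mono[of "norm (\<i> * of_real lam / complex_of_real r ^ 2 - 1 / of_real r ^ 3)" "\<bar>lam\<bar> / r\<^sup>2 + 1 / r ^ 3" _ 1] r by auto
qed

lemma norm_radial2_le:
  assumes r: "r > 0" shows "norm (radial2 lam (of_real r)) \<le> 3 / r ^ 5 + 3 * \<bar>lam\<bar> / r ^ 4 + lam\<^sup>2 / r ^ 3"
proof -
  have "norm (3 / complex_of_real r ^ 5 - 3 * \<i> * of_real lam / of_real r ^ 4 - of_real (lam\<^sup>2) / of_real r ^ 3)
     \<le> 3 / r ^ 5 + 3 * \<bar>lam\<bar> / r ^ 4 + lam\<^sup>2 / r ^ 3"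
    by (rule order_trans[OF norm_triangle_ineq4], rule add_mono, rule order_trans[OF norm_triangle_ineq4])
       (use r in \<open>simp_all add: norm_divide norm_mult norm_power\<close>)
  moreover have "norm (exp (\<i> * of_real lam * complex_of_real r) / of_real (4 * pi)) \<le> 1"
    using four_pi by (simp add: norm_divide)
  ultimately show ?thesis unfolding radial2_def norm_mult
    using mult_mono[of "norm (3 / complex_of_real r ^ 5 - 3 * \<i> * of_real lam / of_real r ^ 4 - of_real (lam\<^sup>2) / of_real r ^ 3)" "3 / r ^ 5 + 3 * \<bar>lam\<bar> / r ^ 4 + lam\<^sup>2 / r ^ 3" _ 1] r by auto
qed

lemma norm_ker1_le:
  assumes z: "z \<noteq> 0 \<or> \<epsilon> > 0" shows "norm (ker1 lam \<epsilon> j z) \<le> \<bar>lam\<bar> / rad \<epsilon> z + 1 / (rad \<epsilon> z)\<^sup>2"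
proof -
  note r = rad_pos[OF z]
  have "\<bar>z $ j\<bar> \<le> rad \<epsilon> z" using component_le_norm_cart[of z j] norm_le_rad[of z \<epsilon>] by simp
  then have "norm (ker1 lam \<epsilon> j z) \<le> (\<bar>lam\<bar> / (rad \<epsilon> z)\<^sup>2 + 1 / (rad \<epsilon> z) ^ 3) * rad \<epsilon> z"
    unfolding ker1_def norm_mult using norm_radial1_le[OF r] r by (intro mult_mono) auto
  also have "\<dots> = \<bar>lam\<bar> / rad \<epsilon> z + 1 / (rad \<epsilon> z)\<^sup>2"
    using r by (simp add: distrib_right power2_eq_square power3_eq_cube)
  finally show ?thesis .
qed

lemma norm_ker2_le:
  assumes z: "z \<noteq> 0 \<or> \<epsilon> > 0"
  shows "norm (ker2 lam \<epsilon> i j z) \<le> lam\<^sup>2 / rad \<epsilon> z + 4 * \<bar>lam\<bar> / (rad \<epsilon> z)\<^sup>2 + 4 / (rad \<epsilon> z) ^ 3"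
proof -
  note r = rad_pos[OF z]
  have c: "\<bar>z $ j\<bar> \<le> rad \<epsilon> z" for j using component_le_norm_cart[of z j] norm_le_rad[of z \<epsilon>] by simp
  have "norm (complex_of_real (z $ i * z $ j)) \<le> (rad \<epsilon> z)\<^sup>2"
    using mult_mono[OF c[of i] c[of j]] r by (simp add: abs_mult power2_eq_square norm_mult)
  then have 2: "norm (radial2 lam (of_real (rad \<epsilon> z)) * of_real (z $ i * z $ j)) \<le> (3 / (rad \<epsilon> z) ^ 5 + 3 * \<bar>lam\<bar> / (rad \<epsilon> z) ^ 4 + lam\<^sup>2 / (rad \<epsilon> z) ^ 3) * (rad \<epsilon> z)\<^sup>2"
    unfolding norm_mult[of "radial2 _ _"] using norm_radial2_le[OF r, of lam] r by (intro mult_mono) auto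
  have 1: "norm (radial1 lam (of_real (rad \<epsilon> z)) * (if i = j then 1 else 0)) \<le> \<bar>lam\<bar> / (rad \<epsilon> z)\<^sup>2 + 1 / (rad \<epsilon> z) ^ 3"
    using norm_radial1_le[OF r, of lam] r by (auto simp: norm_mult)
  have "(3 / (rad \<epsilon> z) ^ 5 + 3 * \<bar>lam\<bar> / (rad \<epsilon> z) ^ 4 + lam\<^sup>2 / (rad \<epsilon> z) ^ 3) * (rad \<epsilon> z)\<^sup>2
    = 3 / (rad \<epsilon> z) ^ 3 + 3 * \<bar>lam\<bar> / (rad \<epsilon> z)\<^sup>2 + lam\<^sup>2 / rad \<epsilon> z"
    using r by (simp add: distrib_right power_numeral_reduce)
  then show ?thesis unfolding ker2_def
    using norm_triangle_mono[OF 1 2] by simp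
qed

lemma continuous_on_rad: "continuous_on A (rad \<epsilon>)"
  unfolding rad_def[abs_def] by (intro continuous_intros)

lemma continuous_on_kernels:
  assumes "\<epsilon> > 0 \<or> 0 \<notin> A"
  shows "continuous_on A (ker0 lam \<epsilon>)" "continuous_on A (ker1 lam \<epsilon> j)" "continuous_on A (ker2 lam \<epsilon> i j)"
proof -
  have "rad \<epsilon> z \<noteq> 0" if "z \<in> A" for z using rad_pos[of z \<epsilon>] assms that by (cases "z = 0") auto
  then show "continuous_on A (ker0 lam \<epsilon>)" "continuous_on A (ker1 lam \<epsilon> j)" "continuous_on A (ker2 lam \<epsilon> i j)"
    unfolding ker0_def ker1_def ker2_def radial0_def radial1_def radial2_def
    by (auto intro!: continuous_intros continuous_on_rad)
qed

lemma borel_measurable_kernels [measurable]: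
  "ker0 lam \<epsilon> \<in> borel_measurable borel" "ker1 lam \<epsilon> j \<in> borel_measurable borel" "ker2 lam \<epsilon> i j \<in> borel_measurable borel"
proof -
  have [measurable]: "rad \<epsilon> \<in> borel_measurable borel" by (intro borel_measurable_continuous_onI continuous_on_rad)
  have [measurable]: "(\<lambda>z::real^3. z $ j) \<in> borel_measurable borel" for j
    by (intro borel_measurable_continuous_onI continuous_intros)
  show "ker0 lam \<epsilon> \<in> borel_measurable borel" "ker1 lam \<epsilon> j \<in> borel_measurable borel" "ker2 lam \<epsilon> i j \<in> borel_measurable borel"
    unfolding ker0_def ker1_def ker2_def radial0_def radial1_def radial2_def by measurable
qed

lemma rad_tendsto:
  assumes "s \<longlonglongrightarrow> 0" shows "(\<lambda>n. rad (s n) z) \<longlonglongrightarrow> norm z"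
proof -
  have "(\<lambda>n. sqrt ((norm z)\<^sup>2 + (s n)\<^sup>2)) \<longlonglongrightarrow> sqrt ((norm z)\<^sup>2 + 0\<^sup>2)" by (intro tendsto_intros assms)
  then show ?thesis by (simp add: rad_def)
qed

lemma kernels_tendsto:
  assumes s: "s \<longlonglongrightarrow> 0" and z: "z \<noteq> 0"
  shows "(\<lambda>n. ker0 lam (s n) z) \<longlonglongrightarrow> ker0 lam 0 z" "(\<lambda>n. ker1 lam (s n) j z) \<longlonglongrightarrow> ker1 lam 0 j z"
  unfolding ker0_def ker1_def radial0_def radial1_def rad_0
  by (intro tendsto_intros rad_tendsto[OF s]; use z in simp)+

subsection \<open>Volume potentials\<close>

lemma sum_scaleR_bound:
  fixes c :: "3 \<Rightarrow> complex"
  assumes "\<And>j. norm (c j) \<le> b" shows "norm (\<Sum>j\<in>UNIV. (h::real^3) $ j *\<^sub>R c j) \<le> 3 * b * norm h"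
proof -
  have "norm (\<Sum>j\<in>UNIV. h $ j *\<^sub>R c j) \<le> (\<Sum>j\<in>(UNIV::3 set). norm h * b)"
    by (rule sum_norm_le) (auto intro!: mult_mono assms component_le_norm_cart order_trans[OF norm_ge_zero assms])
  then show ?thesis by (simp add: algebra_simps)
qed

text \<open>Dominated convergence for difference quotients. With b a bound on the partial
  derivatives, the mean value inequality bounds an increment of \<open>k\<close> by 3 b times the
  step, and the linear part obeys the same bound, whence \<open>6 * w\<close>. It is applied to
  regularised kernels, and to singular ones at points away from the support of the density.\<close>

lemma has_derivative_kernel_integral:
  fixes k f :: "real^3 \<Rightarrow> complex" and dk :: "3 \<Rightarrow> real^3 \<Rightarrow> complex"
  assumes M: "sets M = sets borel" and f: "f \<in> borel_measurable borel" and k: "k \<in> borel_measurable borel"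
    and dk: "\<And>j. dk j \<in> borel_measurable borel" and \<delta>: "\<delta> > 0"
    and der: "\<And>x y. x \<in> ball x0 \<delta> \<Longrightarrow> f y \<noteq> 0 \<Longrightarrow> (k has_derivative (\<lambda>h. \<Sum>j\<in>UNIV. h $ j *\<^sub>R dk j (x - y))) (at (x - y))"
    and bnd: "\<And>x y j. x \<in> ball x0 \<delta> \<Longrightarrow> f y \<noteq> 0 \<Longrightarrow> norm (dk j (x - y)) * norm (f y) \<le> w y"
    and w: "integrable M w" and int: "\<And>x. x \<in> ball x0 \<delta> \<Longrightarrow> integrable M (\<lambda>y. k (x - y) * f y)"
  shows "integrable M (\<lambda>y. dk j (x0 - y) * f y)"
    and "((\<lambda>x. \<integral>y. k (x - y) * f y \<partial>M) has_derivative (\<lambda>h. \<Sum>j\<in>UNIV. h $ j *\<^sub>R (\<integral>y. dk j (x0 - y) * f y \<partial>M))) (at x0)"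
proof -
  note [measurable_cong] = M
  note [measurable] = f k dk
  have x0: "x0 \<in> ball x0 \<delta>" using \<delta> by simp
  have bnd': "norm (dk j (x0 - y) * f y) \<le> norm (w y)" for j y
    using bnd[OF x0, of y j] by (cases "f y = 0") (auto simp: norm_mult)
  show id: "integrable M (\<lambda>y. dk j (x0 - y) * f y)" for j
    by (rule Bochner_Integration.integrable_bound[OF w]) (use bnd' in auto)
  let ?P = "\<lambda>x. \<integral>y. k (x - y) * f y \<partial>M"
  let ?D = "\<lambda>h. \<Sum>j\<in>UNIV. h $ j *\<^sub>R (\<integral>y. dk j (x0 - y) * f y \<partial>M)"
  have "bounded_linear ?D"
    by (intro bounded_linear_sum bounded_linear_scaleR_const bounded_linear_vec_nth)
  moreover have "((\<lambda>h. norm (?P (x0 + h) - ?P x0 - ?D h) / norm h) \<longlongrightarrow> 0) (at 0)"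
    unfolding tendsto_at_iff_sequentially
  proof (intro allI impI)
    fix X :: "nat \<Rightarrow> real^3" assume X: "\<forall>i. X i \<in> UNIV - {0}" "X \<longlonglongrightarrow> 0"
    from order_tendstoD(2)[OF tendsto_norm[OF X(2)]] \<delta> have "\<forall>\<^sub>F n in sequentially. norm (X n) < \<delta>" by simp
    then obtain N where N: "\<And>n. n \<ge> N \<Longrightarrow> norm (X n) < \<delta>" unfolding eventually_sequentially by blast
    define Y where "Y n = X (n + N)" for n
    have Y: "Y n \<noteq> 0" "norm (Y n) < \<delta>" for n using X(1) N[of "n + N"] by (auto simp: Y_def)
    have Y0: "Y \<longlonglongrightarrow> 0" unfolding Y_def[abs_def] by (rule LIMSEQ_ignore_initial_segment[OF X(2)])
    have x0Y: "x0 + Y n \<in> ball x0 \<delta>" for n using Y(2)[of n] by (simp add: dist_norm)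
    define A where "A n y = k (x0 + Y n - y) - k (x0 - y) - (\<Sum>j\<in>UNIV. Y n $ j *\<^sub>R dk j (x0 - y))" for n y
    define q where "q n y = (1 / norm (Y n)) *\<^sub>R (A n y * f y)" for n y
    have nq: "norm (q n y) = norm (A n y) / norm (Y n) * norm (f y)" for n y by (simp add: q_def norm_mult)
    have qlim: "(\<lambda>n. q n y) \<longlonglongrightarrow> 0" for y
    proof (cases "f y = 0")
      case False
      from der[OF x0 False] have "((\<lambda>h. norm (k ((x0 - y) + h) - k (x0 - y) - (\<Sum>j\<in>UNIV. h $ j *\<^sub>R dk j (x0 - y))) / norm h) \<longlongrightarrow> 0) (at 0)"
        by (simp add: has_derivative_at)
      from this[unfolded tendsto_at_iff_sequentially, rule_format, of Y] Y Y0
      have "(\<lambda>n. norm (k ((x0 - y) + Y n) - k (x0 - y) - (\<Sum>j\<in>UNIV. Y n $ j *\<^sub>R dk j (x0 - y))) / norm (Y n)) \<longlonglongrightarrow> 0"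
        by (simp add: comp_def)
      moreover have "k ((x0 - y) + Y n) - k (x0 - y) - (\<Sum>j\<in>UNIV. Y n $ j *\<^sub>R dk j (x0 - y)) = A n y" for n
        by (simp add: A_def add_diff_eq add.commute diff_add_eq)
      ultimately have "(\<lambda>n. norm (A n y) / norm (Y n)) \<longlonglongrightarrow> 0" by simp
      from tendsto_mult_left_zero[OF this, of "norm (f y)"]
      have "(\<lambda>n. norm (q n y)) \<longlonglongrightarrow> 0" by (simp only: nq)
      then show ?thesis by (rule tendsto_norm_zero_cancel)
    qed (simp add: q_def)
    have qbnd: "norm (q n y) \<le> 6 * w y" if "f y \<noteq> 0" for n y
    proof -
      define b where "b = w y / norm (f y)"
      have b: "norm (dk j (x - y)) \<le> b" if "x \<in> ball x0 \<delta>" for x j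
        using bnd[OF that \<open>f y \<noteq> 0\<close>, of j] \<open>f y \<noteq> 0\<close> by (simp add: b_def pos_le_divide_eq)
      have b0: "0 \<le> b" using order_trans[OF norm_ge_zero b[OF x0]] .
      have "norm (k (x0 + Y n - y) - k (x0 - y)) \<le> 3 * b * norm ((x0 + Y n) - x0)"
      proof (rule differentiable_bound[OF convex_ball, of x0 \<delta> "\<lambda>x. k (x - y)" "\<lambda>x h. \<Sum>j\<in>UNIV. h $ j *\<^sub>R dk j (x - y)"])
        fix x assume x: "x \<in> ball x0 \<delta>"
        have "((\<lambda>x. x - y) has_derivative (\<lambda>h. h)) (at x within ball x0 \<delta>)" by (auto intro!: derivative_eq_intros)
        from has_derivative_compose[OF this der[OF x \<open>f y \<noteq> 0\<close>]]
        show "((\<lambda>x. k (x - y)) has_derivative (\<lambda>h. \<Sum>j\<in>UNIV. h $ j *\<^sub>R dk j (x - y))) (at x within ball x0 \<delta>)" .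
        show "onorm (\<lambda>h. \<Sum>j\<in>UNIV. h $ j *\<^sub>R dk j (x - y)) \<le> 3 * b"
          using b0 sum_scaleR_bound[OF b[OF x]] by (intro onorm_bound) auto
      qed (use x0 x0Y in auto)
      then have 1: "norm (k (x0 + Y n - y) - k (x0 - y)) \<le> 3 * b * norm (Y n)" by simp
      have 2: "norm (\<Sum>j\<in>UNIV. Y n $ j *\<^sub>R dk j (x0 - y)) \<le> 3 * b * norm (Y n)"
        by (rule sum_scaleR_bound[OF b[OF x0]])
      have "norm (A n y) \<le> 6 * b * norm (Y n)"
        using norm_triangle_ineq4[of "k (x0 + Y n - y) - k (x0 - y)" "\<Sum>j\<in>UNIV. Y n $ j *\<^sub>R dk j (x0 - y)"] 1 2
        unfolding A_def by linarith
      then have "norm (A n y) / norm (Y n) \<le> 6 * b"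
        using Y(1)[of n] by (simp add: pos_divide_le_eq)
      then have "norm (q n y) \<le> 6 * b * norm (f y)"
        unfolding nq by (rule mult_right_mono) simp
      then show ?thesis using that by (simp add: b_def)
    qed
    have "(\<lambda>n. \<integral>y. q n y \<partial>M) \<longlonglongrightarrow> (\<integral>y. 0 \<partial>M)"
    proof (rule integral_dominated_convergence[where w="\<lambda>y. norm (6 * w y)"])
      show "AE y in M. norm (q n y) \<le> norm (6 * w y)" for n
      proof (rule AE_I2)
        fix y show "norm (q n y) \<le> norm (6 * w y)"
          using qbnd[of y n] by (cases "f y = 0") (auto simp: q_def)
      qed
      show "integrable M (\<lambda>y. norm (6 * w y))" using w by simp
      show "q n \<in> borel_measurable M" for n unfolding q_def A_def by measurable
    qed (use qlim in auto)
    moreover have "(\<integral>y. q n y \<partial>M) = (1 / norm (Y n)) *\<^sub>R (?P (x0 + Y n) - ?P x0 - ?D (Y n))" for n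
    proof -
      have "q n y = (1 / norm (Y n)) *\<^sub>R (k (x0 + Y n - y) * f y - k (x0 - y) * f y - (\<Sum>j\<in>UNIV. Y n $ j *\<^sub>R (dk j (x0 - y) * f y)))" for y
        by (simp add: q_def A_def left_diff_distrib sum_distrib_right)
      then show ?thesis
        using int[OF x0] int[OF x0Y] id
        by (simp add: integral_diff integral_sum integrable_sum)
    qed
    ultimately have "(\<lambda>n. norm ((1 / norm (Y n)) *\<^sub>R (?P (x0 + Y n) - ?P x0 - ?D (Y n)))) \<longlonglongrightarrow> 0"
      using tendsto_norm_zero by fastforce
    then have "(\<lambda>n. norm (?P (x0 + X (n + N)) - ?P x0 - ?D (X (n + N))) / norm (X (n + N))) \<longlonglongrightarrow> 0"
      by (simp add: Y_def)
    then show "((\<lambda>h. norm (?P (x0 + h) - ?P x0 - ?D h) / norm h) \<circ> X) \<longlonglongrightarrow> 0"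
      unfolding comp_def by (rule LIMSEQ_offset)
  qed
  ultimately show "(?P has_derivative ?D) (at x0)" by (simp add: has_derivative_at)
qed

lemma borel_measurable_cball [measurable]: "cball (0::real^3) b \<in> sets borel" "- cball (0::real^3) b \<in> sets borel"
  by simp_all

lemma integrable_powr_ball:
  assumes "a < 3" shows "integrable lborel (\<lambda>x::real^3. norm x powr (- a) * indicator (cball 0 b) x)"
proof (rule integrableI_bounded)
  have "(\<integral>\<^sup>+x. ennreal (norm (norm (x::real^3) powr (- a) * indicator (cball 0 b) x)) \<partial>lborel)
    \<le> (\<integral>\<^sup>+x. ennreal (norm (x::real^3) powr (- a)) * indicator (cball 0 (\<bar>b\<bar> + 1)) x \<partial>lborel)"
    by (intro nn_integral_mono) (auto simp: indicator_def)
  also have "\<dots> < \<infinity>" by (rule nn_integral_powr_ball[OF assms]) simp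
  finally show "(\<integral>\<^sup>+x. ennreal (norm (norm (x::real^3) powr (- a) * indicator (cball 0 b) x)) \<partial>lborel) < \<infinity>" .
qed measurable

lemma integrable_powr_outside:
  assumes "a > 3" "b > 0" shows "integrable lborel (\<lambda>x::real^3. norm x powr (- a) * indicator (- cball 0 b) x)"
proof (rule integrableI_bounded)
  have "(\<integral>\<^sup>+x. ennreal (norm (norm (x::real^3) powr (- a) * indicator (- cball 0 b) x)) \<partial>lborel)
    \<le> (\<integral>\<^sup>+x. ennreal (norm (x::real^3) powr (- a)) * indicator (- ball 0 b) x \<partial>lborel)"
    by (intro nn_integral_mono) (auto simp: indicator_def)
  also have "\<dots> < \<infinity>" by (rule nn_integral_powr_outside[OF assms])
  finally show "(\<integral>\<^sup>+x. ennreal (norm (norm (x::real^3) powr (- a) * indicator (- cball 0 b) x)) \<partial>lborel) < \<infinity>" .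
qed measurable

lemma distr_reflect_lborel: "distr lborel borel (\<lambda>y. x - y) = (lborel :: 'a::euclidean_space measure)"
  by (subst lborel_affine[of "-1" x]) (auto simp: density_1)

lemma integrable_reflect:
  fixes g :: "'a::euclidean_space \<Rightarrow> 'b::{banach, second_countable_topology}"
  assumes "integrable lborel g" shows "integrable lborel (\<lambda>y. g (x - y))"
proof -
  have "integrable (distr lborel borel (\<lambda>y. x - y)) g" using assms by (simp add: distr_reflect_lborel)
  from integrable_distr[OF _ this] show ?thesis by simp
qed

lemma integral_reflect:
  fixes g :: "'a::euclidean_space \<Rightarrow> 'b::{banach, second_countable_topology}"
  assumes "g \<in> borel_measurable borel" shows "(\<integral>y. g (x - y) \<partial>lborel) = (\<integral>y. g y \<partial>lborel)"
  using integral_distr[of "\<lambda>y. x - y" lborel borel g] assms by (simp add: distr_reflect_lborel)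

text \<open>Common majorant, up to a constant, of \<open>ker0\<close> and \<open>ker1\<close> for
  all \<epsilon>. It is locally integrable in three dimensions, and integrable at infinity against
  densities that decay faster than |y|^-2.\<close>

definition sing :: "real^3 \<Rightarrow> real" where "sing z = 1 / norm z + 1 / (norm z)\<^sup>2"

lemma sing_nonneg: "0 \<le> sing z" by (simp add: sing_def)

lemma sing_powr: "sing z = norm z powr (- 1) + norm z powr (- 2)"
  by (cases "z = 0") (simp_all add: sing_def powr_minus inverse_eq_divide powr_numeral)

lemma borel_measurable_sing [measurable]: "sing \<in> borel_measurable borel"
  unfolding sing_def[abs_def] by measurable

lemma kernel_sing_bounds:
  assumes "z \<noteq> 0"
  shows "norm (ker0 lam \<epsilon> z) \<le> (1 + \<bar>lam\<bar>) * sing z" "norm (ker1 lam \<epsilon> j z) \<le> (1 + \<bar>lam\<bar>) * sing z"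
proof -
  have n: "norm z > 0" using assms by simp
  have i: "1 / rad \<epsilon> z \<le> 1 / norm z" using n norm_le_rad[of z \<epsilon>] by (intro frac_le) auto
  have i2: "1 / (rad \<epsilon> z)\<^sup>2 \<le> 1 / (norm z)\<^sup>2"
    using n norm_le_rad[of z \<epsilon>] by (intro frac_le power_mono) auto
  have "norm (ker0 lam \<epsilon> z) \<le> 1 / norm z" using norm_ker0_le[of z \<epsilon> lam] assms i by simp
  also have "\<dots> \<le> 1 * sing z" by (simp add: sing_def)
  also have "\<dots> \<le> (1 + \<bar>lam\<bar>) * sing z" by (intro mult_right_mono sing_nonneg) auto
  finally show "norm (ker0 lam \<epsilon> z) \<le> (1 + \<bar>lam\<bar>) * sing z" .
  have "norm (ker1 lam \<epsilon> j z) \<le> \<bar>lam\<bar> * (1 / rad \<epsilon> z) + 1 / (rad \<epsilon> z)\<^sup>2" using norm_ker1_le[of z \<epsilon> lam j] assms by simp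
  also have "\<dots> \<le> \<bar>lam\<bar> * (1 / norm z) + 1 / (norm z)\<^sup>2" by (intro add_mono mult_left_mono i i2) auto
  also have "\<dots> \<le> \<bar>lam\<bar> * (1 / norm z) + 1 / (norm z)\<^sup>2 + (1 / norm z + \<bar>lam\<bar> * (1 / (norm z)\<^sup>2))" by simp
  also have "\<dots> = (1 + \<bar>lam\<bar>) * sing z"
  proof -
    have "l * a + b + (a + l * b) = (1 + l) * (a + b)" for a b l :: real by (simp add: algebra_simps)
    then show ?thesis unfolding sing_def .
  qed
  finally show "norm (ker1 lam \<epsilon> j z) \<le> (1 + \<bar>lam\<bar>) * sing z" .
qed

text \<open>The distance \<open>J\<close> between the partial derivatives does not depend on the
  point of the ball, so they converge uniformly, and limit and derivative may be exchanged. A share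
  e/3 for each of the three components adds up to e.\<close>

lemma has_derivative_limit:
  fixes F :: "nat \<Rightarrow> real^3 \<Rightarrow> complex" and q :: "nat \<Rightarrow> 3 \<Rightarrow> real^3 \<Rightarrow> complex"
  assumes d: "\<And>n x. x \<in> ball x0 1 \<Longrightarrow> (F n has_derivative (\<lambda>h. \<Sum>j\<in>UNIV. h $ j *\<^sub>R q n j x)) (at x)"
    and J: "\<And>n j x. x \<in> ball x0 1 \<Longrightarrow> norm (q n j x - Q j x) \<le> J n j" "\<And>j. (\<lambda>n. J n j) \<longlonglongrightarrow> 0"
    and P: "\<And>x. x \<in> ball x0 1 \<Longrightarrow> (\<lambda>n. F n x) \<longlonglongrightarrow> P x"
  shows "(P has_derivative (\<lambda>h. \<Sum>j\<in>UNIV. h $ j *\<^sub>R Q j x0)) (at x0)"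
proof -
  define D where "D n x h = (\<Sum>j\<in>UNIV. h $ j *\<^sub>R q n j x)" for n x and h :: "real^3"
  define D0 where "D0 x h = (\<Sum>j\<in>UNIV. h $ j *\<^sub>R Q j x)" for x and h :: "real^3"
  have x0: "x0 \<in> ball x0 1" by simp
  have ev: "\<forall>\<^sub>F n in sequentially. \<forall>x\<in>ball x0 1. \<forall>h. norm (D n x h - D0 x h) \<le> e * norm h" if e: "e > 0" for e
  proof -
    have "\<forall>\<^sub>F n in sequentially. \<forall>j\<in>UNIV. J n j < e / 3"
      by (intro eventually_ball_finite ballI order_tendstoD(2)[OF J(2)]) (use e in auto)
    then show ?thesis
    proof eventually_elim
      case (elim n)
      show ?case
      proof (intro ballI allI)
        fix x h assume x: "x \<in> ball x0 1"
        have "norm (q n j x - Q j x) \<le> e / 3" for j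
          using J(1)[OF x, of n j] elim by (meson UNIV_I less_imp_le order_trans)
        then have "norm (\<Sum>j\<in>UNIV. h $ j *\<^sub>R (q n j x - Q j x)) \<le> 3 * (e / 3) * norm h"
          by (rule sum_scaleR_bound)
        then show "norm (D n x h - D0 x h) \<le> e * norm h"
          by (simp add: D_def D0_def sum_subtractf scaleR_diff_right)
      qed
    qed
  qed
  have dD: "(F n has_derivative D n x) (at x within ball x0 1)" if "x \<in> ball x0 1" for n x
    using has_derivative_at_withinI[OF d[OF that]] by (simp add: D_def[abs_def])
  from has_derivative_sequence[OF convex_ball dD ev x0 P[OF x0]]
  obtain g where g: "\<And>x. x \<in> ball x0 1 \<Longrightarrow> (\<lambda>n. F n x) \<longlonglongrightarrow> g x"
    "\<And>x. x \<in> ball x0 1 \<Longrightarrow> (g has_derivative D0 x) (at x within ball x0 1)" by blast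
  have "g x = P x" if "x \<in> ball x0 1" for x using LIMSEQ_unique[OF g(1)[OF that] P[OF that]] .
  moreover have "(g has_derivative D0 x0) (at x0)"
    using g(2)[OF x0] at_within_open[OF x0 open_ball] by simp
  ultimately have "(P has_derivative D0 x0) (at x0)"
    by (intro has_derivative_transform_within_open[of g "D0 x0" x0 UNIV "ball x0 1" P]) auto
  then show ?thesis by (simp add: D0_def[abs_def])
qed

text \<open>\<open>f\<close> stands for a source extended by zero from the exterior; it may jump
  across the boundary, so measurability is asked instead of continuity. Vanishing near 0, where
  \<open>G\<close> contains a ball, turns the power bound into a global bound by a constant.\<close>

locale decaying_density =
  fixes f :: "real^3 \<Rightarrow> complex" and C \<delta> \<rho> :: real
  assumes f [measurable]: "f \<in> borel_measurable borel" and C: "C \<ge> 0" and \<delta>: "\<delta> > 0" and rho: "2 < \<rho>" "\<rho> < 3"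
    and decay: "\<And>y. norm (f y) \<le> C * norm y powr (- \<rho>)" and zero: "\<And>y. norm y < \<delta> \<Longrightarrow> f y = 0"
begin

lemma bounded_f: "norm (f y) \<le> C * \<delta> powr (- \<rho>)"
proof (cases "norm y < \<delta>")
  case False
  then have "norm y powr (- \<rho>) \<le> \<delta> powr (- \<rho>)" using \<delta> rho by (intro powr_mono2') auto
  then show ?thesis using decay[of y] C mult_left_mono[of "norm y powr (- \<rho>)" "\<delta> powr (- \<rho>)" C] by linarith
qed (use C zero in simp)

text \<open>A majorant of \<open>norm (f (x - z))\<close> that is the same for all x with 2 |x|
  \<le> Z: beyond radius Z the point x - z has norm at least |z|/2, and within it the global bound
  of \<open>f\<close> is taken.\<close>

definition env :: "real \<Rightarrow> real^3 \<Rightarrow> real" where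
  "env Z z = (if norm z \<le> Z then C * \<delta> powr (- \<rho>) else C * (norm z / 2) powr (- \<rho>))"

lemma env_nonneg: "0 \<le> env Z z" using C by (simp add: env_def)

lemma f_le_env: assumes "2 * norm x \<le> Z" shows "norm (f (x - z)) \<le> env Z z"
proof (cases "norm z \<le> Z")
  case True
  then show ?thesis using bounded_f by (simp add: env_def)
next
  case False
  have "norm z - norm x \<le> norm (x - z)" using norm_triangle_ineq2[of z x] by (simp add: norm_minus_commute)
  then have n2: "norm z / 2 \<le> norm (x - z)" using False assms by linarith
  have "norm (x - z) powr (- \<rho>) \<le> (norm z / 2) powr (- \<rho>)"
  proof (rule powr_mono2')
    show "0 < norm z / 2" using False norm_ge_zero[of x] assms by linarith
  qed (use rho n2 in auto)
  then show ?thesis using False decay[of "x - z"] C mult_left_mono[of "norm (x - z) powr (- \<rho>)" "(norm z / 2) powr (- \<rho>)" C]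
    by (simp add: env_def)
qed

lemma integrable_sing_env:
  assumes Z: "Z > 0" shows "integrable lborel (\<lambda>z. sing z * env Z z)"
proof -
  have "sing z * env Z z = C * \<delta> powr (- \<rho>) * (norm z powr (- 1) * indicator (cball 0 Z) z)
      + C * \<delta> powr (- \<rho>) * (norm z powr (- 2) * indicator (cball 0 Z) z)
      + C * 2 powr \<rho> * (norm z powr (- (1 + \<rho>)) * indicator (- cball 0 Z) z)
      + C * 2 powr \<rho> * (norm z powr (- (2 + \<rho>)) * indicator (- cball 0 Z) z)" for z
  proof (cases "norm z \<le> Z")
    case True
    then have i: "indicator (cball 0 Z) z = (1::real)" "indicator (- cball 0 Z) z = (0::real)" by auto
    have "(p + q) * c = c * (p * 1) + c * (q * 1) + d * (p' * 0) + d * (q' * 0)" for p q p' q' c d :: real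
      by (simp add: algebra_simps)
    note g = this
    have e: "env Z z = C * \<delta> powr (- \<rho>)" using True by (simp only: env_def if_True)
    show ?thesis unfolding i sing_powr e by (rule g)
  next
    case False
    then have i: "indicator (cball 0 Z) z = (0::real)" "indicator (- cball 0 Z) z = (1::real)" by auto
    have h: "(norm z / 2) powr (- \<rho>) = 2 powr \<rho> * norm z powr (- \<rho>)"
      using powr_divide[of "norm z" 2 "- \<rho>"] powr_minus[of 2 \<rho>] by (simp add: field_simps)
    have "norm z powr (- 1 + - \<rho>) = norm z powr (- 1) * norm z powr (- \<rho>)"
      "norm z powr (- 2 + - \<rho>) = norm z powr (- 2) * norm z powr (- \<rho>)"
      by (rule powr_add)+
    moreover have "- 1 + - \<rho> = - (1 + \<rho>)" "- 2 + - \<rho> = - (2 + \<rho>)" by auto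
    ultimately have e: "norm z powr (- (1 + \<rho>)) = norm z powr (- 1) * norm z powr (- \<rho>)"
      "norm z powr (- (2 + \<rho>)) = norm z powr (- 2) * norm z powr (- \<rho>)"
      by metis+
    have "(p + q) * (C * (t * u)) = d * (p' * 0) + d * (q' * 0) + C * t * (p * u * 1) + C * t * (q * u * 1)" for p q p' q' d t u :: real
      by (simp add: algebra_simps)
    note g = this
    have e': "env Z z = C * (2 powr \<rho> * norm z powr (- \<rho>))" using False by (simp only: env_def if_False h)
    show ?thesis unfolding i e sing_powr e' by (rule g)
  qed
  moreover have "integrable lborel (\<lambda>z. C * \<delta> powr (- \<rho>) * (norm z powr (- 1) * indicator (cball 0 Z) z)
      + C * \<delta> powr (- \<rho>) * (norm z powr (- 2) * indicator (cball 0 Z) z)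
      + C * 2 powr \<rho> * (norm z powr (- (1 + \<rho>)) * indicator (- cball 0 Z) z)
      + C * 2 powr \<rho> * (norm z powr (- (2 + \<rho>)) * indicator (- cball (0::real^3) Z) z))"
    using rho Z by (intro Bochner_Integration.integrable_add integrable_mult_right integrable_powr_ball integrable_powr_outside) auto
  ultimately show ?thesis by simp
qed

lemma integrable_kernel:
  fixes \<kappa> :: "real^3 \<Rightarrow> complex"
  assumes [measurable]: "\<kappa> \<in> borel_measurable borel" and k: "\<And>z. z \<noteq> 0 \<Longrightarrow> norm (\<kappa> z) \<le> c * sing z"
  shows "integrable lborel (\<lambda>y. \<kappa> (x - y) * f y)"
proof -
  define Z where "Z = 2 * norm x + 1"
  have Z: "Z > 0" "2 * norm x \<le> Z" using norm_ge_zero[of x] by (simp_all add: Z_def add_nonneg_pos)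
  have "integrable lborel (\<lambda>z. c * (sing z * env Z z))" using integrable_sing_env[OF Z(1)] by simp
  from integrable_reflect[OF this, of x] show ?thesis
  proof (rule Bochner_Integration.integrable_bound)
    show "AE y in lborel. norm (\<kappa> (x - y) * f y) \<le> norm (c * (sing (x - y) * env Z (x - y)))"
      using AE_lborel_singleton[of x]
    proof eventually_elim
      case (elim y)
      have "norm (\<kappa> (x - y)) * norm (f y) \<le> (c * sing (x - y)) * env Z (x - y)"
        using k[of "x - y"] elim f_le_env[OF Z(2), of "x - y"] by (intro mult_mono) (auto intro: order_trans[OF norm_ge_zero k])
      then have "norm (\<kappa> (x - y) * f y) \<le> c * (sing (x - y) * env Z (x - y))" by (simp add: norm_mult mult.assoc)
      then show ?case by (rule order_trans) simp
    qed
  qed simp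
qed

text \<open>For fixed positive \<epsilon> the gradient kernel is bounded and decays like 1/|y|, so
  one majorant \<open>w\<close> serves all x in the unit ball around \<open>x0\<close>.\<close>

lemma regularised_derivative:
  assumes \<epsilon>: "\<epsilon> > 0"
  shows "((\<lambda>x. \<integral>y. ker0 lam \<epsilon> (x - y) * f y \<partial>lborel) has_derivative
    (\<lambda>h. \<Sum>j\<in>UNIV. h $ j *\<^sub>R (\<integral>y. ker1 lam \<epsilon> j (x0 - y) * f y \<partial>lborel))) (at x0)"
proof -
  define Z where "Z = 2 * (norm x0 + 1)"
  have Z: "Z > 0" using norm_ge_zero[of x0] by (simp add: Z_def add_nonneg_pos)
  define w where "w y = (\<bar>lam\<bar> / \<epsilon> + 1 / \<epsilon>\<^sup>2) * C * \<delta> powr (- \<rho>) * indicator (cball 0 Z) y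
     + C * 2 * \<bar>lam\<bar> * (norm y powr (- (1 + \<rho>)) * indicator (- cball 0 Z) y)
     + C * 4 * (norm y powr (- (2 + \<rho>)) * indicator (- cball 0 Z) y)" for y :: "real^3"
  have bnd: "norm (ker1 lam \<epsilon> j (x - y)) * norm (f y) \<le> w y" if x: "x \<in> ball x0 1" for x y j
  proof -
    define r where "r = rad \<epsilon> (x - y)"
    have r: "r > 0" "\<epsilon> \<le> r" "norm (x - y) \<le> r"
      using \<epsilon> by (auto simp: r_def rad_pos eps_le_rad norm_le_rad)
    have k: "norm (ker1 lam \<epsilon> j (x - y)) \<le> \<bar>lam\<bar> / r + 1 / r\<^sup>2"
      unfolding r_def using \<epsilon> by (intro norm_ker1_le) simp
    show ?thesis
    proof (cases "norm y \<le> Z")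
      case True
      have "\<bar>lam\<bar> / r + 1 / r\<^sup>2 \<le> \<bar>lam\<bar> / \<epsilon> + 1 / \<epsilon>\<^sup>2"
        using r \<epsilon> by (intro add_mono divide_left_mono power_mono mult_pos_pos) auto
      then have "norm (ker1 lam \<epsilon> j (x - y)) * norm (f y) \<le> (\<bar>lam\<bar> / \<epsilon> + 1 / \<epsilon>\<^sup>2) * (C * \<delta> powr (- \<rho>))"
        using k bounded_f[of y] \<epsilon> by (intro mult_mono add_nonneg_nonneg divide_nonneg_pos) auto
      then show ?thesis using True by (simp add: w_def mult.assoc)
    next
      case False
      have "norm x \<le> norm x0 + 1" using x norm_triangle_ineq2[of x x0] by (simp add: dist_norm norm_minus_commute)
      moreover have "norm y - norm x \<le> norm (x - y)" using norm_triangle_ineq2[of y x] by (simp add: norm_minus_commute)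
      ultimately have r': "norm y / 2 \<le> r" using False r(3) unfolding Z_def by argo
      have yp: "norm y > 0" using False Z by linarith
      have e1: "norm y powr (- (1 + \<rho>)) = norm y powr (- \<rho>) / norm y"
      proof -
        have "- (1 + \<rho>) = - \<rho> - 1" by simp
        then show ?thesis using powr_diff[of "norm y" "- \<rho>" 1] yp by (simp only: powr_one)
      qed
      have e2: "norm y powr (- (2 + \<rho>)) = norm y powr (- \<rho>) / (norm y)\<^sup>2"
      proof -
        have "- (2 + \<rho>) = - \<rho> - 2" by simp
        moreover have "norm y powr 2 = (norm y)\<^sup>2" by simp
        ultimately show ?thesis using powr_diff[of "norm y" "- \<rho>" 2] by (simp only:)
      qed
      have "\<bar>lam\<bar> / r + 1 / r\<^sup>2 \<le> \<bar>lam\<bar> / (norm y / 2) + 1 / (norm y / 2)\<^sup>2"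
        using r' yp r by (intro add_mono divide_left_mono power_mono mult_pos_pos) auto
      then have "norm (ker1 lam \<epsilon> j (x - y)) * norm (f y) \<le> (\<bar>lam\<bar> / (norm y / 2) + 1 / (norm y / 2)\<^sup>2) * (C * norm y powr (- \<rho>))"
        using k decay[of y] by (intro mult_mono) auto
      also have "\<dots> = C * 2 * \<bar>lam\<bar> * norm y powr (- (1 + \<rho>)) + C * 4 * norm y powr (- (2 + \<rho>))"
        unfolding e1 e2 using yp by (simp add: field_simps power2_eq_square)
      also have "\<dots> = w y" using False by (simp add: w_def)
      finally show ?thesis .
    qed
  qed
  have w: "integrable lborel w"
    unfolding w_def using rho Z emeasure_bounded_finite[of "cball (0::real^3) Z"]
    by (intro Bochner_Integration.integrable_add integrable_mult_right integrable_powr_outside integrable_real_indicator) auto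
  show ?thesis
  proof (rule has_derivative_kernel_integral(2)[where \<delta>=1 and w=w])
    show "integrable lborel (\<lambda>y. ker0 lam \<epsilon> (x - y) * f y)" for x
      by (intro integrable_kernel[where c="1 + \<bar>lam\<bar>"] kernel_sing_bounds) auto
  qed (use \<epsilon> bnd w in \<open>auto intro: ker0_deriv\<close>)
qed

text \<open>The singularity of \<open>ker1\<close> at y = x rules out a majorant common to all x
  near \<open>x0\<close>. After the substitution z = x - y it sits at 0 for every x, and
  \<open>env\<close> bounds the density uniformly. Hence the gradients of the regularised potentials
  differ from the claimed one by at most \<open>J n j\<close>, independently of x, and this tends to
  0 by dominated convergence.\<close>

theorem volume_potential_derivative:
  "((\<lambda>x. \<integral>y. ker0 lam 0 (x - y) * f y \<partial>lborel) has_derivative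
    (\<lambda>h. \<Sum>j\<in>UNIV. h $ j *\<^sub>R (\<integral>y. ker1 lam 0 j (x0 - y) * f y \<partial>lborel))) (at x0)"
proof -
  define Z where "Z = 2 * (norm x0 + 1)"
  have Z: "Z > 0" using norm_ge_zero[of x0] by (simp add: Z_def add_nonneg_pos)
  define s where "s n = 1 / real (Suc n)" for n
  have s: "s \<longlonglongrightarrow> 0" "s n > 0" for n unfolding s_def using LIMSEQ_Suc[OF lim_1_over_n[where 'a=real]] by auto
  have ae0: "AE z in lborel. (z::real^3) \<noteq> 0" by (rule AE_lborel_singleton)
  define J where "J n j = (\<integral>z. norm (ker1 lam (s n) j z - ker1 lam 0 j z) * env Z z \<partial>lborel)" for n j
  have env [measurable]: "env Z \<in> borel_measurable borel" unfolding env_def[abs_def] by measurable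
  let ?b = "\<lambda>z. 2 * (1 + \<bar>lam\<bar>) * (sing z * env Z z)"
  have ib: "integrable lborel ?b" using integrable_sing_env[OF Z] by simp
  have dom: "norm (norm (ker1 lam (s n) j z - ker1 lam 0 j z) * env Z z) \<le> ?b z" if "z \<noteq> 0" for n j z
  proof -
    have "norm (ker1 lam (s n) j z - ker1 lam 0 j z) \<le> 2 * (1 + \<bar>lam\<bar>) * sing z"
      using norm_triangle_ineq4[of "ker1 lam (s n) j z" "ker1 lam 0 j z"] kernel_sing_bounds(2)[OF that, of lam "s n" j]
        kernel_sing_bounds(2)[OF that, of lam 0 j] by linarith
    from mult_right_mono[OF this env_nonneg] show ?thesis using env_nonneg by (simp add: mult.assoc)
  qed
  have iJ: "integrable lborel (\<lambda>z. norm (ker1 lam (s n) j z - ker1 lam 0 j z) * env Z z)" for n j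
    by (rule Bochner_Integration.integrable_bound[OF ib])
       (use ae0 dom in \<open>auto elim!: eventually_mono intro: order_trans[OF _ abs_ge_self]\<close>)
  have J0: "(\<lambda>n. J n j) \<longlonglongrightarrow> 0" for j
  proof -
    have "(\<lambda>n. \<integral>z. norm (ker1 lam (s n) j z - ker1 lam 0 j z) * env Z z \<partial>lborel) \<longlonglongrightarrow> (\<integral>z. 0 \<partial>(lborel :: (real^3) measure))"
    proof (rule integral_dominated_convergence[OF _ _ ib])
      show "AE z in lborel. (\<lambda>n. norm (ker1 lam (s n) j z - ker1 lam 0 j z) * env Z z) \<longlonglongrightarrow> 0"
        using ae0
      proof eventually_elim
        case (elim z)
        have "(\<lambda>n. norm (ker1 lam (s n) j z - ker1 lam 0 j z) * env Z z) \<longlonglongrightarrow> norm (ker1 lam 0 j z - ker1 lam 0 j z) * env Z z"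
          by (intro tendsto_intros kernels_tendsto s elim)
        then show ?case by simp
      qed
      show "AE z in lborel. norm (norm (ker1 lam (s n) j z - ker1 lam 0 j z) * env Z z) \<le> ?b z" for n
        using ae0 by (rule eventually_mono) (rule dom)
    qed simp_all
    then show ?thesis by (simp add: J_def)
  qed
  let ?Q = "\<lambda>\<epsilon> j x. \<integral>y. ker1 lam \<epsilon> j (x - y) * f y \<partial>lborel"
  have i1: "integrable lborel (\<lambda>y. ker1 lam \<epsilon> j (x - y) * f y)" for \<epsilon> j x
    by (intro integrable_kernel[where c="1 + \<bar>lam\<bar>"] kernel_sing_bounds) auto
  have Qdiff: "norm (?Q (s n) j x - ?Q 0 j x) \<le> J n j" if x: "x \<in> ball x0 1" for n j x
  proof -
    have "norm x \<le> norm x0 + 1" using x norm_triangle_ineq2[of x x0] by (simp add: dist_norm norm_minus_commute)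
    then have xZ: "2 * norm x \<le> Z" by (simp add: Z_def)
    have "norm (?Q (s n) j x - ?Q 0 j x) = norm (\<integral>y. (ker1 lam (s n) j (x - y) - ker1 lam 0 j (x - y)) * f y \<partial>lborel)"
      using i1 by (simp add: left_diff_distrib)
    also have "\<dots> \<le> (\<integral>y. norm (ker1 lam (s n) j (x - y) - ker1 lam 0 j (x - y)) * env Z (x - y) \<partial>lborel)"
    proof (rule order_trans[OF integral_norm_bound integral_mono])
      show "integrable lborel (\<lambda>y. norm ((ker1 lam (s n) j (x - y) - ker1 lam 0 j (x - y)) * f y))"
        using i1 by (simp add: left_diff_distrib)
      show "integrable lborel (\<lambda>y. norm (ker1 lam (s n) j (x - y) - ker1 lam 0 j (x - y)) * env Z (x - y))"
        by (rule integrable_reflect[OF iJ])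
      show "norm ((ker1 lam (s n) j (x - y) - ker1 lam 0 j (x - y)) * f y) \<le> norm (ker1 lam (s n) j (x - y) - ker1 lam 0 j (x - y)) * env Z (x - y)" for y
        unfolding norm_mult using f_le_env[OF xZ, of "x - y"] by (intro mult_left_mono) auto
    qed
    also have "\<dots> = J n j" unfolding J_def
      by (rule integral_reflect[of "\<lambda>z. norm (ker1 lam (s n) j z - ker1 lam 0 j z) * env Z z"]) measurable
    finally show ?thesis .
  qed
  let ?P = "\<lambda>\<epsilon> x. \<integral>y. ker0 lam \<epsilon> (x - y) * f y \<partial>lborel"
  have Plim: "(\<lambda>n. ?P (s n) x) \<longlonglongrightarrow> ?P 0 x" for x
  proof -
    define Z' where "Z' = 2 * norm x + 1"
    have Z': "Z' > 0" "2 * norm x \<le> Z'" using norm_ge_zero[of x] by (simp_all add: Z'_def add_nonneg_pos)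
    have "integrable lborel (\<lambda>z. (1 + \<bar>lam\<bar>) * (sing z * env Z' z))" using integrable_sing_env[OF Z'(1)] by simp
    from integrable_reflect[OF this, of x] show ?thesis
    proof (rule integral_dominated_convergence[rotated 2])
      show "AE y in lborel. (\<lambda>n. ker0 lam (s n) (x - y) * f y) \<longlonglongrightarrow> ker0 lam 0 (x - y) * f y"
        using AE_lborel_singleton[of x] by eventually_elim (intro tendsto_intros kernels_tendsto s, simp)
      show "AE y in lborel. norm (ker0 lam (s n) (x - y) * f y) \<le> (1 + \<bar>lam\<bar>) * (sing (x - y) * env Z' (x - y))" for n
        using AE_lborel_singleton[of x]
      proof eventually_elim
        case (elim y)
        have "norm (ker0 lam (s n) (x - y)) * norm (f y) \<le> ((1 + \<bar>lam\<bar>) * sing (x - y)) * env Z' (x - y)"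
          using kernel_sing_bounds(1)[of "x - y" lam "s n"] elim f_le_env[OF Z'(2), of "x - y"]
          by (intro mult_mono) (auto intro: mult_nonneg_nonneg sing_nonneg)
        then show ?case by (simp add: norm_mult mult.assoc)
      qed
    qed simp_all
  qed
  show ?thesis
    by (rule has_derivative_limit[where q="\<lambda>n. ?Q (s n)" and J=J and F="\<lambda>n. ?P (s n)"])
       (auto intro: regularised_derivative s Qdiff J0 Plim simp del: mem_ball)
qed

end

text \<open>Stated for an arbitrary Borel measure, so that volume and surface integrals share it.
  The majorant is \<open>sing\<close> times the density, which excludes trouble at x as long as the
  density carries no mass there.\<close>

lemma kernel_limit:
  fixes c :: "real^3 \<Rightarrow> complex"
  assumes M: "sets M = sets borel" and c: "c \<in> borel_measurable borel"
    and i: "integrable M (\<lambda>y. sing (x - y) * norm (c y))" and x: "AE y in M. c y \<noteq> 0 \<longrightarrow> y \<noteq> x"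
  shows "integrable M (\<lambda>y. ker0 lam \<epsilon> (x - y) * c y)" "integrable M (\<lambda>y. ker1 lam \<epsilon> j (x - y) * c y)"
    "s \<longlonglongrightarrow> 0 \<Longrightarrow> (\<lambda>n. \<integral>y. ker0 lam (s n) (x - y) * c y \<partial>M) \<longlonglongrightarrow> (\<integral>y. ker0 lam 0 (x - y) * c y \<partial>M)"
    "s \<longlonglongrightarrow> 0 \<Longrightarrow> (\<lambda>n. \<integral>y. ker1 lam (s n) j (x - y) * c y \<partial>M) \<longlonglongrightarrow> (\<integral>y. ker1 lam 0 j (x - y) * c y \<partial>M)"
proof -
  note [measurable_cong] = M
  note [measurable] = c
  let ?w = "\<lambda>y. (1 + \<bar>lam\<bar>) * (sing (x - y) * norm (c y))"
  have iw: "integrable M ?w" using i by simp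
  have b0: "AE y in M. norm (ker0 lam \<epsilon> (x - y) * c y) \<le> ?w y" for \<epsilon>
    using x
  proof eventually_elim
    case (elim y)
    show ?case
    proof (cases "c y = 0")
      case False
      then have "norm (ker0 lam \<epsilon> (x - y)) \<le> (1 + \<bar>lam\<bar>) * sing (x - y)" using elim by (intro kernel_sing_bounds) auto
      from mult_right_mono[OF this, of "norm (c y)"] show ?thesis by (simp add: norm_mult mult.assoc)
    qed simp
  qed
  have b1: "AE y in M. norm (ker1 lam \<epsilon> j (x - y) * c y) \<le> ?w y" for \<epsilon>
    using x
  proof eventually_elim
    case (elim y)
    show ?case
    proof (cases "c y = 0")
      case False
      then have "norm (ker1 lam \<epsilon> j (x - y)) \<le> (1 + \<bar>lam\<bar>) * sing (x - y)" using elim by (intro kernel_sing_bounds) auto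
      from mult_right_mono[OF this, of "norm (c y)"] show ?thesis by (simp add: norm_mult mult.assoc)
    qed simp
  qed
  show "integrable M (\<lambda>y. ker0 lam \<epsilon> (x - y) * c y)"
  proof (rule Bochner_Integration.integrable_bound[OF iw])
    show "AE y in M. norm (ker0 lam \<epsilon> (x - y) * c y) \<le> norm (?w y)"
      using b0[of \<epsilon>] by (rule eventually_mono) (erule order_trans, simp only: real_norm_def abs_ge_self)
  qed measurable
  show "integrable M (\<lambda>y. ker1 lam \<epsilon> j (x - y) * c y)"
  proof (rule Bochner_Integration.integrable_bound[OF iw])
    show "AE y in M. norm (ker1 lam \<epsilon> j (x - y) * c y) \<le> norm (?w y)"
      using b1[of \<epsilon>] by (rule eventually_mono) (erule order_trans, simp only: real_norm_def abs_ge_self)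
  qed measurable
  assume s: "s \<longlonglongrightarrow> 0"
  show "(\<lambda>n. \<integral>y. ker0 lam (s n) (x - y) * c y \<partial>M) \<longlonglongrightarrow> (\<integral>y. ker0 lam 0 (x - y) * c y \<partial>M)"
  proof (rule integral_dominated_convergence[OF _ _ iw _ b0])
    show "AE y in M. (\<lambda>n. ker0 lam (s n) (x - y) * c y) \<longlonglongrightarrow> ker0 lam 0 (x - y) * c y"
      using x
    proof eventually_elim
      case (elim y)
      then show ?case using kernels_tendsto(1)[OF s, of "x - y" lam] by (cases "c y = 0") (auto intro: tendsto_mult)
    qed
  qed measurable
  show "(\<lambda>n. \<integral>y. ker1 lam (s n) j (x - y) * c y \<partial>M) \<longlonglongrightarrow> (\<integral>y. ker1 lam 0 j (x - y) * c y \<partial>M)"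
  proof (rule integral_dominated_convergence[OF _ _ iw _ b1])
    show "AE y in M. (\<lambda>n. ker1 lam (s n) j (x - y) * c y) \<longlonglongrightarrow> ker1 lam 0 j (x - y) * c y"
      using x
    proof eventually_elim
      case (elim y)
      then show ?case using kernels_tendsto(2)[OF s, of "x - y" lam j] by (cases "c y = 0") (auto intro: tendsto_mult)
    qed
  qed measurable
qed

lemma integrable_sing_compact:
  fixes c :: "real^3 \<Rightarrow> complex"
  assumes c [measurable]: "c \<in> borel_measurable borel" and B: "\<And>y. norm (c y) \<le> B" and L: "\<And>y. norm y > L \<Longrightarrow> c y = 0"
  shows "integrable lborel (\<lambda>y. sing (x - y) * norm (c y))"
proof -
  let ?g = "\<lambda>z::real^3. B * (norm z powr (- 1) * indicator (cball 0 (L + norm x)) z + norm z powr (- 2) * indicator (cball 0 (L + norm x)) z)"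
  have B0: "0 \<le> B" using order_trans[OF norm_ge_zero B] .
  have i: "integrable lborel (\<lambda>z::real^3. norm z powr (- 1) * indicator (cball 0 (L + norm x)) z)"
    "integrable lborel (\<lambda>z::real^3. norm z powr (- 2) * indicator (cball 0 (L + norm x)) z)"
    by (rule integrable_powr_ball, simp)+
  have "integrable lborel ?g" by (intro integrable_mult_right Bochner_Integration.integrable_add i)
  from integrable_reflect[OF this, of x] show ?thesis
  proof (rule Bochner_Integration.integrable_bound)
    show "AE y in lborel. norm (sing (x - y) * norm (c y)) \<le> norm (?g (x - y))"
    proof (rule AE_I2)
      fix y
      show "norm (sing (x - y) * norm (c y)) \<le> norm (?g (x - y))"
      proof (cases "norm y \<le> L")
        case True
        have "norm (x - y) \<le> L + norm x" using norm_triangle_ineq4[of x y] True by linarith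
        then have "?g (x - y) = B * sing (x - y)" by (simp only: mem_cball_0 indicator_simps sing_powr mult_1_right)
        moreover have "sing (x - y) * norm (c y) \<le> B * sing (x - y)"
          by (subst mult.commute[of B]) (intro mult_left_mono B sing_nonneg)
        ultimately have le: "sing (x - y) * norm (c y) \<le> ?g (x - y)" by linarith
        have nn: "0 \<le> sing (x - y) * norm (c y)" by (intro mult_nonneg_nonneg sing_nonneg norm_ge_zero)
        show ?thesis unfolding real_norm_def abs_of_nonneg[OF nn] by (rule order_trans[OF le abs_ge_self])
      qed (use L in simp)
    qed
  qed simp
qed

section \<open>The regularised Laplacian as an approximate identity\<close>

lemma integral_affine3:
  fixes g :: "real^3 \<Rightarrow> complex"
  assumes [measurable]: "g \<in> borel_measurable borel" and e: "e > 0"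
  shows "(\<integral>y. g y \<partial>lborel) = (\<integral>w. complex_of_real (e ^ 3) * g (x - e *\<^sub>R w) \<partial>lborel)"
proof -
  have "(\<integral>y. g y \<partial>lborel) = (\<integral>y. g y \<partial>density (distr lborel borel (\<lambda>w. x + (- e) *\<^sub>R w)) (\<lambda>_. ennreal (\<bar>- e\<bar> ^ DIM(real^3))))"
    using e by (subst lborel_affine[of "- e" x]) (auto simp: ennreal_power)
  also have "\<dots> = (\<integral>y. (\<bar>- e\<bar> ^ DIM(real^3)) *\<^sub>R g y \<partial>distr lborel borel (\<lambda>w. x + (- e) *\<^sub>R w))"
    using e by (intro integral_density) auto
  also have "\<dots> = (\<integral>w. (\<bar>- e\<bar> ^ DIM(real^3)) *\<^sub>R g (x + (- e) *\<^sub>R w) \<partial>lborel)"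
    by (intro integral_distr) auto
  finally show ?thesis using e by (simp add: scaleR_conv_of_real)
qed

definition poisson :: "real^3 \<Rightarrow> real" where "poisson w = 3 / (4 * pi * sqrt (1 + (norm w)\<^sup>2) ^ 5)"

lemma poisson: "integrable lborel poisson" "(\<integral>w. poisson w \<partial>lborel) = 1" "0 \<le> poisson w"
proof -
  have m: "poisson \<in> borel_measurable borel" unfolding poisson_def[abs_def] by measurable
  have p: "0 \<le> poisson w" for w by (auto simp: poisson_def)
  then show "0 \<le> poisson w" .
  have n: "(\<integral>\<^sup>+w. ennreal (poisson w) \<partial>lborel) = 1" unfolding poisson_def by (rule nn_integral_poisson_kernel)
  show i: "integrable lborel poisson" by (rule integrableI_nonneg) (use m p n in auto)
  have "ennreal (\<integral>w. poisson w \<partial>lborel) = 1" using nn_integral_eq_integral[OF i] p n by simp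
  then show "(\<integral>w. poisson w \<partial>lborel) = 1" using p integral_nonneg_AE[of poisson lborel] by (simp flip: ennreal_1)
qed

text \<open>\<open>main\<close> comes from the term 3/r^5 of \<open>radial2\<close>. The
  substitution y = x - \<epsilon> w turns it into the fixed profile \<open>poisson\<close> of mass
  1, times a phase that tends to 1, against \<open>U (x - \<epsilon> w)\<close>. \<open>rest\<close>
  collects the other two terms; it is dominated by a multiple of \<open>sing\<close> uniformly in
  \<epsilon> and tends to 0 away from x. Continuity of \<open>U\<close> enters at x alone, so
  \<open>U\<close> may jump at the boundary.\<close>

lemma approximate_identity:
  fixes U :: "real^3 \<Rightarrow> complex"
  assumes U [measurable]: "U \<in> borel_measurable borel" and B: "\<And>y. norm (U y) \<le> B" and L: "\<And>y. norm y > L \<Longrightarrow> U y = 0"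
    and x: "isCont U x" and s: "s \<longlonglongrightarrow> 0" "\<And>n. s n > 0"
  shows "(\<lambda>n. \<integral>y. of_real ((s n)\<^sup>2) * radial2 lam (of_real (rad (s n) (x - y))) * U y \<partial>lborel) \<longlonglongrightarrow> U x"
proof -
  let ?E = "\<lambda>r. exp (\<i> * complex_of_real lam * complex_of_real r)"
  have B0: "0 \<le> B" using order_trans[OF norm_ge_zero B] .
  have mr [measurable]: "rad \<epsilon> \<in> borel_measurable borel" for \<epsilon> by (intro borel_measurable_continuous_onI continuous_on_rad)
  define main where "main \<epsilon> z = complex_of_real (3 * \<epsilon>\<^sup>2 / (4 * pi * rad \<epsilon> z ^ 5)) * ?E (rad \<epsilon> z)" for \<epsilon> z
  define rest where "rest \<epsilon> z = complex_of_real (\<epsilon>\<^sup>2) * (3 * \<i> * of_real lam / of_real (rad \<epsilon> z) ^ 4 + of_real (lam\<^sup>2) / of_real (rad \<epsilon> z) ^ 3) * (?E (rad \<epsilon> z) / of_real (4 * pi))" for \<epsilon> z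
  have split: "of_real (\<epsilon>\<^sup>2) * radial2 lam (of_real (rad \<epsilon> z)) = main \<epsilon> z - rest \<epsilon> z" if "\<epsilon> > 0" for \<epsilon> z
    by (simp add: radial2_def main_def rest_def algebra_simps)
  have [measurable]: "main \<epsilon> \<in> borel_measurable borel" "rest \<epsilon> \<in> borel_measurable borel" for \<epsilon>
    unfolding main_def[abs_def] rest_def[abs_def] by measurable
  have rest_le: "norm (rest \<epsilon> z) \<le> (3 * \<bar>lam\<bar> + lam\<^sup>2) * sing z" if e: "\<epsilon> > 0" and z: "z \<noteq> 0" for \<epsilon> z
  proof -
    define r where "r = rad \<epsilon> z"
    have r: "r > 0" "\<epsilon> \<le> r" "norm z \<le> r" using e by (auto simp: r_def rad_pos eps_le_rad norm_le_rad)
    have nz: "norm z > 0" using z by simp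
    have "norm (rest \<epsilon> z) \<le> \<epsilon>\<^sup>2 * (3 * \<bar>lam\<bar> / r ^ 4 + lam\<^sup>2 / r ^ 3) * 1"
      unfolding rest_def norm_mult
    proof (intro mult_mono)
      show "norm (3 * \<i> * of_real lam / complex_of_real (rad \<epsilon> z) ^ 4 + of_real (lam\<^sup>2) / of_real (rad \<epsilon> z) ^ 3) \<le> 3 * \<bar>lam\<bar> / r ^ 4 + lam\<^sup>2 / r ^ 3"
        by (rule order_trans[OF norm_triangle_ineq]) (use r in \<open>simp add: norm_divide norm_mult norm_power r_def\<close>)
      show "norm (?E (rad \<epsilon> z) / of_real (4 * pi)) \<le> 1" using four_pi by (simp add: norm_divide)
    qed (use r in \<open>auto simp: norm_power\<close>)
    \<comment> \<open>Since \<epsilon> \<le> r, the factor \<epsilon>^2 is traded for two powers of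
      r, and what is left is no more singular than \<open>sing\<close>.\<close>
    also have "\<dots> \<le> r\<^sup>2 * (3 * \<bar>lam\<bar> / r ^ 4 + lam\<^sup>2 / r ^ 3) * 1"
      using r e by (intro mult_right_mono power_mono) auto
    also have "\<dots> = 3 * \<bar>lam\<bar> * (1 / r\<^sup>2) + lam\<^sup>2 * (1 / r)" using r by (simp add: field_simps power_numeral_reduce)
    also have "\<dots> \<le> 3 * \<bar>lam\<bar> * (1 / (norm z)\<^sup>2) + lam\<^sup>2 * (1 / norm z)"
      using r nz by (intro add_mono mult_left_mono frac_le power_mono) auto
    also have "\<dots> \<le> 3 * \<bar>lam\<bar> * (1 / (norm z)\<^sup>2) + lam\<^sup>2 * (1 / norm z) + (3 * \<bar>lam\<bar> * (1 / norm z) + lam\<^sup>2 * (1 / (norm z)\<^sup>2))" by simp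
    also have "\<dots> = (3 * \<bar>lam\<bar> + lam\<^sup>2) * sing z"
    proof -
      have "p * b + q * a + (p * a + q * b) = (p + q) * (a + b)" for p q a b :: real by (simp add: algebra_simps)
      then show ?thesis unfolding sing_def .
    qed
    finally show ?thesis .
  qed
  have isc: "integrable lborel (\<lambda>y. (3 * \<bar>lam\<bar> + lam\<^sup>2) * (sing (x - y) * norm (U y)))"
    using integrable_sing_compact[OF U B L, where x=x] by simp
  have rbound: "AE y in lborel. norm (rest (s n) (x - y) * U y) \<le> (3 * \<bar>lam\<bar> + lam\<^sup>2) * (sing (x - y) * norm (U y))" for n
    using AE_lborel_singleton[of x]
  proof eventually_elim
    case (elim y)
    then show ?case using mult_right_mono[OF rest_le[OF s(2), of "x - y" n], of "norm (U y)"] by (simp add: norm_mult mult.assoc)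
  qed
  have irest: "integrable lborel (\<lambda>y. rest (s n) (x - y) * U y)" for n
    by (rule Bochner_Integration.integrable_bound[OF isc])
       (simp, rule eventually_mono[OF rbound], erule order_trans, simp only: real_norm_def abs_ge_self)
  have lrest: "(\<lambda>n. \<integral>y. rest (s n) (x - y) * U y \<partial>lborel) \<longlonglongrightarrow> 0"
  proof -
    have "(\<lambda>n. \<integral>y. rest (s n) (x - y) * U y \<partial>lborel) \<longlonglongrightarrow> (\<integral>y. 0 \<partial>(lborel :: (real^3) measure))"
    proof (rule integral_dominated_convergence[OF _ _ isc _ rbound])
      show "AE y in lborel. (\<lambda>n. rest (s n) (x - y) * U y) \<longlonglongrightarrow> 0"
        using AE_lborel_singleton[of x]
      proof eventually_elim
        case (elim y)
        then have nz: "norm (x - y) \<noteq> 0" by simp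
        have "(\<lambda>n. rest (s n) (x - y) * U y) \<longlonglongrightarrow> complex_of_real (0\<^sup>2) * (3 * \<i> * of_real lam / of_real (norm (x - y)) ^ 4 + of_real (lam\<^sup>2) / of_real (norm (x - y)) ^ 3) * (?E (norm (x - y)) / of_real (4 * pi)) * U y"
          unfolding rest_def by (intro tendsto_intros rad_tendsto s; use nz in simp)
        then show ?case by simp
      qed
    qed measurable
    then show ?thesis by simp
  qed
  have imain: "integrable lborel (\<lambda>y. main (s n) (x - y) * U y)" for n
  proof (rule integrableI_bounded_set[where A="cball 0 L" and B="3 * (s n)\<^sup>2 / (4 * pi * s n ^ 5) * B"])
    show "AE y in lborel. y \<in> cball 0 L \<longrightarrow> norm (main (s n) (x - y) * U y) \<le> 3 * (s n)\<^sup>2 / (4 * pi * s n ^ 5) * B"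
    proof (intro AE_I2 impI)
      fix y
      have r: "0 < rad (s n) (x - y)" "s n \<le> rad (s n) (x - y)" using s(2)[of n] by (auto simp: rad_pos eps_le_rad less_imp_le)
      have "norm (main (s n) (x - y)) = 3 * (s n)\<^sup>2 / (4 * pi * rad (s n) (x - y) ^ 5)"
        using r by (simp add: main_def norm_mult del: of_real_divide of_real_mult of_real_power)
      also have "\<dots> \<le> 3 * (s n)\<^sup>2 / (4 * pi * s n ^ 5)"
        using r s(2)[of n] by (intro divide_left_mono mult_left_mono power_mono mult_pos_pos) auto
      finally show "norm (main (s n) (x - y) * U y) \<le> 3 * (s n)\<^sup>2 / (4 * pi * s n ^ 5) * B"
        unfolding norm_mult using B[of y] s(2)[of n] by (intro mult_mono) auto
    qed
    show "emeasure lborel (cball (0::real^3) L) < \<infinity>" by (intro emeasure_bounded_finite) auto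
    show "AE y in lborel. y \<notin> cball 0 L \<longrightarrow> main (s n) (x - y) * U y = 0" using L by auto
  qed simp_all
  have lmain: "(\<lambda>n. \<integral>y. main (s n) (x - y) * U y \<partial>lborel) \<longlonglongrightarrow> U x"
  proof -
    have eq: "(\<integral>y. main (s n) (x - y) * U y \<partial>lborel) = (\<integral>w. complex_of_real (poisson w) * ?E (s n * sqrt (1 + (norm w)\<^sup>2)) * U (x - s n *\<^sub>R w) \<partial>lborel)" for n
    proof -
      have "(\<integral>y. main (s n) (x - y) * U y \<partial>lborel) = (\<integral>w. complex_of_real (s n ^ 3) * (main (s n) (x - (x - s n *\<^sub>R w)) * U (x - s n *\<^sub>R w)) \<partial>lborel)"
        by (rule integral_affine3) (use s in auto)
      also have "\<dots> = (\<integral>w. complex_of_real (poisson w) * ?E (s n * sqrt (1 + (norm w)\<^sup>2)) * U (x - s n *\<^sub>R w) \<partial>lborel)"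
      proof (rule Bochner_Integration.integral_cong[OF refl])
        fix w :: "real^3"
        have rw: "rad (s n) (s n *\<^sub>R w) = s n * sqrt (1 + (norm w)\<^sup>2)"
        proof -
          have "(norm (s n *\<^sub>R w))\<^sup>2 + (s n)\<^sup>2 = (s n)\<^sup>2 * (1 + (norm w)\<^sup>2)" using s(2)[of n] by (simp add: power_mult_distrib algebra_simps)
          then show ?thesis using s(2)[of n] by (simp add: rad_def real_sqrt_mult)
        qed
        have sq: "sqrt (1 + (norm w)\<^sup>2) > 0" by (simp add: add_pos_nonneg)
        have "s n ^ 3 * (3 * (s n)\<^sup>2 / (4 * pi * (s n * sqrt (1 + (norm w)\<^sup>2)) ^ 5)) = poisson w"
        proof -
          have "a ^ 3 * (3 * a\<^sup>2 / (4 * pi * (a * q) ^ 5)) = 3 / (4 * pi * q ^ 5)" if "a > 0" "q > 0" for a q :: real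
            using that by (simp add: field_simps power_numeral_reduce)
          from this[OF s(2) sq] show ?thesis by (simp only: poisson_def)
        qed
        then have "complex_of_real (s n ^ 3) * complex_of_real (3 * (s n)\<^sup>2 / (4 * pi * (s n * sqrt (1 + (norm w)\<^sup>2)) ^ 5)) = complex_of_real (poisson w)"
          by (simp only: of_real_mult[symmetric])
        then show "complex_of_real (s n ^ 3) * (main (s n) (x - (x - s n *\<^sub>R w)) * U (x - s n *\<^sub>R w)) = complex_of_real (poisson w) * ?E (s n * sqrt (1 + (norm w)\<^sup>2)) * U (x - s n *\<^sub>R w)"
          unfolding main_def by (simp only: rw diff_diff_eq2 add_diff_cancel_left' mult.assoc[symmetric])
      qed
      finally show ?thesis .
    qed
    have pm [measurable]: "poisson \<in> borel_measurable borel" unfolding poisson_def[abs_def] by measurable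
    have "(\<lambda>n. \<integral>w. complex_of_real (poisson w) * ?E (s n * sqrt (1 + (norm w)\<^sup>2)) * U (x - s n *\<^sub>R w) \<partial>lborel)
      \<longlonglongrightarrow> (\<integral>w. complex_of_real (poisson w) * U x \<partial>lborel)"
    proof (rule integral_dominated_convergence[where w="\<lambda>w. B * poisson w"])
      show "integrable lborel (\<lambda>w. B * poisson w)" using poisson(1) by simp
      show "AE w in lborel. norm (complex_of_real (poisson w) * ?E (s n * sqrt (1 + (norm w)\<^sup>2)) * U (x - s n *\<^sub>R w)) \<le> B * poisson w" for n
      proof (rule AE_I2)
        fix w :: "real^3"
        have "norm (complex_of_real (poisson w) * ?E (s n * sqrt (1 + (norm w)\<^sup>2)) * U (x - s n *\<^sub>R w)) = poisson w * norm (U (x - s n *\<^sub>R w))"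
          unfolding norm_mult norm_exp_real using poisson(3)[of w] by simp
        also have "\<dots> \<le> poisson w * B" by (intro mult_left_mono B poisson)
        finally show "norm (complex_of_real (poisson w) * ?E (s n * sqrt (1 + (norm w)\<^sup>2)) * U (x - s n *\<^sub>R w)) \<le> B * poisson w"
          by (simp add: mult.commute)
      qed
      show "AE w in lborel. (\<lambda>n. complex_of_real (poisson w) * ?E (s n * sqrt (1 + (norm w)\<^sup>2)) * U (x - s n *\<^sub>R w)) \<longlonglongrightarrow> complex_of_real (poisson w) * U x"
      proof (rule AE_I2)
        fix w :: "real^3"
        have "(\<lambda>n. x - s n *\<^sub>R w) \<longlonglongrightarrow> x - 0 *\<^sub>R w" by (intro tendsto_intros s)
        then have 1: "(\<lambda>n. U (x - s n *\<^sub>R w)) \<longlonglongrightarrow> U x" using isCont_tendsto_compose[OF x] by simp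
        have "(\<lambda>n. ?E (s n * sqrt (1 + (norm w)\<^sup>2))) \<longlonglongrightarrow> ?E (0 * sqrt (1 + (norm w)\<^sup>2))" by (intro tendsto_intros s)
        from tendsto_mult[OF tendsto_mult[OF tendsto_const[of "complex_of_real (poisson w)"] this] 1]
        show "(\<lambda>n. complex_of_real (poisson w) * ?E (s n * sqrt (1 + (norm w)\<^sup>2)) * U (x - s n *\<^sub>R w)) \<longlonglongrightarrow> complex_of_real (poisson w) * U x" by simp
      qed
    qed measurable
    moreover have "(\<integral>w. complex_of_real (poisson w) * U x \<partial>lborel) = U x"
      using poisson(1,2) by simp
    ultimately show ?thesis unfolding eq by (simp only:)
  qed
  have "(\<lambda>n. (\<integral>y. main (s n) (x - y) * U y \<partial>lborel) - (\<integral>y. rest (s n) (x - y) * U y \<partial>lborel)) \<longlonglongrightarrow> U x - 0"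
    by (intro tendsto_diff lmain lrest)
  moreover have "(\<integral>y. main (s n) (x - y) * U y \<partial>lborel) - (\<integral>y. rest (s n) (x - y) * U y \<partial>lborel)
     = (\<integral>y. of_real ((s n)\<^sup>2) * radial2 lam (of_real (rad (s n) (x - y))) * U y \<partial>lborel)" for n
    unfolding split[OF s(2)] left_diff_distrib by (rule Bochner_Integration.integral_diff[symmetric, OF imain irest])
  ultimately show ?thesis by simp
qed

subsection \<open>The identity for the cut-off field\<close>

lemma C1_on_cmult: "C1_on \<Omega> f df \<Longrightarrow> C1_on \<Omega> (\<lambda>x. c * f x) (\<lambda>x. \<chi> j. c * df x $ j)"
  unfolding C1_on_def
  by (auto intro!: continuous_intros derivative_eq_intros simp: sum_distrib_left)

lemma C1_on_ker0:
  assumes "\<epsilon> > 0" shows "C1_on UNIV (\<lambda>y. ker0 lam \<epsilon> (x - y)) (\<lambda>y. \<chi> i. - ker1 lam \<epsilon> i (x - y))"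
  unfolding C1_on_def
proof (intro conjI ballI)
  show "continuous_on (closure UNIV) (\<lambda>y. ker0 lam \<epsilon> (x - y))"
    by (rule continuous_on_compose2[OF continuous_on_kernels(1)[of \<epsilon> UNIV]]) (use assms in \<open>auto intro!: continuous_intros\<close>)
  have "continuous_on UNIV (\<lambda>y. ker1 lam \<epsilon> i (x - y))" for i
    by (rule continuous_on_compose2[OF continuous_on_kernels(2)[of \<epsilon> UNIV]]) (use assms in \<open>auto intro!: continuous_intros\<close>)
  then show "continuous_on (closure UNIV) (\<lambda>y. \<chi> i. - ker1 lam \<epsilon> i (x - y))"
    by (auto intro!: continuous_intros)
  fix y :: "real^3"
  have "((\<lambda>y. x - y) has_derivative (\<lambda>h. - h)) (at y)" by (auto intro!: derivative_eq_intros)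
  from has_derivative_compose[OF this ker0_deriv[of "x - y" \<epsilon> lam]] assms
  show "((\<lambda>y. ker0 lam \<epsilon> (x - y)) has_derivative (\<lambda>h. \<Sum>j\<in>UNIV. h $ j *\<^sub>R (\<chi> i. - ker1 lam \<epsilon> i (x - y)) $ j)) (at y)" by simp
qed

lemma C1_on_ker1:
  assumes "\<epsilon> > 0" shows "C1_on UNIV (\<lambda>y. ker1 lam \<epsilon> j (x - y)) (\<lambda>y. \<chi> i. - ker2 lam \<epsilon> i j (x - y))"
  unfolding C1_on_def
proof (intro conjI ballI)
  show "continuous_on (closure UNIV) (\<lambda>y. ker1 lam \<epsilon> j (x - y))"
    by (rule continuous_on_compose2[OF continuous_on_kernels(2)[of \<epsilon> UNIV]]) (use assms in \<open>auto intro!: continuous_intros\<close>)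
  have "continuous_on UNIV (\<lambda>y. ker2 lam \<epsilon> i j (x - y))" for i
    by (rule continuous_on_compose2[OF continuous_on_kernels(3)[of \<epsilon> UNIV]]) (use assms in \<open>auto intro!: continuous_intros\<close>)
  then show "continuous_on (closure UNIV) (\<lambda>y. \<chi> i. - ker2 lam \<epsilon> i j (x - y))"
    by (auto intro!: continuous_intros)
  fix y :: "real^3"
  have "((\<lambda>y. x - y) has_derivative (\<lambda>h. - h)) (at y)" by (auto intro!: derivative_eq_intros)
  from has_derivative_compose[OF this ker1_deriv[of "x - y" \<epsilon> lam]] assms
  show "((\<lambda>y. ker1 lam \<epsilon> j (x - y)) has_derivative (\<lambda>h. \<Sum>i\<in>UNIV. h $ i *\<^sub>R (\<chi> i. - ker2 lam \<epsilon> i j (x - y)) $ i)) (at y)" by simp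
qed

text \<open>\<open>cyclic c a b\<close> says that component \<open>c\<close> of a cross product \<open>v \<times> w\<close> is \<open>v\<^sub>a w\<^sub>b - v\<^sub>b w\<^sub>a\<close>.\<close>

definition cyclic :: "3 \<Rightarrow> 3 \<Rightarrow> 3 \<Rightarrow> bool" where
  "cyclic c a b \<longleftrightarrow> (c, a, b) \<in> {(1, 2, 3), (2, 3, 1), (3, 1, 2)}"

lemma cyclic_rotate: "cyclic c a b \<Longrightarrow> cyclic a b c"
  by (auto simp: cyclic_def)

lemma cyclic_exists: "\<exists>a b. cyclic c a b"
  using exhaust_3[of c] by (auto simp: cyclic_def)

lemma sum_cyclic: "cyclic c a b \<Longrightarrow> (\<Sum>i\<in>UNIV. g i) = g c + g a + g b" for g :: "3 \<Rightarrow> 'a::comm_monoid_add"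
  by (auto simp: cyclic_def sum_3 ac_simps)

lemma curl_cyclic: "cyclic c a b \<Longrightarrow> curl v x $ c = partial_deriv a v x $ b - partial_deriv b v x $ a"
  by (auto simp: cyclic_def curl_def)

lemma rc_cross_cyclic: "cyclic c a b \<Longrightarrow> rc_cross p v $ c = of_real (p $ a) * v $ b - of_real (p $ b) * v $ a"
  by (auto simp: cyclic_def rc_cross_def)

lemma vec3_component_le: "norm (v $ k) \<le> norm (v :: complex^3)"
  by (rule Finite_Cartesian_Product.norm_nth_le)

text \<open>Equal to 1 for |y| \<le> R and to 0 for |y| \<ge> 2 R. The difference
  \<open>y - 0\<close> keeps the shape in which \<open>smooth_bump\<close> is stated.\<close>

definition cutoff :: "real \<Rightarrow> real^3 \<Rightarrow> complex" where
  "cutoff R y = complex_of_real (smooth_step (2 - (1 / R\<^sup>2) * (norm (y - 0))\<^sup>2))"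

definition cutoff' :: "real \<Rightarrow> real^3 \<Rightarrow> complex^3" where
  "cutoff' R y = (\<chi> j. complex_of_real (smooth_step' (2 - (1 / R\<^sup>2) * (norm (y - 0))\<^sup>2) * (- 2 * (1 / R\<^sup>2) * (y - 0) $ j)))"

lemma C1_on_cutoff: "R > 0 \<Longrightarrow> C1_on UNIV (cutoff R) (cutoff' R)"
  unfolding cutoff_def[abs_def] cutoff'_def[abs_def] by (rule smooth_bump) auto

lemma norm_cutoff_le: "norm (cutoff R y) \<le> 1"
  using smooth_step_bounds by (simp add: cutoff_def)

lemma cutoff_inside:
  assumes "R > 0" "norm y \<le> R" shows "cutoff R y = 1" "cutoff' R y = 0"
proof -
  have "(norm y)\<^sup>2 / R\<^sup>2 \<le> 1" using assms by (simp add: divide_le_eq power_mono)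
  then show "cutoff R y = 1" "cutoff' R y = 0"
    by (auto simp: cutoff_def cutoff'_def smooth_step_ge_1 vec_eq_iff)
qed

lemma cutoff_outside:
  assumes "R > 0" "2 * R \<le> norm y" shows "cutoff R y = 0" "cutoff' R y = 0"
proof -
  have "(2 * R)\<^sup>2 \<le> (norm y)\<^sup>2" using assms by (intro power_mono) auto
  moreover have "(2 * R)\<^sup>2 = 4 * R\<^sup>2" by (simp add: power_mult_distrib)
  ultimately have "2 * R\<^sup>2 \<le> (norm y)\<^sup>2" using zero_le_power2[of R] by linarith
  then have "2 \<le> (norm y)\<^sup>2 / R\<^sup>2" using assms by (simp add: le_divide_eq)
  then show "cutoff R y = 0" "cutoff' R y = 0"
    by (auto simp: cutoff_def cutoff'_def smooth_step_le_0 vec_eq_iff)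
qed

text \<open>A radial cut-off has a radial gradient, and this alignment with y/|y| is what brings the
  radiation condition into the error term. The bound is 2/R^2 times the bound 16 on
  \<open>smooth_step'\<close>.\<close>

lemma cutoff'_radial:
  obtains \<mu> where "cutoff' R y = (\<chi> j. complex_of_real (- \<mu> * y $ j))" "0 \<le> \<mu>" "\<mu> \<le> 32 / R\<^sup>2"
proof
  let ?\<mu> = "smooth_step' (2 - (1 / R\<^sup>2) * (norm (y - 0))\<^sup>2) * (2 / R\<^sup>2)"
  show "cutoff' R y = (\<chi> j. complex_of_real (- ?\<mu> * y $ j))" by (simp add: cutoff'_def vec_eq_iff)
  show "0 \<le> ?\<mu>" using smooth_step'_bounds by simp
  show "?\<mu> \<le> 32 / R\<^sup>2" using mult_right_mono[OF smooth_step'_bounds(2), of "2 / R\<^sup>2"] by simp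
qed

text \<open>The shape shared by volume and surface integrands in the formula for component c: one
  density against the kernel and three against its partial derivatives in the directions c, a,
  b.\<close>

abbreviation kern where
  "kern lam \<epsilon> x y k0 kc ka kb c a b \<equiv> ker0 lam \<epsilon> (x - y) * k0 y + ker1 lam \<epsilon> c (x - y) * kc y
     + ker1 lam \<epsilon> a (x - y) * ka y + ker1 lam \<epsilon> b (x - y) * kb y"

locale exterior_field =
  fixes m :: nat and lam :: real and G :: "(real^3) set" and \<eta> :: "real^3 \<Rightarrow> real^3" and u :: "real^3 \<Rightarrow> complex^3"
  assumes G: "bounded_domain_of_class (Suc m) G" and normal: "outward_unit_normal G \<eta>"
    and u: "C1_closure (- closure G) u"
begin

abbreviation \<Omega> where "\<Omega> \<equiv> - closure G"
abbreviation S where "S \<equiv> frontier G"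
abbreviation \<sigma> where "\<sigma> \<equiv> surface_measure (frontier G)"

lemma open_ext: "open \<Omega>" by (intro open_Compl closed_closure)

lemma ext_borel [measurable]: "\<Omega> \<in> sets borel" by (rule borel_open[OF open_ext])

lemma S_subset: "S \<subseteq> closure \<Omega>" by (rule frontier_subset_closure_exterior[OF G])

lemma compact_S: "compact S" by (rule compact_frontier_domain[OF G])

lemma finite_S: "emeasure \<sigma> S < \<infinity>" by (rule surface_frontier_finite[OF G])

lemma continuous_on_normal: "continuous_on S \<eta>" by (rule continuous_on_frontier_normal[OF G normal])

lemma ext_not_S: "x \<in> \<Omega> \<Longrightarrow> x \<notin> S"
  by (auto simp: frontier_def)

text \<open>A continuous extension of the partial derivatives to the closed exterior, as
  \<open>C1_closure\<close> grants it. At frontier points nothing is known about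
  \<open>partial_deriv\<close>, so continuity up to the boundary is carried by
  \<open>D\<close>.\<close>

definition D :: "3 \<Rightarrow> real^3 \<Rightarrow> complex^3" where
  "D j = (SOME D. continuous_on (closure \<Omega>) D \<and> (\<forall>x\<in>\<Omega>. D x = partial_deriv j u x))"

lemma D: "continuous_on (closure \<Omega>) (D j)" "x \<in> \<Omega> \<Longrightarrow> D j x = partial_deriv j u x"
proof -
  have "\<exists>D. continuous_on (closure \<Omega>) D \<and> (\<forall>x\<in>\<Omega>. D x = partial_deriv j u x)"
    using u unfolding C1_closure_def by blast
  from someI_ex[OF this]
  have "continuous_on (closure \<Omega>) (D j) \<and> (\<forall>x\<in>\<Omega>. D j x = partial_deriv j u x)" unfolding D_def .
  then show "continuous_on (closure \<Omega>) (D j)" "x \<in> \<Omega> \<Longrightarrow> D j x = partial_deriv j u x" by auto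
qed

lemma continuous_u: "continuous_on (closure \<Omega>) u" using u by (simp add: C1_closure_def)

lemma C1_u: "C1_on \<Omega> (\<lambda>x. u x $ k) (\<lambda>x. \<chi> j. D j x $ k)"
  unfolding C1_on_def
proof (intro conjI ballI)
  show "continuous_on (closure \<Omega>) (\<lambda>x. u x $ k)" by (intro continuous_intros continuous_u)
  show "continuous_on (closure \<Omega>) (\<lambda>x. \<chi> j. D j x $ k)" by (intro continuous_intros D)
  fix x assume x: "x \<in> \<Omega>"
  have d: "(u has_derivative frechet_derivative u (at x)) (at x)"
    using u x unfolding C1_closure_def frechet_derivative_works by blast
  have lin: "linear (frechet_derivative u (at x))" by (rule has_derivative_linear[OF d])
  have "frechet_derivative u (at x) h $ k = (\<Sum>j\<in>UNIV. h $ j *\<^sub>R D j x $ k)" for h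
  proof -
    have "frechet_derivative u (at x) h = frechet_derivative u (at x) (\<Sum>j\<in>UNIV. h $ j *\<^sub>R axis j 1)"
      using basis_expansion[of h] by (simp add: vector_scalar_mult_def scalar_mult_eq_scaleR)
    also have "\<dots> = (\<Sum>j\<in>UNIV. h $ j *\<^sub>R D j x)"
      by (simp add: linear_sum[OF lin] linear_scale[OF lin] D(2)[OF x] partial_deriv_def)
    finally show ?thesis by simp
  qed
  then show "((\<lambda>x. u x $ k) has_derivative (\<lambda>h. \<Sum>j\<in>UNIV. h $ j *\<^sub>R (\<chi> j. D j x $ k) $ j)) (at x)"
    using bounded_linear.has_derivative[OF bounded_linear_vec_nth d, of k] by simp
qed

lemma u_bounds: "\<exists>B\<ge>0. \<forall>x\<in>\<Omega>. \<forall>k. norm (u x $ k) \<le> B \<and> (\<forall>j. norm (D j x $ k) \<le> B)"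
proof -
  have "bounded (u ` \<Omega>)" using u by (simp add: C1_closure_def)
  then obtain B0 where B0: "\<And>x. x \<in> \<Omega> \<Longrightarrow> norm (u x) \<le> B0" unfolding bounded_iff by blast
  have "\<forall>j. \<exists>B. \<forall>x\<in>\<Omega>. norm (D j x) \<le> B"
  proof
    fix j
    have "bounded (partial_deriv j u ` \<Omega>)" using u by (simp add: C1_closure_def)
    then obtain B where "\<And>x. x \<in> \<Omega> \<Longrightarrow> norm (partial_deriv j u x) \<le> B" unfolding bounded_iff by blast
    then show "\<exists>B. \<forall>x\<in>\<Omega>. norm (D j x) \<le> B" using D(2) by auto
  qed
  then obtain B where B: "\<And>j x. x \<in> \<Omega> \<Longrightarrow> norm (D j x) \<le> B j" by metis
  define b where "b = \<bar>B0\<bar> + (\<Sum>j\<in>UNIV. \<bar>B j\<bar>)"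
  have b: "\<bar>B0\<bar> \<le> b" "\<bar>B j\<bar> \<le> b" for j
    using member_le_sum[of j UNIV "\<lambda>j. \<bar>B j\<bar>"] by (auto simp: b_def intro: add_increasing2 sum_nonneg)
  show ?thesis
  proof (intro exI[of _ b] conjI ballI allI)
    show "0 \<le> b" using b(1) by linarith
    fix x k assume x: "x \<in> \<Omega>"
    show "norm (u x $ k) \<le> b" using vec3_component_le[of "u x" k] B0[OF x] b(1) by linarith
    show "norm (D j x $ k) \<le> b" for j using vec3_component_le[of "D j x" k] B[OF x, of j] b(2)[of j] by linarith
  qed
qed

text \<open>Written with \<open>D\<close> so that the sources are continuous up to the frontier; in
  the exterior \<open>dv\<close> is the divergence, and for a cyclic triple \<open>cv c a b\<close>
  is component c of curl u - lam u.\<close>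

definition dv :: "real^3 \<Rightarrow> complex" where "dv y = (\<Sum>i\<in>UNIV. D i y $ i)"

definition cv :: "3 \<Rightarrow> 3 \<Rightarrow> 3 \<Rightarrow> real^3 \<Rightarrow> complex" where
  "cv c a b y = D a y $ b - D b y $ a - of_real lam * u y $ c"

lemma dv_eq: "y \<in> \<Omega> \<Longrightarrow> dv y = divergence u y"
  by (simp add: dv_def divergence_def D)

lemma cv_eq: "cyclic c a b \<Longrightarrow> y \<in> \<Omega> \<Longrightarrow> cv c a b y = (curl u y - lam *\<^sub>R u y) $ c"
  by (simp add: cv_def D curl_cyclic) (simp add: scaleR_conv_of_real)

lemma continuous_dv: "continuous_on (closure \<Omega>) dv"
  unfolding dv_def[abs_def] by (intro continuous_intros D)

lemma continuous_cv: "continuous_on (closure \<Omega>) (cv c a b)"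
  unfolding cv_def[abs_def] by (intro continuous_intros D continuous_u)

text \<open>Coefficients of the kernels \<open>ker0\<close>, \<open>ker1 c\<close>, \<open>ker1 a\<close>, \<open>ker1 b\<close> in the divergence of the vector field
  to which Green's formula is applied.\<close>

definition coef0 where
  "coef0 c a b R y = of_real lam * (cutoff R y * cv c a b y + (cutoff' R y $ a * u y $ b - cutoff' R y $ b * u y $ a))"
definition coefc where
  "coefc c a b R y = - (cutoff R y * dv y + (cutoff' R y $ c * u y $ c + cutoff' R y $ a * u y $ a + cutoff' R y $ b * u y $ b))"
definition coefa where
  "coefa c a b R y = cutoff R y * cv b c a y + (cutoff' R y $ c * u y $ a - cutoff' R y $ a * u y $ c)"
definition coefb where
  "coefb c a b R y = - (cutoff R y * cv a b c y + (cutoff' R y $ b * u y $ c - cutoff' R y $ c * u y $ b))"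

text \<open>On the frontier the normal takes the place of the gradient of the cut-off; otherwise the
  pattern is that of the gradient terms in \<open>coef0\<close> to \<open>coefb\<close>.\<close>

definition coefS0 where
  "coefS0 c a b y = of_real lam * (of_real (\<eta> y $ a) * u y $ b - of_real (\<eta> y $ b) * u y $ a)"
definition coefSc where
  "coefSc c a b y = - (of_real (\<eta> y $ c) * u y $ c + of_real (\<eta> y $ a) * u y $ a + of_real (\<eta> y $ b) * u y $ b)"
definition coefSa where
  "coefSa c a b y = of_real (\<eta> y $ c) * u y $ a - of_real (\<eta> y $ a) * u y $ c"
definition coefSb where
  "coefSb c a b y = - (of_real (\<eta> y $ b) * u y $ c - of_real (\<eta> y $ c) * u y $ b)"

lemma continuous_coefs:
  assumes "R > 0"
  shows "continuous_on (closure \<Omega>) (coef0 c a b R)" "continuous_on (closure \<Omega>) (coefc c a b R)"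
    "continuous_on (closure \<Omega>) (coefa c a b R)" "continuous_on (closure \<Omega>) (coefb c a b R)"
proof -
  have c: "continuous_on (closure \<Omega>) (cutoff R)" "continuous_on (closure \<Omega>) (cutoff' R)"
    using C1_on_cutoff[OF assms] by (auto simp: C1_on_def intro: continuous_on_subset)
  show "continuous_on (closure \<Omega>) (coef0 c a b R)" "continuous_on (closure \<Omega>) (coefc c a b R)"
    "continuous_on (closure \<Omega>) (coefa c a b R)" "continuous_on (closure \<Omega>) (coefb c a b R)"
    unfolding coef0_def coefc_def coefa_def coefb_def
    by (intro continuous_intros c continuous_u continuous_cv continuous_dv)+
qed

lemma continuous_coefS:
  "continuous_on S (coefS0 c a b)" "continuous_on S (coefSc c a b)"
  "continuous_on S (coefSa c a b)" "continuous_on S (coefSb c a b)"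
  unfolding coefS0_def coefSc_def coefSa_def coefSb_def
  by (intro continuous_intros continuous_on_normal continuous_on_subset[OF continuous_u S_subset])+

lemma coefs_outside:
  assumes "R > 0" "2 * R \<le> norm y"
  shows "coef0 c a b R y = 0" "coefc c a b R y = 0" "coefa c a b R y = 0" "coefb c a b R y = 0"
  using cutoff_outside[OF assms] by (simp_all add: coef0_def coefc_def coefa_def coefb_def)

text \<open>Green's formula is applied in direction c to \<open>wc\<close>, in direction a to
  \<open>wa\<close> and in direction b to \<open>wb\<close>, the components of one vector field. In
  its divergence the mixed second derivatives of the kernel cancel and the Laplacian multiplies
  \<open>u $ c\<close>. The derivatives of \<open>u\<close> form the divergence and the curl, and
  the remaining terms with lam complete the curl to \<open>cv\<close>.\<close>

lemma regularised_identity: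
  assumes cyc: "cyclic c a b" and \<epsilon>: "\<epsilon> > 0" and R: "R > 0" "S \<subseteq> cball 0 R"
  shows "(LINT y:\<Omega>|lborel. kern lam \<epsilon> x y (coef0 c a b R) (coefc c a b R) (coefa c a b R) (coefb c a b R) c a b
      - of_real (\<epsilon>\<^sup>2) * radial2 lam (of_real (rad \<epsilon> (x - y))) * (cutoff R y * u y $ c))
    = - (LINT y:S|\<sigma>. kern lam \<epsilon> x y (coefS0 c a b) (coefSc c a b) (coefSa c a b) (coefSb c a b) c a b)"
proof -
  let ?h = "cutoff R" and ?dh = "cutoff' R"
  let ?k0 = "\<lambda>y. ker0 lam \<epsilon> (x - y)" and ?k1 = "\<lambda>j y. ker1 lam \<epsilon> j (x - y)"
  let ?d0 = "\<lambda>y. \<chi> i. - ker1 lam \<epsilon> i (x - y)" and ?d1 = "\<lambda>j y. \<chi> i. - ker2 lam \<epsilon> i j (x - y)"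
  let ?u = "\<lambda>k y. u y $ k" and ?du = "\<lambda>k y. \<chi> j. D j y $ k"
  have h: "C1_on \<Omega> ?h ?dh" using C1_on_cutoff[OF R(1)] by (rule C1_on_subset) simp
  have k0: "C1_on \<Omega> ?k0 ?d0" using C1_on_ker0[OF \<epsilon>] by (rule C1_on_subset) simp
  have k1: "C1_on \<Omega> (?k1 j) (?d1 j)" for j using C1_on_ker1[OF \<epsilon>] by (rule C1_on_subset) simp
  define pr where "pr f df g dg y = (\<chi> j. f y * dg y $ j + df y $ j * g y)" for f g :: "real^3 \<Rightarrow> complex" and df dg :: "real^3 \<Rightarrow> complex^3" and y
  have prod: "C1_on \<Omega> (\<lambda>y. f y * g y) (pr f df g dg)" if "C1_on \<Omega> f df" "C1_on \<Omega> g dg" for f df g dg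
    unfolding pr_def[abs_def] by (rule C1_on_mult[OF that])
  \<comment> \<open>General shape of the three components: the cut-off times a combination of three
    products of a kernel with a component of \<open>u\<close>. The gradient \<open>dw\<close> comes
    from the product rule, and Green's formula for all three is then proved at once.\<close>
  define v where "v s t r f f' f'' p q z y = ?h y * (s * (f y * ?u p y) + t * (f' y * ?u q y) + r * (f'' y * ?u z y))" for s t r :: complex and f f' f'' p q z y
  define dw where "dw s t r f df f' df' f'' df'' p q z = pr ?h ?dh (\<lambda>y. s * (f y * ?u p y) + t * (f' y * ?u q y) + r * (f'' y * ?u z y))
     (\<lambda>y. (\<chi> j. s * pr f df (?u p) (?du p) y $ j) + (\<chi> j. t * pr f' df' (?u q) (?du q) y $ j) + (\<chi> j. r * pr f'' df'' (?u z) (?du z) y $ j))"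
    for s t r f df f' df' f'' df'' p q z
  have green: "(LINT y:\<Omega>|lborel. dw s t r f df f' df' f'' df'' p q z y $ i) = - (LINT y:S|\<sigma>. of_real (\<eta> y $ i) * v s t r f f' f'' p q z y)"
    and int: "set_integrable lborel \<Omega> (\<lambda>y. dw s t r f df f' df' f'' df'' p q z y $ i)"
    and intS: "set_integrable \<sigma> S (\<lambda>y. of_real (\<eta> y $ i) * v s t r f f' f'' p q z y)"
    if f: "C1_on \<Omega> f df" "C1_on \<Omega> f' df'" "C1_on \<Omega> f'' df''" for s t r f df f' df' f'' df'' p q z i
  proof -
    have C: "C1_on \<Omega> (v s t r f f' f'' p q z) (dw s t r f df f' df' f'' df'' p q z)"
      unfolding v_def[abs_def] dw_def
      by (intro prod h C1_on_add C1_on_cmult f C1_u)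
    have z: "v s t r f f' f'' p q z y = 0 \<and> dw s t r f df f' df' f'' df'' p q z y = 0" if "y \<notin> cball 0 (2 * R)" for y
      using cutoff_outside[OF R(1), of y] that by (simp add: v_def dw_def pr_def vec_eq_iff)
    show "(LINT y:\<Omega>|lborel. dw s t r f df f' df' f'' df'' p q z y $ i) = - (LINT y:S|\<sigma>. of_real (\<eta> y $ i) * v s t r f f' f'' p q z y)"
      by (rule green_exterior[OF G normal C compact_cball[of 0 "2 * R"]]) (rule z)
    have cd: "continuous_on (closure \<Omega>) (\<lambda>y. dw s t r f df f' df' f'' df'' p q z y $ i)"
      using C by (intro continuous_intros) (simp add: C1_on_def)
    show "set_integrable lborel \<Omega> (\<lambda>y. dw s t r f df f' df' f'' df'' p q z y $ i)"
      by (rule set_integrable_compact_support(1)[OF open_ext cd compact_cball[of 0 "2 * R"]]) (use z in auto)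
    show "set_integrable \<sigma> S (\<lambda>y. of_real (\<eta> y $ i) * v s t r f f' f'' p q z y)"
      using C by (intro set_integrable_compact compact_S finite_S continuous_intros continuous_on_normal)
        (auto simp: C1_on_def intro: continuous_on_subset[OF _ S_subset])
  qed
  \<comment> \<open>With h the cut-off, and K and its derivatives taken at x - y, the field is h
    times - d_c K u - u_c grad K + (grad K . u) e_c + lam K (u \<times> e_c), where e_c is the unit
    vector in direction c.\<close>
  define wc where "wc = v (-1) 1 1 (?k1 c) (?k1 a) (?k1 b) c a b"
  define dwc where "dwc = dw (-1) 1 1 (?k1 c) (?d1 c) (?k1 a) (?d1 a) (?k1 b) (?d1 b) c a b"
  define wa where "wa = v (-1) (-1) (of_real lam) (?k1 c) (?k1 a) ?k0 a c b"
  define dwa where "dwa = dw (-1) (-1) (of_real lam) (?k1 c) (?d1 c) (?k1 a) (?d1 a) ?k0 ?d0 a c b"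
  define wb where "wb = v (-1) (-1) (- of_real lam) (?k1 c) (?k1 b) ?k0 b c a"
  define dwb where "dwb = dw (-1) (-1) (- of_real lam) (?k1 c) (?d1 c) (?k1 b) (?d1 b) ?k0 ?d0 b c a"
  have gc: "(LINT y:\<Omega>|lborel. dwc y $ c) = - (LINT y:S|\<sigma>. of_real (\<eta> y $ c) * wc y)"
    unfolding dwc_def wc_def by (rule green[OF k1 k1 k1])
  have ic: "set_integrable lborel \<Omega> (\<lambda>y. dwc y $ c)" unfolding dwc_def by (rule int[OF k1 k1 k1])
  have sc: "set_integrable \<sigma> S (\<lambda>y. of_real (\<eta> y $ c) * wc y)" unfolding wc_def by (rule intS[OF k1 k1 k1])
  have ga: "(LINT y:\<Omega>|lborel. dwa y $ a) = - (LINT y:S|\<sigma>. of_real (\<eta> y $ a) * wa y)"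
    unfolding dwa_def wa_def by (rule green[OF k1 k1 k0])
  have ia: "set_integrable lborel \<Omega> (\<lambda>y. dwa y $ a)" unfolding dwa_def by (rule int[OF k1 k1 k0])
  have sa: "set_integrable \<sigma> S (\<lambda>y. of_real (\<eta> y $ a) * wa y)" unfolding wa_def by (rule intS[OF k1 k1 k0])
  have gb: "(LINT y:\<Omega>|lborel. dwb y $ b) = - (LINT y:S|\<sigma>. of_real (\<eta> y $ b) * wb y)"
    unfolding dwb_def wb_def by (rule green[OF k1 k1 k0])
  have ib: "set_integrable lborel \<Omega> (\<lambda>y. dwb y $ b)" unfolding dwb_def by (rule int[OF k1 k1 k0])
  have sb: "set_integrable \<sigma> S (\<lambda>y. of_real (\<eta> y $ b) * wb y)" unfolding wb_def by (rule intS[OF k1 k1 k0])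
  have sym: "ker2 lam \<epsilon> i j z = ker2 lam \<epsilon> j i z" for i j z by (simp add: ker2_def mult.commute eq_commute)
  \<comment> \<open>Each mixed derivative \<open>ker2 i j\<close> that occurs does so twice, with
    opposite signs. The trace is replaced by \<open>lap\<close>, which also supplies - lam^2 K u_c
    and so completes lam curl u to lam (curl u - lam u).\<close>
  have vol: "dwc y $ c + dwa y $ a + dwb y $ b = kern lam \<epsilon> x y (coef0 c a b R) (coefc c a b R) (coefa c a b R) (coefb c a b R) c a b
      - of_real (\<epsilon>\<^sup>2) * radial2 lam (of_real (rad \<epsilon> (x - y))) * (cutoff R y * u y $ c)" for y
  proof -
    have "of_real (\<epsilon>\<^sup>2) * radial2 lam (of_real (rad \<epsilon> (x - y))) = - (ker2 lam \<epsilon> c c (x - y) + ker2 lam \<epsilon> a a (x - y) + ker2 lam \<epsilon> b b (x - y)) - of_real (lam\<^sup>2) * ker0 lam \<epsilon> (x - y)"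
      using ker_laplace[of "x - y" \<epsilon> lam] \<epsilon> unfolding sum_cyclic[OF cyc] by simp
    note lap = this
    show ?thesis
      unfolding lap dwc_def dwa_def dwb_def dw_def pr_def coef0_def coefc_def coefa_def coefb_def cv_def dv_def sum_cyclic[OF cyc]
      by (simp add: algebra_simps power2_eq_square sym[of a c] sym[of b c])
  qed
  have surf: "of_real (\<eta> y $ c) * wc y + of_real (\<eta> y $ a) * wa y + of_real (\<eta> y $ b) * wb y
     = kern lam \<epsilon> x y (coefS0 c a b) (coefSc c a b) (coefSa c a b) (coefSb c a b) c a b" if "y \<in> S" for y
  proof -
    have "cutoff R y = 1" using that R by (intro cutoff_inside) auto
    then show ?thesis unfolding wc_def wa_def wb_def v_def coefS0_def coefSc_def coefSa_def coefSb_def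
      by (simp add: algebra_simps)
  qed
  have "(LINT y:\<Omega>|lborel. kern lam \<epsilon> x y (coef0 c a b R) (coefc c a b R) (coefa c a b R) (coefb c a b R) c a b
      - of_real (\<epsilon>\<^sup>2) * radial2 lam (of_real (rad \<epsilon> (x - y))) * (cutoff R y * u y $ c)) = (LINT y:\<Omega>|lborel. dwc y $ c + dwa y $ a + dwb y $ b)"
    unfolding vol ..
  also have "\<dots> = (LINT y:\<Omega>|lborel. dwc y $ c) + (LINT y:\<Omega>|lborel. dwa y $ a) + (LINT y:\<Omega>|lborel. dwb y $ b)"
    using ic ia ib by (simp add: set_integral_add)
  also have "\<dots> = - ((LINT y:S|\<sigma>. of_real (\<eta> y $ c) * wc y) + (LINT y:S|\<sigma>. of_real (\<eta> y $ a) * wa y) + (LINT y:S|\<sigma>. of_real (\<eta> y $ b) * wb y))"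
    unfolding gc ga gb by simp
  also have "(LINT y:S|\<sigma>. of_real (\<eta> y $ c) * wc y) + (LINT y:S|\<sigma>. of_real (\<eta> y $ a) * wa y) + (LINT y:S|\<sigma>. of_real (\<eta> y $ b) * wb y)
    = (LINT y:S|\<sigma>. of_real (\<eta> y $ c) * wc y + of_real (\<eta> y $ a) * wa y + of_real (\<eta> y $ b) * wb y)"
    using sc sa sb by (simp add: set_integral_add)
  also have "\<dots> = (LINT y:S|\<sigma>. kern lam \<epsilon> x y (coefS0 c a b) (coefSc c a b) (coefSa c a b) (coefSb c a b) c a b)"
    unfolding set_lebesgue_integral_def
  proof (rule Bochner_Integration.integral_cong[OF refl])
    fix y show "indicator S y *\<^sub>R (of_real (\<eta> y $ c) * wc y + of_real (\<eta> y $ a) * wa y + of_real (\<eta> y $ b) * wb y)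
      = indicator S y *\<^sub>R (kern lam \<epsilon> x y (coefS0 c a b) (coefSc c a b) (coefSa c a b) (coefSb c a b) c a b)"
      by (cases "y \<in> S") (simp_all add: surf)
  qed
  finally show ?thesis .
qed

end

text \<open>The hypotheses of \<open>kernel_limit\<close> for the density \<open>k\<close> on
  \<open>A\<close>, bundled so that volume and surface integrals pass to \<epsilon> = 0 by the same
  rules.\<close>

definition admissible :: "(real^3) measure \<Rightarrow> (real^3) set \<Rightarrow> real^3 \<Rightarrow> (real^3 \<Rightarrow> complex) \<Rightarrow> bool" where
  "admissible M A x k \<longleftrightarrow> sets M = sets borel \<and> (\<lambda>y. indicator A y *\<^sub>R k y) \<in> borel_measurable borel \<and>
    integrable M (\<lambda>y. sing (x - y) * norm (indicator A y *\<^sub>R k y)) \<and> (AE y in M. indicator A y *\<^sub>R k y \<noteq> 0 \<longrightarrow> y \<noteq> x)"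

lemma admissible_kernels:
  assumes "admissible M A x k"
  shows "set_integrable M A (\<lambda>y. ker0 lam \<epsilon> (x - y) * k y)" "set_integrable M A (\<lambda>y. ker1 lam \<epsilon> j (x - y) * k y)"
    "s \<longlonglongrightarrow> 0 \<Longrightarrow> (\<lambda>n. LINT y:A|M. ker0 lam (s n) (x - y) * k y) \<longlonglongrightarrow> (LINT y:A|M. ker0 lam 0 (x - y) * k y)"
    "s \<longlonglongrightarrow> 0 \<Longrightarrow> (\<lambda>n. LINT y:A|M. ker1 lam (s n) j (x - y) * k y) \<longlonglongrightarrow> (LINT y:A|M. ker1 lam 0 j (x - y) * k y)"
  using kernel_limit[of M "\<lambda>y. indicator A y *\<^sub>R k y" x] assms
  unfolding admissible_def set_integrable_def set_lebesgue_integral_def by simp_all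

lemma admissible_cmult:
  assumes "admissible M A x k" shows "admissible M A x (\<lambda>y. c * k y)"
proof -
  have 1: "indicator A y *\<^sub>R (c * k y) = c * (indicator A y *\<^sub>R k y)" for y by simp
  have 2: "sing (x - y) * norm (c * (indicator A y *\<^sub>R k y)) = norm c * (sing (x - y) * norm (indicator A y *\<^sub>R k y))" for y
    by (simp only: norm_mult mult.left_commute)
  have k: "sets M = sets borel" "(\<lambda>y. indicator A y *\<^sub>R k y) \<in> borel_measurable borel"
    "integrable M (\<lambda>y. sing (x - y) * norm (indicator A y *\<^sub>R k y))" "AE y in M. indicator A y *\<^sub>R k y \<noteq> 0 \<longrightarrow> y \<noteq> x"
    using assms by (simp_all only: admissible_def)
  show ?thesis unfolding admissible_def 1 2
  proof (intro conjI k(1) borel_measurable_times borel_measurable_const k(2) integrable_mult_right k(3))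
    show "AE y in M. c * (indicator A y *\<^sub>R k y) \<noteq> 0 \<longrightarrow> y \<noteq> x"
      using k(4) by (rule eventually_mono) (metis mult_zero_right)
  qed
qed

lemma admissible_minus: "admissible M A x k \<Longrightarrow> admissible M A x (\<lambda>y. - k y)"
  using admissible_cmult[of M A x k "- 1"] by simp

lemma admissible_kern:
  assumes "admissible M A x k0" "admissible M A x kc" "admissible M A x ka" "admissible M A x kb"
  shows "set_integrable M A (\<lambda>y. kern lam \<epsilon> x y k0 kc ka kb c a b)" (is ?int)
    "(LINT y:A|M. kern lam \<epsilon> x y k0 kc ka kb c a b) = (LINT y:A|M. ker0 lam \<epsilon> (x - y) * k0 y) + (LINT y:A|M. ker1 lam \<epsilon> c (x - y) * kc y)
      + (LINT y:A|M. ker1 lam \<epsilon> a (x - y) * ka y) + (LINT y:A|M. ker1 lam \<epsilon> b (x - y) * kb y)"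
    "s \<longlonglongrightarrow> 0 \<Longrightarrow> (\<lambda>n. LINT y:A|M. kern lam (s n) x y k0 kc ka kb c a b) \<longlonglongrightarrow> (LINT y:A|M. kern lam 0 x y k0 kc ka kb c a b)"
proof -
  note i = admissible_kernels(1)[OF assms(1)] admissible_kernels(2)[OF assms(2)] admissible_kernels(2)[OF assms(3)] admissible_kernels(2)[OF assms(4)]
  show ?int by (intro set_integral_add i)
  show eq: "(LINT y:A|M. kern lam \<epsilon> x y k0 kc ka kb c a b) = (LINT y:A|M. ker0 lam \<epsilon> (x - y) * k0 y) + (LINT y:A|M. ker1 lam \<epsilon> c (x - y) * kc y)
      + (LINT y:A|M. ker1 lam \<epsilon> a (x - y) * ka y) + (LINT y:A|M. ker1 lam \<epsilon> b (x - y) * kb y)" for \<epsilon>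
    using i by (simp add: set_integral_add)
  show "(\<lambda>n. LINT y:A|M. kern lam (s n) x y k0 kc ka kb c a b) \<longlonglongrightarrow> (LINT y:A|M. kern lam 0 x y k0 kc ka kb c a b)" if "s \<longlonglongrightarrow> 0"
    unfolding eq by (intro tendsto_add admissible_kernels(3)[OF assms(1) that] admissible_kernels(4)[OF assms(2) that]
      admissible_kernels(4)[OF assms(3) that] admissible_kernels(4)[OF assms(4) that])
qed

context exterior_field
begin

lemma admissible_compact_support:
  assumes k: "continuous_on (closure \<Omega>) k" and L: "\<And>y. L < norm y \<Longrightarrow> k y = 0"
  shows "admissible lborel \<Omega> x k"
proof -
  have 0: "\<And>y. y \<in> closure \<Omega> \<Longrightarrow> y \<notin> cball 0 L \<Longrightarrow> k y = 0" using L by auto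
  note s = set_integrable_compact_support[OF open_ext k compact_cball[of 0 L] 0]
  obtain B where B: "B \<ge> 0" "\<And>y. y \<in> closure \<Omega> \<Longrightarrow> norm (k y) \<le> B" using s(2) by blast
  have b: "norm (indicator \<Omega> y *\<^sub>R k y) \<le> B" for y
    using B closure_subset[of \<Omega>] by (auto simp: indicator_def)
  have "integrable lborel (\<lambda>y. sing (x - y) * norm (indicator \<Omega> y *\<^sub>R k y))"
    by (rule integrable_sing_compact[OF s(3) b, of L]) (use L in simp_all)
  moreover have "AE y in lborel. indicator \<Omega> y *\<^sub>R k y \<noteq> 0 \<longrightarrow> y \<noteq> x"
    using AE_lborel_singleton[of x] by eventually_elim simp
  ultimately show ?thesis using s(3) by (simp add: admissible_def)
qed

lemma admissible_surface:
  assumes k: "continuous_on S k" and x: "x \<notin> S"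
  shows "admissible \<sigma> S x k"
proof -
  have "continuous_on S (\<lambda>y. sing (x - y) * norm (k y))"
    unfolding sing_def using x by (intro continuous_intros k) auto
  then have "set_integrable \<sigma> S (\<lambda>y. sing (x - y) * norm (k y))"
    by (intro set_integrable_compact compact_S finite_S) simp_all
  then have "integrable \<sigma> (\<lambda>y. sing (x - y) * norm (indicator S y *\<^sub>R k y))"
    unfolding set_integrable_def by (rule Bochner_Integration.integrable_cong[THEN iffD1, rotated -1]) (auto simp: indicator_def)
  moreover have "(\<lambda>y. indicator S y *\<^sub>R k y) \<in> borel_measurable borel"
    using compact_S by (intro borel_measurable_continuous_on_indicator k borel_compact)
  ultimately show ?thesis using x by (auto simp: admissible_def indicator_def)
qed

text \<open>In the limit of vanishing \<epsilon> the approximate identity returns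
  \<open>u x $ c\<close>: the cut-off is 1 at x because |x| < R, and extension by zero keeps
  continuity at x because the exterior is open.\<close>

lemma cutoff_identity:
  assumes cyc: "cyclic c a b" and x: "x \<in> \<Omega>" "norm x < R" and R: "R > 0" "S \<subseteq> cball 0 R"
  shows "u x $ c = (LINT y:\<Omega>|lborel. kern lam 0 x y (coef0 c a b R) (coefc c a b R) (coefa c a b R) (coefb c a b R) c a b)
    + (LINT y:S|\<sigma>. kern lam 0 x y (coefS0 c a b) (coefSc c a b) (coefSa c a b) (coefSb c a b) c a b)"
proof -
  define s where "s n = 1 / real (Suc n)" for n
  have s: "s \<longlonglongrightarrow> 0" "s n > 0" for n unfolding s_def using LIMSEQ_Suc[OF lim_1_over_n[where 'a=real]] by auto
  note co = coefs_outside[OF R(1)]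
  note cc = continuous_coefs[OF R(1), of c a b]
  have adm: "admissible lborel \<Omega> x (coef0 c a b R)" "admissible lborel \<Omega> x (coefc c a b R)"
    "admissible lborel \<Omega> x (coefa c a b R)" "admissible lborel \<Omega> x (coefb c a b R)"
    by (rule admissible_compact_support[where L="2 * R"], (rule cc, use co in simp))+
  have xS: "x \<notin> S" using ext_not_S[OF x(1)] .
  note admS = admissible_surface[OF continuous_coefS(1)[of c a b] xS] admissible_surface[OF continuous_coefS(2)[of c a b] xS]
    admissible_surface[OF continuous_coefS(3)[of c a b] xS] admissible_surface[OF continuous_coefS(4)[of c a b] xS]
  let ?V = "\<lambda>\<epsilon> y. kern lam \<epsilon> x y (coef0 c a b R) (coefc c a b R) (coefa c a b R) (coefb c a b R) c a b"
  let ?W = "\<lambda>\<epsilon> y. kern lam \<epsilon> x y (coefS0 c a b) (coefSc c a b) (coefSa c a b) (coefSb c a b) c a b"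
  let ?d = "\<lambda>\<epsilon> y. of_real (\<epsilon>\<^sup>2) * radial2 lam (of_real (rad \<epsilon> (x - y)))"
  let ?hu = "\<lambda>y. cutoff R y * u y $ c"
  have chu: "continuous_on (closure \<Omega>) ?hu"
    using C1_on_cutoff[OF R(1)] by (intro continuous_intros continuous_u) (auto simp: C1_on_def intro: continuous_on_subset)
  have hu0: "?hu y = 0" if "2 * R < norm y" for y using cutoff_outside(1)[OF R(1), of y] that by simp
  have idl: "set_integrable lborel \<Omega> (\<lambda>y. ?d \<epsilon> y * ?hu y)" if "\<epsilon> > 0" for \<epsilon>
  proof (rule set_integrable_compact_support(1)[OF open_ext _ compact_cball[of 0 "2 * R"]])
    have "continuous_on UNIV (\<lambda>y. rad \<epsilon> (x - y))"
      by (rule continuous_on_compose2[OF continuous_on_rad[of UNIV]]) (auto intro!: continuous_intros)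
    moreover have "rad \<epsilon> (x - y) \<noteq> 0" for y using rad_pos[of "x - y" \<epsilon>] that by simp
    ultimately have "continuous_on UNIV (?d \<epsilon>)" unfolding radial2_def by (intro continuous_intros) auto
    from continuous_on_mult[OF continuous_on_subset[OF this subset_UNIV] chu]
    show "continuous_on (closure \<Omega>) (\<lambda>y. ?d \<epsilon> y * ?hu y)" .
  qed (use hu0 in auto)
  have id: "(LINT y:\<Omega>|lborel. ?V (s n) y) - (LINT y:\<Omega>|lborel. ?d (s n) y * ?hu y) = - (LINT y:S|\<sigma>. ?W (s n) y)" for n
    using regularised_identity[OF cyc s(2)[of n] R, of x] set_integral_diff(2)[OF admissible_kern(1)[OF adm] idl[OF s(2)]]
    by simp
  have lim: "(\<lambda>n. LINT y:\<Omega>|lborel. ?d (s n) y * ?hu y) \<longlonglongrightarrow> u x $ c"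
  proof -
    define U where "U y = indicator \<Omega> y *\<^sub>R ?hu y" for y
    have Ux: "U x = u x $ c" using x cutoff_inside(1)[OF R(1), of x] by (simp add: U_def)
    have 0: "\<And>y. y \<in> closure \<Omega> \<Longrightarrow> y \<notin> cball 0 (2 * R) \<Longrightarrow> ?hu y = 0" using hu0 by auto
    note sc = set_integrable_compact_support[OF open_ext chu compact_cball[of 0 "2 * R"] 0]
    obtain B where B: "B \<ge> 0" "\<And>y. y \<in> closure \<Omega> \<Longrightarrow> norm (?hu y) \<le> B" using sc(2) by blast
    have cont: "isCont U x"
    proof -
      have c1: "isCont ?hu x" using continuous_on_subset[OF chu closure_subset] open_ext x(1) continuous_on_eq_continuous_at by blast
      have ev: "\<forall>\<^sub>F y in nhds x. U y = ?hu y"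
        using eventually_nhds_in_open[OF open_ext x(1)] by eventually_elim (simp add: U_def)
      show ?thesis using isCont_cong[OF ev] c1 by (simp only:)
    qed
    have "(\<lambda>n. \<integral>y. ?d (s n) y * U y \<partial>lborel) \<longlonglongrightarrow> U x"
    proof (rule approximate_identity[OF _ _ _ cont s, where B=B and L="2 * R"])
      show "U \<in> borel_measurable borel" using sc(3) by (simp add: U_def[abs_def])
      show "norm (U y) \<le> B" for y using B closure_subset[of \<Omega>] by (auto simp: U_def indicator_def)
      show "U y = 0" if "2 * R < norm y" for y using hu0[OF that] by (simp add: U_def)
    qed
    moreover have "(\<integral>y. ?d (s n) y * U y \<partial>lborel) = (LINT y:\<Omega>|lborel. ?d (s n) y * ?hu y)" for n
      unfolding set_lebesgue_integral_def U_def by (intro Bochner_Integration.integral_cong) auto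
    ultimately show ?thesis by (simp add: Ux)
  qed
  have "(\<lambda>n. (LINT y:\<Omega>|lborel. ?V (s n) y) - (LINT y:\<Omega>|lborel. ?d (s n) y * ?hu y)) \<longlonglongrightarrow> (LINT y:\<Omega>|lborel. ?V 0 y) - u x $ c"
    by (intro tendsto_diff admissible_kern(3)[OF adm] lim s)
  moreover have "(\<lambda>n. - (LINT y:S|\<sigma>. ?W (s n) y)) \<longlonglongrightarrow> - (LINT y:S|\<sigma>. ?W 0 y)"
    by (intro tendsto_minus admissible_kern(3)[OF admS] s)
  ultimately have "(LINT y:\<Omega>|lborel. ?V 0 y) - u x $ c = - (LINT y:S|\<sigma>. ?W 0 y)"
    unfolding id by (rule LIMSEQ_unique)
  then show ?thesis by (simp add: algebra_simps)
qed

end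

text \<open>With r = |x - y|, the gradient kernel is (i lam - 1/r) K times the unit vector (x -
  y)/r, and each component of that vector differs from the one of - y/|y| by at most 2 |x|/r. The
  constant depends on x, which stays fixed while y goes to infinity.\<close>

lemma ker1_far:
  assumes r: "x \<noteq> y" and y: "y \<noteq> 0"
  shows "norm (ker1 lam 0 j (x - y) - (- \<i> * of_real lam * ker0 lam 0 (x - y) * of_real (y $ j / norm y)))
    \<le> (2 * \<bar>lam\<bar> * norm x + 1) / (norm (x - y))\<^sup>2"
proof -
  define r where "r = norm (x - y)"
  define g where "g = ker0 lam 0 (x - y)"
  define t where "t = (x $ j - y $ j) / r"
  have r0: "r > 0" using assms by (simp add: r_def)
  have ny: "norm y > 0" using y by simp
  have g: "norm g \<le> 1 / r" using norm_ker0_le[of "x - y" 0 lam] assms by (simp add: g_def r_def)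
  have t: "\<bar>t\<bar> \<le> 1" using component_le_norm_cart[of "x - y" j] r0 by (simp add: t_def r_def)
  have k1: "ker1 lam 0 j (x - y) = (\<i> * of_real lam - 1 / of_real r) * g * of_real t"
    using r0 by (simp add: ker1_def radial1_def g_def ker0_def radial0_def t_def r_def[symmetric] field_simps power_numeral_reduce)
  have tn: "\<bar>t + y $ j / norm y\<bar> \<le> 2 * norm x / r"
  proof -
    have "t + y $ j / norm y = x $ j / r + (y $ j / norm y) * ((r - norm y) / r)"
      using r0 ny by (simp add: t_def field_simps)
    moreover have "\<bar>x $ j / r\<bar> \<le> norm x / r" using component_le_norm_cart[of x j] r0 by (simp add: divide_right_mono)
    moreover have "\<bar>(y $ j / norm y) * ((r - norm y) / r)\<bar> \<le> 1 * (norm x / r)"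
      unfolding abs_mult
    proof (rule mult_mono)
      show "\<bar>y $ j / norm y\<bar> \<le> 1" using component_le_norm_cart[of y j] ny by simp
      have "\<bar>r - norm y\<bar> \<le> norm x" using norm_triangle_ineq3[of "x - y" "- y"] by (simp add: r_def)
      then show "\<bar>(r - norm y) / r\<bar> \<le> norm x / r" using r0 by (simp add: divide_right_mono)
    qed auto
    moreover note abs_triangle_ineq[of "x $ j / r" "(y $ j / norm y) * ((r - norm y) / r)"]
    moreover have "2 * norm x / r = norm x / r + norm x / r" by simp
    ultimately show ?thesis by linarith
  qed
  have "ker1 lam 0 j (x - y) - (- \<i> * of_real lam * g * of_real (y $ j / norm y)) = \<i> * of_real lam * g * of_real (t + y $ j / norm y) - g * of_real (t / r)"
    unfolding k1 by (simp add: algebra_simps)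
  also have "norm \<dots> \<le> \<bar>lam\<bar> * (1 / r) * (2 * norm x / r) + (1 / r) * (1 / r)"
  proof (rule order_trans[OF norm_triangle_ineq4 add_mono])
    show "norm (\<i> * of_real lam * g * of_real (t + y $ j / norm y)) \<le> \<bar>lam\<bar> * (1 / r) * (2 * norm x / r)"
      unfolding norm_mult norm_of_real using g tn r0 by (intro mult_mono) auto
    show "norm (g * of_real (t / r)) \<le> (1 / r) * (1 / r)"
      unfolding norm_mult norm_of_real using g t r0 by (intro mult_mono) (auto simp: divide_right_mono)
  qed
  also have "\<dots> = (2 * \<bar>lam\<bar> * norm x + 1) / r\<^sup>2" using r0 by (simp add: field_simps power2_eq_square)
  finally show ?thesis by (simp only: g_def r_def)
qed

text \<open>Here \<open>nc\<close>, \<open>na\<close>, \<open>nb\<close> are the components of n =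
  y/|y|, \<open>m\<close> is the length of the gradient of the cut-off, \<open>g\<close> the kernel,
  \<open>l\<close> the parameter lam, and \<open>rc\<close>, \<open>ra\<close>, \<open>rb\<close>
  are the remainders of \<open>ker1_far\<close>. To leading order both gradients are parallel to n.
  By |n| = 1 the three terms with the kernel gradient then combine to - u_c, while the term with the
  kernel itself gives the cross product.\<close>

lemma radiation_error_algebra:
  fixes nc na nb g l m uc ua ub rc ra rb :: complex
  assumes "nc\<^sup>2 + na\<^sup>2 + nb\<^sup>2 = 1"
  shows "g * (l * ((- m * na) * ub - (- m * nb) * ua)) + (- \<i> * l * g * nc + rc) * - ((- m * nc) * uc + (- m * na) * ua + (- m * nb) * ub)
     + (- \<i> * l * g * na + ra) * ((- m * nc) * ua - (- m * na) * uc) + (- \<i> * l * g * nb + rb) * - ((- m * nb) * uc - (- m * nc) * ub)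
   = \<i> * m * l * g * (\<i> * (na * ub - nb * ua) - uc)
     + (m * (rc * (nc * uc + na * ua + nb * ub) - ra * (nc * ua - na * uc) + rb * (nb * uc - nc * ub)))"
proof -
  have "\<i> * m * l * g * uc * (nc\<^sup>2 + na\<^sup>2 + nb\<^sup>2) = \<i> * m * l * g * uc" using assms by simp
  then show ?thesis by (simp add: algebra_simps power2_eq_square)
qed

subsection \<open>The representation formula\<close>

text \<open>Rewriting \<open>vector\<close>, which is given by a list, as a componentwise definition
  reduces continuity to the components.\<close>

lemma continuous_on_rc_cross:
  assumes "continuous_on A p" "continuous_on A v" shows "continuous_on A (\<lambda>x. rc_cross (p x) (v x))"
proof -
  have eq: "rc_cross q w = (\<chi> j. if j = 1 then of_real (q $ 2) * w $ 3 - of_real (q $ 3) * w $ 2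
      else if j = 2 then of_real (q $ 3) * w $ 1 - of_real (q $ 1) * w $ 3
      else of_real (q $ 1) * w $ 2 - of_real (q $ 2) * w $ 1)" for q w
    by (simp add: rc_cross_def vec_eq_iff forall_3)
  have "continuous_on A (\<lambda>x. if j = 1 then of_real (p x $ 2) * v x $ 3 - of_real (p x $ 3) * v x $ 2
      else if j = 2 then of_real (p x $ 3) * v x $ 1 - of_real (p x $ 1) * v x $ 3
      else of_real (p x $ 1) * v x $ 2 - of_real (p x $ 2) * v x $ 1)" for j :: 3
    by (cases "j = 1"; cases "j = 2") (auto intro!: continuous_intros assms)
  then show ?thesis unfolding eq by (intro continuous_on_vec_lambda)
qed

context exterior_field
begin

text \<open>The integrand of the radiation hypothesis, with \<open>norm y\<close> for the radius, so
  that it is one function on the whole exterior instead of one for each sphere.\<close>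

definition rad_defect :: "real^3 \<Rightarrow> real" where
  "rad_defect y = norm (\<i> *s rc_cross (y /\<^sub>R norm y) (u y) - u y)"

text \<open>The parts of \<open>coef0\<close> to \<open>coefb\<close> that carry the gradient of the
  cut-off, and hence vanish unless R < |y| < 2 R.\<close>

definition err0 where "err0 c a b R y = of_real lam * (cutoff' R y $ a * u y $ b - cutoff' R y $ b * u y $ a)"
definition errc where "errc c a b R y = - (cutoff' R y $ c * u y $ c + cutoff' R y $ a * u y $ a + cutoff' R y $ b * u y $ b)"
definition erra where "erra c a b R y = cutoff' R y $ c * u y $ a - cutoff' R y $ a * u y $ c"
definition errb where "errb c a b R y = - (cutoff' R y $ b * u y $ c - cutoff' R y $ c * u y $ b)"

lemma coefs_split:
  "coef0 c a b R y = cutoff R y * (of_real lam * cv c a b y) + err0 c a b R y"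
  "coefc c a b R y = cutoff R y * (- dv y) + errc c a b R y"
  "coefa c a b R y = cutoff R y * cv b c a y + erra c a b R y"
  "coefb c a b R y = cutoff R y * (- cv a b c y) + errb c a b R y"
  by (simp_all add: coef0_def coefc_def coefa_def coefb_def err0_def errc_def erra_def errb_def algebra_simps)

text \<open>In the shell the gradient of the cut-off is at most 32/R^2 times 2 R, that is 64/R; the
  kernel is at most 2/R, because |x - y| \<ge> R/2; and each remainder \<open>\<rho>\<close> is at
  most 4 (2 |lam| |x| + 1)/R^2. So 128 is 64 times 2, and 1792 is 64 times 4 times 7, where 7 = 3 +
  2 + 2 counts the products of components of n and \<open>u\<close> that multiply the
  remainders.\<close>

lemma error_bound:
  assumes cyc: "cyclic c a b" and R: "R \<ge> 1" "2 * norm x \<le> R"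
  shows "norm (kern lam 0 x y (err0 c a b R) (errc c a b R) (erra c a b R) (errb c a b R) c a b)
    \<le> indicator {y. R < norm y \<and> norm y < 2 * R} y *
      (128 * \<bar>lam\<bar> / R\<^sup>2 * rad_defect y + 1792 * (2 * \<bar>lam\<bar> * norm x + 1) / R ^ 3 * norm (u y))"
proof (cases "R < norm y \<and> norm y < 2 * R")
  case False
  then have "cutoff' R y = 0" using cutoff_inside(2)[of R y] cutoff_outside(2)[of R y] R by linarith
  then have "kern lam 0 x y (err0 c a b R) (errc c a b R) (erra c a b R) (errb c a b R) c a b = 0"
    by (simp add: err0_def errc_def erra_def errb_def)
  then show ?thesis using False by simp
next
  case True
  have ny: "norm y > 0" "y \<noteq> 0" using True R by auto
  define \<nu> where "\<nu> j = complex_of_real (y $ j / norm y)" for j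
  obtain \<mu> where mu: "cutoff' R y = (\<chi> j. complex_of_real (- \<mu> * y $ j))" "0 \<le> \<mu>" "\<mu> \<le> 32 / R\<^sup>2" by (rule cutoff'_radial)
  define t where "t = complex_of_real (\<mu> * norm y)"
  define g where "g = ker0 lam 0 (x - y)"
  define \<rho> where "\<rho> j = ker1 lam 0 j (x - y) - (- \<i> * of_real lam * g * \<nu> j)" for j
  have k1: "ker1 lam 0 j (x - y) = - \<i> * of_real lam * g * \<nu> j + \<rho> j" for j by (simp add: \<rho>_def)
  have dh: "cutoff' R y $ j = - t * \<nu> j" for j
  proof -
    have "- \<mu> * y $ j = - (\<mu> * norm y) * (y $ j / norm y)" using ny by simp
    then show ?thesis
      unfolding mu(1) t_def \<nu>_def by (simp only: vec_lambda_beta of_real_mult[symmetric] of_real_minus[symmetric])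
  qed
  have sum1: "(\<nu> c)\<^sup>2 + (\<nu> a)\<^sup>2 + (\<nu> b)\<^sup>2 = 1"
  proof -
    have "(norm y)\<^sup>2 = (y $ c)\<^sup>2 + (y $ a)\<^sup>2 + (y $ b)\<^sup>2"
      unfolding power2_norm_eq_inner inner_vec_def using sum_cyclic[OF cyc, of "\<lambda>i. y $ i \<bullet> y $ i"] by (simp add: power2_eq_square)
    note this[symmetric]
    then have "(y $ c / norm y)\<^sup>2 + (y $ a / norm y)\<^sup>2 + (y $ b / norm y)\<^sup>2 = 1"
      unfolding power_divide add_divide_distrib[symmetric] using ny by simp
    then show ?thesis unfolding \<nu>_def by (simp only: of_real_power[symmetric] of_real_add[symmetric] of_real_1)
  qed
  have nxy: "R / 2 \<le> norm (x - y)" using norm_triangle_ineq2[of y x] True R by (simp add: norm_minus_commute)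
  then have xy: "x \<noteq> y" "norm (x - y) > 0" using R by auto
  have g: "norm g \<le> 2 / R"
  proof -
    have "norm g \<le> 1 / norm (x - y)" using norm_ker0_le[of "x - y" 0 lam] xy by (simp add: g_def)
    also have "\<dots> \<le> 1 / (R / 2)" using nxy R by (intro frac_le) auto
    finally show ?thesis by simp
  qed
  have rho: "norm (\<rho> j) \<le> 4 * (2 * \<bar>lam\<bar> * norm x + 1) / R\<^sup>2" for j
  proof -
    have "norm (\<rho> j) \<le> (2 * \<bar>lam\<bar> * norm x + 1) / (norm (x - y))\<^sup>2"
      unfolding \<rho>_def g_def \<nu>_def by (rule ker1_far[OF xy(1) ny(2)])
    also have "\<dots> \<le> (2 * \<bar>lam\<bar> * norm x + 1) / (R / 2)\<^sup>2"
      using nxy R by (intro frac_le power_mono) auto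
    finally show ?thesis by (simp add: power_divide)
  qed
  have nu: "norm (\<nu> j) \<le> 1" for j using component_le_norm_cart[of y j] ny by (simp add: \<nu>_def norm_divide)
  have t: "norm t \<le> 64 / R"
  proof -
    have "norm t = \<mu> * norm y" using mu(2) by (simp add: t_def norm_mult)
    also have "\<dots> \<le> 32 / R\<^sup>2 * (2 * R)" using mu True R by (intro mult_mono) auto
    finally show ?thesis using R by (simp add: power2_eq_square)
  qed
  have eq: "kern lam 0 x y (err0 c a b R) (errc c a b R) (erra c a b R) (errb c a b R) c a b
    = \<i> * t * of_real lam * g * (\<i> * (\<nu> a * u y $ b - \<nu> b * u y $ a) - u y $ c)
     + (t * (\<rho> c * (\<nu> c * u y $ c + \<nu> a * u y $ a + \<nu> b * u y $ b) - \<rho> a * (\<nu> c * u y $ a - \<nu> a * u y $ c) + \<rho> b * (\<nu> b * u y $ c - \<nu> c * u y $ b)))"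
    unfolding err0_def errc_def erra_def errb_def dh k1 g_def[symmetric] by (rule radiation_error_algebra[OF sum1])
  have 1: "norm (\<i> * t * of_real lam * g * (\<i> * (\<nu> a * u y $ b - \<nu> b * u y $ a) - u y $ c)) \<le> 128 * \<bar>lam\<bar> / R\<^sup>2 * rad_defect y"
  proof -
    have "\<i> * (\<nu> a * u y $ b - \<nu> b * u y $ a) - u y $ c = (\<i> *s rc_cross (y /\<^sub>R norm y) (u y) - u y) $ c"
      by (simp add: rc_cross_cyclic[OF cyc] \<nu>_def divide_inverse mult.commute)
    then have d: "norm (\<i> * (\<nu> a * u y $ b - \<nu> b * u y $ a) - u y $ c) \<le> rad_defect y"
      unfolding rad_defect_def using vec3_component_le by metis
    have "norm (\<i> * t * of_real lam * g * (\<i> * (\<nu> a * u y $ b - \<nu> b * u y $ a) - u y $ c)) \<le> (64 / R * \<bar>lam\<bar> * (2 / R)) * rad_defect y"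
      unfolding norm_mult norm_of_real norm_ii mult_1_left using t g d R by (intro mult_mono) auto
    then show ?thesis using R by (simp add: power2_eq_square)
  qed
  define r where "r = 4 * (2 * \<bar>lam\<bar> * norm x + 1) / R\<^sup>2"
  have r0: "0 \<le> r" unfolding r_def by (intro divide_nonneg_nonneg mult_nonneg_nonneg add_nonneg_nonneg) auto
  have nuu: "norm (\<nu> i * u y $ j) \<le> norm (u y)" for i j
    unfolding norm_mult using mult_mono[OF nu[of i] vec3_component_le[of "u y" j]] by simp
  have 2: "norm (t * (\<rho> c * (\<nu> c * u y $ c + \<nu> a * u y $ a + \<nu> b * u y $ b) - \<rho> a * (\<nu> c * u y $ a - \<nu> a * u y $ c) + \<rho> b * (\<nu> b * u y $ c - \<nu> c * u y $ b)))
     \<le> 1792 * (2 * \<bar>lam\<bar> * norm x + 1) / R ^ 3 * norm (u y)"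
  proof -
    have "norm (\<nu> c * u y $ c + \<nu> a * u y $ a + \<nu> b * u y $ b) \<le> 3 * norm (u y)"
      using nuu[of c c] nuu[of a a] nuu[of b b] norm_triangle_ineq[of "\<nu> c * u y $ c + \<nu> a * u y $ a" "\<nu> b * u y $ b"] norm_triangle_ineq[of "\<nu> c * u y $ c" "\<nu> a * u y $ a"] by linarith
    from mult_mono[OF rho[of c, folded r_def] this] have A: "norm (\<rho> c * (\<nu> c * u y $ c + \<nu> a * u y $ a + \<nu> b * u y $ b)) \<le> r * (3 * norm (u y))"
      using r0 by (simp add: norm_mult)
    have "norm (\<nu> c * u y $ a - \<nu> a * u y $ c) \<le> 2 * norm (u y)"
      using nuu[of c a] nuu[of a c] norm_triangle_ineq4[of "\<nu> c * u y $ a" "\<nu> a * u y $ c"] by linarith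
    from mult_mono[OF rho[of a, folded r_def] this] have B: "norm (\<rho> a * (\<nu> c * u y $ a - \<nu> a * u y $ c)) \<le> r * (2 * norm (u y))"
      using r0 by (simp add: norm_mult)
    have "norm (\<nu> b * u y $ c - \<nu> c * u y $ b) \<le> 2 * norm (u y)"
      using nuu[of b c] nuu[of c b] norm_triangle_ineq4[of "\<nu> b * u y $ c" "\<nu> c * u y $ b"] by linarith
    from mult_mono[OF rho[of b, folded r_def] this] have C: "norm (\<rho> b * (\<nu> b * u y $ c - \<nu> c * u y $ b)) \<le> r * (2 * norm (u y))"
      using r0 by (simp add: norm_mult)
    have "norm (\<rho> c * (\<nu> c * u y $ c + \<nu> a * u y $ a + \<nu> b * u y $ b) - \<rho> a * (\<nu> c * u y $ a - \<nu> a * u y $ c) + \<rho> b * (\<nu> b * u y $ c - \<nu> c * u y $ b)) \<le> r * (3 * norm (u y)) + r * (2 * norm (u y)) + r * (2 * norm (u y))"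
      by (rule order_trans[OF norm_triangle_ineq add_mono[OF order_trans[OF norm_triangle_ineq4 add_mono[OF A B]] C]])
    also have "\<dots> = 7 * r * norm (u y)" by simp
    finally have "norm (t * (\<rho> c * (\<nu> c * u y $ c + \<nu> a * u y $ a + \<nu> b * u y $ b) - \<rho> a * (\<nu> c * u y $ a - \<nu> a * u y $ c) + \<rho> b * (\<nu> b * u y $ c - \<nu> c * u y $ b)))
      \<le> 64 / R * (7 * r * norm (u y))"
      unfolding norm_mult[of t] using t r0 R by (intro mult_mono) auto
    also have "64 / R * (7 * r * norm (u y)) = 1792 * (2 * \<bar>lam\<bar> * norm x + 1) / R ^ 3 * norm (u y)"
    proof -
      have "64 / R * (7 * (4 * k / R\<^sup>2) * n) = 1792 * k / R ^ 3 * n" for k n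
        using R by (simp add: power2_eq_square power3_eq_cube)
      then show ?thesis unfolding r_def .
    qed
    finally show ?thesis .
  qed
  show ?thesis unfolding eq using norm_triangle_mono[OF 1 2] True by simp
qed

end

text \<open>The hypotheses in the form in which they are used. The decay of the sources is a bound
  on the whole exterior with one constant, which is possible because the ball of radius \<delta>
  inside \<open>G\<close> keeps the exterior away from the origin.\<close>

locale decaying_field = exterior_field +
  fixes C \<delta> \<rho> :: real
  assumes C: "C \<ge> 0" and \<delta>: "\<delta> > 0" and rho: "2 < \<rho>" "\<rho> < 3" and ball: "ball 0 \<delta> \<subseteq> G"
    and dv_decay: "\<And>y. y \<in> \<Omega> \<Longrightarrow> norm (dv y) \<le> C * norm y powr (- \<rho>)"
    and cv_decay: "\<And>c a b y. cyclic c a b \<Longrightarrow> y \<in> \<Omega> \<Longrightarrow> norm (cv c a b y) \<le> C * norm y powr (- \<rho>)"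
    and radiation: "(\<lambda>R. LINT x:sphere 0 R|surface_measure (sphere 0 R). norm (\<i> *s rc_cross (x /\<^sub>R R) (u x) - u x)) \<in> o[at_top](\<lambda>R. R)"
    and average: "(\<lambda>R. LINT x:sphere 0 R|surface_measure (sphere 0 R). norm (u x)) \<in> o[at_top](\<lambda>R. R\<^sup>2)"
begin

lemma ext_norm: "y \<in> \<Omega> \<Longrightarrow> \<delta> \<le> norm y"
  using ball closure_subset[of G] by (force simp: not_less[symmetric])

lemma density:
  assumes k: "continuous_on (closure \<Omega>) k" and d: "\<And>y. y \<in> \<Omega> \<Longrightarrow> norm (k y) \<le> C * norm y powr (- \<rho>)"
  shows "decaying_density (\<lambda>y. indicator \<Omega> y *\<^sub>R k y) C \<delta> \<rho>"
proof
  show "(\<lambda>y. indicator \<Omega> y *\<^sub>R k y) \<in> borel_measurable borel"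
    by (intro borel_measurable_continuous_on_indicator continuous_on_subset[OF k closure_subset] ext_borel)
  show "norm (indicator \<Omega> y *\<^sub>R k y) \<le> C * norm y powr (- \<rho>)" for y
    using d[of y] C by (cases "y \<in> \<Omega>") auto
  show "indicator \<Omega> y *\<^sub>R k y = 0" if "norm y < \<delta>" for y using ext_norm[of y] that by (auto simp: indicator_def)
qed (use C \<delta> rho in auto)

lemma density_dv: "decaying_density (\<lambda>y. indicator \<Omega> y *\<^sub>R dv y) C \<delta> \<rho>"
  by (rule density[OF continuous_dv dv_decay])

lemma density_cv:
  assumes "cyclic c a b" shows "decaying_density (\<lambda>y. indicator \<Omega> y *\<^sub>R cv c a b y) C \<delta> \<rho>"
  by (rule density[OF continuous_cv cv_decay[OF assms]])

lemma admissible_density: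
  assumes "decaying_density (\<lambda>y. indicator \<Omega> y *\<^sub>R k y) C \<delta> \<rho>"
  shows "admissible lborel \<Omega> x k"
proof -
  interpret decaying_density "\<lambda>y. indicator \<Omega> y *\<^sub>R k y" C \<delta> \<rho> by fact
  have "integrable lborel (\<lambda>y. complex_of_real (sing (x - y)) * (indicator \<Omega> y *\<^sub>R k y))"
    by (rule integrable_kernel[where c=1]) (auto simp: sing_nonneg)
  from integrable_norm[OF this] have "integrable lborel (\<lambda>y. sing (x - y) * norm (indicator \<Omega> y *\<^sub>R k y))"
    by (simp only: norm_mult norm_of_real abs_of_nonneg[OF sing_nonneg])
  moreover have "AE y in lborel. indicator \<Omega> y *\<^sub>R k y \<noteq> 0 \<longrightarrow> y \<noteq> x"
    using AE_lborel_singleton[of x] by eventually_elim simp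
  ultimately show ?thesis using f by (simp only: admissible_def sets_lborel simp_thms)
qed

text \<open>The cut-off is bounded by 1, and at any given point it equals 1 as soon as n is large,
  so the uncut integrand itself is the majorant.\<close>

lemma cutoff_limit:
  fixes \<kappa> k :: "real^3 \<Rightarrow> complex"
  assumes i: "set_integrable lborel \<Omega> (\<lambda>y. \<kappa> y * k y)"
  shows "(\<lambda>n. LINT y:\<Omega>|lborel. \<kappa> y * (cutoff (real (Suc n)) y * k y)) \<longlonglongrightarrow> (LINT y:\<Omega>|lborel. \<kappa> y * k y)"
  unfolding set_lebesgue_integral_def
proof (rule integral_dominated_convergence[where w="\<lambda>y. norm (indicator \<Omega> y *\<^sub>R (\<kappa> y * k y))"])
  have m [measurable]: "(\<lambda>y. indicator \<Omega> y *\<^sub>R (\<kappa> y * k y)) \<in> borel_measurable lborel"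
    using i unfolding set_integrable_def by (rule borel_measurable_integrable)
  have c [measurable]: "cutoff (real (Suc n)) \<in> borel_measurable borel" for n
    using C1_on_cutoff[of "real (Suc n)"] by (intro borel_measurable_continuous_onI) (simp add: C1_on_def)
  have eq: "indicator \<Omega> y *\<^sub>R (\<kappa> y * (cutoff (real (Suc n)) y * k y)) = cutoff (real (Suc n)) y * (indicator \<Omega> y *\<^sub>R (\<kappa> y * k y))" for n y
    by simp
  show "(\<lambda>y. indicator \<Omega> y *\<^sub>R (\<kappa> y * k y)) \<in> borel_measurable lborel" by (rule m)
  show "(\<lambda>y. indicator \<Omega> y *\<^sub>R (\<kappa> y * (cutoff (real (Suc n)) y * k y))) \<in> borel_measurable lborel" for n
    unfolding eq by measurable
  show "integrable lborel (\<lambda>y. norm (indicator \<Omega> y *\<^sub>R (\<kappa> y * k y)))"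
    using i unfolding set_integrable_def by (rule integrable_norm)
  show "AE y in lborel. (\<lambda>n. indicator \<Omega> y *\<^sub>R (\<kappa> y * (cutoff (real (Suc n)) y * k y))) \<longlonglongrightarrow> indicator \<Omega> y *\<^sub>R (\<kappa> y * k y)"
  proof (rule AE_I2, rule tendsto_eventually)
    fix y :: "real^3"
    obtain N where "norm y \<le> real N" using real_arch_simple by blast
    then show "\<forall>\<^sub>F n in sequentially. indicator \<Omega> y *\<^sub>R (\<kappa> y * (cutoff (real (Suc n)) y * k y)) = indicator \<Omega> y *\<^sub>R (\<kappa> y * k y)"
      by (intro eventually_sequentiallyI[of N]) (simp add: cutoff_inside(1))
  qed
  show "AE y in lborel. norm (indicator \<Omega> y *\<^sub>R (\<kappa> y * (cutoff (real (Suc n)) y * k y))) \<le> norm (indicator \<Omega> y *\<^sub>R (\<kappa> y * k y))" for n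
    unfolding eq norm_mult[of "cutoff _ _"] by (intro AE_I2 mult_left_le_one_le norm_cutoff_le) auto
qed

lemma rad_defect_continuous: "continuous_on \<Omega> rad_defect"
  unfolding rad_defect_def[abs_def] vector_scalar_mult_def
  using ext_norm \<delta> by (intro continuous_intros continuous_on_rc_cross continuous_on_subset[OF continuous_u closure_subset]) force+

lemma bounded_boundary: "\<exists>R0>0. closure G \<subseteq> ball 0 R0"
proof -
  have "bounded G" using G by (simp add: bounded_domain_of_class_def)
  then obtain B where B: "\<And>y. y \<in> closure G \<Longrightarrow> norm y \<le> B" using bounded_closure[of G] unfolding bounded_iff by blast
  then show ?thesis by (intro exI[of _ "\<bar>B\<bar> + 1"]) force
qed

text \<open>Up to constants, the first spherical mean contributes R^-2 times \<epsilon> R times the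
  width R of the shell, and the second one R^-3 times \<epsilon> R^2 times R; both are of order
  \<epsilon>. This holds once R is so large that the shell lies in the exterior and 2 |x| \<le>
  R.\<close>

lemma error_limit:
  assumes cyc: "cyclic c a b"
  shows "(\<lambda>n. LINT y:\<Omega>|lborel. kern lam 0 x y (err0 c a b (real (Suc n))) (errc c a b (real (Suc n))) (erra c a b (real (Suc n))) (errb c a b (real (Suc n))) c a b) \<longlonglongrightarrow> 0"
proof (rule LIMSEQ_I)
  fix e :: real assume e: "e > 0"
  define A where "A = 128 * \<bar>lam\<bar>"
  define B where "B = 1792 * (2 * \<bar>lam\<bar> * norm x + 1)"
  have AB: "A \<ge> 0" "B \<ge> 0" by (auto simp: A_def B_def intro: add_nonneg_nonneg)
  \<comment> \<open>The final bound is \<open>(4 * A + 8 * B) * \<epsilon>\<close>. The added 1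
    keeps the denominator positive, and the factor 2 leaves room for a strict inequality.\<close>
  define \<epsilon> where "\<epsilon> = e / (2 * (4 * A + 8 * B + 1))"
  have den: "4 * A + 8 * B + 1 > 0" using AB by linarith
  have \<epsilon>: "\<epsilon> > 0" using e den by (simp add: \<epsilon>_def)
  obtain R0 where R0: "R0 > 0" "closure G \<subseteq> ball 0 R0" using bounded_boundary by blast
  have "\<forall>\<^sub>F R in at_top. norm (LINT x:sphere 0 R|surface_measure (sphere 0 R). norm (\<i> *s rc_cross (x /\<^sub>R R) (u x) - u x)) \<le> \<epsilon> * norm R"
    by (rule landau_o.smallD[OF radiation \<epsilon>])
  then obtain R1 where R1: "\<And>R. R \<ge> R1 \<Longrightarrow> norm (LINT x:sphere 0 R|surface_measure (sphere 0 R). norm (\<i> *s rc_cross (x /\<^sub>R R) (u x) - u x)) \<le> \<epsilon> * norm R"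
    unfolding eventually_at_top_linorder by blast
  have "\<forall>\<^sub>F R in at_top. norm (LINT x:sphere 0 R|surface_measure (sphere 0 R). norm (u x)) \<le> \<epsilon> * norm (R\<^sup>2)"
    by (rule landau_o.smallD[OF average \<epsilon>])
  then obtain R2 where R2: "\<And>R. R \<ge> R2 \<Longrightarrow> norm (LINT x:sphere 0 R|surface_measure (sphere 0 R). norm (u x)) \<le> \<epsilon> * norm (R\<^sup>2)"
    unfolding eventually_at_top_linorder by blast
  obtain N :: nat where N: "max (max R0 R1) (max R2 (2 * norm x)) \<le> real N" using real_arch_simple by blast
  show "\<exists>no. \<forall>n\<ge>no. norm ((LINT y:\<Omega>|lborel. kern lam 0 x y (err0 c a b (real (Suc n))) (errc c a b (real (Suc n))) (erra c a b (real (Suc n))) (errb c a b (real (Suc n))) c a b) - 0) < e"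
  proof (intro exI allI impI)
    fix n assume "n \<ge> N"
    define R where "R = real (Suc n)"
    have R: "R \<ge> 1" "R0 \<le> R" "R1 \<le> R" "R2 \<le> R" "2 * norm x \<le> R" using N \<open>n \<ge> N\<close> by (auto simp: R_def)
    have sph: "sphere 0 r \<subseteq> \<Omega>" if "R < r" for r using that R R0(2) by force
    define F1 where "F1 y = indicator \<Omega> y *\<^sub>R rad_defect y" for y
    define F2 where "F2 y = indicator \<Omega> y *\<^sub>R norm (u y)" for y
    have m1 [measurable]: "F1 \<in> borel_measurable borel" unfolding F1_def[abs_def]
      by (intro borel_measurable_continuous_on_indicator rad_defect_continuous ext_borel)
    have cu: "continuous_on \<Omega> (\<lambda>y. norm (u y))" by (intro continuous_intros continuous_on_subset[OF continuous_u closure_subset])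
    have m2 [measurable]: "F2 \<in> borel_measurable borel" unfolding F2_def[abs_def]
      by (intro borel_measurable_continuous_on_indicator cu ext_borel)
    let ?X = "{y. R < norm y \<and> norm y < 2 * R}"
    have mX [measurable]: "?X \<in> sets (borel :: (real^3) measure)"
      by (intro borel_open open_Collect_conj open_Collect_less continuous_intros)
    have I1: "(\<integral>\<^sup>+y. indicator ?X y * ennreal (F1 y) \<partial>lborel) \<le> 2 * ennreal (\<epsilon> * (2 * R)) * ennreal (2 * R - R)"
    proof (rule nn_integral_annulus_le)
      show "0 < R" using R by simp
      show "0 \<le> F1 y" for y by (simp add: F1_def rad_defect_def)
      fix r assume r: "R < r" "r < 2 * R"
      show "continuous_on (sphere 0 r) F1"
        by (rule continuous_on_eq[OF continuous_on_subset[OF rad_defect_continuous sph[OF r(1)]]]) (use sph[OF r(1)] in \<open>auto simp: F1_def\<close>)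
      have "(LINT y:sphere 0 r|surface_measure (sphere 0 r). F1 y) = (LINT x:sphere 0 r|surface_measure (sphere 0 r). norm (\<i> *s rc_cross (x /\<^sub>R r) (u x) - u x))"
        unfolding set_lebesgue_integral_def
      proof (rule Bochner_Integration.integral_cong[OF refl])
        fix y show "indicator (sphere 0 r) y *\<^sub>R F1 y = indicator (sphere 0 r) y *\<^sub>R norm (\<i> *s rc_cross (y /\<^sub>R r) (u y) - u y)"
          using sph[OF r(1)] by (cases "y \<in> sphere 0 r") (auto simp: F1_def rad_defect_def)
      qed
      also have "\<dots> \<le> \<epsilon> * norm r" using R1[of r] r R by (simp add: abs_le_iff)
      also have "\<dots> \<le> \<epsilon> * (2 * R)" using r R \<epsilon> by (intro mult_left_mono) auto
      finally show "(LINT y:sphere 0 r|surface_measure (sphere 0 r). F1 y) \<le> \<epsilon> * (2 * R)" .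
    qed (rule m1)
    have I2: "(\<integral>\<^sup>+y. indicator ?X y * ennreal (F2 y) \<partial>lborel) \<le> 2 * ennreal (\<epsilon> * (2 * R)\<^sup>2) * ennreal (2 * R - R)"
    proof (rule nn_integral_annulus_le)
      show "0 < R" using R by simp
      show "0 \<le> F2 y" for y by (simp add: F2_def)
      fix r assume r: "R < r" "r < 2 * R"
      show "continuous_on (sphere 0 r) F2"
        by (rule continuous_on_eq[OF continuous_on_subset[OF cu sph[OF r(1)]]]) (use sph[OF r(1)] in \<open>auto simp: F2_def\<close>)
      have "(LINT y:sphere 0 r|surface_measure (sphere 0 r). F2 y) = (LINT x:sphere 0 r|surface_measure (sphere 0 r). norm (u x))"
        unfolding set_lebesgue_integral_def
      proof (rule Bochner_Integration.integral_cong[OF refl])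
        fix y show "indicator (sphere 0 r) y *\<^sub>R F2 y = indicator (sphere 0 r) y *\<^sub>R norm (u y)"
          using sph[OF r(1)] by (cases "y \<in> sphere 0 r") (auto simp: F2_def)
      qed
      also have "\<dots> \<le> \<epsilon> * norm (r\<^sup>2)" using R2[of r] r R by (simp add: abs_le_iff)
      also have "\<dots> \<le> \<epsilon> * (2 * R)\<^sup>2" using r R \<epsilon> power_mono[of r "2 * R" 2] by (intro mult_left_mono) auto
      finally show "(LINT y:sphere 0 r|surface_measure (sphere 0 r). F2 y) \<le> \<epsilon> * (2 * R)\<^sup>2" .
    qed (rule m2)
    let ?K = "\<lambda>y. kern lam 0 x y (err0 c a b R) (errc c a b R) (erra c a b R) (errb c a b R) c a b"
    have i: "set_integrable lborel \<Omega> ?K"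
    proof (rule admissible_kern(1))
      have cc: "continuous_on (closure \<Omega>) (cutoff' R)"
        using C1_on_cutoff[of R] R by (auto simp: C1_on_def intro: continuous_on_subset)
      have z: "cutoff' R y = 0" if "2 * R < norm y" for y using cutoff_outside(2)[of R y] that R by simp
      show "admissible lborel \<Omega> x (err0 c a b R)" "admissible lborel \<Omega> x (errc c a b R)" "admissible lborel \<Omega> x (erra c a b R)" "admissible lborel \<Omega> x (errb c a b R)"
        unfolding err0_def[abs_def] errc_def[abs_def] erra_def[abs_def] errb_def[abs_def]
        by (rule admissible_compact_support[where L="2 * R"], (intro continuous_intros cc continuous_u), simp add: z)+
    qed
    have "ennreal (norm (LINT y:\<Omega>|lborel. ?K y)) \<le> (\<integral>\<^sup>+y. norm (indicator \<Omega> y *\<^sub>R ?K y) \<partial>lborel)"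
      unfolding set_lebesgue_integral_def using i unfolding set_integrable_def by (rule integral_norm_bound_ennreal)
    also have "\<dots> \<le> (\<integral>\<^sup>+y. ennreal (A / R\<^sup>2) * (indicator ?X y * ennreal (F1 y)) + ennreal (B / R ^ 3) * (indicator ?X y * ennreal (F2 y)) \<partial>lborel)"
    proof (rule nn_integral_mono)
      fix y :: "real^3"
      have "norm (indicator \<Omega> y *\<^sub>R ?K y) \<le> indicator \<Omega> y * (indicator ?X y * (A / R\<^sup>2 * rad_defect y + B / R ^ 3 * norm (u y)))"
        unfolding norm_scaleR A_def B_def using error_bound[OF cyc R(1,5)] by (simp add: mult_left_mono)
      also have "\<dots> = indicator ?X y * (A / R\<^sup>2 * F1 y + B / R ^ 3 * F2 y)" by (simp add: F1_def F2_def algebra_simps)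
      finally have le: "ennreal (norm (indicator \<Omega> y *\<^sub>R ?K y)) \<le> ennreal (indicator ?X y * (A / R\<^sup>2 * F1 y + B / R ^ 3 * F2 y))" by (rule ennreal_leI)
      have "0 \<le> F1 y" "0 \<le> F2 y" by (simp_all add: F1_def F2_def rad_defect_def)
      then have "ennreal (indicator ?X y * (A / R\<^sup>2 * F1 y + B / R ^ 3 * F2 y)) = ennreal (A / R\<^sup>2) * (indicator ?X y * ennreal (F1 y)) + ennreal (B / R ^ 3) * (indicator ?X y * ennreal (F2 y))"
        using AB R by (cases "y \<in> ?X") (auto simp: ennreal_mult[symmetric] ennreal_plus[symmetric] simp del: ennreal_plus)
      with le show "ennreal (norm (indicator \<Omega> y *\<^sub>R ?K y)) \<le> ennreal (A / R\<^sup>2) * (indicator ?X y * ennreal (F1 y)) + ennreal (B / R ^ 3) * (indicator ?X y * ennreal (F2 y))" by simp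
    qed
    also have "\<dots> = ennreal (A / R\<^sup>2) * (\<integral>\<^sup>+y. indicator ?X y * ennreal (F1 y) \<partial>lborel) + ennreal (B / R ^ 3) * (\<integral>\<^sup>+y. indicator ?X y * ennreal (F2 y) \<partial>lborel)"
      by (subst nn_integral_add) (auto simp: nn_integral_cmult)
    also have "\<dots> \<le> ennreal (A / R\<^sup>2) * (2 * ennreal (\<epsilon> * (2 * R)) * ennreal (2 * R - R)) + ennreal (B / R ^ 3) * (2 * ennreal (\<epsilon> * (2 * R)\<^sup>2) * ennreal (2 * R - R))"
      by (intro add_mono mult_left_mono I1 I2) auto
    also have "\<dots> = ennreal (A / R\<^sup>2 * (2 * (\<epsilon> * (2 * R)) * (2 * R - R)) + B / R ^ 3 * (2 * (\<epsilon> * (2 * R)\<^sup>2) * (2 * R - R)))"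
    proof -
      have t: "(2::ennreal) = ennreal 2" by simp
      show ?thesis unfolding t using AB R \<epsilon>
        by (simp only: ennreal_mult[symmetric] ennreal_plus[symmetric] mult_nonneg_nonneg divide_nonneg_nonneg zero_le_power add_nonneg_nonneg)
    qed
    also have "A / R\<^sup>2 * (2 * (\<epsilon> * (2 * R)) * (2 * R - R)) + B / R ^ 3 * (2 * (\<epsilon> * (2 * R)\<^sup>2) * (2 * R - R)) = (4 * A + 8 * B) * \<epsilon>"
      using R by (simp add: power2_eq_square power3_eq_cube field_simps)
    finally have "norm (LINT y:\<Omega>|lborel. ?K y) \<le> (4 * A + 8 * B) * \<epsilon>"
      using AB \<epsilon> by (simp add: ennreal_le_iff)
    also have "\<dots> \<le> (4 * A + 8 * B + 1) * \<epsilon>" using \<epsilon> by (intro mult_right_mono) auto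
    also have "\<dots> = e / 2"
    proof -
      have "d * (e / (2 * d)) = e / 2" if "d > 0" for d using that by simp
      from this[OF den] show ?thesis unfolding \<epsilon>_def .
    qed
    also have "\<dots> < e" using e by simp
    finally show "norm ((LINT y:\<Omega>|lborel. kern lam 0 x y (err0 c a b (real (Suc n))) (errc c a b (real (Suc n))) (erra c a b (real (Suc n))) (errb c a b (real (Suc n))) c a b) - 0) < e"
      by (simp add: R_def)
  qed
qed

text \<open>For all large n the identity for the cut-off field has the same left side, and
  \<open>coefs_split\<close> separates its volume integral into cut-off sources and an error. The
  former converge by \<open>cutoff_limit\<close>, the latter to 0. The integrability that the
  separation requires comes from compact support.\<close>

theorem representation:
  assumes cyc: "cyclic c a b" and x: "x \<in> \<Omega>"
  shows "u x $ c = (LINT y:\<Omega>|lborel. kern lam 0 x y (\<lambda>y. of_real lam * cv c a b y) (\<lambda>y. - dv y) (cv b c a) (\<lambda>y. - cv a b c y) c a b)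
    + (LINT y:S|\<sigma>. kern lam 0 x y (coefS0 c a b) (coefSc c a b) (coefSa c a b) (coefSb c a b) c a b)"
proof -
  let ?W = "LINT y:S|\<sigma>. kern lam 0 x y (coefS0 c a b) (coefSc c a b) (coefSa c a b) (coefSb c a b) c a b"
  have cyc': "cyclic b c a" "cyclic a b c" using cyc cyclic_rotate by blast+
  have adm: "admissible lborel \<Omega> x (\<lambda>y. of_real lam * cv c a b y)" "admissible lborel \<Omega> x (\<lambda>y. - dv y)"
    "admissible lborel \<Omega> x (cv b c a)" "admissible lborel \<Omega> x (\<lambda>y. - cv a b c y)"
    by - (rule admissible_cmult[OF admissible_density[OF density_cv[OF cyc]]], rule admissible_minus[OF admissible_density[OF density_dv]],
      rule admissible_density[OF density_cv[OF cyc'(1)]], rule admissible_minus[OF admissible_density[OF density_cv[OF cyc'(2)]]])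
  let ?h = "\<lambda>n y. cutoff (real (Suc n)) y"
  let ?I = "\<lambda>n. LINT y:\<Omega>|lborel. kern lam 0 x y (\<lambda>y. ?h n y * (of_real lam * cv c a b y)) (\<lambda>y. ?h n y * - dv y) (\<lambda>y. ?h n y * cv b c a y) (\<lambda>y. ?h n y * - cv a b c y) c a b"
  let ?E = "\<lambda>n. LINT y:\<Omega>|lborel. kern lam 0 x y (err0 c a b (real (Suc n))) (errc c a b (real (Suc n))) (erra c a b (real (Suc n))) (errb c a b (real (Suc n))) c a b"
  have cc: "continuous_on (closure \<Omega>) (cutoff (real (Suc n)))" "continuous_on (closure \<Omega>) (cutoff' (real (Suc n)))" for n
    using C1_on_cutoff[of "real (Suc n)"] by (auto simp: C1_on_def intro: continuous_on_subset)
  have z: "cutoff (real (Suc n)) y = 0" "cutoff' (real (Suc n)) y = 0" if "2 * real (Suc n) < norm y" for n y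
    using cutoff_outside[of "real (Suc n)" y] that by simp_all
  have admh: "admissible lborel \<Omega> x (\<lambda>y. ?h n y * (of_real lam * cv c a b y))" "admissible lborel \<Omega> x (\<lambda>y. ?h n y * - dv y)"
    "admissible lborel \<Omega> x (\<lambda>y. ?h n y * cv b c a y)" "admissible lborel \<Omega> x (\<lambda>y. ?h n y * - cv a b c y)" for n
    by (rule admissible_compact_support[where L="2 * real (Suc n)"], (intro continuous_intros cc continuous_dv continuous_cv), simp only: z mult_zero_left)+
  have adme: "admissible lborel \<Omega> x (err0 c a b (real (Suc n)))" "admissible lborel \<Omega> x (errc c a b (real (Suc n)))"
     "admissible lborel \<Omega> x (erra c a b (real (Suc n)))" "admissible lborel \<Omega> x (errb c a b (real (Suc n)))" for n
    unfolding err0_def[abs_def] errc_def[abs_def] erra_def[abs_def] errb_def[abs_def]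
    by (rule admissible_compact_support[where L="2 * real (Suc n)"], (intro continuous_intros cc continuous_u), simp only: z zero_index mult_zero_left mult_zero_right diff_zero add_0 minus_zero)+
  have "?I \<longlonglongrightarrow> (LINT y:\<Omega>|lborel. kern lam 0 x y (\<lambda>y. of_real lam * cv c a b y) (\<lambda>y. - dv y) (cv b c a) (\<lambda>y. - cv a b c y) c a b)"
    unfolding admissible_kern(2)[OF admh] admissible_kern(2)[OF adm]
    by (intro tendsto_add cutoff_limit admissible_kernels(1)[OF adm(1)] admissible_kernels(2)[OF adm(2)] admissible_kernels(2)[OF adm(3)] admissible_kernels(2)[OF adm(4)])
  moreover have "?E \<longlonglongrightarrow> 0" by (rule error_limit[OF cyc])
  ultimately have lim: "(\<lambda>n. ?I n + ?E n + ?W) \<longlonglongrightarrow> (LINT y:\<Omega>|lborel. kern lam 0 x y (\<lambda>y. of_real lam * cv c a b y) (\<lambda>y. - dv y) (cv b c a) (\<lambda>y. - cv a b c y) c a b) + 0 + ?W"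
    by (intro tendsto_add tendsto_const)
  have ev: "\<forall>\<^sub>F n in sequentially. ?I n + ?E n + ?W = u x $ c"
  proof -
    obtain R0 where R0: "R0 > 0" "closure G \<subseteq> ball 0 R0" using bounded_boundary by blast
    obtain N :: nat where N: "max R0 (norm x) \<le> real N" using real_arch_simple by blast
    show ?thesis
    proof (rule eventually_sequentiallyI[of N])
      fix n assume "N \<le> n"
      then have R: "real (Suc n) > 0" "norm x < real (Suc n)" "R0 \<le> real (Suc n)" using N by auto
      have SR: "S \<subseteq> cball 0 (real (Suc n))" using R(3) R0(2) by (force simp: frontier_def)
      have "?I n + ?E n = (LINT y:\<Omega>|lborel. kern lam 0 x y (coef0 c a b (real (Suc n))) (coefc c a b (real (Suc n))) (coefa c a b (real (Suc n))) (coefb c a b (real (Suc n))) c a b)"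
        unfolding set_integral_add(2)[OF admissible_kern(1)[OF admh] admissible_kern(1)[OF adme], symmetric] coefs_split
        by (simp only: distrib_left ac_simps)
      then show "?I n + ?E n + ?W = u x $ c" using cutoff_identity[OF cyc x R(2,1) SR] by simp
    qed
  qed
  from LIMSEQ_unique[OF tendsto_eventually[OF ev] lim] show ?thesis by (simp only: add_0_right)
qed

end

section \<open>Vector potentials and their scalar components\<close>

lemma bounded_linear_axis: "bounded_linear (axis c :: complex \<Rightarrow> complex^3)"
  unfolding linear_conv_bounded_linear[symmetric]
  by (rule linearI) (simp_all add: vec_eq_iff axis_def)

lemma set_integrable_vec:
  fixes f :: "'a \<Rightarrow> complex^3"
  assumes "\<And>c. set_integrable M A (\<lambda>y. f y $ c)" shows "set_integrable M A f"
proof -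
  have "indicator A y *\<^sub>R f y = (\<Sum>c\<in>UNIV. axis c (indicator A y *\<^sub>R f y $ c))" for y
    by (simp add: vec_eq_iff axis_def)
  moreover have "integrable M (\<lambda>y. \<Sum>c\<in>UNIV. axis c (indicator A y *\<^sub>R f y $ c))"
    using assms unfolding set_integrable_def
    by (intro Bochner_Integration.integrable_sum integrable_bounded_linear[OF bounded_linear_axis])
  ultimately show ?thesis by (simp only: set_integrable_def)
qed

lemma set_integral_vec_nth:
  fixes f :: "'a \<Rightarrow> complex^3"
  assumes "set_integrable M A f" shows "(LINT y:A|M. f y) $ c = (LINT y:A|M. f y $ c)"
  using integral_bounded_linear[OF bounded_linear_vec_nth assms[unfolded set_integrable_def], of c]
  by (simp add: set_lebesgue_integral_def)

lemma set_integral_factor: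
  fixes \<kappa> f :: "'a \<Rightarrow> complex"
  shows "(LINT y:A|M. \<kappa> y * (c * f y)) = c * (LINT y:A|M. \<kappa> y * f y)"
proof -
  have "(LINT y:A|M. \<kappa> y * (c * f y)) = (LINT y:A|M. c * (\<kappa> y * f y))" by (simp only: mult.left_commute)
  then show ?thesis by simp
qed

lemma set_integral_factor_minus:
  fixes \<kappa> f :: "'a \<Rightarrow> complex"
  shows "(LINT y:A|M. \<kappa> y * (- f y)) = - (LINT y:A|M. \<kappa> y * f y)"
  using set_integral_factor[where c="- 1" and \<kappa>=\<kappa> and f=f and A=A and M=M] by simp

lemma partial_deriv_eq:
  assumes "(f has_derivative f') (at x)" shows "partial_deriv j f x = f' (axis j 1)"
  using frechet_derivative_at[OF assms] by (simp add: partial_deriv_def)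

lemma sum_axis: "(\<Sum>i\<in>UNIV. (axis j 1 :: real^3) $ i *\<^sub>R (g i :: complex)) = g j"
  by (simp add: axis_def if_distrib[of "\<lambda>c. c *\<^sub>R _"] cong: if_cong)

lemma has_derivative_vec3:
  fixes f :: "real^3 \<Rightarrow> complex^3"
  assumes "\<And>c. ((\<lambda>x. f x $ c) has_derivative (\<lambda>h. f' h $ c)) (at x)"
  shows "(f has_derivative f') (at x)"
proof -
  have "((\<lambda>x. \<Sum>c\<in>UNIV. axis c (f x $ c)) has_derivative (\<lambda>h. \<Sum>c\<in>UNIV. axis c (f' h $ c))) (at x)"
    by (intro has_derivative_sum bounded_linear.has_derivative[OF bounded_linear_axis] assms)
  moreover have "(\<Sum>c\<in>UNIV. axis c (v $ c)) = v" for v :: "complex^3"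
    by (simp add: vec_eq_iff axis_def)
  ultimately show ?thesis by simp
qed

context decaying_field
begin

text \<open>\<open>k\<close> is a volume density and \<open>l\<close> a surface density; by
  \<open>pot_derivative\<close>, \<open>pot1 j\<close> is the j-th partial derivative of
  \<open>pot0\<close> in the exterior. The representation, the decay and the radiation condition are
  all reduced to these scalar potentials.\<close>

definition pot0 where "pot0 k l x = (LINT y:\<Omega>|lborel. ker0 lam 0 (x - y) * k y) + (LINT y:S|\<sigma>. ker0 lam 0 (x - y) * l y)"

definition pot1 where "pot1 j k l x = (LINT y:\<Omega>|lborel. ker1 lam 0 j (x - y) * k y) + (LINT y:S|\<sigma>. ker1 lam 0 j (x - y) * l y)"

text \<open>The point \<open>x0\<close> has positive distance from the frontier, so for x near it
  the gradient kernel is bounded on \<open>S\<close>, and a multiple of the indicator of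
  \<open>S\<close> is a majorant, \<open>S\<close> having finite area.\<close>

lemma surface_potential_derivative:
  assumes l: "continuous_on S l" and x: "x0 \<in> \<Omega>"
  shows "((\<lambda>x. LINT y:S|\<sigma>. ker0 lam 0 (x - y) * l y) has_derivative
    (\<lambda>h. \<Sum>j\<in>UNIV. h $ j *\<^sub>R (LINT y:S|\<sigma>. ker1 lam 0 j (x0 - y) * l y))) (at x0)"
proof -
  let ?f = "\<lambda>y. indicator S y *\<^sub>R l y"
  obtain r where r: "r > 0" "ball x0 r \<subseteq> \<Omega>" using open_ext x open_contains_ball by blast
  define d where "d = r / 2"
  have d: "d > 0" using r by (simp add: d_def)
  have far: "d \<le> norm (x - y)" if "x \<in> ball x0 d" "y \<in> S" for x y
  proof (rule ccontr)
    assume "\<not> d \<le> norm (x - y)"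
    then have "dist x0 y < r" using that(1) dist_triangle[of x0 y x] by (simp add: d_def dist_norm)
    then show False using r(2) ext_not_S[of y] that(2) by auto
  qed
  have "compact (l ` S)" by (rule compact_continuous_image[OF l compact_S])
  then obtain B where B: "\<And>y. y \<in> S \<Longrightarrow> norm (l y) \<le> B" using compact_imp_bounded bounded_iff by (metis imageI)
  define b where "b = (1 + \<bar>lam\<bar>) * (1 / d + 1 / d\<^sup>2) * \<bar>B\<bar>"
  have "((\<lambda>x. \<integral>y. ker0 lam 0 (x - y) * ?f y \<partial>\<sigma>) has_derivative (\<lambda>h. \<Sum>j\<in>UNIV. h $ j *\<^sub>R (\<integral>y. ker1 lam 0 j (x0 - y) * ?f y \<partial>\<sigma>))) (at x0)"
  proof (rule has_derivative_kernel_integral(2)[where \<delta>=d and w="\<lambda>y. b * indicator S y"])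
    show "?f \<in> borel_measurable borel" using compact_S by (intro borel_measurable_continuous_on_indicator l borel_compact)
    show "integrable \<sigma> (\<lambda>y. b * indicator S y)"
      using finite_S compact_S by (intro integrable_mult_right integrable_real_indicator) (auto simp: borel_compact)
    fix x y j assume x: "x \<in> ball x0 d"
    show "integrable \<sigma> (\<lambda>y. ker0 lam 0 (x - y) * ?f y)"
    proof -
      have "x \<notin> S" using x far[of x x] d by auto
      from admissible_kernels(1)[OF admissible_surface[OF l this]] show ?thesis by (simp add: set_integrable_def)
    qed
    assume fy: "?f y \<noteq> 0"
    then have y: "y \<in> S" by (auto simp: indicator_def)
    have n: "d \<le> norm (x - y)" by (rule far[OF x y])
    then have nz: "x - y \<noteq> 0" using d by auto
    then show "(ker0 lam 0 has_derivative (\<lambda>h. \<Sum>j\<in>UNIV. h $ j *\<^sub>R ker1 lam 0 j (x - y))) (at (x - y))"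
      by (intro ker0_deriv) simp
    have "sing (x - y) \<le> 1 / d + 1 / d\<^sup>2" unfolding sing_def using n d by (intro add_mono frac_le power_mono) auto
    then have "norm (ker1 lam 0 j (x - y)) \<le> (1 + \<bar>lam\<bar>) * (1 / d + 1 / d\<^sup>2)"
      using kernel_sing_bounds(2)[OF nz, of lam 0 j] mult_left_mono[of "sing (x - y)" "1 / d + 1 / d\<^sup>2" "1 + \<bar>lam\<bar>"] by linarith
    moreover have "norm (?f y) \<le> \<bar>B\<bar>" using B[OF y] y by simp
    ultimately have "norm (ker1 lam 0 j (x - y)) * norm (?f y) \<le> b" unfolding b_def using d by (intro mult_mono) auto
    then show "norm (ker1 lam 0 j (x - y)) * norm (?f y) \<le> b * indicator S y" using y by simp
  qed (use d in auto)
  then show ?thesis by (simp add: set_lebesgue_integral_def)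
qed

lemma pot_derivative:
  assumes k: "decaying_density (\<lambda>y. indicator \<Omega> y *\<^sub>R k y) C \<delta> \<rho>" and l: "continuous_on S l" and x: "x0 \<in> \<Omega>"
  shows "(pot0 k l has_derivative (\<lambda>h. \<Sum>j\<in>UNIV. h $ j *\<^sub>R pot1 j k l x0)) (at x0)"
proof -
  interpret dd: decaying_density "\<lambda>y. indicator \<Omega> y *\<^sub>R k y" C \<delta> \<rho> by (rule k)
  have "((\<lambda>x. LINT y:\<Omega>|lborel. ker0 lam 0 (x - y) * k y) has_derivative (\<lambda>h. \<Sum>j\<in>UNIV. h $ j *\<^sub>R (LINT y:\<Omega>|lborel. ker1 lam 0 j (x0 - y) * k y))) (at x0)"
    using dd.volume_potential_derivative[of lam x0] by (simp add: set_lebesgue_integral_def)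
  from has_derivative_add[OF this surface_potential_derivative[OF l x]]
  show ?thesis unfolding pot0_def[abs_def] pot1_def by (simp add: scaleR_add_right sum.distrib)
qed

lemma continuous_rc:
  "continuous_on S (\<lambda>y. rc_dot (\<eta> y) (u y))" "continuous_on S (\<lambda>y. rc_cross (\<eta> y) (u y) $ c)"
  unfolding rc_dot_def
  by (intro continuous_intros continuous_on_rc_cross continuous_on_normal continuous_on_subset[OF continuous_u S_subset])+

text \<open>\<open>divergence\<close> and \<open>curl\<close> match \<open>dv\<close> and
  \<open>cv\<close> on the exterior, which is the range of the volume integrals, so the potentials
  of the theorem become the scalar potentials \<open>pot0\<close>.\<close>

lemma kernel_integrals:
  assumes x: "x \<in> \<Omega>"
  shows "set_integrable lborel \<Omega> (\<lambda>y. helmholtz_kernel lam (x - y) * divergence u y)"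
    "set_integrable \<sigma> S (\<lambda>y. helmholtz_kernel lam (x - y) * rc_dot (\<eta> y) (u y))"
    "set_integrable lborel \<Omega> (\<lambda>y. helmholtz_kernel lam (x - y) *s (curl u y - lam *\<^sub>R u y))"
    "set_integrable \<sigma> S (\<lambda>y. helmholtz_kernel lam (x - y) *s rc_cross (\<eta> y) (u y))"
    "scalar_potential lam G \<eta> u x = pot0 dv (\<lambda>y. rc_dot (\<eta> y) (u y)) x"
    "cyclic c a b \<Longrightarrow> vector_potential lam G \<eta> u x $ c = pot0 (cv c a b) (\<lambda>y. rc_cross (\<eta> y) (u y) $ c) x"
proof -
  have xS: "x \<notin> S" by (rule ext_not_S[OF x])
  have cong: "set_integrable lborel \<Omega> f \<longleftrightarrow> set_integrable lborel \<Omega> g" "(LINT y:\<Omega>|lborel. f y) = (LINT y:\<Omega>|lborel. g y)"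
    if "\<forall>y\<in>\<Omega>. f y = g y" for f g :: "real^3 \<Rightarrow> complex"
  proof -
    have "indicator \<Omega> y *\<^sub>R f y = indicator \<Omega> y *\<^sub>R g y" for y using that by (cases "y \<in> \<Omega>") auto
    then show "set_integrable lborel \<Omega> f \<longleftrightarrow> set_integrable lborel \<Omega> g" "(LINT y:\<Omega>|lborel. f y) = (LINT y:\<Omega>|lborel. g y)"
      by (simp_all only: set_integrable_def set_lebesgue_integral_def)
  qed
  have dd: "\<forall>y\<in>\<Omega>. helmholtz_kernel lam (x - y) * divergence u y = ker0 lam 0 (x - y) * dv y"
    by (simp add: dv_eq helmholtz_kernel_eq)
  have cc: "\<forall>y\<in>\<Omega>. (helmholtz_kernel lam (x - y) *s (curl u y - lam *\<^sub>R u y)) $ c = ker0 lam 0 (x - y) * cv c a b y" if "cyclic c a b" for c a b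
    using cv_eq[OF that] by (simp only: helmholtz_kernel_eq vector_smult_component) simp
  show "set_integrable lborel \<Omega> (\<lambda>y. helmholtz_kernel lam (x - y) * divergence u y)"
    unfolding cong(1)[OF dd] by (rule admissible_kernels(1)[OF admissible_density[OF density_dv]])
  show s1: "set_integrable \<sigma> S (\<lambda>y. helmholtz_kernel lam (x - y) * rc_dot (\<eta> y) (u y))"
    unfolding helmholtz_kernel_eq by (rule admissible_kernels(1)[OF admissible_surface[OF continuous_rc(1) xS]])
  show v: "set_integrable lborel \<Omega> (\<lambda>y. helmholtz_kernel lam (x - y) *s (curl u y - lam *\<^sub>R u y))"
  proof (rule set_integrable_vec)
    fix c obtain a b where cyc: "cyclic c a b" using cyclic_exists by blast
    show "set_integrable lborel \<Omega> (\<lambda>y. (helmholtz_kernel lam (x - y) *s (curl u y - lam *\<^sub>R u y)) $ c)"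
      unfolding cong(1)[OF cc[OF cyc]] by (rule admissible_kernels(1)[OF admissible_density[OF density_cv[OF cyc]]])
  qed
  show s2: "set_integrable \<sigma> S (\<lambda>y. helmholtz_kernel lam (x - y) *s rc_cross (\<eta> y) (u y))"
  proof (rule set_integrable_vec)
    fix c show "set_integrable \<sigma> S (\<lambda>y. (helmholtz_kernel lam (x - y) *s rc_cross (\<eta> y) (u y)) $ c)"
      unfolding vector_smult_component helmholtz_kernel_eq
      by (rule admissible_kernels(1)[OF admissible_surface[OF continuous_rc(2) xS]])
  qed
  show "scalar_potential lam G \<eta> u x = pot0 dv (\<lambda>y. rc_dot (\<eta> y) (u y)) x"
    unfolding scalar_potential_def pot0_def cong(2)[OF dd] by (simp only: helmholtz_kernel_eq)
  assume cyc: "cyclic c a b"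
  show "vector_potential lam G \<eta> u x $ c = pot0 (cv c a b) (\<lambda>y. rc_cross (\<eta> y) (u y) $ c) x"
    unfolding vector_potential_def vector_add_component set_integral_vec_nth[OF v] set_integral_vec_nth[OF s2] cong(2)[OF cc[OF cyc]]
    by (simp only: pot0_def vector_smult_component helmholtz_kernel_eq)
qed

lemma scalar_potential_derivative:
  assumes x: "x \<in> \<Omega>"
  shows "(scalar_potential lam G \<eta> u has_derivative (\<lambda>h. \<Sum>j\<in>UNIV. h $ j *\<^sub>R pot1 j dv (\<lambda>y. rc_dot (\<eta> y) (u y)) x)) (at x)"
  by (rule has_derivative_transform_within_open[OF pot_derivative[OF density_dv continuous_rc(1) x] open_ext x])
     (rule kernel_integrals(5)[symmetric])

lemma vector_potential_derivative:
  assumes x: "x \<in> \<Omega>" and cyc: "cyclic c a b"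
  shows "((\<lambda>x. vector_potential lam G \<eta> u x $ c) has_derivative (\<lambda>h. \<Sum>j\<in>UNIV. h $ j *\<^sub>R pot1 j (cv c a b) (\<lambda>y. rc_cross (\<eta> y) (u y) $ c) x)) (at x)"
  by (rule has_derivative_transform_within_open[OF pot_derivative[OF density_cv[OF cyc] continuous_rc(2) x] open_ext x])
     (rule kernel_integrals(6)[OF _ cyc, symmetric])

lemma vector_potential_differentiable:
  assumes x: "x \<in> \<Omega>" shows "vector_potential lam G \<eta> u differentiable (at x)"
proof -
  have "\<forall>c. \<exists>g. ((\<lambda>x. vector_potential lam G \<eta> u x $ c) has_derivative g) (at x)"
    using vector_potential_derivative[OF x] cyclic_exists by blast
  then obtain g where g: "\<And>c. ((\<lambda>x. vector_potential lam G \<eta> u x $ c) has_derivative g c) (at x)" by metis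
  have "(vector_potential lam G \<eta> u has_derivative (\<lambda>h. \<chi> c. g c h)) (at x)"
    by (rule has_derivative_vec3) (simp add: g)
  then show ?thesis by (rule differentiableI)
qed

text \<open>Decay and radiation are read off term by term from this form, in which each term is a
  potential or a first derivative of one.\<close>

lemma representation_pot:
  assumes x: "x \<in> \<Omega>" and cyc: "cyclic c a b"
  shows "u x $ c = of_real lam * pot0 (cv c a b) (\<lambda>y. rc_cross (\<eta> y) (u y) $ c) x - pot1 c dv (\<lambda>y. rc_dot (\<eta> y) (u y)) x
    + pot1 a (cv b c a) (\<lambda>y. rc_cross (\<eta> y) (u y) $ b) x - pot1 b (cv a b c) (\<lambda>y. rc_cross (\<eta> y) (u y) $ a) x"
proof -
  have cyc': "cyclic b c a" "cyclic a b c" using cyc cyclic_rotate by blast+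
  have xS: "x \<notin> S" by (rule ext_not_S[OF x])
  have adm: "admissible lborel \<Omega> x (\<lambda>y. of_real lam * cv c a b y)" "admissible lborel \<Omega> x (\<lambda>y. - dv y)"
    "admissible lborel \<Omega> x (cv b c a)" "admissible lborel \<Omega> x (\<lambda>y. - cv a b c y)"
    by - (rule admissible_cmult[OF admissible_density[OF density_cv[OF cyc]]], rule admissible_minus[OF admissible_density[OF density_dv]],
      rule admissible_density[OF density_cv[OF cyc'(1)]], rule admissible_minus[OF admissible_density[OF density_cv[OF cyc'(2)]]])
  note admS = admissible_surface[OF continuous_coefS(1)[of c a b] xS] admissible_surface[OF continuous_coefS(2)[of c a b] xS]
    admissible_surface[OF continuous_coefS(3)[of c a b] xS] admissible_surface[OF continuous_coefS(4)[of c a b] xS]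
  have cS: "coefS0 c a b = (\<lambda>y. of_real lam * rc_cross (\<eta> y) (u y) $ c)" "coefSc c a b = (\<lambda>y. - rc_dot (\<eta> y) (u y))"
    "coefSa c a b = (\<lambda>y. rc_cross (\<eta> y) (u y) $ b)" "coefSb c a b = (\<lambda>y. - rc_cross (\<eta> y) (u y) $ a)"
    unfolding coefS0_def[abs_def] coefSc_def[abs_def] coefSa_def[abs_def] coefSb_def[abs_def]
      rc_cross_cyclic[OF cyc] rc_cross_cyclic[OF cyc'(1)] rc_cross_cyclic[OF cyc'(2)] rc_dot_def sum_cyclic[OF cyc] by simp_all
  show ?thesis
    unfolding representation[OF cyc x] admissible_kern(2)[OF adm] admissible_kern(2)[OF admS]
    unfolding cS set_integral_factor set_integral_factor_minus pot0_def pot1_def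
    by (simp add: algebra_simps)
qed

theorem representation_formula:
  assumes x: "x \<in> \<Omega>"
  shows "u x = - grad (scalar_potential lam G \<eta> u) x + curl (vector_potential lam G \<eta> u) x + lam *\<^sub>R vector_potential lam G \<eta> u x"
proof (rule vec_eq_iff[THEN iffD2], rule allI)
  fix c
  obtain a b where cyc: "cyclic c a b" using cyclic_exists by blast
  have cyc': "cyclic b c a" "cyclic a b c" using cyc cyclic_rotate by blast+
  let ?A = "vector_potential lam G \<eta> u"
  have "grad (scalar_potential lam G \<eta> u) x $ c = pot1 c dv (\<lambda>y. rc_dot (\<eta> y) (u y)) x"
    unfolding grad_def by (simp add: partial_deriv_eq[OF scalar_potential_derivative[OF x]] sum_axis)
  \<comment> \<open>\<open>partial_deriv\<close> of a vector function is defined through its total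
    derivative, so differentiability of the whole vector potential is needed before passing to
    components.\<close>
  moreover have pd: "partial_deriv j ?A x $ p = pot1 j (cv p q r) (\<lambda>y. rc_cross (\<eta> y) (u y) $ p) x" if "cyclic p q r" for j p q r
  proof -
    have d: "(?A has_derivative frechet_derivative ?A (at x)) (at x)"
      using vector_potential_differentiable[OF x] frechet_derivative_works by blast
    have "partial_deriv j (\<lambda>x. ?A x $ p) x = frechet_derivative ?A (at x) (axis j 1) $ p"
      by (rule partial_deriv_eq[OF bounded_linear.has_derivative[OF bounded_linear_vec_nth d]])
    moreover have "partial_deriv j (\<lambda>x. ?A x $ p) x = pot1 j (cv p q r) (\<lambda>y. rc_cross (\<eta> y) (u y) $ p) x"
      by (simp add: partial_deriv_eq[OF vector_potential_derivative[OF x that]] sum_axis)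
    ultimately show ?thesis by (simp add: partial_deriv_def)
  qed
  ultimately show "u x $ c = (- grad (scalar_potential lam G \<eta> u) x + curl ?A x + lam *\<^sub>R ?A x) $ c"
    unfolding representation_pot[OF x cyc] vector_add_component vector_uminus_component vector_scaleR_component
      curl_cyclic[OF cyc] pd[OF cyc'(1)] pd[OF cyc'(2)] kernel_integrals(6)[OF x cyc]
    by (simp add: scaleR_conv_of_real)
qed

end

subsection \<open>Decay at infinity\<close>

text \<open>Homogeneity: under y = r w the Jacobian r^3 meets the factor r^-a of the power. Complex
  values are inserted to match the form of \<open>integral_affine3\<close>.\<close>

lemma integral_powr_scale:
  fixes h :: "real \<Rightarrow> real"
  assumes [measurable]: "h \<in> borel_measurable borel" and r: "r > 0"
  shows "(\<integral>y. norm (y::real^3) powr (- a) * h (norm y / r) \<partial>lborel) = r powr (3 - a) * (\<integral>y. norm (y::real^3) powr (- a) * h (norm y) \<partial>lborel)"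
proof -
  let ?g = "\<lambda>y::real^3. norm y powr (- a) * h (norm y / r)"
  have "complex_of_real (\<integral>y. ?g y \<partial>lborel) = (\<integral>y. complex_of_real (?g y) \<partial>lborel)" by (rule integral_complex_of_real[symmetric])
  also have "\<dots> = (\<integral>w. complex_of_real (r ^ 3) * complex_of_real (?g (0 - r *\<^sub>R w)) \<partial>lborel)"
    by (rule integral_affine3[OF _ r]) measurable
  also have "\<dots> = (\<integral>w. complex_of_real (r powr (3 - a) * (norm (w::real^3) powr (- a) * h (norm w))) \<partial>lborel)"
  proof (rule Bochner_Integration.integral_cong[OF refl])
    fix w :: "real^3"
    have "r ^ 3 * (r * norm w) powr (- a) = r powr (3 - a) * norm w powr (- a)"
      using r powr_add[of r 3 "- a"] by (simp add: powr_mult powr_numeral)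
    then show "complex_of_real (r ^ 3) * complex_of_real (?g (0 - r *\<^sub>R w)) = complex_of_real (r powr (3 - a) * (norm w powr (- a) * h (norm w)))"
      using r unfolding of_real_mult[symmetric] by (simp add: mult.assoc[symmetric])
  qed
  also have "\<dots> = complex_of_real (r powr (3 - a) * (\<integral>y. norm (y::real^3) powr (- a) * h (norm y) \<partial>lborel))"
    by (simp only: integral_complex_of_real integral_mult_right_zero)
  finally show ?thesis by (simp only: of_real_eq_iff)
qed

lemma indicator_cball_norm:
  fixes y :: "real^3"
  assumes "r > 0"
  shows "(indicator (cball 0 (b * r)) y :: real) = indicator {..b} (norm y / r)" "(indicator (- cball 0 (b * r)) y :: real) = indicator {b<..} (norm y / r)"
  using assms by (auto simp: indicator_def pos_divide_le_eq pos_less_divide_eq)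

text \<open>For |y| \<le> |x|/2 the distance |x - y| is at least |x|/2; in the shell |y| itself is;
  and for |y| > 2 |x| the distance is at least |y|/2. The three regions are enlarged to sets
  described by |y| \<le> |x|, |x - y| \<le> 4 |x| and |y| > |x|, so that each term can be evaluated
  by scaling.\<close>

lemma riesz_convolution_pointwise:
  fixes x y :: "real^3"
  assumes a: "0 < a" and \<rho>: "0 < \<rho>" and x: "x \<noteq> 0"
  shows "norm (x - y) powr (- a) * norm y powr (- \<rho>) \<le>
    2 powr a * norm x powr (- a) * (norm y powr (- \<rho>) * indicator (cball 0 (1 * norm x)) y)
    + 2 powr \<rho> * norm x powr (- \<rho>) * (norm (x - y) powr (- a) * indicator (cball 0 (4 * norm x)) (x - y))
    + 2 powr a * (norm y powr (- (a + \<rho>)) * indicator (- cball 0 (1 * norm x)) y)" (is "?W \<le> ?T1 + ?T2 + ?T3")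
proof -
  have half: "s powr (- q) \<le> 2 powr q * t powr (- q)" if "t / 2 \<le> s" "0 < t" "0 < q" for s t q :: real
  proof -
    have "s powr (- q) \<le> (t / 2) powr (- q)" using that by (intro powr_mono2') auto
    also have "\<dots> = 2 powr q * t powr (- q)" using that by (simp add: powr_divide powr_minus_divide)
    finally show ?thesis .
  qed
  have nn: "0 \<le> ?T1" "0 \<le> ?T2" "0 \<le> ?T3" by simp_all
  have x': "norm x > 0" using x by simp
  consider "norm y \<le> norm x / 2" | "norm x / 2 < norm y" "norm y \<le> 2 * norm x" | "2 * norm x < norm y" by linarith
  then show ?thesis
  proof cases
    case 1
    have "norm x \<le> norm (x - y) + norm y" using norm_triangle_sub[of x y] by linarith
    then have "norm (x - y) powr (- a) \<le> 2 powr a * norm x powr (- a)" using 1 x' a by (intro half) auto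
    then have "?W \<le> 2 powr a * norm x powr (- a) * norm y powr (- \<rho>)" by (intro mult_right_mono) auto
    also have "\<dots> = ?T1" using 1 norm_ge_zero[of x] order_trans[of "norm y" "norm x / 2" "norm x"] by simp
    finally show ?thesis using nn by linarith
  next
    case 2
    have "norm (x - y) \<le> norm x + norm y" by (rule norm_triangle_ineq4)
    then have i: "norm (x - y) \<le> 4 * norm x" using 2 by linarith
    have "norm y powr (- \<rho>) \<le> 2 powr \<rho> * norm x powr (- \<rho>)" using 2 x' \<rho> by (intro half) auto
    then have "norm (x - y) powr (- a) * norm y powr (- \<rho>) \<le> norm (x - y) powr (- a) * (2 powr \<rho> * norm x powr (- \<rho>))"
      by (intro mult_left_mono) auto
    also have "\<dots> = ?T2" using i by simp
    finally show ?thesis using nn by linarith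
  next
    case 3
    have "norm y \<le> norm (x - y) + norm x" using norm_triangle_sub[of y x] by (simp add: norm_minus_commute)
    then have "norm (x - y) powr (- a) \<le> 2 powr a * norm y powr (- a)" using 3 x' a by (intro half) auto
    then have "?W \<le> 2 powr a * norm y powr (- a) * norm y powr (- \<rho>)" by (intro mult_right_mono) auto
    also have "\<dots> = ?T3"
    proof -
      have "norm x < norm y" using 3 x' by linarith
      then show ?thesis using powr_add[of "norm y" "- a" "- \<rho>"] by simp
    qed
    finally show ?thesis using nn by linarith
  qed
qed

text \<open>Each of the three majorants scales like |x|^(3 - a - \<rho>), with constants
  \<open>J1\<close>, \<open>J2\<close>, \<open>J3\<close> free of x. The conditions \<rho> < 3, a <
  3 and a + \<rho> > 3 are integrability at 0, at x and at infinity.\<close>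

lemma riesz_convolution_bound:
  assumes a: "0 < a" "a < 3" and \<rho>: "0 < \<rho>" "\<rho> < 3" and a\<rho>: "3 < a + \<rho>"
  shows "\<exists>M\<ge>0. \<forall>x::real^3. x \<noteq> 0 \<longrightarrow> integrable lborel (\<lambda>y. norm (x - y) powr (- a) * norm y powr (- \<rho>)) \<and>
    (\<integral>y. norm (x - y) powr (- a) * norm y powr (- \<rho>) \<partial>lborel) \<le> M * norm x powr (3 - a - \<rho>)"
proof -
  define J1 where "J1 = (\<integral>y. norm (y::real^3) powr (- \<rho>) * indicator {..1} (norm y) \<partial>lborel)"
  define J2 where "J2 = (\<integral>y. norm (y::real^3) powr (- a) * indicator {..4} (norm y) \<partial>lborel)"
  define J3 where "J3 = (\<integral>y. norm (y::real^3) powr (- (a + \<rho>)) * indicator {1<..} (norm y) \<partial>lborel)"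
  have J: "0 \<le> J1" "0 \<le> J2" "0 \<le> J3" unfolding J1_def J2_def J3_def by simp_all
  define M where "M = 2 powr a * J1 + 2 powr \<rho> * J2 + 2 powr a * J3"
  have "integrable lborel (\<lambda>y. norm (x - y) powr (- a) * norm y powr (- \<rho>)) \<and>
    (\<integral>y. norm (x - y) powr (- a) * norm y powr (- \<rho>) \<partial>lborel) \<le> M * norm x powr (3 - a - \<rho>)" if x: "x \<noteq> 0" for x :: "real^3"
  proof -
    let ?T1 = "\<lambda>y::real^3. norm y powr (- \<rho>) * indicator (cball 0 (1 * norm x)) y"
    let ?T2 = "\<lambda>y::real^3. norm y powr (- a) * indicator (cball 0 (4 * norm x)) y"
    let ?T3 = "\<lambda>y::real^3. norm y powr (- (a + \<rho>)) * indicator (- cball 0 (1 * norm x)) y"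
    let ?W = "\<lambda>y. norm (x - y) powr (- a) * norm y powr (- \<rho>)"
    let ?T = "\<lambda>y. 2 powr a * norm x powr (- a) * ?T1 y + 2 powr \<rho> * norm x powr (- \<rho>) * ?T2 (x - y) + 2 powr a * ?T3 y"
    have r: "norm x > 0" using x by simp
    have i: "integrable lborel ?T1" "integrable lborel ?T2" "integrable lborel ?T3"
      using a \<rho> a\<rho> r by (intro integrable_powr_ball integrable_powr_outside; simp)+
    have i2: "integrable lborel (\<lambda>y. ?T2 (x - y))" by (rule integrable_reflect[OF i(2)])
    have iT: "integrable lborel ?T"
      by (intro Bochner_Integration.integrable_add integrable_mult_right i i2)
    have e: "integral\<^sup>L lborel ?T1 = norm x powr (3 - \<rho>) * J1" "integral\<^sup>L lborel ?T2 = norm x powr (3 - a) * J2"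
      "integral\<^sup>L lborel ?T3 = norm x powr (3 - (a + \<rho>)) * J3"
      unfolding J1_def J2_def J3_def indicator_cball_norm[OF r] by (rule integral_powr_scale[OF _ r]; measurable)+
    have e2: "(\<integral>y. ?T2 (x - y) \<partial>lborel) = integral\<^sup>L lborel ?T2"
      by (rule integral_reflect) measurable
    have b: "?W y \<le> ?T y" for y by (rule riesz_convolution_pointwise[OF a(1) \<rho>(1) x])
    have iW: "integrable lborel ?W"
      by (rule Bochner_Integration.integrable_bound[OF iT]) (measurable, use b in \<open>auto intro!: AE_I2 order_trans[OF b] abs_ge_self\<close>)
    have "integral\<^sup>L lborel ?W \<le> integral\<^sup>L lborel ?T" by (rule integral_mono[OF iW iT b])
    also have "\<dots> = 2 powr a * norm x powr (- a) * integral\<^sup>L lborel ?T1 + 2 powr \<rho> * norm x powr (- \<rho>) * (\<integral>y. ?T2 (x - y) \<partial>lborel) + 2 powr a * integral\<^sup>L lborel ?T3"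
      by (simp only: Bochner_Integration.integral_add Bochner_Integration.integrable_add integrable_mult_right i i2 integral_mult_right_zero)
    also have "\<dots> = 2 powr a * J1 * (norm x powr (- a) * norm x powr (3 - \<rho>)) + 2 powr \<rho> * J2 * (norm x powr (- \<rho>) * norm x powr (3 - a)) + 2 powr a * J3 * norm x powr (3 - (a + \<rho>))"
      unfolding e2 e by (simp only: ac_simps)
    also have "\<dots> = M * norm x powr (3 - a - \<rho>)"
    proof -
      have p: "- a + (3 - \<rho>) = 3 - a - \<rho>" "- \<rho> + (3 - a) = 3 - a - \<rho>" "3 - (a + \<rho>) = 3 - a - \<rho>" by simp_all
      show ?thesis unfolding powr_add[symmetric] p M_def by (simp only: distrib_right)
    qed
    finally show ?thesis using iW by blast
  qed
  moreover have "0 \<le> M" unfolding M_def using J by simp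
  ultimately show ?thesis by blast
qed

lemma bigo_at_infinityI:
  fixes f :: "real^3 \<Rightarrow> complex"
  assumes "\<And>x. X \<le> norm x \<Longrightarrow> norm (f x) \<le> K * w x"
  shows "f \<in> O[at_infinity](\<lambda>x. complex_of_real (w x))"
proof (rule bigoI[where c="\<bar>K\<bar>"])
  have "norm (f x) \<le> \<bar>K\<bar> * norm (complex_of_real (w x))" if "X \<le> norm x" for x
  proof -
    have "K * w x \<le> \<bar>K * w x\<bar>" by simp
    then show ?thesis using assms[OF that] by (simp add: abs_mult)
  qed
  then show "\<forall>\<^sub>F x in at_infinity. norm (f x) \<le> \<bar>K\<bar> * norm (complex_of_real (w x))" unfolding eventually_at_infinity by blast
qed

lemma bigo_cmult: "f \<in> O[F](g) \<Longrightarrow> (\<lambda>x. c * f x) \<in> O[F](g)" for c :: "'a::real_normed_field"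
  by (cases "c = 0") simp_all

text \<open>\<open>sing\<close> is the sum of the powers of order 1 and 2. The first gives |x|^(2 -
  \<rho>), the second |x|^(1 - \<rho>), which is no larger for |x| \<ge> 1; so the slowly decaying
  part of the kernel decides the rate.\<close>

lemma (in decaying_density) potential_bigo:
  fixes \<kappa> :: "real^3 \<Rightarrow> complex"
  assumes [measurable]: "\<kappa> \<in> borel_measurable borel" and k: "\<And>z. z \<noteq> 0 \<Longrightarrow> norm (\<kappa> z) \<le> c * sing z" and c: "c \<ge> 0"
  shows "(\<lambda>x. \<integral>y. \<kappa> (x - y) * f y \<partial>lborel) \<in> O[at_infinity](\<lambda>x. complex_of_real (norm x powr (2 - \<rho>)))"
proof -
  obtain M1 where M1: "M1 \<ge> 0" "\<forall>x::real^3. x \<noteq> 0 \<longrightarrow> integrable lborel (\<lambda>y. norm (x - y) powr (- 1) * norm y powr (- \<rho>)) \<and>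
      (\<integral>y. norm (x - y) powr (- 1) * norm y powr (- \<rho>) \<partial>lborel) \<le> M1 * norm x powr (3 - 1 - \<rho>)"
    using riesz_convolution_bound[of 1 \<rho>] rho by auto
  obtain M2 where M2: "M2 \<ge> 0" "\<forall>x::real^3. x \<noteq> 0 \<longrightarrow> integrable lborel (\<lambda>y. norm (x - y) powr (- 2) * norm y powr (- \<rho>)) \<and>
      (\<integral>y. norm (x - y) powr (- 2) * norm y powr (- \<rho>) \<partial>lborel) \<le> M2 * norm x powr (3 - 2 - \<rho>)"
    using riesz_convolution_bound[of 2 \<rho>] rho by auto
  have "norm (\<integral>y. \<kappa> (x - y) * f y \<partial>lborel) \<le> c * C * (M1 + M2) * norm x powr (2 - \<rho>)" if x1: "1 \<le> norm x" for x
  proof -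
    have x: "x \<noteq> 0" using x1 by auto
    let ?W = "\<lambda>a y. norm (x - y) powr (- a) * norm y powr (- \<rho>)"
    have i: "integrable lborel (?W 1)" "integrable lborel (?W 2)" using M1(2) M2(2) x by blast+
    have ii: "integral\<^sup>L lborel (?W 1) \<le> M1 * norm x powr (3 - 1 - \<rho>)" "integral\<^sup>L lborel (?W 2) \<le> M2 * norm x powr (3 - 2 - \<rho>)" using M1(2) M2(2) x by blast+
    have b: "norm (\<kappa> (x - y) * f y) \<le> c * C * (?W 1 y + ?W 2 y)" if "y \<noteq> x" for y
    proof -
      have "norm (\<kappa> (x - y)) * norm (f y) \<le> (c * sing (x - y)) * (C * norm y powr (- \<rho>))"
        using k[of "x - y"] that c sing_nonneg decay by (intro mult_mono) auto
      then show ?thesis unfolding norm_mult sing_powr by (simp only: algebra_simps)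
    qed
    have "norm (\<integral>y. \<kappa> (x - y) * f y \<partial>lborel) \<le> (\<integral>y. c * C * (?W 1 y + ?W 2 y) \<partial>lborel)"
    proof (rule order_trans[OF Bochner_Integration.integral_norm_bound], rule integral_mono_AE)
      show "integrable lborel (\<lambda>y. norm (\<kappa> (x - y) * f y))" by (rule integrable_norm, rule integrable_kernel[OF _ k]) measurable
      show "integrable lborel (\<lambda>y. c * C * (?W 1 y + ?W 2 y))" by (intro integrable_mult_right Bochner_Integration.integrable_add i)
      show "AE y in lborel. norm (\<kappa> (x - y) * f y) \<le> c * C * (?W 1 y + ?W 2 y)"
        using AE_lborel_singleton[of x] by eventually_elim (rule b)
    qed
    also have "\<dots> = c * C * (integral\<^sup>L lborel (?W 1) + integral\<^sup>L lborel (?W 2))"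
      by (simp only: integral_mult_right_zero Bochner_Integration.integral_add[OF i])
    also have "\<dots> \<le> c * C * ((M1 + M2) * norm x powr (2 - \<rho>))"
    proof (rule mult_left_mono)
      have "norm x powr (3 - 2 - \<rho>) \<le> norm x powr (2 - \<rho>)" using x1 by (intro powr_mono) auto
      then have "M2 * norm x powr (3 - 2 - \<rho>) \<le> M2 * norm x powr (2 - \<rho>)" using M2(1) by (rule mult_left_mono)
      moreover have "3 - 1 - \<rho> = 2 - \<rho>" by simp
      ultimately show "integral\<^sup>L lborel (?W 1) + integral\<^sup>L lborel (?W 2) \<le> (M1 + M2) * norm x powr (2 - \<rho>)" using ii by (simp only: distrib_right)
    qed (use c C in simp)
    finally show ?thesis by (simp only: mult.assoc)
  qed
  then show ?thesis by (rule bigo_at_infinityI)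
qed

text \<open>Once |x| \<ge> 2 |L| + 1, every y in the support has |x - y| \<ge> |x|/2, so
  \<open>sing (x - y)\<close> is at most 2/|x| + 4/|x|^2 and hence at most 6/|x|.\<close>

lemma far_potential_bigo:
  fixes \<kappa> f :: "real^3 \<Rightarrow> complex"
  assumes M: "sets M = sets borel" and f: "integrable M f" and L: "\<And>y. norm y > L \<Longrightarrow> f y = 0"
    and k: "\<And>z. z \<noteq> 0 \<Longrightarrow> norm (\<kappa> z) \<le> c * sing z" and c: "c \<ge> 0"
  shows "(\<lambda>x. \<integral>y. \<kappa> (x - y) * f y \<partial>M) \<in> O[at_infinity](\<lambda>x. complex_of_real (1 / norm x))"
proof -
  have "norm (\<integral>y. \<kappa> (x - y) * f y \<partial>M) \<le> c * 6 * (\<integral>y. norm (f y) \<partial>M) * (1 / norm x)" if x: "2 * \<bar>L\<bar> + 1 \<le> norm x" for x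
  proof -
    have x1: "norm x > 0" "1 \<le> norm x" using x by linarith+
    have b: "norm (\<kappa> (x - y) * f y) \<le> c * 6 / norm x * norm (f y)" for y
    proof (cases "f y = 0")
      case False
      then have "norm y \<le> L" using L[of y] by linarith
      then have n: "norm x / 2 \<le> norm (x - y)" using norm_triangle_sub[of x y] x by linarith
      then have "1 / norm (x - y) \<le> 1 / (norm x / 2)" "1 / (norm (x - y))\<^sup>2 \<le> 1 / (norm x / 2)\<^sup>2"
        using x1 by (intro frac_le power_mono; simp)+
      moreover have "1 / (norm x / 2)\<^sup>2 \<le> 4 / norm x" using x1 by (simp add: power_divide power2_eq_square field_simps)
      ultimately have "sing (x - y) \<le> 6 / norm x" unfolding sing_def by simp
      then have "c * sing (x - y) \<le> c * (6 / norm x)" by (rule mult_left_mono) (rule c)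
      moreover have "x - y \<noteq> 0" using n x1 by auto
      ultimately have "norm (\<kappa> (x - y)) \<le> c * 6 / norm x" using k[of "x - y"] by simp
      then show ?thesis unfolding norm_mult by (rule mult_right_mono) simp
    qed simp
    have "norm (\<integral>y. \<kappa> (x - y) * f y \<partial>M) \<le> (\<integral>y. c * 6 / norm x * norm (f y) \<partial>M)"
    proof (rule Bochner_Integration.integral_norm_bound[THEN order_trans], rule integral_mono')
      show "integrable M (\<lambda>y. c * 6 / norm x * norm (f y))" by (intro integrable_mult_right integrable_norm f)
    qed (use b c in auto)
    also have "\<dots> = c * 6 * (\<integral>y. norm (f y) \<partial>M) * (1 / norm x)" by (simp only: integral_mult_right_zero) simp
    finally show ?thesis .
  qed
  then show ?thesis by (rule bigo_at_infinityI)
qed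

context decaying_field
begin

lemma surface_integrable:
  assumes "continuous_on S l" shows "integrable \<sigma> (\<lambda>y. indicator S y *\<^sub>R l y :: complex)"
  using set_integrable_compact[OF sets_surface_measure compact_S finite_S assms] by (simp add: set_integrable_def)

lemma volume_bigo:
  assumes "decaying_density (\<lambda>y. indicator \<Omega> y *\<^sub>R k y) C \<delta> \<rho>"
  shows "(\<lambda>x. LINT y:\<Omega>|lborel. ker0 lam 0 (x - y) * k y) \<in> O[at_infinity](\<lambda>x. complex_of_real (norm x powr (2 - \<rho>)))"
    "(\<lambda>x. LINT y:\<Omega>|lborel. ker1 lam 0 j (x - y) * k y) \<in> O[at_infinity](\<lambda>x. complex_of_real (norm x powr (2 - \<rho>)))"
  using decaying_density.potential_bigo[OF assms _ kernel_sing_bounds(1)[of _ lam 0]]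
    decaying_density.potential_bigo[OF assms _ kernel_sing_bounds(2)[of _ lam 0 j]]
  by (simp_all add: set_lebesgue_integral_def)

lemma volume_bigo_compact:
  assumes k: "decaying_density (\<lambda>y. indicator \<Omega> y *\<^sub>R k y) C \<delta> \<rho>" and i: "set_integrable lborel \<Omega> k" and L: "\<And>y. y \<in> \<Omega> \<Longrightarrow> L < norm y \<Longrightarrow> k y = 0"
  shows "(\<lambda>x. LINT y:\<Omega>|lborel. ker0 lam 0 (x - y) * k y) \<in> O[at_infinity](\<lambda>x. complex_of_real (1 / norm x))"
    "(\<lambda>x. LINT y:\<Omega>|lborel. ker1 lam 0 j (x - y) * k y) \<in> O[at_infinity](\<lambda>x. complex_of_real (1 / norm x))"
proof -
  have z: "indicator \<Omega> y *\<^sub>R k y = 0" if "L < norm y" for y using L[OF _ that] by (cases "y \<in> \<Omega>") auto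
  note f = far_potential_bigo[OF sets_lborel i[unfolded set_integrable_def] z]
  show "(\<lambda>x. LINT y:\<Omega>|lborel. ker0 lam 0 (x - y) * k y) \<in> O[at_infinity](\<lambda>x. complex_of_real (1 / norm x))"
    using f[OF _ kernel_sing_bounds(1)[of _ lam 0]] by (simp add: set_lebesgue_integral_def)
  show "(\<lambda>x. LINT y:\<Omega>|lborel. ker1 lam 0 j (x - y) * k y) \<in> O[at_infinity](\<lambda>x. complex_of_real (1 / norm x))"
    using f[OF _ kernel_sing_bounds(2)[of _ lam 0 j]] by (simp add: set_lebesgue_integral_def)
qed

lemma surface_support: "\<exists>L. \<forall>y. L < norm y \<longrightarrow> y \<notin> S"
  using compact_imp_bounded[OF compact_S] unfolding bounded_iff by (meson not_less)

lemma surface_bigo: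
  assumes l: "continuous_on S l"
  shows "(\<lambda>x. LINT y:S|\<sigma>. ker0 lam 0 (x - y) * l y) \<in> O[at_infinity](\<lambda>x. complex_of_real (1 / norm x))"
    "(\<lambda>x. LINT y:S|\<sigma>. ker1 lam 0 j (x - y) * l y) \<in> O[at_infinity](\<lambda>x. complex_of_real (1 / norm x))"
proof -
  obtain L where "\<forall>y. L < norm y \<longrightarrow> y \<notin> S" using surface_support by blast
  then have z: "indicator S y *\<^sub>R l y = 0" if "L < norm y" for y using that by simp
  note f = far_potential_bigo[OF sets_surface_measure surface_integrable[OF l] z]
  show "(\<lambda>x. LINT y:S|\<sigma>. ker0 lam 0 (x - y) * l y) \<in> O[at_infinity](\<lambda>x. complex_of_real (1 / norm x))"
    using f[OF _ kernel_sing_bounds(1)[of _ lam 0]] by (simp add: set_lebesgue_integral_def)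
  show "(\<lambda>x. LINT y:S|\<sigma>. ker1 lam 0 j (x - y) * l y) \<in> O[at_infinity](\<lambda>x. complex_of_real (1 / norm x))"
    using f[OF _ kernel_sing_bounds(2)[of _ lam 0 j]] by (simp add: set_lebesgue_integral_def)
qed

lemma eventually_ext: "\<forall>\<^sub>F x in at_infinity. x \<in> \<Omega>"
proof -
  obtain R0 where "closure G \<subseteq> ball 0 R0" using bounded_boundary by blast
  then show ?thesis unfolding eventually_at_infinity by (intro exI[of _ R0]) force
qed

lemma field_bigo:
  assumes dv: "\<And>j. pot1 j dv (\<lambda>y. rc_dot (\<eta> y) (u y)) \<in> O[at_infinity](\<lambda>x. complex_of_real (w x))"
    and cv: "\<And>c a b. cyclic c a b \<Longrightarrow> pot0 (cv c a b) (\<lambda>y. rc_cross (\<eta> y) (u y) $ c) \<in> O[at_infinity](\<lambda>x. complex_of_real (w x))"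
      "\<And>c a b j. cyclic c a b \<Longrightarrow> pot1 j (cv c a b) (\<lambda>y. rc_cross (\<eta> y) (u y) $ c) \<in> O[at_infinity](\<lambda>x. complex_of_real (w x))"
  shows "(\<lambda>x. norm (u x)) \<in> O[at_infinity](w)"
proof -
  have comp: "(\<lambda>x. u x $ c) \<in> O[at_infinity](\<lambda>x. complex_of_real (w x))" for c
  proof -
    obtain a b where cyc: "cyclic c a b" using cyclic_exists by blast
    have cyc': "cyclic b c a" "cyclic a b c" using cyc cyclic_rotate by blast+
    let ?v = "\<lambda>x. of_real lam * pot0 (cv c a b) (\<lambda>y. rc_cross (\<eta> y) (u y) $ c) x - pot1 c dv (\<lambda>y. rc_dot (\<eta> y) (u y)) x
      + pot1 a (cv b c a) (\<lambda>y. rc_cross (\<eta> y) (u y) $ b) x - pot1 b (cv a b c) (\<lambda>y. rc_cross (\<eta> y) (u y) $ a) x"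
    have "\<forall>\<^sub>F x in at_infinity. u x $ c = ?v x"
      using eventually_ext by eventually_elim (rule representation_pot[OF _ cyc])
    note eq = this
    have "?v \<in> O[at_infinity](\<lambda>x. complex_of_real (w x))"
      by (intro sum_in_bigo bigo_cmult dv cv cyc cyc')
    then show ?thesis by (rule landau_o.big.in_cong[OF eq, THEN iffD2])
  qed
  have "(\<lambda>x. \<Sum>c\<in>UNIV. norm (u x $ c)) \<in> O[at_infinity](w)"
    by (rule big_sum_in_bigo) (use comp in \<open>simp add: bigo_def\<close>)
  moreover have "(\<lambda>x. norm (u x)) \<in> O[at_infinity](\<lambda>x. \<Sum>c\<in>UNIV. norm (u x $ c))"
    by (rule landau_o.big_mono) (auto intro!: always_eventually L2_set_le_sum order_trans[OF _ abs_ge_self] simp: norm_vec_def)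
  ultimately show ?thesis by (rule landau_o.big_trans[rotated])
qed

text \<open>Surface potentials decay like 1/|x|, and \<rho> < 3 makes this no slower than the volume
  part; so they do not spoil the rate |x|^(2 - \<rho>).\<close>

lemma inverse_norm_bigo: "(\<lambda>x::real^3. complex_of_real (1 / norm x)) \<in> O[at_infinity](\<lambda>x. complex_of_real (norm x powr (2 - \<rho>)))"
proof (rule bigo_at_infinityI[where X=1 and K=1])
  fix x :: "real^3" assume x: "1 \<le> norm x"
  then have "norm x powr (- 1) \<le> norm x powr (2 - \<rho>)" using rho by (intro powr_mono) auto
  then show "norm (complex_of_real (1 / norm x)) \<le> 1 * norm x powr (2 - \<rho>)" using x by (simp add: powr_minus_divide norm_divide)
qed

theorem field_decay: "(\<lambda>x. norm (u x)) \<in> O[at_infinity](\<lambda>x. norm x powr (- (\<rho> - 2)))"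
proof -
  have p: "pot0 k l \<in> O[at_infinity](\<lambda>x. complex_of_real (norm x powr (2 - \<rho>)))"
    "pot1 j k l \<in> O[at_infinity](\<lambda>x. complex_of_real (norm x powr (2 - \<rho>)))"
    if "decaying_density (\<lambda>y. indicator \<Omega> y *\<^sub>R k y) C \<delta> \<rho>" "continuous_on S l" for k l j
    unfolding pot0_def[abs_def] pot1_def
    by (intro sum_in_bigo volume_bigo[OF that(1)] landau_o.big_trans[OF surface_bigo(1)[OF that(2)] inverse_norm_bigo]
      landau_o.big_trans[OF surface_bigo(2)[OF that(2)] inverse_norm_bigo])+
  have "(\<lambda>x. norm (u x)) \<in> O[at_infinity](\<lambda>x. norm x powr (2 - \<rho>))"
    by (intro field_bigo p density_dv density_cv continuous_rc)
  then show ?thesis by simp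
qed

end

subsection \<open>The Sommerfeld radiation condition\<close>

text \<open>A stronger radiation condition: a pointwise rate |y|^-2 instead of a supremum of size
  o(1/R), together with differentiability far out. In this form it is closed under linear
  combinations and under equality near infinity.\<close>

definition sommerfeld :: "real \<Rightarrow> (real^3 \<Rightarrow> complex) \<Rightarrow> bool" where
  "sommerfeld lam T \<longleftrightarrow> (\<exists>K X. \<forall>y. X \<le> norm y \<longrightarrow> (\<exists>T'. (T has_derivative T') (at y) \<and>
    norm (T' (y /\<^sub>R norm y) - \<i> * of_real lam * T y) \<le> K / (norm y)\<^sup>2))"

lemma sommerfeld_add:
  assumes "sommerfeld lam T" "sommerfeld lam U" shows "sommerfeld lam (\<lambda>x. T x + U x)"
proof -
  obtain K X where 1: "\<And>y. X \<le> norm y \<Longrightarrow> \<exists>T'. (T has_derivative T') (at y) \<and> norm (T' (y /\<^sub>R norm y) - \<i> * of_real lam * T y) \<le> K / (norm y)\<^sup>2"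
    using assms(1) unfolding sommerfeld_def by blast
  obtain L Y where 2: "\<And>y. Y \<le> norm y \<Longrightarrow> \<exists>T'. (U has_derivative T') (at y) \<and> norm (T' (y /\<^sub>R norm y) - \<i> * of_real lam * U y) \<le> L / (norm y)\<^sup>2"
    using assms(2) unfolding sommerfeld_def by blast
  have "\<exists>T'. ((\<lambda>x. T x + U x) has_derivative T') (at y) \<and> norm (T' (y /\<^sub>R norm y) - \<i> * of_real lam * (T y + U y)) \<le> (K + L) / (norm y)\<^sup>2"
    if y: "max X Y \<le> norm y" for y
  proof -
    obtain T' where T': "(T has_derivative T') (at y)" "norm (T' (y /\<^sub>R norm y) - \<i> * of_real lam * T y) \<le> K / (norm y)\<^sup>2" using 1[of y] y by auto
    obtain U' where U': "(U has_derivative U') (at y)" "norm (U' (y /\<^sub>R norm y) - \<i> * of_real lam * U y) \<le> L / (norm y)\<^sup>2" using 2[of y] y by auto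
    have eq: "T' (y /\<^sub>R norm y) + U' (y /\<^sub>R norm y) - \<i> * of_real lam * (T y + U y)
      = (T' (y /\<^sub>R norm y) - \<i> * of_real lam * T y) + (U' (y /\<^sub>R norm y) - \<i> * of_real lam * U y)" by (simp add: algebra_simps)
    have "norm (T' (y /\<^sub>R norm y) + U' (y /\<^sub>R norm y) - \<i> * of_real lam * (T y + U y)) \<le> K / (norm y)\<^sup>2 + L / (norm y)\<^sup>2"
      unfolding eq by (rule norm_triangle_mono[OF T'(2) U'(2)])
    with has_derivative_add[OF T'(1) U'(1)] show ?thesis unfolding add_divide_distrib by blast
  qed
  then show ?thesis unfolding sommerfeld_def by blast
qed

lemma sommerfeld_cmult:
  assumes "sommerfeld lam T" shows "sommerfeld lam (\<lambda>x. c * T x)"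
proof -
  obtain K X where 1: "\<And>y. X \<le> norm y \<Longrightarrow> \<exists>T'. (T has_derivative T') (at y) \<and> norm (T' (y /\<^sub>R norm y) - \<i> * of_real lam * T y) \<le> K / (norm y)\<^sup>2"
    using assms(1) unfolding sommerfeld_def by blast
  have "\<exists>T'. ((\<lambda>x. c * T x) has_derivative T') (at y) \<and> norm (T' (y /\<^sub>R norm y) - \<i> * of_real lam * (c * T y)) \<le> norm c * K / (norm y)\<^sup>2"
    if y: "X \<le> norm y" for y
  proof -
    obtain T' where T': "(T has_derivative T') (at y)" "norm (T' (y /\<^sub>R norm y) - \<i> * of_real lam * T y) \<le> K / (norm y)\<^sup>2" using 1[OF y] by blast
    have "c * T' (y /\<^sub>R norm y) - \<i> * of_real lam * (c * T y) = c * (T' (y /\<^sub>R norm y) - \<i> * of_real lam * T y)" by (simp add: algebra_simps)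
    then have "norm (c * T' (y /\<^sub>R norm y) - \<i> * of_real lam * (c * T y)) \<le> norm c * (K / (norm y)\<^sup>2)"
      using mult_left_mono[OF T'(2), of "norm c"] by (simp add: norm_mult)
    then show ?thesis using has_derivative_mult_right[OF T'(1), of c] by (intro exI[of _ "\<lambda>h. c * T' h"]) simp
  qed
  then show ?thesis unfolding sommerfeld_def by blast
qed

lemma sommerfeld_diff: "sommerfeld lam T \<Longrightarrow> sommerfeld lam U \<Longrightarrow> sommerfeld lam (\<lambda>x. T x - U x)"
  using sommerfeld_add[of lam T "\<lambda>x. - 1 * U x"] sommerfeld_cmult[of lam U "- 1"] by simp

lemma sommerfeld_cong:
  assumes T: "sommerfeld lam T" and eq: "\<forall>\<^sub>F x in at_infinity. T x = U x" shows "sommerfeld lam U"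
proof -
  obtain K X where 1: "\<And>y. X \<le> norm y \<Longrightarrow> \<exists>T'. (T has_derivative T') (at y) \<and> norm (T' (y /\<^sub>R norm y) - \<i> * of_real lam * T y) \<le> K / (norm y)\<^sup>2"
    using T unfolding sommerfeld_def by blast
  obtain Y where Y: "\<And>x. Y \<le> norm x \<Longrightarrow> T x = U x" using eq unfolding eventually_at_infinity by blast
  \<comment> \<open>The margin 1 makes T and U agree on a neighbourhood of y, as is needed to
    transfer a derivative.\<close>
  have "\<exists>T'. (U has_derivative T') (at y) \<and> norm (T' (y /\<^sub>R norm y) - \<i> * of_real lam * U y) \<le> K / (norm y)\<^sup>2"
    if y: "max X (Y + 1) \<le> norm y" for y
  proof -
    obtain T' where T': "(T has_derivative T') (at y)" "norm (T' (y /\<^sub>R norm y) - \<i> * of_real lam * T y) \<le> K / (norm y)\<^sup>2" using 1[of y] y by auto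
    have "(U has_derivative T') (at y)"
      by (rule has_derivative_transform_within_open[OF T'(1), of "- cball 0 Y"]) (use y Y in auto)
    then show ?thesis using T'(2) Y[of y] y by auto
  qed
  then show ?thesis unfolding sommerfeld_def by blast
qed

text \<open>Far from the support, differentiation under the integral is dominated, so the defect of
  the potential is the integral of the defects of \<open>k\<close>. Each of these is O(|x - y|^-2),
  and |x - y| \<ge> |x|/2 produces the factor 4 in \<open>K\<close>.\<close>

lemma sommerfeld_potential:
  fixes k f :: "real^3 \<Rightarrow> complex"
  assumes M: "sets M = sets borel" and fm: "f \<in> borel_measurable borel" and f: "integrable M f" and L: "\<And>y. norm y > L \<Longrightarrow> f y = 0"
    and k: "k \<in> borel_measurable borel" and dk: "\<And>j. dk j \<in> borel_measurable borel"
    and der: "\<And>z. z \<noteq> 0 \<Longrightarrow> (k has_derivative (\<lambda>h. \<Sum>j\<in>UNIV. h $ j *\<^sub>R dk j z)) (at z)"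
    and b: "\<And>z. 1 \<le> norm z \<Longrightarrow> norm (k z) \<le> b" "\<And>z j. 1 \<le> norm z \<Longrightarrow> norm (dk j z) \<le> b"
    and far: "\<And>x y. x \<noteq> 0 \<Longrightarrow> 1 \<le> norm (x - y) \<Longrightarrow>
      norm ((\<Sum>j\<in>UNIV. (x /\<^sub>R norm x) $ j *\<^sub>R dk j (x - y)) - \<i> * of_real lam * k (x - y)) \<le> c * (1 + norm y) / (norm (x - y))\<^sup>2"
    and c: "c \<ge> 0"
  shows "sommerfeld lam (\<lambda>x. \<integral>y. k (x - y) * f y \<partial>M)"
proof -
  note [measurable_cong] = M
  note [measurable] = fm k dk
  let ?P = "\<lambda>x. \<integral>y. k (x - y) * f y \<partial>M"
  define K where "K = 4 * c * (1 + \<bar>L\<bar>) * (\<integral>y. norm (f y) \<partial>M)"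
  have "\<exists>T'. (?P has_derivative T') (at x0) \<and> norm (T' (x0 /\<^sub>R norm x0) - \<i> * of_real lam * ?P x0) \<le> K / (norm x0)\<^sup>2"
    if x0: "2 * \<bar>L\<bar> + 4 \<le> norm x0" for x0
  proof -
    have n: "norm x0 > 0" "x0 \<noteq> 0" using x0 by auto
    \<comment> \<open>The margin 4 in the bound on |x0| keeps the unit ball around \<open>x0\<close>
      at distance more than 1 from the support, so the bounds \<open>b\<close> apply there.\<close>
    have sep: "1 \<le> norm (x - y)" "norm y \<le> \<bar>L\<bar>" if "x \<in> ball x0 1" "f y \<noteq> 0" for x y
    proof -
      show y: "norm y \<le> \<bar>L\<bar>" using L[of y] that(2) by linarith
      have "norm x0 \<le> norm (x0 - x) + norm (x - y) + norm y"
        using norm_triangle_ineq[of "x0 - x" "x - y"] norm_triangle_ineq[of "(x0 - x) + (x - y)" y] by simp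
      then show "1 \<le> norm (x - y)" using that(1) y x0 by (simp add: dist_norm)
    qed
    have int: "integrable M (\<lambda>y. k (x - y) * f y)" if "x \<in> ball x0 1" for x
    proof (rule Bochner_Integration.integrable_bound[where f="\<lambda>y. b * norm (f y)"])
      have "norm (k (x - y) * f y) \<le> norm (b * norm (f y))" for y
      proof (cases "f y = 0")
        case False
        from b(1)[OF sep(1)[OF that False]] have "norm (k (x - y)) * norm (f y) \<le> \<bar>b\<bar> * norm (f y)" by (intro mult_right_mono) auto
        then show ?thesis by (simp add: norm_mult abs_mult)
      qed simp
      then show "AE y in M. norm (k (x - y) * f y) \<le> norm (b * norm (f y))" by simp
    qed (use f in \<open>auto intro!: integrable_mult_right\<close>)
    have d: "integrable M (\<lambda>y. dk j (x0 - y) * f y)"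
      "(?P has_derivative (\<lambda>h. \<Sum>j\<in>UNIV. h $ j *\<^sub>R (\<integral>y. dk j (x0 - y) * f y \<partial>M))) (at x0)" for j
    proof -
      have der': "(k has_derivative (\<lambda>h. \<Sum>j\<in>UNIV. h $ j *\<^sub>R dk j (x - y))) (at (x - y))" if "x \<in> ball x0 1" "f y \<noteq> 0" for x y
        using sep(1)[OF that] by (intro der) auto
      have bnd: "norm (dk j (x - y)) * norm (f y) \<le> b * norm (f y)" if "x \<in> ball x0 1" "f y \<noteq> 0" for x y j
        using b(2)[OF sep(1)[OF that]] by (intro mult_right_mono) auto
      have w: "integrable M (\<lambda>y. b * norm (f y))" using f by (intro integrable_mult_right integrable_norm)
      show "integrable M (\<lambda>y. dk j (x0 - y) * f y)"
        "(?P has_derivative (\<lambda>h. \<Sum>j\<in>UNIV. h $ j *\<^sub>R (\<integral>y. dk j (x0 - y) * f y \<partial>M))) (at x0)"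
        by (rule has_derivative_kernel_integral[OF M fm k dk zero_less_one der' bnd w int]; assumption)+
    qed
    define \<nu> where "\<nu> = x0 /\<^sub>R norm x0"
    let ?q = "\<lambda>y. ((\<Sum>j\<in>UNIV. \<nu> $ j *\<^sub>R dk j (x0 - y)) - \<i> * of_real lam * k (x0 - y)) * f y"
    have x00: "x0 \<in> ball x0 1" by simp
    have q: "?q y = (\<Sum>j\<in>UNIV. \<nu> $ j *\<^sub>R (dk j (x0 - y) * f y)) - \<i> * of_real lam * (k (x0 - y) * f y)" for y
      unfolding left_diff_distrib sum_distrib_right scaleR_left_distrib mult_scaleR_left mult.assoc ..
    have e: "(\<Sum>j\<in>UNIV. \<nu> $ j *\<^sub>R (\<integral>y. dk j (x0 - y) * f y \<partial>M)) - \<i> * of_real lam * ?P x0 = (\<integral>y. ?q y \<partial>M)"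
      unfolding q using d(1) int[OF x00] by simp
    have "norm (\<integral>y. ?q y \<partial>M) \<le> (\<integral>y. 4 * c * (1 + \<bar>L\<bar>) / (norm x0)\<^sup>2 * norm (f y) \<partial>M)"
    proof (rule order_trans[OF Bochner_Integration.integral_norm_bound], rule integral_mono')
      show "integrable M (\<lambda>y. 4 * c * (1 + \<bar>L\<bar>) / (norm x0)\<^sup>2 * norm (f y))" using f by (intro integrable_mult_right integrable_norm)
      fix y
      show "0 \<le> 4 * c * (1 + \<bar>L\<bar>) / (norm x0)\<^sup>2 * norm (f y)" using c by simp
      show "norm (?q y) \<le> 4 * c * (1 + \<bar>L\<bar>) / (norm x0)\<^sup>2 * norm (f y)"
      proof (cases "f y = 0")
        case False
        note s = sep[OF x00 False]
        have "norm x0 / 2 \<le> norm (x0 - y)" using norm_triangle_sub[of x0 y] s x0 by linarith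
        then have "(norm x0 / 2)\<^sup>2 \<le> (norm (x0 - y))\<^sup>2" by (intro power_mono) auto
        then have "c * (1 + norm y) / (norm (x0 - y))\<^sup>2 \<le> c * (1 + \<bar>L\<bar>) / (norm x0 / 2)\<^sup>2"
          using s(2) c n by (intro frac_le mult_left_mono) auto
        also have "\<dots> = 4 * c * (1 + \<bar>L\<bar>) / (norm x0)\<^sup>2" by (simp add: power_divide)
        finally have "norm ((\<Sum>j\<in>UNIV. \<nu> $ j *\<^sub>R dk j (x0 - y)) - \<i> * of_real lam * k (x0 - y)) \<le> 4 * c * (1 + \<bar>L\<bar>) / (norm x0)\<^sup>2"
          using far[OF n(2) s(1)] unfolding \<nu>_def by linarith
        then show ?thesis unfolding norm_mult by (rule mult_right_mono) simp
      qed simp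
    qed
    also have "\<dots> = K / (norm x0)\<^sup>2" unfolding integral_mult_right_zero K_def by simp
    finally have "norm ((\<Sum>j\<in>UNIV. (x0 /\<^sub>R norm x0) $ j *\<^sub>R (\<integral>y. dk j (x0 - y) * f y \<partial>M)) - \<i> * of_real lam * ?P x0) \<le> K / (norm x0)\<^sup>2"
      unfolding \<nu>_def[symmetric] e .
    with d(2) show ?thesis by (intro exI conjI)
  qed
  then show ?thesis unfolding sommerfeld_def by blast
qed

text \<open>With n = x/|x|, the gradient kernel is i lam K n up to O(|x - y|^-2); contraction with n
  and |n| = 1 leave i lam K.\<close>

lemma ker0_radiating:
  assumes x: "x \<noteq> 0" and n: "1 \<le> norm (x - y)"
  shows "norm ((\<Sum>j\<in>UNIV. (x /\<^sub>R norm x) $ j *\<^sub>R ker1 lam 0 j (x - y)) - \<i> * of_real lam * ker0 lam 0 (x - y)) \<le> (3 + 6 * \<bar>lam\<bar>) * (1 + norm y) / (norm (x - y))\<^sup>2"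
proof -
  define \<nu> where "\<nu> = x /\<^sub>R norm x"
  have \<nu>: "norm \<nu> = 1" using x by (simp add: \<nu>_def)
  have xy: "y \<noteq> x" using n by auto
  define e where "e j = ker1 lam 0 j (x - y) - \<i> * of_real lam * ker0 lam 0 (x - y) * of_real (\<nu> $ j)" for j
  \<comment> \<open>\<open>ker1_far\<close> with - y as the fixed point and - x as the distant one:
    the difference (- y) - (- x) is x - y again, and the leading term changes its sign.\<close>
  have e: "norm (e j) \<le> (2 * \<bar>lam\<bar> * norm y + 1) / (norm (x - y))\<^sup>2" for j
    using ker1_far[of "- y" "- x" lam j] x xy by (auto simp: e_def \<nu>_def divide_inverse mult.commute)
  have "(\<Sum>j\<in>UNIV. \<nu> $ j * \<nu> $ j) = 1" using \<nu> unfolding norm_eq_1 inner_vec_def by simp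
  then have "(\<Sum>j\<in>UNIV. complex_of_real (\<nu> $ j) * of_real (\<nu> $ j)) = 1" by (metis (no_types, lifting) of_real_1 of_real_mult of_real_sum sum.cong)
  moreover have "\<nu> $ j *\<^sub>R ker1 lam 0 j (x - y) = \<nu> $ j *\<^sub>R e j + \<i> * of_real lam * ker0 lam 0 (x - y) * (of_real (\<nu> $ j) * of_real (\<nu> $ j))" for j
    by (simp add: e_def scaleR_conv_of_real algebra_simps)
  ultimately have "(\<Sum>j\<in>UNIV. \<nu> $ j *\<^sub>R ker1 lam 0 j (x - y)) - \<i> * of_real lam * ker0 lam 0 (x - y) = (\<Sum>j\<in>UNIV. \<nu> $ j *\<^sub>R e j)"
    by (simp only: sum.distrib sum_distrib_left[symmetric]) simp
  moreover have "norm (\<Sum>j\<in>UNIV. \<nu> $ j *\<^sub>R e j) \<le> 3 * ((2 * \<bar>lam\<bar> * norm y + 1) / (norm (x - y))\<^sup>2)"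
    using sum_scaleR_bound[of e "(2 * \<bar>lam\<bar> * norm y + 1) / (norm (x - y))\<^sup>2" \<nu>, OF e] \<nu> by simp
  moreover have "3 * (2 * \<bar>lam\<bar> * norm y + 1) \<le> (3 + 6 * \<bar>lam\<bar>) * (1 + norm y)" by (simp add: algebra_simps)
  then have "3 * ((2 * \<bar>lam\<bar> * norm y + 1) / (norm (x - y))\<^sup>2) \<le> (3 + 6 * \<bar>lam\<bar>) * (1 + norm y) / (norm (x - y))\<^sup>2"
    by (simp add: divide_right_mono)
  ultimately show ?thesis unfolding \<nu>_def by simp
qed

text \<open>To leading order, radial differentiation multiplies by i lam: the terms lam^2/r^2
  cancel, and 3/r^4 - 2 i lam/r^3 times exp(i lam r)/(4 pi) is left.\<close>

lemma radial_difference: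
  assumes r: "r \<ge> 1"
  shows "norm (radial2 lam (of_real r) * of_real r - \<i> * of_real lam * radial1 lam (of_real r)) \<le> (3 + 2 * \<bar>lam\<bar>) / r ^ 3"
proof -
  define w where "w = complex_of_real r"
  have w: "w \<noteq> 0" using r by (simp add: w_def)
  define E where "E = exp (\<i> * of_real lam * w) / of_real (4 * pi)"
  have E: "norm E \<le> 1" unfolding E_def w_def using four_pi by (simp add: norm_divide)
  have "(3 / w ^ 5 - 3 * \<i> * of_real lam / w ^ 4 - of_real (lam\<^sup>2) / w ^ 3) * w - \<i> * of_real lam * (\<i> * of_real lam / w ^ 2 - 1 / w ^ 3)
    = 3 / w ^ 4 - 2 * \<i> * of_real lam / w ^ 3"
    using w by (simp add: field_simps eval_nat_numeral)
  moreover have "(A * E) * w - \<i> * of_real lam * (B * E) = (A * w - \<i> * of_real lam * B) * E" for A B by (simp add: algebra_simps)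
  ultimately have eq: "radial2 lam w * w - \<i> * of_real lam * radial1 lam w = (3 / w ^ 4 - 2 * \<i> * of_real lam / w ^ 3) * E"
    unfolding radial1_def radial2_def E_def[symmetric] by simp
  have "norm (3 / w ^ 4 - 2 * \<i> * of_real lam / w ^ 3) \<le> 3 / r ^ 4 + 2 * \<bar>lam\<bar> / r ^ 3"
    by (rule order_trans[OF norm_triangle_ineq4]) (use r in \<open>simp add: w_def norm_divide norm_mult norm_power\<close>)
  moreover have "3 / r ^ 4 \<le> 3 / r ^ 3" using r by (intro divide_left_mono power_increasing) auto
  ultimately have "norm (3 / w ^ 4 - 2 * \<i> * of_real lam / w ^ 3) \<le> (3 + 2 * \<bar>lam\<bar>) / r ^ 3" by (simp add: add_divide_distrib)
  then have "norm (3 / w ^ 4 - 2 * \<i> * of_real lam / w ^ 3) * norm E \<le> (3 + 2 * \<bar>lam\<bar>) / r ^ 3 * 1"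
    using E r by (intro mult_mono) auto
  then show ?thesis unfolding w_def[symmetric] eq norm_mult by simp
qed

text \<open>With n = x/|x|, z = x - y and r = |z|, the defect is n_j \<open>radial1\<close>, plus (n
  . z - r) \<open>radial2\<close> z_j from replacing n . z by r, plus z_j times the expression
  bounded in \<open>radial_difference\<close>. The factor 1 + |y| stems from the middle term, as |n
  . z - r| \<le> 2 |y|.\<close>

lemma ker1_radiating:
  assumes x: "x \<noteq> 0" and n: "1 \<le> norm (x - y)"
  shows "norm ((\<Sum>i\<in>UNIV. (x /\<^sub>R norm x) $ i *\<^sub>R ker2 lam 0 i j (x - y)) - \<i> * of_real lam * ker1 lam 0 j (x - y))
    \<le> (6 + 6 * \<bar>lam\<bar> + 2 * lam\<^sup>2) * (1 + norm y) / (norm (x - y))\<^sup>2"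
proof -
  define \<nu> where "\<nu> = x /\<^sub>R norm x"
  have \<nu>: "norm \<nu> = 1" using x by (simp add: \<nu>_def)
  define z where "z = x - y"
  define r where "r = norm z"
  have r: "r \<ge> 1" using n by (simp add: r_def z_def)
  define g where "g = radial1 lam (of_real r)"
  define h where "h = radial2 lam (of_real r)"
  have zj: "norm (complex_of_real (z $ j)) \<le> r" using component_le_norm_cart[of z j] by (simp add: r_def)
  have \<nu>j: "norm (complex_of_real (\<nu> $ j)) \<le> 1" using component_le_norm_cart[of \<nu> j] \<nu> by simp
  have "\<nu> \<bullet> z = norm x - \<nu> \<bullet> y" using x by (simp add: \<nu>_def z_def inner_diff_right dot_square_norm power2_eq_square)
  moreover have "\<bar>\<nu> \<bullet> y\<bar> \<le> norm y" using Cauchy_Schwarz_ineq2[of \<nu> y] \<nu> by simp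
  moreover have "\<bar>norm x - r\<bar> \<le> norm y" using norm_triangle_ineq3[of x z] by (simp add: r_def z_def)
  ultimately have dot: "norm (complex_of_real (\<nu> \<bullet> z - r)) \<le> 2 * norm y" unfolding norm_of_real by linarith
  have "(\<Sum>i\<in>UNIV. \<nu> $ i *\<^sub>R ker2 lam 0 i j z) = of_real (\<nu> $ j) * g + of_real (\<nu> \<bullet> z) * h * of_real (z $ j)"
  proof -
    have "\<nu> $ i *\<^sub>R ker2 lam 0 i j z = (if i = j then of_real (\<nu> $ i) * g else 0) + of_real (\<nu> $ i * z $ i) * (h * of_real (z $ j))" for i
      by (simp add: ker2_def g_def h_def r_def scaleR_conv_of_real algebra_simps)
    then show ?thesis by (simp add: sum.distrib sum_distrib_right[symmetric] inner_vec_def mult.assoc flip: of_real_mult of_real_sum)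
  qed
  then have "(\<Sum>i\<in>UNIV. \<nu> $ i *\<^sub>R ker2 lam 0 i j z) - \<i> * of_real lam * ker1 lam 0 j z
    = of_real (\<nu> $ j) * g + (of_real (\<nu> \<bullet> z - r) * h * of_real (z $ j) + (h * of_real r - \<i> * of_real lam * g) * of_real (z $ j))"
    by (simp add: ker1_def g_def r_def algebra_simps)
  moreover have "norm (of_real (\<nu> $ j) * g) \<le> 1 * ((\<bar>lam\<bar> + 1) / r\<^sup>2)"
    unfolding norm_mult
  proof (rule mult_mono[OF \<nu>j])
    have "1 / r ^ 3 \<le> 1 / r\<^sup>2" using r by (intro divide_left_mono power_increasing) auto
    then show "norm g \<le> (\<bar>lam\<bar> + 1) / r\<^sup>2" using norm_radial1_le[of r lam] r by (simp add: g_def add_divide_distrib)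
  qed (use r in auto)
  moreover have "norm (of_real (\<nu> \<bullet> z - r) * h * of_real (z $ j)) \<le> 2 * norm y * ((3 + 3 * \<bar>lam\<bar> + lam\<^sup>2) / r ^ 3) * r"
    unfolding norm_mult
  proof (intro mult_mono dot zj)
    have "1 / r ^ 5 \<le> 1 / r ^ 3" "1 / r ^ 4 \<le> 1 / r ^ 3" using r by (intro divide_left_mono power_increasing; simp)+
    then have "3 * (1 / r ^ 5) + 3 * \<bar>lam\<bar> * (1 / r ^ 4) \<le> 3 * (1 / r ^ 3) + 3 * \<bar>lam\<bar> * (1 / r ^ 3)" by (intro add_mono mult_left_mono) auto
    then show "norm h \<le> (3 + 3 * \<bar>lam\<bar> + lam\<^sup>2) / r ^ 3" using norm_radial2_le[of r lam] r by (simp add: h_def add_divide_distrib)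
  qed (use r in auto)
  moreover have "norm ((h * of_real r - \<i> * of_real lam * g) * of_real (z $ j)) \<le> (3 + 2 * \<bar>lam\<bar>) / r ^ 3 * r"
    unfolding norm_mult g_def h_def using r by (intro mult_mono radial_difference zj) auto
  ultimately have "norm ((\<Sum>i\<in>UNIV. \<nu> $ i *\<^sub>R ker2 lam 0 i j z) - \<i> * of_real lam * ker1 lam 0 j z)
    \<le> 1 * ((\<bar>lam\<bar> + 1) / r\<^sup>2) + (2 * norm y * ((3 + 3 * \<bar>lam\<bar> + lam\<^sup>2) / r ^ 3) * r + (3 + 2 * \<bar>lam\<bar>) / r ^ 3 * r)"
    by (simp only:) (intro norm_triangle_mono)
  also have "\<dots> = (4 + 3 * \<bar>lam\<bar> + (6 + 6 * \<bar>lam\<bar> + 2 * lam\<^sup>2) * norm y) / r\<^sup>2"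
    using r by (simp add: field_simps power2_eq_square power3_eq_cube)
  also have "\<dots> \<le> (6 + 6 * \<bar>lam\<bar> + 2 * lam\<^sup>2) * (1 + norm y) / r\<^sup>2"
    using zero_le_power2[of lam] by (intro divide_right_mono) (simp_all add: algebra_simps)
  finally show ?thesis unfolding z_def r_def \<nu>_def .
qed

lemma sommerfeld_kernels:
  fixes f :: "real^3 \<Rightarrow> complex"
  assumes "sets M = sets borel" "f \<in> borel_measurable borel" "integrable M f" "\<And>y. norm y > L \<Longrightarrow> f y = 0"
  shows "sommerfeld lam (\<lambda>x. \<integral>y. ker0 lam 0 (x - y) * f y \<partial>M)" "sommerfeld lam (\<lambda>x. \<integral>y. ker1 lam 0 j (x - y) * f y \<partial>M)"
proof -
  have pow: "a / norm z ^ m \<le> a" if "1 \<le> norm z" "0 \<le> a" for z :: "real^3" and m and a :: real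
    using frac_le[of a a 1 "norm z ^ m"] one_le_power[OF that(1), of m] that(2) by simp
  have p: "a / norm z \<le> a" "a / (norm z)\<^sup>2 \<le> a" "a / norm z ^ 3 \<le> a" "z \<noteq> 0 \<or> (0::real) < 0"
    if "1 \<le> norm z" "0 \<le> a" for z :: "real^3" and a :: real
    using pow[OF that, of 1] pow[OF that] that(1) by auto
  have lam: "0 \<le> \<bar>lam\<bar>" "0 \<le> 4 * \<bar>lam\<bar>" "0 \<le> lam\<^sup>2" "0 \<le> (1::real)" "0 \<le> (4::real)" by simp_all
  have k0: "norm (ker0 lam 0 z) \<le> 4 + 4 * \<bar>lam\<bar> + lam\<^sup>2" if "1 \<le> norm z" for z
    using norm_ker0_le[OF p(4)[OF that lam(1)], of lam, unfolded rad_0] p(1)[OF that lam(4)] lam by linarith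
  have k1: "norm (ker1 lam 0 j z) \<le> 4 + 4 * \<bar>lam\<bar> + lam\<^sup>2" if "1 \<le> norm z" for z j
    using norm_ker1_le[OF p(4)[OF that lam(1)], of lam j, unfolded rad_0] p(2)[OF that lam(4)] p(1)[OF that lam(1)] lam by linarith
  have k2: "norm (ker2 lam 0 i j z) \<le> 4 + 4 * \<bar>lam\<bar> + lam\<^sup>2" if "1 \<le> norm z" for z i j
    using norm_ker2_le[OF p(4)[OF that lam(1)], of lam i j, unfolded rad_0] p(3)[OF that lam(5)] p(2)[OF that lam(2)] p(1)[OF that lam(3)] lam by linarith
  show "sommerfeld lam (\<lambda>x. \<integral>y. ker0 lam 0 (x - y) * f y \<partial>M)"
    by (rule sommerfeld_potential[OF assms borel_measurable_kernels(1) borel_measurable_kernels(2) ker0_deriv k0 k1 ker0_radiating]) auto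
  show "sommerfeld lam (\<lambda>x. \<integral>y. ker1 lam 0 j (x - y) * f y \<partial>M)"
    by (rule sommerfeld_potential[OF assms borel_measurable_kernels(2) borel_measurable_kernels(3) ker1_deriv k1 k2 ker1_radiating]) auto
qed

text \<open>A real supremum is informative only for a nonempty set that is bounded above. The
  pointwise bound K/R^2 gives boundedness as well as the upper estimate, and norms being
  non-negative gives the lower one; K/R^2 is o(1/R).\<close>

lemma sommerfeld_supremum:
  assumes "sommerfeld lam a"
  shows "(\<lambda>R. SUP y\<in>sphere 0 R. norm (rc_dot (y /\<^sub>R R) (grad a y) - \<i> * of_real lam * a y)) \<in> o[at_top](\<lambda>R. 1 / R)"
proof -
  let ?h = "\<lambda>R y. norm (rc_dot (y /\<^sub>R R) (grad a y) - \<i> * of_real lam * a y)"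
  obtain K X where 1: "\<And>y. X \<le> norm y \<Longrightarrow> \<exists>T'. (a has_derivative T') (at y) \<and> norm (T' (y /\<^sub>R norm y) - \<i> * of_real lam * a y) \<le> K / (norm y)\<^sup>2"
    using assms unfolding sommerfeld_def by blast
  have bnd: "?h R y \<le> K / R\<^sup>2" if y: "y \<in> sphere 0 R" and XR: "X \<le> R" for R y
  proof -
    have R: "norm y = R" using y by simp
    obtain T' where T': "(a has_derivative T') (at y)" "norm (T' (y /\<^sub>R norm y) - \<i> * of_real lam * a y) \<le> K / (norm y)\<^sup>2" using 1[of y] XR R by auto
    note lin = has_derivative_linear[OF T'(1)]
    have rc: "rc_dot \<nu> (grad a y) = T' \<nu>" for \<nu>
    proof -
      have "rc_dot \<nu> (grad a y) = (\<Sum>j\<in>UNIV. \<nu> $ j *\<^sub>R T' (axis j 1))"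
        unfolding rc_dot_def grad_def by (simp add: partial_deriv_eq[OF T'(1)] scaleR_conv_of_real)
      also have "\<dots> = T' (\<Sum>j\<in>UNIV. \<nu> $ j *\<^sub>R axis j 1)" by (simp only: linear_sum[OF lin] linear_scale[OF lin])
      also have "(\<Sum>j\<in>UNIV. \<nu> $ j *\<^sub>R axis j 1) = \<nu>"
        using basis_expansion[of \<nu>] by (simp add: vector_scalar_mult_def scalar_mult_eq_scaleR)
      finally show ?thesis .
    qed
    show ?thesis using T'(2) unfolding rc R .
  qed
  have sup: "norm (SUP y\<in>sphere 0 R. ?h R y) \<le> K / R\<^sup>2" if R: "X \<le> R" "0 \<le> R" for R
  proof -
    have ne: "(sphere 0 R :: (real^3) set) \<noteq> {}" using R by simp
    then obtain y :: "real^3" where y: "y \<in> sphere 0 R" by blast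
    have "bdd_above (?h R ` sphere 0 R)" using bnd[OF _ R(1)] by (intro bdd_aboveI2)
    then have "0 \<le> (SUP y\<in>sphere 0 R. ?h R y)" by (rule cSUP_upper2[OF _ y]) simp
    moreover have "(SUP y\<in>sphere 0 R. ?h R y) \<le> K / R\<^sup>2" using bnd[OF _ R(1)] by (rule cSUP_least[OF ne])
    ultimately show ?thesis by simp
  qed
  show ?thesis
  proof (rule landau_o.smallI)
    fix e :: real assume e: "e > 0"
    have "norm (SUP y\<in>sphere 0 R. ?h R y) \<le> e * norm (1 / R)" if R: "max (max X 1) (K / e) \<le> R" for R
    proof -
      have "K \<le> e * R" "R > 0" using R e by (auto simp: pos_divide_le_eq mult.commute)
      then have "K / R\<^sup>2 \<le> e / R" by (simp add: field_simps power2_eq_square)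
      then show ?thesis using sup[of R] R \<open>R > 0\<close> by simp
    qed
    then show "\<forall>\<^sub>F R in at_top. norm (SUP y\<in>sphere 0 R. ?h R y) \<le> e * norm (1 / R)" unfolding eventually_at_top_linorder by blast
  qed
qed

section \<open>Fields with compactly supported sources\<close>

context decaying_field
begin

lemma compact_support:
  assumes k: "continuous_on (closure \<Omega>) k" and L: "\<And>y. y \<in> \<Omega> \<Longrightarrow> L < norm y \<Longrightarrow> (k y :: complex) = 0"
  shows "set_integrable lborel \<Omega> k"
proof -
  obtain R0 where R0: "closure G \<subseteq> ball 0 R0" using bounded_boundary by blast
  have "k y = 0" if "y \<notin> cball 0 (max L R0)" for y using that R0 by (intro L) auto
  then show ?thesis by (intro set_integrable_compact_support(1)[OF open_ext k compact_cball[of 0 "max L R0"]])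
qed

lemma sommerfeld_pot:
  assumes k: "decaying_density (\<lambda>y. indicator \<Omega> y *\<^sub>R k y) C \<delta> \<rho>" "continuous_on (closure \<Omega>) k" and L: "\<forall>y\<in>\<Omega>. L < norm y \<longrightarrow> k y = 0" and l: "continuous_on S l"
  shows "sommerfeld lam (pot0 k l)" "sommerfeld lam (pot1 j k l)"
    "pot0 k l \<in> O[at_infinity](\<lambda>x. complex_of_real (1 / norm x))" "pot1 j k l \<in> O[at_infinity](\<lambda>x. complex_of_real (1 / norm x))"
proof -
  interpret dd: decaying_density "\<lambda>y. indicator \<Omega> y *\<^sub>R k y" C \<delta> \<rho> by (rule k)
  have L': "k y = 0" if "y \<in> \<Omega>" "L < norm y" for y using L that by blast
  have i: "set_integrable lborel \<Omega> k" by (rule compact_support[OF k(2)]) (rule L')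
  have z: "indicator \<Omega> y *\<^sub>R k y = 0" if "L < norm y" for y using L'[OF _ that] by (cases "y \<in> \<Omega>") auto
  obtain B where "\<forall>y. B < norm y \<longrightarrow> y \<notin> S" using surface_support by blast
  then have z': "indicator S y *\<^sub>R l y = 0" if "B < norm y" for y using that by simp
  have m: "(\<lambda>y. indicator S y *\<^sub>R l y) \<in> borel_measurable borel" using compact_S by (intro borel_measurable_continuous_on_indicator l borel_compact)
  have v: "sommerfeld lam (\<lambda>x. LINT y:\<Omega>|lborel. ker0 lam 0 (x - y) * k y)" "sommerfeld lam (\<lambda>x. LINT y:\<Omega>|lborel. ker1 lam 0 j (x - y) * k y)"
    unfolding set_lebesgue_integral_def mult_scaleR_right[symmetric]
    by (rule sommerfeld_kernels[OF sets_lborel dd.f i[unfolded set_integrable_def]], erule z)+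
  have s: "sommerfeld lam (\<lambda>x. LINT y:S|\<sigma>. ker0 lam 0 (x - y) * l y)" "sommerfeld lam (\<lambda>x. LINT y:S|\<sigma>. ker1 lam 0 j (x - y) * l y)"
    unfolding set_lebesgue_integral_def mult_scaleR_right[symmetric]
    by (rule sommerfeld_kernels[OF sets_surface_measure m surface_integrable[OF l]], erule z')+
  show "sommerfeld lam (pot0 k l)" "sommerfeld lam (pot1 j k l)"
    unfolding pot0_def[abs_def] pot1_def[abs_def] by (rule sommerfeld_add[OF v(1) s(1)] sommerfeld_add[OF v(2) s(2)])+
  show "pot0 k l \<in> O[at_infinity](\<lambda>x. complex_of_real (1 / norm x))" "pot1 j k l \<in> O[at_infinity](\<lambda>x. complex_of_real (1 / norm x))"
    unfolding pot0_def[abs_def] pot1_def[abs_def]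
    by (rule sum_in_bigo(1)[OF volume_bigo_compact(1)[OF k(1) i L'] surface_bigo(1)[OF l]] sum_in_bigo(1)[OF volume_bigo_compact(2)[OF k(1) i L'] surface_bigo(2)[OF l]]; assumption)+
qed

theorem compactly_supported:
  assumes L: "\<forall>y\<in>\<Omega>. L < norm y \<longrightarrow> dv y = 0" "\<And>c a b. cyclic c a b \<Longrightarrow> \<forall>y\<in>\<Omega>. L < norm y \<longrightarrow> cv c a b y = 0"
  shows "(\<lambda>x. norm (u x)) \<in> O[at_infinity](\<lambda>x. 1 / norm x)" "sommerfeld lam (\<lambda>x. u x $ c)"
proof -
  note d = sommerfeld_pot[OF density_dv continuous_dv L(1) continuous_rc(1)]
  have v: "sommerfeld lam (pot0 (cv c a b) (\<lambda>y. rc_cross (\<eta> y) (u y) $ c))" "sommerfeld lam (pot1 j (cv c a b) (\<lambda>y. rc_cross (\<eta> y) (u y) $ c))"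
    "pot0 (cv c a b) (\<lambda>y. rc_cross (\<eta> y) (u y) $ c) \<in> O[at_infinity](\<lambda>x. complex_of_real (1 / norm x))"
    "pot1 j (cv c a b) (\<lambda>y. rc_cross (\<eta> y) (u y) $ c) \<in> O[at_infinity](\<lambda>x. complex_of_real (1 / norm x))" if "cyclic c a b" for c a b j
    by (rule sommerfeld_pot[OF density_cv[OF that] continuous_cv L(2)[OF that] continuous_rc(2)])+
  show "(\<lambda>x. norm (u x)) \<in> O[at_infinity](\<lambda>x. 1 / norm x)"
    by (intro field_bigo d v)
  obtain a b where cyc: "cyclic c a b" using cyclic_exists by blast
  have cyc': "cyclic b c a" "cyclic a b c" using cyc cyclic_rotate by blast+
  let ?v = "\<lambda>x. of_real lam * pot0 (cv c a b) (\<lambda>y. rc_cross (\<eta> y) (u y) $ c) x - pot1 c dv (\<lambda>y. rc_dot (\<eta> y) (u y)) x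
    + pot1 a (cv b c a) (\<lambda>y. rc_cross (\<eta> y) (u y) $ b) x - pot1 b (cv a b c) (\<lambda>y. rc_cross (\<eta> y) (u y) $ a) x"
  have "sommerfeld lam ?v"
    using sommerfeld_diff[OF sommerfeld_add[OF sommerfeld_diff[OF sommerfeld_cmult[OF v(1)[OF cyc], of "of_real lam"] d(2)[of c]] v(2)[OF cyc'(1), of a]] v(2)[OF cyc'(2), of b]]
    by simp
  moreover have "\<forall>\<^sub>F x in at_infinity. ?v x = u x $ c"
    using eventually_ext by eventually_elim (rule representation_pot[OF _ cyc, symmetric])
  ultimately show "sommerfeld lam (\<lambda>x. u x $ c)" by (rule sommerfeld_cong)
qed

end

text \<open>Beyond some radius r the O-bound applies. Before it |y|^-\<rho> is at least r^-\<rho>,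
  so the constant |B| r^\<rho> absorbs the bound \<open>B\<close>. The origin is kept out of
  \<open>A\<close> because \<open>0 powr a\<close> is 0.\<close>

lemma decay_constant:
  fixes F :: "real^3 \<Rightarrow> 'a::real_normed_vector"
  assumes F: "(\<lambda>x. norm (F x)) \<in> O[at_infinity](\<lambda>x. norm x powr (- \<rho>))" and \<rho>: "\<rho> > 0"
    and A: "0 \<notin> A" "\<And>y. y \<in> A \<Longrightarrow> norm (F y) \<le> B"
  shows "\<exists>C\<ge>0. \<forall>y\<in>A. norm (F y) \<le> C * norm y powr (- \<rho>)"
proof -
  from landau_o.bigE[OF F] obtain c where c: "c > 0" "\<forall>\<^sub>F x in at_infinity. norm (norm (F x)) \<le> c * norm (norm x powr (- \<rho>))" by blast
  then obtain b where b: "\<And>x. b \<le> norm x \<Longrightarrow> norm (F x) \<le> c * norm x powr (- \<rho>)" unfolding eventually_at_infinity by auto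
  define r where "r = max b 1"
  have r: "r > 0" by (simp add: r_def)
  define C where "C = c + \<bar>B\<bar> * r powr \<rho>"
  have "norm (F y) \<le> C * norm y powr (- \<rho>)" if y: "y \<in> A" for y
  proof (cases "r \<le> norm y")
    case True
    then have "norm (F y) \<le> c * norm y powr (- \<rho>)" using b by (simp add: r_def)
    also have "\<dots> \<le> C * norm y powr (- \<rho>)" unfolding C_def by (intro mult_right_mono) simp_all
    finally show ?thesis .
  next
    case False
    have "y \<noteq> 0" using y A(1) by auto
    then have "r powr (- \<rho>) \<le> norm y powr (- \<rho>)" using False \<rho> by (intro powr_mono2') auto
    then have "\<bar>B\<bar> * r powr \<rho> * r powr (- \<rho>) \<le> \<bar>B\<bar> * r powr \<rho> * norm y powr (- \<rho>)" by (rule mult_left_mono) simp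
    moreover have "\<bar>B\<bar> * r powr \<rho> * r powr (- \<rho>) = \<bar>B\<bar>" using r by (simp add: powr_minus)
    moreover have "\<bar>B\<bar> * r powr \<rho> * norm y powr (- \<rho>) \<le> C * norm y powr (- \<rho>)"
      unfolding C_def using c(1) by (intro mult_right_mono) simp_all
    ultimately show ?thesis using A(2)[OF y] by linarith
  qed
  moreover have "C \<ge> 0" using c(1) by (simp add: C_def)
  ultimately show ?thesis by blast
qed

context exterior_field
begin

lemma source_bounds:
  obtains B where "\<And>y. y \<in> \<Omega> \<Longrightarrow> norm (divergence u y) \<le> B" "\<And>y. y \<in> \<Omega> \<Longrightarrow> norm (curl u y - lam *\<^sub>R u y) \<le> B"
proof -
  from u_bounds obtain B where B: "\<And>x k. x \<in> \<Omega> \<Longrightarrow> norm (u x $ k) \<le> B" "\<And>x k j. x \<in> \<Omega> \<Longrightarrow> norm (D j x $ k) \<le> B" by blast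
  define K where "K = (2 + \<bar>lam\<bar>) * B"
  have "norm (divergence u y) \<le> 3 * B + 3 * K" "norm (curl u y - lam *\<^sub>R u y) \<le> 3 * B + 3 * K" if y: "y \<in> \<Omega>" for y
  proof -
    have B0: "0 \<le> B" using order_trans[OF norm_ge_zero B(1)[OF y]] .
    then have K0: "0 \<le> K" by (simp add: K_def)
    have "norm (dv y) \<le> (\<Sum>i\<in>(UNIV :: 3 set). B)" unfolding dv_def by (intro sum_norm_le B(2)[OF y])
    then show "norm (divergence u y) \<le> 3 * B + 3 * K" using K0 by (simp add: dv_eq[OF y])
    have "norm ((curl u y - lam *\<^sub>R u y) $ c) \<le> K" for c
    proof -
      obtain a b where cyc: "cyclic c a b" using cyclic_exists by blast
      have "norm (of_real lam * u y $ c) \<le> \<bar>lam\<bar> * B" unfolding norm_mult norm_of_real by (intro mult_left_mono B(1)[OF y]) simp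
      then have "norm (cv c a b y) \<le> (B + B) + \<bar>lam\<bar> * B"
        unfolding cv_def by (intro order_trans[OF norm_triangle_ineq4] add_mono B(2)[OF y])
      also have "\<dots> = K" by (simp add: K_def algebra_simps)
      finally show ?thesis unfolding cv_eq[OF cyc y] .
    qed
    then have "(\<Sum>c\<in>UNIV. norm ((curl u y - lam *\<^sub>R u y) $ c)) \<le> (\<Sum>c\<in>(UNIV :: 3 set). K)" by (intro sum_mono)
    moreover have "norm (curl u y - lam *\<^sub>R u y) \<le> (\<Sum>c\<in>UNIV. norm ((curl u y - lam *\<^sub>R u y) $ c))"
      unfolding norm_vec_def by (intro L2_set_le_sum) simp
    ultimately show "norm (curl u y - lam *\<^sub>R u y) \<le> 3 * B + 3 * K" using B0 by simp
  qed
  then show ?thesis by (rule that)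
qed

end

lemma compact_closure_support:
  fixes F :: "real^3 \<Rightarrow> 'a::zero"
  assumes "compact (closure {x \<in> A. F x \<noteq> 0})"
  obtains L where "\<forall>y\<in>A. L < norm y \<longrightarrow> F y = 0"
proof -
  obtain L where L: "\<And>x. x \<in> closure {x \<in> A. F x \<noteq> 0} \<Longrightarrow> norm x \<le> L" using compact_imp_bounded[OF assms] unfolding bounded_iff by blast
  have "F y = 0" if "y \<in> A" "L < norm y" for y
  proof (rule ccontr)
    assume "F y \<noteq> 0"
    then have "y \<in> {x \<in> A. F x \<noteq> 0}" using that(1) by simp
    then have "y \<in> closure {x \<in> A. F x \<noteq> 0}" by (rule subsetD[OF closure_subset])
    then show False using L[of y] that(2) by simp
  qed
  then show ?thesis using that by blast
qed

theorem theorem2p12: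
  fixes k :: nat and lam \<rho> :: real
    and G \<Omega> S :: "(real^3) set"
    and \<eta> :: "real^3 \<Rightarrow> real^3"
    and u :: "real^3 \<Rightarrow> complex^3"
  assumes G: "bounded_domain_of_class (k + 5) G" "G homeomorphic ball (0::real^3) 1" "0 \<in> G"
    and Omega: "\<Omega> = - closure G"
    and S: "S = frontier G"
    and normal: "outward_unit_normal G \<eta>"
    and u: "C1_closure \<Omega> u"
    and radiation: "(\<lambda>R. LINT x:sphere 0 R|surface_measure (sphere 0 R).
          norm (\<i> *s rc_cross (x /\<^sub>R R) (u x) - u x)) \<in> o[at_top](\<lambda>R. R)"
    and average: "(\<lambda>R. LINT x:sphere 0 R|surface_measure (sphere 0 R). norm (u x))
          \<in> o[at_top](\<lambda>R. R\<^sup>2)"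
    and rho: "2 < \<rho>" "\<rho> < 3"
    and div_decay: "(\<lambda>x. norm (divergence u x)) \<in> O[at_infinity](\<lambda>x. norm x powr (- \<rho>))"
    and curl_decay: "(\<lambda>x. norm (curl u x - lam *\<^sub>R u x)) \<in> O[at_infinity](\<lambda>x. norm x powr (- \<rho>))"
  shows "(\<forall>x\<in>\<Omega>.
        set_integrable lborel \<Omega> (\<lambda>y. helmholtz_kernel lam (x - y) * divergence u y) \<and>
        set_integrable (surface_measure S) S
          (\<lambda>y. helmholtz_kernel lam (x - y) * rc_dot (\<eta> y) (u y)) \<and>
        set_integrable lborel \<Omega> (\<lambda>y. helmholtz_kernel lam (x - y) *s (curl u y - lam *\<^sub>R u y)) \<and>
        set_integrable (surface_measure S) S
          (\<lambda>y. helmholtz_kernel lam (x - y) *s rc_cross (\<eta> y) (u y)) \<and>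
        scalar_potential lam G \<eta> u differentiable (at x) \<and>
        vector_potential lam G \<eta> u differentiable (at x) \<and>
        u x = - grad (scalar_potential lam G \<eta> u) x + curl (vector_potential lam G \<eta> u) x
              + lam *\<^sub>R vector_potential lam G \<eta> u x) \<and>
      (\<lambda>x. norm (u x)) \<in> O[at_infinity](\<lambda>x. norm x powr (- (\<rho> - 2))) \<and>
      (compact (closure {x \<in> \<Omega>. divergence u x \<noteq> 0}) \<and>
       compact (closure {x \<in> \<Omega>. curl u x - lam *\<^sub>R u x \<noteq> 0}) \<longrightarrow>
         (\<lambda>x. norm (u x)) \<in> O[at_infinity](\<lambda>x. 1 / norm x) \<and>
         (\<forall>j. (\<lambda>R. SUP y\<in>sphere 0 R.
                 norm (rc_dot (y /\<^sub>R R) (grad (\<lambda>z. u z $ j) y) - \<i> * of_real lam * u y $ j))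
               \<in> o[at_top](\<lambda>R. 1 / R)))"
proof -
  \<comment> \<open>The class \<open>k + 5\<close> is \<open>Suc (k + 4)\<close>, the form in which
    the locale takes it.\<close>
  interpret ext: exterior_field "k + 4" lam G \<eta> u
    using G(1) normal u by unfold_locales (simp_all add: Omega eval_nat_numeral)
  have "open G" using G(1) by (simp add: bounded_domain_of_class_def)
  then obtain \<delta> where \<delta>: "\<delta> > 0" "ball 0 \<delta> \<subseteq> G" using G(3) open_contains_ball by blast
  have "0 \<notin> - closure G" using G(3) closure_subset by blast
  obtain B where B: "\<And>y. y \<in> - closure G \<Longrightarrow> norm (divergence u y) \<le> B" "\<And>y. y \<in> - closure G \<Longrightarrow> norm (curl u y - lam *\<^sub>R u y) \<le> B"
    using ext.source_bounds by blast
  have "\<rho> > 0" using rho by simp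
  from decay_constant[OF div_decay this \<open>0 \<notin> - closure G\<close> B(1)] decay_constant[OF curl_decay this \<open>0 \<notin> - closure G\<close> B(2)]
  obtain C1 C2 where C1: "C1 \<ge> 0" "\<And>y. y \<in> - closure G \<Longrightarrow> norm (divergence u y) \<le> C1 * norm y powr (- \<rho>)"
    and C2: "C2 \<ge> 0" "\<And>y. y \<in> - closure G \<Longrightarrow> norm (curl u y - lam *\<^sub>R u y) \<le> C2 * norm y powr (- \<rho>)" by blast
  have mono: "C1 * norm y powr (- \<rho>) \<le> (C1 + C2) * norm y powr (- \<rho>)" "C2 * norm y powr (- \<rho>) \<le> (C1 + C2) * norm y powr (- \<rho>)" for y :: "real^3"
    using C1(1) C2(1) by (intro mult_right_mono; simp)+
  \<comment> \<open>The locale has one constant for both sources; the sum dominates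
    \<open>C1\<close> and \<open>C2\<close>.\<close>
  interpret decaying_field "k + 4" lam G \<eta> u "C1 + C2" \<delta> \<rho>
  proof unfold_locales
    fix y assume y: "y \<in> - closure G"
    show "norm (ext.dv y) \<le> (C1 + C2) * norm y powr (- \<rho>)"
      unfolding ext.dv_eq[OF y] by (rule order_trans[OF C1(2)[OF y] mono(1)])
    fix c a b assume "cyclic c a b"
    show "norm (ext.cv c a b y) \<le> (C1 + C2) * norm y powr (- \<rho>)"
      unfolding ext.cv_eq[OF \<open>cyclic c a b\<close> y]
      by (rule order_trans[OF order_trans[OF vec3_component_le C2(2)[OF y]] mono(2)])
  qed (use C1(1) C2(1) \<delta> rho radiation average in simp_all)
  have compact_case: "(\<lambda>x. norm (u x)) \<in> O[at_infinity](\<lambda>x. 1 / norm x)" "sommerfeld lam (\<lambda>z. u z $ j)"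
    if s: "compact (closure {x \<in> \<Omega>. divergence u x \<noteq> 0})" "compact (closure {x \<in> \<Omega>. curl u x - lam *\<^sub>R u x \<noteq> 0})" for j
  proof -
    obtain L1 where L1: "\<forall>y\<in>\<Omega>. L1 < norm y \<longrightarrow> divergence u y = 0" using compact_closure_support[OF s(1)] by blast
    obtain L2 where L2: "\<forall>y\<in>\<Omega>. L2 < norm y \<longrightarrow> curl u y - lam *\<^sub>R u y = 0" using compact_closure_support[OF s(2)] by blast
    have d: "\<forall>y\<in>- closure G. max L1 L2 < norm y \<longrightarrow> ext.dv y = 0" using L1 by (simp add: Omega ext.dv_eq)
    have c: "\<forall>y\<in>- closure G. max L1 L2 < norm y \<longrightarrow> ext.cv c a b y = 0" if "cyclic c a b" for c a b
    proof (intro ballI impI)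
      fix y assume y: "y \<in> - closure G" "max L1 L2 < norm y"
      then have "curl u y - lam *\<^sub>R u y = 0" using L2 by (simp add: Omega)
      then show "ext.cv c a b y = 0" unfolding ext.cv_eq[OF that y(1)] by (simp only: zero_index)
    qed
    show "(\<lambda>x. norm (u x)) \<in> O[at_infinity](\<lambda>x. 1 / norm x)" "sommerfeld lam (\<lambda>z. u z $ j)"
      by (rule compactly_supported[OF d c]; assumption)+
  qed
  show ?thesis
    unfolding Omega S
  proof (intro conjI ballI impI allI; (elim conjE)?)
    fix x assume x: "x \<in> - closure G"
    show "set_integrable lborel (- closure G) (\<lambda>y. helmholtz_kernel lam (x - y) * divergence u y)"
      "set_integrable (surface_measure (frontier G)) (frontier G) (\<lambda>y. helmholtz_kernel lam (x - y) * rc_dot (\<eta> y) (u y))"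
      "set_integrable lborel (- closure G) (\<lambda>y. helmholtz_kernel lam (x - y) *s (curl u y - lam *\<^sub>R u y))"
      "set_integrable (surface_measure (frontier G)) (frontier G) (\<lambda>y. helmholtz_kernel lam (x - y) *s rc_cross (\<eta> y) (u y))"
      by (rule kernel_integrals(1-4)[OF x])+
    show "scalar_potential lam G \<eta> u differentiable (at x)"
      by (rule differentiableI[OF scalar_potential_derivative[OF x]])
    show "vector_potential lam G \<eta> u differentiable (at x)"
      by (rule vector_potential_differentiable[OF x])
    show "u x = - grad (scalar_potential lam G \<eta> u) x + curl (vector_potential lam G \<eta> u) x + lam *\<^sub>R vector_potential lam G \<eta> u x"
      by (rule representation_formula[OF x])
  next
    show "(\<lambda>x. norm (u x)) \<in> O[at_infinity](\<lambda>x. norm x powr (- (\<rho> - 2)))" by (rule field_decay)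
  next
    assume s: "compact (closure {x \<in> - closure G. divergence u x \<noteq> 0})" "compact (closure {x \<in> - closure G. curl u x - lam *\<^sub>R u x \<noteq> 0})"
    show "(\<lambda>x. norm (u x)) \<in> O[at_infinity](\<lambda>x. 1 / norm x)"
      by (rule compact_case(1)) (use s in \<open>simp_all only: Omega\<close>)
    fix j
    show "(\<lambda>R. SUP y\<in>sphere 0 R. norm (rc_dot (y /\<^sub>R R) (grad (\<lambda>z. u z $ j) y) - \<i> * of_real lam * u y $ j)) \<in> o[at_top](\<lambda>R. 1 / R)"
      by (rule sommerfeld_supremum, rule compact_case(2)) (use s in \<open>simp_all only: Omega\<close>)
  qed
qed

end
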